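(* Let $H$ be a Hopf algebra over a field $\Bbbk$ and let $(Q,m,u,\Delta,\varepsilon,\omega)$ be a connected coquasi-bialgebra in ${}_H^H\mathcal{YD}$. Then the associated graded coalgebra $\mathrm{gr}\,Q$ (with its induced multiplication and unit) is a connected bialgebra in ${}_H^H\mathcal{YD}$.
   Context: ${}_H^H\mathcal{YD}$ is the category of left-left Yetter-Drinfeld modules over $H$: left $H$-modules and left $H$-comodules $V$ (coaction $v\mapsto v_{-1}\otimes v_0$) with $(h_1v)_{-1}h_2\otimes(h_1v)_0=h_1v_{-1}\otimes h_2v_0$. It is monoidal (diagonal action, codiagonal coaction, unit $\Bbbk$ with trivial structures) and pre-braided by $c_{V,W}(v\otimes w)=v_{-1}w\otimes v_0$. Tensor products of coalgebras in ${}_H^H\mathcal{YD}$ have comultiplication $(C\otimes c_{C,D}\otimes D)(\Delta_C\otimes\Delta_D)$, and $*$ denotes convolution with respect to such comultiplications. A coquasi-bialgebra $(Q,m,u,\Delta,\varepsilon,\omega)$ in ${}_H^H\mathcal{YD}$ is a coalgebra $(Q,\Delta,\varepsilon)$ in ${}_H^H\mathcal{YD}$ with coalgebra morphisms $m:Q\otimes Q\to Q$, $u:\Bbbk\to Q$ in ${}_H^H\mathcal{YD}$ and a convolution invertible $\omega\in{}_H^H\mathcal{YD}(Q^{\otimes3},\Bbbk)$ such that $\omega(Q\otimes Q\otimes m)*\omega(m\otimes Q\otimes Q)=(\varepsilon\otimes\omega)*\omega(Q\otimes m\otimes Q)*(\omega\otimes\varepsilon)$; $\omega(Q\otimes u\otimes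 Q)=\omega(u\otimes Q\otimes Q)=\omega(Q\otimes Q\otimes u)=\varepsilon_{Q\otimes Q}$; $m(Q\otimes m)*\omega=\omega*m(m\otimes Q)$; $m(u\otimes Q)=\mathrm{Id}_Q=m(Q\otimes u)$. It is connected if its coradical is $Q_0=\Bbbk1_Q$, $1_Q=u(1)$; likewise for bialgebras in ${}_H^H\mathcal{YD}$. $\mathrm{gr}\,Q=\bigoplus_{i\ge0}Q_i/Q_{i-1}$, where $(Q_n)$ is the coradical filtration and $Q_{-1}=0$, with $\Delta(x+Q_{n-1})=\sum_{0\le i\le n}(x_1+Q_{i-1})\otimes(x_2+Q_{n-i-1})$ for $x\in Q_n$, counit $\varepsilon$ in degree $0$ and zero in positive degrees, multiplication $(x+Q_{a-1})(y+Q_{b-1})=xy+Q_{a+b-1}$ for $x\in Q_a,y\in Q_b$, unit $1_Q+Q_{-1}$, and the induced $H$-action and $H$-coaction. *)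

theory Defs
  imports "HOL-Algebra.AbelCoset" "HOL-Algebra.Module"
begin

text \<open>
  Vector spaces over a field \<open>K\<close> are modules \<open>module K V\<close> in the sense of HOL-Algebra. The record
  fields \<open>mult\<close> and \<open>one\<close> of a module are ignored unless a multiplication on it is explicitly
  spoken of. All structure maps are only relevant on carriers.
\<close>

section \<open>Linear algebra\<close>

definition linear_map ::
  "('k, 'm) ring_scheme \<Rightarrow> ('k, 'v, 'a) module_scheme \<Rightarrow> ('k, 'w, 'b) module_scheme \<Rightarrow> ('v \<Rightarrow> 'w) \<Rightarrow> bool"
  where "linear_map K V W f \<longleftrightarrow>
    f \<in> carrier V \<rightarrow> carrier W \<and>
    (\<forall>x\<in>carrier V. \<forall>y\<in>carrier V. f (x \<oplus>\<^bsub>V\<^esub> y) = f x \<oplus>\<^bsub>W\<^esub> f y) \<and>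
    (\<forall>a\<in>carrier K. \<forall>x\<in>carrier V. f (a \<odot>\<^bsub>V\<^esub> x) = a \<odot>\<^bsub>W\<^esub> f x)"

definition bilinear_map ::
  "('k, 'm) ring_scheme \<Rightarrow> ('k, 'v, 'a) module_scheme \<Rightarrow> ('k, 'w, 'b) module_scheme \<Rightarrow>
    ('k, 'u, 'c) module_scheme \<Rightarrow> ('v \<Rightarrow> 'w \<Rightarrow> 'u) \<Rightarrow> bool"
  where "bilinear_map K V W U \<beta> \<longleftrightarrow>
    (\<forall>v\<in>carrier V. linear_map K W U (\<beta> v)) \<and>
    (\<forall>w\<in>carrier W. linear_map K V U (\<lambda>v. \<beta> v w))"

definition subspace_hull ::
  "('k, 'm) ring_scheme \<Rightarrow> ('k, 'v, 'a) module_scheme \<Rightarrow> 'v set \<Rightarrow> 'v set"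
  where "subspace_hull K V S = \<Inter>{N. submodule N K V \<and> S \<subseteq> N}"

definition quotient_module ::
  "('k, 'v, 'a) module_scheme \<Rightarrow> 'v set \<Rightarrow> ('k, 'v set) module"
  where "quotient_module V N = \<lparr>carrier = a_rcosets\<^bsub>V\<^esub> N, mult = undefined, one = undefined,
    zero = N, add = (\<lambda>X Y. X <+>\<^bsub>V\<^esub> Y), smult = (\<lambda>a X. \<Union>x\<in>X. N +>\<^bsub>V\<^esub> (a \<odot>\<^bsub>V\<^esub> x))\<rparr>"

definition direct_sum ::
  "(nat \<Rightarrow> ('k, 'v, 'a) module_scheme) \<Rightarrow> ('k, nat \<Rightarrow> 'v) module"
  where "direct_sum M = \<lparr>
    carrier = {f. (\<forall>n. f n \<in> carrier (M n)) \<and> finite {n. f n \<noteq> \<zero>\<^bsub>M n\<^esub>}},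
    mult = undefined, one = undefined,
    zero = (\<lambda>n. \<zero>\<^bsub>M n\<^esub>), add = (\<lambda>f g n. f n \<oplus>\<^bsub>M n\<^esub> g n), smult = (\<lambda>a f n. a \<odot>\<^bsub>M n\<^esub> f n)\<rparr>"

definition free_module :: "('k, 'm) ring_scheme \<Rightarrow> 's set \<Rightarrow> ('k, 's \<Rightarrow> 'k) module"
  where "free_module K S = \<lparr>
    carrier = {f. (\<forall>s. f s \<in> carrier K) \<and> finite {s. f s \<noteq> \<zero>\<^bsub>K\<^esub>} \<and> {s. f s \<noteq> \<zero>\<^bsub>K\<^esub>} \<subseteq> S},
    mult = undefined, one = undefined,
    zero = (\<lambda>s. \<zero>\<^bsub>K\<^esub>), add = (\<lambda>f g s. f s \<oplus>\<^bsub>K\<^esub> g s), smult = (\<lambda>a f s. a \<otimes>\<^bsub>K\<^esub> f s)\<rparr>"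

definition free_gen :: "('k, 'm) ring_scheme \<Rightarrow> 's \<Rightarrow> 's \<Rightarrow> 'k"
  where "free_gen K s = (\<lambda>t. if t = s then \<one>\<^bsub>K\<^esub> else \<zero>\<^bsub>K\<^esub>)"

subsection \<open>Tensor products\<close>

text \<open>
  \<open>V \<otimes> W\<close> is the quotient of the free module on \<open>V \<times> W\<close> by the bilinearity relations.
\<close>

type_synonym ('k, 'v, 'w) tensor = "('v \<times> 'w \<Rightarrow> 'k) set"

definition tensor_rels ::
  "('k, 'm) ring_scheme \<Rightarrow> ('k, 'v, 'a) module_scheme \<Rightarrow> ('k, 'w, 'b) module_scheme \<Rightarrow>
    ('v \<times> 'w \<Rightarrow> 'k) set"
  where "tensor_rels K V W =
    (let F = free_module K (carrier V \<times> carrier W); \<delta> = free_gen K in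
     subspace_hull K F
      ({\<delta> (v \<oplus>\<^bsub>V\<^esub> v', w) \<ominus>\<^bsub>F\<^esub> (\<delta> (v, w) \<oplus>\<^bsub>F\<^esub> \<delta> (v', w)) | v v' w.
          v \<in> carrier V \<and> v' \<in> carrier V \<and> w \<in> carrier W} \<union>
       {\<delta> (v, w \<oplus>\<^bsub>W\<^esub> w') \<ominus>\<^bsub>F\<^esub> (\<delta> (v, w) \<oplus>\<^bsub>F\<^esub> \<delta> (v, w')) | v w w'.
          v \<in> carrier V \<and> w \<in> carrier W \<and> w' \<in> carrier W} \<union>
       {\<delta> (a \<odot>\<^bsub>V\<^esub> v, w) \<ominus>\<^bsub>F\<^esub> a \<odot>\<^bsub>F\<^esub> \<delta> (v, w) | a v w.
          a \<in> carrier K \<and> v \<in> carrier V \<and> w \<in> carrier W} \<union>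
       {\<delta> (v, a \<odot>\<^bsub>W\<^esub> w) \<ominus>\<^bsub>F\<^esub> a \<odot>\<^bsub>F\<^esub> \<delta> (v, w) | a v w.
          a \<in> carrier K \<and> v \<in> carrier V \<and> w \<in> carrier W}))"

definition tensor_product ::
  "('k, 'm) ring_scheme \<Rightarrow> ('k, 'v, 'a) module_scheme \<Rightarrow> ('k, 'w, 'b) module_scheme \<Rightarrow>
    ('k, ('k, 'v, 'w) tensor) module"
  where "tensor_product K V W =
    quotient_module (free_module K (carrier V \<times> carrier W)) (tensor_rels K V W)"

definition pure_tensor ::
  "('k, 'm) ring_scheme \<Rightarrow> ('k, 'v, 'a) module_scheme \<Rightarrow> ('k, 'w, 'b) module_scheme \<Rightarrow>
    'v \<Rightarrow> 'w \<Rightarrow> ('k, 'v, 'w) tensor"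
  where "pure_tensor K V W v w =
    tensor_rels K V W +>\<^bsub>free_module K (carrier V \<times> carrier W)\<^esub> free_gen K (v, w)"

text \<open>
  The linear map \<open>V \<otimes> W \<rightarrow> U\<close> induced by a bilinear map \<open>\<beta> : V \<times> W \<rightarrow> U\<close>, evaluated on an
  arbitrary representative \<open>f = \<Sum> f(v,w) (v,w)\<close> of the tensor \<open>X\<close>. It renders Sweedler notation:
  if \<open>X = \<Sum> x\<^sub>1 \<otimes> x\<^sub>2\<close>, then \<open>tensor_lift K U \<beta> X = \<Sum> \<beta> x\<^sub>1 x\<^sub>2\<close>.
\<close>

definition tensor_lift ::
  "('k, 'm) ring_scheme \<Rightarrow> ('k, 'u, 'c) module_scheme \<Rightarrow> ('v \<Rightarrow> 'w \<Rightarrow> 'u) \<Rightarrow>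
    ('k, 'v, 'w) tensor \<Rightarrow> 'u"
  where "tensor_lift K U \<beta> X =
    (let f = (SOME f. f \<in> X) in
     \<Oplus>\<^bsub>U\<^esub>p\<in>{p. f p \<noteq> \<zero>\<^bsub>K\<^esub>}. f p \<odot>\<^bsub>U\<^esub> \<beta> (fst p) (snd p))"

text \<open>\<open>f \<otimes> g\<close>, with \<open>V\<close> and \<open>W\<close> the codomains of \<open>f\<close> and \<open>g\<close>.\<close>

definition tensor_map ::
  "('k, 'm) ring_scheme \<Rightarrow> ('k, 'v, 'a) module_scheme \<Rightarrow> ('k, 'w, 'b) module_scheme \<Rightarrow>
    ('x \<Rightarrow> 'v) \<Rightarrow> ('y \<Rightarrow> 'w) \<Rightarrow> ('k, 'x, 'y) tensor \<Rightarrow> ('k, 'v, 'w) tensor"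
  where "tensor_map K V W f g =
    tensor_lift K (tensor_product K V W) (\<lambda>x y. pure_tensor K V W (f x) (g y))"

text \<open>Iterated tensor products are nested to the right.\<close>

definition tensor_lift3 ::
  "('k, 'm) ring_scheme \<Rightarrow> ('k, 'u, 'c) module_scheme \<Rightarrow> ('x \<Rightarrow> 'y \<Rightarrow> 'z \<Rightarrow> 'u) \<Rightarrow>
    ('k, 'x, ('k, 'y, 'z) tensor) tensor \<Rightarrow> 'u"
  where "tensor_lift3 K U \<phi> = tensor_lift K U (\<lambda>x. tensor_lift K U (\<phi> x))"

definition tensor_lift4 ::
  "('k, 'm) ring_scheme \<Rightarrow> ('k, 'u, 'c) module_scheme \<Rightarrow> ('x \<Rightarrow> 'y \<Rightarrow> 'z \<Rightarrow> 't \<Rightarrow> 'u) \<Rightarrow>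
    ('k, 'x, ('k, 'y, ('k, 'z, 't) tensor) tensor) tensor \<Rightarrow> 'u"
  where "tensor_lift4 K U \<phi> = tensor_lift K U (\<lambda>x. tensor_lift3 K U (\<phi> x))"

definition ground_module :: "('k, 'm) ring_scheme \<Rightarrow> ('k, 'k) module"
  where "ground_module K = \<lparr>carrier = carrier K, mult = mult K, one = \<one>\<^bsub>K\<^esub>,
    zero = \<zero>\<^bsub>K\<^esub>, add = add K, smult = mult K\<rparr>"

text \<open>The image of \<open>A \<otimes> B\<close> in \<open>V \<otimes> W\<close>, for subspaces \<open>A\<close> of \<open>V\<close> and \<open>B\<close> of \<open>W\<close>.\<close>

definition sub_tensor ::
  "('k, 'm) ring_scheme \<Rightarrow> ('k, 'v, 'a) module_scheme \<Rightarrow> ('k, 'w, 'b) module_scheme \<Rightarrow>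
    'v set \<Rightarrow> 'w set \<Rightarrow> ('k, 'v, 'w) tensor set"
  where "sub_tensor K V W A B =
    subspace_hull K (tensor_product K V W) {pure_tensor K V W x y | x y. x \<in> A \<and> y \<in> B}"

section \<open>Coalgebras and Hopf algebras\<close>

record ('k, 'v) coalgebra = "('k, 'v) module" +
  comult :: "'v \<Rightarrow> ('k, 'v, 'v) tensor"
  counit :: "'v \<Rightarrow> 'k"

locale coalgebra = field K + C: module K C
  for K :: "('k, 'm) ring_scheme" and C :: "('k, 'v, 'a) coalgebra_scheme" +
  assumes comult_linear: "linear_map K C (tensor_product K C C) (comult C)"
    and counit_linear: "linear_map K C (ground_module K) (counit C)"
    and coassoc: "c \<in> carrier C \<Longrightarrow>
      tensor_lift K (tensor_product K C (tensor_product K C C))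
        (\<lambda>x y. tensor_lift K (tensor_product K C (tensor_product K C C))
          (\<lambda>x1 x2. pure_tensor K C (tensor_product K C C) x1 (pure_tensor K C C x2 y)) (comult C x))
        (comult C c)
      = tensor_map K C (tensor_product K C C) (\<lambda>x. x) (comult C) (comult C c)"
    and counit_left: "c \<in> carrier C \<Longrightarrow>
      tensor_lift K C (\<lambda>x y. counit C x \<odot>\<^bsub>C\<^esub> y) (comult C c) = c"
    and counit_right: "c \<in> carrier C \<Longrightarrow>
      tensor_lift K C (\<lambda>x y. counit C y \<odot>\<^bsub>C\<^esub> x) (comult C c) = c"

definition subcoalgebra ::
  "('k, 'm) ring_scheme \<Rightarrow> ('k, 'v, 'a) coalgebra_scheme \<Rightarrow> 'v set \<Rightarrow> bool"
  where "subcoalgebra K C D \<longleftrightarrow> submodule D K C \<and> comult C ` D \<subseteq> sub_tensor K C C D D"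

definition simple_subcoalgebra ::
  "('k, 'm) ring_scheme \<Rightarrow> ('k, 'v, 'a) coalgebra_scheme \<Rightarrow> 'v set \<Rightarrow> bool"
  where "simple_subcoalgebra K C D \<longleftrightarrow> subcoalgebra K C D \<and> D \<noteq> {\<zero>\<^bsub>C\<^esub>} \<and>
    (\<forall>E. subcoalgebra K C E \<and> E \<subseteq> D \<longrightarrow> E = {\<zero>\<^bsub>C\<^esub>} \<or> E = D)"

definition coradical ::
  "('k, 'm) ring_scheme \<Rightarrow> ('k, 'v, 'a) coalgebra_scheme \<Rightarrow> 'v set"
  where "coradical K C = subspace_hull K C (\<Union>{D. simple_subcoalgebra K C D})"

text \<open>\<open>C\<^sub>n = \<Delta>\<^sup>-\<^sup>1(C \<otimes> C\<^sub>n\<^sub>-\<^sub>1 + C\<^sub>0 \<otimes> C)\<close>.\<close>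

primrec coradical_filtration ::
  "('k, 'm) ring_scheme \<Rightarrow> ('k, 'v, 'a) coalgebra_scheme \<Rightarrow> nat \<Rightarrow> 'v set"
  where
    "coradical_filtration K C 0 = coradical K C"
  | "coradical_filtration K C (Suc n) = {x \<in> carrier C. comult C x \<in>
      sub_tensor K C C (carrier C) (coradical_filtration K C n)
        <+>\<^bsub>tensor_product K C C\<^esub> sub_tensor K C C (coradical K C) (carrier C)}"

record ('k, 'h) hopf_algebra = "('k, 'h) coalgebra" +
  antipode :: "'h \<Rightarrow> 'h"

locale hopf_algebra = coalgebra K H + H: ring H
  for K :: "('k, 'm) ring_scheme" and H :: "('k, 'h, 'a) hopf_algebra_scheme" +
  assumes mult_bilinear: "bilinear_map K H H H (mult H)"
    and comult_mult: "\<lbrakk>x \<in> carrier H; y \<in> carrier H\<rbrakk> \<Longrightarrow> comult H (x \<otimes>\<^bsub>H\<^esub> y) =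
      tensor_lift K (tensor_product K H H)
        (\<lambda>x1 x2. tensor_map K H H (\<lambda>y1. x1 \<otimes>\<^bsub>H\<^esub> y1) (\<lambda>y2. x2 \<otimes>\<^bsub>H\<^esub> y2) (comult H y)) (comult H x)"
    and comult_one: "comult H \<one>\<^bsub>H\<^esub> = pure_tensor K H H \<one>\<^bsub>H\<^esub> \<one>\<^bsub>H\<^esub>"
    and counit_mult: "\<lbrakk>x \<in> carrier H; y \<in> carrier H\<rbrakk> \<Longrightarrow>
      counit H (x \<otimes>\<^bsub>H\<^esub> y) = counit H x \<otimes>\<^bsub>K\<^esub> counit H y"
    and counit_one: "counit H \<one>\<^bsub>H\<^esub> = \<one>\<^bsub>K\<^esub>"
    and antipode_linear: "linear_map K H H (antipode H)"
    and antipode_left: "x \<in> carrier H \<Longrightarrow>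
      tensor_lift K H (\<lambda>x1 x2. antipode H x1 \<otimes>\<^bsub>H\<^esub> x2) (comult H x) = counit H x \<odot>\<^bsub>H\<^esub> \<one>\<^bsub>H\<^esub>"
    and antipode_right: "x \<in> carrier H \<Longrightarrow>
      tensor_lift K H (\<lambda>x1 x2. x1 \<otimes>\<^bsub>H\<^esub> antipode H x2) (comult H x) = counit H x \<odot>\<^bsub>H\<^esub> \<one>\<^bsub>H\<^esub>"

section \<open>Yetter-Drinfeld modules\<close>

text \<open>
  The action \<open>H \<otimes> V \<rightarrow> V\<close> is given as a bilinear map. Every Yetter-Drinfeld module needed here is
  a coalgebra, so both structures share one record; \<open>yd_module\<close> and \<open>yd_morphism\<close> do not refer to
  \<open>comult\<close> and \<open>counit\<close>.
\<close>

record ('k, 'h, 'v) yd_coalgebra = "('k, 'v) coalgebra" +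
  act :: "'h \<Rightarrow> 'v \<Rightarrow> 'v"
  coact :: "'v \<Rightarrow> ('k, 'h, 'v) tensor"

locale yd_module = hopf_algebra K H + V: module K V
  for K :: "('k, 'm) ring_scheme" and H :: "('k, 'h, 'a) hopf_algebra_scheme"
    and V :: "('k, 'h, 'v, 'b) yd_coalgebra_scheme" +
  assumes act_bilinear: "bilinear_map K H V V (act V)"
    and act_one: "v \<in> carrier V \<Longrightarrow> act V \<one>\<^bsub>H\<^esub> v = v"
    and act_mult: "\<lbrakk>g \<in> carrier H; h \<in> carrier H; v \<in> carrier V\<rbrakk> \<Longrightarrow>
      act V (g \<otimes>\<^bsub>H\<^esub> h) v = act V g (act V h v)"
    and coact_linear: "linear_map K V (tensor_product K H V) (coact V)"
    and coact_coassoc: "v \<in> carrier V \<Longrightarrow>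
      tensor_lift K (tensor_product K H (tensor_product K H V))
        (\<lambda>h y. tensor_lift K (tensor_product K H (tensor_product K H V))
          (\<lambda>h1 h2. pure_tensor K H (tensor_product K H V) h1 (pure_tensor K H V h2 y)) (comult H h))
        (coact V v)
      = tensor_map K H (tensor_product K H V) (\<lambda>h. h) (coact V) (coact V v)"
    and coact_counit: "v \<in> carrier V \<Longrightarrow>
      tensor_lift K V (\<lambda>h y. counit H h \<odot>\<^bsub>V\<^esub> y) (coact V v) = v"
    and yd_compatible: "\<lbrakk>h \<in> carrier H; v \<in> carrier V\<rbrakk> \<Longrightarrow>
      tensor_lift K (tensor_product K H V)
        (\<lambda>h1 h2. tensor_map K H V (\<lambda>g. g \<otimes>\<^bsub>H\<^esub> h2) (\<lambda>y. y) (coact V (act V h1 v))) (comult H h)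
      = tensor_lift K (tensor_product K H V)
        (\<lambda>h1 h2. tensor_map K H V (\<lambda>g. h1 \<otimes>\<^bsub>H\<^esub> g) (\<lambda>y. act V h2 y) (coact V v)) (comult H h)"

definition yd_morphism ::
  "('k, 'm) ring_scheme \<Rightarrow> ('k, 'h, 'a) hopf_algebra_scheme \<Rightarrow> ('k, 'h, 'v, 'b) yd_coalgebra_scheme \<Rightarrow>
    ('k, 'h, 'w, 'c) yd_coalgebra_scheme \<Rightarrow> ('v \<Rightarrow> 'w) \<Rightarrow> bool"
  where "yd_morphism K H V W f \<longleftrightarrow> linear_map K V W f \<and>
    (\<forall>h\<in>carrier H. \<forall>v\<in>carrier V. f (act V h v) = act W h (f v)) \<and>
    (\<forall>v\<in>carrier V. coact W (f v) = tensor_map K H W (\<lambda>h. h) f (coact V v))"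

definition yd_unit ::
  "('k, 'm) ring_scheme \<Rightarrow> ('k, 'h, 'a) hopf_algebra_scheme \<Rightarrow> ('k, 'h, 'k) yd_coalgebra"
  where "yd_unit K H = \<lparr>carrier = carrier K, mult = mult K, one = \<one>\<^bsub>K\<^esub>, zero = \<zero>\<^bsub>K\<^esub>,
    add = add K, smult = mult K,
    comult = (\<lambda>a. pure_tensor K (ground_module K) (ground_module K) a \<one>\<^bsub>K\<^esub>),
    counit = (\<lambda>a. a),
    act = (\<lambda>h a. counit H h \<otimes>\<^bsub>K\<^esub> a),
    coact = (\<lambda>a. pure_tensor K H (ground_module K) \<one>\<^bsub>H\<^esub> a)\<rparr>"

text \<open>\<open>c\<^sub>V\<^sub>,\<^sub>W(v \<otimes> w) = v\<^sub>-\<^sub>1 w \<otimes> v\<^sub>0\<close>\<close>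

definition yd_braiding ::
  "('k, 'm) ring_scheme \<Rightarrow> ('k, 'h, 'v, 'b) yd_coalgebra_scheme \<Rightarrow> ('k, 'h, 'w, 'c) yd_coalgebra_scheme \<Rightarrow>
    ('k, 'v, 'w) tensor \<Rightarrow> ('k, 'w, 'v) tensor"
  where "yd_braiding K V W =
    tensor_lift K (tensor_product K W V)
      (\<lambda>v w. tensor_map K W V (\<lambda>g. act W g w) (\<lambda>y. y) (coact V v))"

definition yd_tensor ::
  "('k, 'm) ring_scheme \<Rightarrow> ('k, 'h, 'a) hopf_algebra_scheme \<Rightarrow> ('k, 'h, 'v, 'b) yd_coalgebra_scheme \<Rightarrow>
    ('k, 'h, 'w, 'c) yd_coalgebra_scheme \<Rightarrow> ('k, 'h, ('k, 'v, 'w) tensor) yd_coalgebra"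
  where "yd_tensor K H C D = (let T = tensor_product K C D; T2 = tensor_product K T T in
    \<lparr>carrier = carrier T, mult = undefined, one = undefined, zero = \<zero>\<^bsub>T\<^esub>, add = add T,
     smult = smult T,
     comult = tensor_lift K T2
       (\<lambda>c d. tensor_lift K T2
         (\<lambda>c1 c2. tensor_lift K T2
           (\<lambda>d1 d2. tensor_lift K T2
             (\<lambda>d1' c2'. pure_tensor K T T (pure_tensor K C D c1 d1') (pure_tensor K C D c2' d2))
             (yd_braiding K C D (pure_tensor K C D c2 d1)))
           (comult D d))
         (comult C c)),
     counit = tensor_lift K (ground_module K) (\<lambda>c d. counit C c \<otimes>\<^bsub>K\<^esub> counit D d),
     act = (\<lambda>h t. tensor_lift K T (\<lambda>h1 h2. tensor_map K C D (act C h1) (act D h2) t) (comult H h)),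
     coact = tensor_lift K (tensor_product K H T)
       (\<lambda>c d. tensor_lift K (tensor_product K H T)
         (\<lambda>g c0. tensor_lift K (tensor_product K H T)
           (\<lambda>h d0. pure_tensor K H T (g \<otimes>\<^bsub>H\<^esub> h) (pure_tensor K C D c0 d0))
           (coact D d))
         (coact C c))\<rparr>)"

locale yd_coalgebra = yd_module K H C + C: coalgebra K C
  for K :: "('k, 'm) ring_scheme" and H :: "('k, 'h, 'a) hopf_algebra_scheme"
    and C :: "('k, 'h, 'v, 'b) yd_coalgebra_scheme" +
  assumes comult_yd: "yd_morphism K H C (yd_tensor K H C C) (comult C)"
    and counit_yd: "yd_morphism K H C (yd_unit K H) (counit C)"

definition yd_coalgebra_morphism ::
  "('k, 'm) ring_scheme \<Rightarrow> ('k, 'h, 'a) hopf_algebra_scheme \<Rightarrow> ('k, 'h, 'v, 'b) yd_coalgebra_scheme \<Rightarrow>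
    ('k, 'h, 'w, 'c) yd_coalgebra_scheme \<Rightarrow> ('v \<Rightarrow> 'w) \<Rightarrow> bool"
  where "yd_coalgebra_morphism K H C D f \<longleftrightarrow> yd_morphism K H C D f \<and>
    (\<forall>c\<in>carrier C. comult D (f c) = tensor_map K D D f f (comult C c)) \<and>
    (\<forall>c\<in>carrier C. counit D (f c) = counit C c)"

section \<open>Bialgebras and coquasi-bialgebras in the Yetter-Drinfeld category\<close>

text \<open>
  The multiplication \<open>m : Q \<otimes> Q \<rightarrow> Q\<close> and the unit \<open>u : K \<rightarrow> Q\<close> are given by the bilinear map
  \<open>mult Q\<close> and the element \<open>one Q = u 1\<close>.
\<close>

definition mult_map ::
  "('k, 'm) ring_scheme \<Rightarrow> ('k, 'v, 'a) module_scheme \<Rightarrow> ('k, 'v, 'v) tensor \<Rightarrow> 'v"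
  where "mult_map K Q = tensor_lift K Q (mult Q)"

definition unit_map :: "('k, 'v, 'a) module_scheme \<Rightarrow> 'k \<Rightarrow> 'v"
  where "unit_map Q a = a \<odot>\<^bsub>Q\<^esub> \<one>\<^bsub>Q\<^esub>"

text \<open>
  A coalgebra in the category with a unital, not necessarily associative, multiplication by coalgebra
  morphisms: the common part of the two notions.
\<close>

locale yd_magma_coalgebra = yd_coalgebra K H Q
  for K :: "('k, 'm) ring_scheme" and H :: "('k, 'h, 'a) hopf_algebra_scheme"
    and Q :: "('k, 'h, 'v, 'b) yd_coalgebra_scheme" +
  assumes product_bilinear: "bilinear_map K Q Q Q (mult Q)"
    and unit_closed: "\<one>\<^bsub>Q\<^esub> \<in> carrier Q"
    and mult_map_morphism: "yd_coalgebra_morphism K H (yd_tensor K H Q Q) Q (mult_map K Q)"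
    and unit_map_morphism: "yd_coalgebra_morphism K H (yd_unit K H) Q (unit_map Q)"
    and unit_left: "x \<in> carrier Q \<Longrightarrow> \<one>\<^bsub>Q\<^esub> \<otimes>\<^bsub>Q\<^esub> x = x"
    and unit_right: "x \<in> carrier Q \<Longrightarrow> x \<otimes>\<^bsub>Q\<^esub> \<one>\<^bsub>Q\<^esub> = x"

locale yd_bialgebra = yd_magma_coalgebra K H B
  for K :: "('k, 'm) ring_scheme" and H :: "('k, 'h, 'a) hopf_algebra_scheme"
    and B :: "('k, 'h, 'v, 'b) yd_coalgebra_scheme" +
  assumes product_assoc: "\<lbrakk>x \<in> carrier B; y \<in> carrier B; z \<in> carrier B\<rbrakk> \<Longrightarrow>
    (x \<otimes>\<^bsub>B\<^esub> y) \<otimes>\<^bsub>B\<^esub> z = x \<otimes>\<^bsub>B\<^esub> (y \<otimes>\<^bsub>B\<^esub> z)"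

text \<open>
  The convolution product of \<open>f : C \<rightarrow> A\<close> and \<open>g : C \<rightarrow> A'\<close> with respect to a bilinear map
  \<open>\<beta> : A \<times> A' \<rightarrow> U\<close>. The latter is the multiplication of \<open>K\<close> for scalar valued maps, and scalar
  multiplication if one of the maps is scalar valued and the other one is not.
\<close>

definition convolution ::
  "('k, 'm) ring_scheme \<Rightarrow> ('k, 'v, 'a) coalgebra_scheme \<Rightarrow> ('k, 'u, 'c) module_scheme \<Rightarrow>
    ('x \<Rightarrow> 'y \<Rightarrow> 'u) \<Rightarrow> ('v \<Rightarrow> 'x) \<Rightarrow> ('v \<Rightarrow> 'y) \<Rightarrow> 'v \<Rightarrow> 'u"
  where "convolution K C U \<beta> f g t = tensor_lift K U (\<lambda>t1 t2. \<beta> (f t1) (g t2)) (comult C t)"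

definition scalar_convolution ::
  "('k, 'm) ring_scheme \<Rightarrow> ('k, 'v, 'a) coalgebra_scheme \<Rightarrow> ('v \<Rightarrow> 'k) \<Rightarrow> ('v \<Rightarrow> 'k) \<Rightarrow> 'v \<Rightarrow> 'k"
  where "scalar_convolution K C = convolution K C (ground_module K) (mult K)"

definition convolution_invertible ::
  "('k, 'm) ring_scheme \<Rightarrow> ('k, 'v, 'a) coalgebra_scheme \<Rightarrow> ('v \<Rightarrow> 'k) \<Rightarrow> bool"
  where "convolution_invertible K C f \<longleftrightarrow> (\<exists>g. linear_map K C (ground_module K) g \<and>
    (\<forall>t\<in>carrier C. scalar_convolution K C f g t = counit C t \<and>
                    scalar_convolution K C g f t = counit C t))"

definition yd_tensor3 ::
  "('k, 'm) ring_scheme \<Rightarrow> ('k, 'h, 'a) hopf_algebra_scheme \<Rightarrow> ('k, 'h, 'v, 'b) yd_coalgebra_scheme \<Rightarrow>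
    ('k, 'h, ('k, 'v, ('k, 'v, 'v) tensor) tensor) yd_coalgebra"
  where "yd_tensor3 K H Q = yd_tensor K H Q (yd_tensor K H Q Q)"

definition yd_tensor4 ::
  "('k, 'm) ring_scheme \<Rightarrow> ('k, 'h, 'a) hopf_algebra_scheme \<Rightarrow> ('k, 'h, 'v, 'b) yd_coalgebra_scheme \<Rightarrow>
    ('k, 'h, ('k, 'v, ('k, 'v, ('k, 'v, 'v) tensor) tensor) tensor) yd_coalgebra"
  where "yd_tensor4 K H Q = yd_tensor K H Q (yd_tensor3 K H Q)"

definition trilinear_of ::
  "('k, 'm) ring_scheme \<Rightarrow> ('k, 'v, 'b) module_scheme \<Rightarrow>
    (('k, 'v, ('k, 'v, 'v) tensor) tensor \<Rightarrow> 'k) \<Rightarrow> 'v \<Rightarrow> 'v \<Rightarrow> 'v \<Rightarrow> 'k"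
  where "trilinear_of K Q \<omega> x y z =
    \<omega> (pure_tensor K Q (tensor_product K Q Q) x (pure_tensor K Q Q y z))"

locale yd_coquasi_bialgebra = yd_magma_coalgebra K H Q
  for K :: "('k, 'm) ring_scheme" and H :: "('k, 'h, 'a) hopf_algebra_scheme"
    and Q :: "('k, 'h, 'v, 'b) yd_coalgebra_scheme"
    and \<omega> :: "('k, 'v, ('k, 'v, 'v) tensor) tensor \<Rightarrow> 'k" +
  assumes omega_morphism: "yd_morphism K H (yd_tensor3 K H Q) (yd_unit K H) \<omega>"
    and omega_invertible: "convolution_invertible K (yd_tensor3 K H Q) \<omega>"
    and omega_cocycle: "s \<in> carrier (yd_tensor4 K H Q) \<Longrightarrow>
      scalar_convolution K (yd_tensor4 K H Q)
        (tensor_lift4 K (ground_module K) (\<lambda>x y z w. trilinear_of K Q \<omega> x y (z \<otimes>\<^bsub>Q\<^esub> w)))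
        (tensor_lift4 K (ground_module K) (\<lambda>x y z w. trilinear_of K Q \<omega> (x \<otimes>\<^bsub>Q\<^esub> y) z w)) s
      = scalar_convolution K (yd_tensor4 K H Q)
        (scalar_convolution K (yd_tensor4 K H Q)
          (tensor_lift4 K (ground_module K)
            (\<lambda>x y z w. counit Q x \<otimes>\<^bsub>K\<^esub> trilinear_of K Q \<omega> y z w))
          (tensor_lift4 K (ground_module K) (\<lambda>x y z w. trilinear_of K Q \<omega> x (y \<otimes>\<^bsub>Q\<^esub> z) w)))
        (tensor_lift4 K (ground_module K)
          (\<lambda>x y z w. trilinear_of K Q \<omega> x y z \<otimes>\<^bsub>K\<^esub> counit Q w)) s"
    and omega_unit_middle: "\<lbrakk>x \<in> carrier Q; y \<in> carrier Q\<rbrakk> \<Longrightarrow>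
      trilinear_of K Q \<omega> x \<one>\<^bsub>Q\<^esub> y = counit (yd_tensor K H Q Q) (pure_tensor K Q Q x y)"
    and omega_unit_left: "\<lbrakk>x \<in> carrier Q; y \<in> carrier Q\<rbrakk> \<Longrightarrow>
      trilinear_of K Q \<omega> \<one>\<^bsub>Q\<^esub> x y = counit (yd_tensor K H Q Q) (pure_tensor K Q Q x y)"
    and omega_unit_right: "\<lbrakk>x \<in> carrier Q; y \<in> carrier Q\<rbrakk> \<Longrightarrow>
      trilinear_of K Q \<omega> x y \<one>\<^bsub>Q\<^esub> = counit (yd_tensor K H Q Q) (pure_tensor K Q Q x y)"
    and quasi_assoc: "t \<in> carrier (yd_tensor3 K H Q) \<Longrightarrow>
      convolution K (yd_tensor3 K H Q) Q (\<lambda>q a. a \<odot>\<^bsub>Q\<^esub> q)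
        (tensor_lift3 K Q (\<lambda>x y z. x \<otimes>\<^bsub>Q\<^esub> (y \<otimes>\<^bsub>Q\<^esub> z))) \<omega> t
      = convolution K (yd_tensor3 K H Q) Q (\<lambda>a q. a \<odot>\<^bsub>Q\<^esub> q)
        \<omega> (tensor_lift3 K Q (\<lambda>x y z. (x \<otimes>\<^bsub>Q\<^esub> y) \<otimes>\<^bsub>Q\<^esub> z)) t"

definition connected_yd ::
  "('k, 'm) ring_scheme \<Rightarrow> ('k, 'v, 'b) coalgebra_scheme \<Rightarrow> bool"
  where "connected_yd K Q \<longleftrightarrow> coradical K Q = {a \<odot>\<^bsub>Q\<^esub> \<one>\<^bsub>Q\<^esub> | a. a \<in> carrier K}"

section \<open>The associated graded object\<close>

definition corad_below ::
  "('k, 'm) ring_scheme \<Rightarrow> ('k, 'v, 'b) coalgebra_scheme \<Rightarrow> nat \<Rightarrow> 'v set"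
  where "corad_below K Q n =
    (case n of 0 \<Rightarrow> {\<zero>\<^bsub>Q\<^esub>} | Suc k \<Rightarrow> coradical_filtration K Q k)"

definition gr_component ::
  "('k, 'm) ring_scheme \<Rightarrow> ('k, 'v, 'b) coalgebra_scheme \<Rightarrow> nat \<Rightarrow> ('k, 'v set) module"
  where "gr_component K Q n =
    quotient_module (Q\<lparr>carrier := coradical_filtration K Q n\<rparr>) (corad_below K Q n)"

definition gr_module ::
  "('k, 'm) ring_scheme \<Rightarrow> ('k, 'v, 'b) coalgebra_scheme \<Rightarrow> ('k, nat \<Rightarrow> 'v set) module"
  where "gr_module K Q = direct_sum (gr_component K Q)"

text \<open>The class \<open>x + Q\<^sub>n\<^sub>-\<^sub>1\<close> of an element \<open>x\<close> of \<open>Q\<^sub>n\<close>, as an element of degree \<open>n\<close> of \<open>gr Q\<close>.\<close>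

definition gr_class ::
  "('k, 'm) ring_scheme \<Rightarrow> ('k, 'v, 'b) coalgebra_scheme \<Rightarrow> nat \<Rightarrow> 'v \<Rightarrow> nat \<Rightarrow> 'v set"
  where "gr_class K Q n x =
    (\<lambda>i. if i = n then corad_below K Q n +>\<^bsub>Q\<^esub> x else \<zero>\<^bsub>gr_component K Q i\<^esub>)"

definition gr_support ::
  "('k, 'm) ring_scheme \<Rightarrow> ('k, 'v, 'b) coalgebra_scheme \<Rightarrow> (nat \<Rightarrow> 'v set) \<Rightarrow> nat set"
  where "gr_support K Q f = {n. f n \<noteq> \<zero>\<^bsub>gr_component K Q n\<^esub>}"

definition coset_rep :: "'v set \<Rightarrow> 'v"
  where "coset_rep X = (SOME x. x \<in> X)"

text \<open>
  \<open>\<Delta>(x + Q\<^sub>n\<^sub>-\<^sub>1)\<close> for \<open>x\<close> in \<open>Q\<^sub>n\<close>. In the formula \<open>\<Sum>\<^sub>i (x\<^sub>1 + Q\<^sub>i\<^sub>-\<^sub>1) \<otimes> (x\<^sub>2 + Q\<^sub>n\<^sub>-\<^sub>i\<^sub>-\<^sub>1)\<close>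
  the \<open>i\<close>-th summand refers to the \<open>i\<close>-th part of a decomposition of \<open>\<Delta>(x)\<close> as a sum of elements
  of \<open>Q\<^sub>i \<otimes> Q\<^sub>n\<^sub>-\<^sub>i\<close>; the result does not depend on the decomposition.
\<close>

definition gr_comult_class ::
  "('k, 'm) ring_scheme \<Rightarrow> ('k, 'v, 'b) coalgebra_scheme \<Rightarrow> nat \<Rightarrow> 'v \<Rightarrow>
    ('k, nat \<Rightarrow> 'v set, nat \<Rightarrow> 'v set) tensor"
  where "gr_comult_class K Q n x = (THE T. \<exists>(N::nat) a b.
    (\<forall>i\<le>n. \<forall>j<N. a i j \<in> coradical_filtration K Q i \<and> b i j \<in> coradical_filtration K Q (n - i)) \<and>
    comult Q x = (\<Oplus>\<^bsub>tensor_product K Q Q\<^esub>i\<in>{..n}. \<Oplus>\<^bsub>tensor_product K Q Q\<^esub>j\<in>{..<N}.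
      pure_tensor K Q Q (a i j) (b i j)) \<and>
    T = (\<Oplus>\<^bsub>tensor_product K (gr_module K Q) (gr_module K Q)\<^esub>i\<in>{..n}.
      \<Oplus>\<^bsub>tensor_product K (gr_module K Q) (gr_module K Q)\<^esub>j\<in>{..<N}.
      pure_tensor K (gr_module K Q) (gr_module K Q)
        (gr_class K Q i (a i j)) (gr_class K Q (n - i) (b i j))))"

text \<open>\<open>x\<^sub>-\<^sub>1 \<otimes> (x\<^sub>0 + Q\<^sub>n\<^sub>-\<^sub>1)\<close> for \<open>x\<close> in \<open>Q\<^sub>n\<close>, where the coaction of \<open>x\<close> is written in \<open>H \<otimes> Q\<^sub>n\<close>.\<close>

definition gr_coact_class ::
  "('k, 'm) ring_scheme \<Rightarrow> ('k, 'h, 'a) hopf_algebra_scheme \<Rightarrow> ('k, 'h, 'v, 'b) yd_coalgebra_scheme \<Rightarrow>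
    nat \<Rightarrow> 'v \<Rightarrow> ('k, 'h, nat \<Rightarrow> 'v set) tensor"
  where "gr_coact_class K H Q n x = (THE T. \<exists>(N::nat) h b.
    (\<forall>j<N. h j \<in> carrier H \<and> b j \<in> coradical_filtration K Q n) \<and>
    coact Q x = (\<Oplus>\<^bsub>tensor_product K H Q\<^esub>j\<in>{..<N}. pure_tensor K H Q (h j) (b j)) \<and>
    T = (\<Oplus>\<^bsub>tensor_product K H (gr_module K Q)\<^esub>j\<in>{..<N}.
      pure_tensor K H (gr_module K Q) (h j) (gr_class K Q n (b j))))"

definition gr ::
  "('k, 'm) ring_scheme \<Rightarrow> ('k, 'h, 'a) hopf_algebra_scheme \<Rightarrow> ('k, 'h, 'v, 'b) yd_coalgebra_scheme \<Rightarrow>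
    ('k, 'h, nat \<Rightarrow> 'v set) yd_coalgebra"
  where "gr K H Q = (let G = gr_module K Q in
    \<lparr>carrier = carrier G,
     mult = (\<lambda>f g n. \<Oplus>\<^bsub>gr_component K Q n\<^esub>a\<in>{..n}.
       corad_below K Q n +>\<^bsub>Q\<^esub> (coset_rep (f a) \<otimes>\<^bsub>Q\<^esub> coset_rep (g (n - a)))),
     one = gr_class K Q 0 \<one>\<^bsub>Q\<^esub>,
     zero = \<zero>\<^bsub>G\<^esub>, add = add G, smult = smult G,
     comult = (\<lambda>f. \<Oplus>\<^bsub>tensor_product K G G\<^esub>n\<in>gr_support K Q f. gr_comult_class K Q n (coset_rep (f n))),
     counit = (\<lambda>f. counit Q (coset_rep (f 0))),
     act = (\<lambda>h f n. corad_below K Q n +>\<^bsub>Q\<^esub> act Q h (coset_rep (f n))),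
     coact = (\<lambda>f. \<Oplus>\<^bsub>tensor_product K H G\<^esub>n\<in>gr_support K Q f. gr_coact_class K H Q n (coset_rep (f n)))\<rparr>)"

end

theory Submission
  imports Defs
begin

text \<open>
  Write \<open>Q\<^sub>n\<close> for the terms of the coradical filtration of \<open>Q\<close>. The proof has three parts.

  \<^bold>\<open>The filtration is respected.\<close> Since \<open>Q\<close> is connected, \<open>Q\<^sub>0\<close> is spanned by the grouplike element \<open>1\<close>, on which
  all structure maps are known. Induction on \<open>n\<close>, with \<open>Q\<^sub>n\<^sub>+\<^sub>1 = \<Delta>\<^sup>-\<^sup>1(Q \<otimes> Q\<^sub>n + Q\<^sub>0 \<otimes> Q)\<close>, gives
  \<open>\<Delta> Q\<^sub>n \<subseteq> \<Sum> Q\<^sub>i \<otimes> Q\<^sub>n\<^sub>-\<^sub>i\<close> (\<open>comult_F\<close>, from coassociativity), \<open>H Q\<^sub>n \<subseteq> Q\<^sub>n\<close> (\<open>act_F\<close>, from linearity of \<open>\<Delta>\<close> over \<open>H\<close>),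
  \<open>Q\<^sub>n \<rightarrow> H \<otimes> Q\<^sub>n\<close> for the coaction (\<open>coact_F\<close>, from colinearity of \<open>\<Delta>\<close>) and \<open>Q\<^sub>a Q\<^sub>b \<subseteq> Q\<^sub>a\<^sub>+\<^sub>b\<close> (\<open>mult_F\<close>, as the
  multiplication is a morphism of coalgebras).

  \<^bold>\<open>Identities pass to symbols.\<close> A filtered space, its associated graded space and the passage from the one to
  the other are packed into a single relation \<open>R n x g\<close>: the element \<open>x\<close> lies in the \<open>n\<close>-th filtration term and \<open>g\<close>
  is its symbol in degree \<open>n\<close>. Such relations can be tensored (\<open>filtered_tensor\<close>) and are preserved by maps
  that are given in Sweedler notation by related bilinear maps (\<open>rel_lift\<close>). The structure maps of \<open>Q\<close> and \<open>gr Q\<close>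
  are related by the first part. As symbols are unique and span the graded space, an identity between
  composites of structure maps that holds in \<open>Q\<close> holds in \<open>gr Q\<close> (\<open>symbol_transfer\<close>). This yields every axiom
  but associativity. The quasi-associativity \<open>m(Q \<otimes> m) * \<omega> = \<omega> * m(m \<otimes> Q)\<close> is transferred in the same way, and \<open>\<omega>\<close>
  then has to be replaced by its symbol. This symbol vanishes in positive degrees because \<open>\<omega>\<close> is scalar valued,
  and it is the counit in degree \<open>0\<close> because \<open>\<omega>(x \<otimes> 1 \<otimes> z) = \<epsilon>(x) \<epsilon>(z)\<close> (\<open>omega_rel\<close>). So the convolutions with \<open>\<omega>\<close>
  become convolutions with the counit of \<open>gr Q \<otimes> gr Q \<otimes> gr Q\<close>, which are trivial (\<open>counital_tensor\<close>), and the
  multiplication of \<open>gr Q\<close> is associative.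

  \<^bold>\<open>Connectedness.\<close> Let \<open>D\<close> be a nonzero subcoalgebra of \<open>gr Q\<close> and \<open>n\<close> minimal such that \<open>D\<close> has a nonzero element
  \<open>d\<close> of degree at most \<open>n\<close>. Suppose \<open>n > 0\<close>. The projection \<open>\<pi>\<close> to the degrees at least \<open>n\<close> is injective on \<open>D\<close>, hence
  so is \<open>\<pi> \<otimes> \<pi>\<close> on \<open>D \<otimes> D\<close>. But \<open>\<pi> \<otimes> \<pi>\<close> kills \<open>\<Delta> d\<close>, whose total degree is at most \<open>n < 2 n\<close>. So \<open>\<Delta> d = 0\<close> and
  \<open>d = 0\<close>, a contradiction. Thus \<open>D\<close> contains \<open>1\<close>, and the line spanned by \<open>1\<close> is the only simple subcoalgebra.
\<close>

section \<open>Linear maps, quotients and free modules\<close>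

locale vector_spaces = K: field K for K :: "('k, 'm) ring_scheme"
begin

lemma linear_mapI:
  assumes "\<And>x. x \<in> carrier V \<Longrightarrow> f x \<in> carrier W"
    and "\<And>x y. x \<in> carrier V \<Longrightarrow> y \<in> carrier V \<Longrightarrow> f (x \<oplus>\<^bsub>V\<^esub> y) = f x \<oplus>\<^bsub>W\<^esub> f y"
    and "\<And>a x. a \<in> carrier K \<Longrightarrow> x \<in> carrier V \<Longrightarrow> f (a \<odot>\<^bsub>V\<^esub> x) = a \<odot>\<^bsub>W\<^esub> f x"
  shows "linear_map K V W f"
  using assms unfolding linear_map_def by auto

lemma linear_closed: "linear_map K V W f \<Longrightarrow> x \<in> carrier V \<Longrightarrow> f x \<in> carrier W"
  unfolding linear_map_def by auto

lemma linear_add: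
  "linear_map K V W f \<Longrightarrow> x \<in> carrier V \<Longrightarrow> y \<in> carrier V \<Longrightarrow> f (x \<oplus>\<^bsub>V\<^esub> y) = f x \<oplus>\<^bsub>W\<^esub> f y"
  unfolding linear_map_def by auto

lemma linear_smult:
  "linear_map K V W f \<Longrightarrow> a \<in> carrier K \<Longrightarrow> x \<in> carrier V \<Longrightarrow> f (a \<odot>\<^bsub>V\<^esub> x) = a \<odot>\<^bsub>W\<^esub> f x"
  unfolding linear_map_def by auto

lemma diff_add_cancel:
  assumes "module K V" "x \<in> carrier V" "y \<in> carrier V"
  shows "(x \<ominus>\<^bsub>V\<^esub> y) \<oplus>\<^bsub>V\<^esub> y = x" "x \<ominus>\<^bsub>V\<^esub> y = \<zero>\<^bsub>V\<^esub> \<longleftrightarrow> x = y"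
    "y \<oplus>\<^bsub>V\<^esub> (x \<ominus>\<^bsub>V\<^esub> y) = x"
proof -
  interpret V: module K V by fact
  show 1: "(x \<ominus>\<^bsub>V\<^esub> y) \<oplus>\<^bsub>V\<^esub> y = x" using assms(2,3) by (simp add: V.minus_eq V.a_assoc V.l_neg)
  then show "x \<ominus>\<^bsub>V\<^esub> y = \<zero>\<^bsub>V\<^esub> \<longleftrightarrow> x = y" using assms(2,3) by (auto simp: V.minus_eq V.r_neg)
  show "y \<oplus>\<^bsub>V\<^esub> (x \<ominus>\<^bsub>V\<^esub> y) = x" using 1 assms(2,3) by (subst V.a_comm) auto
qed

lemma add_cancel_inner:
  assumes "module K V" "x \<in> carrier V" "y \<in> carrier V"
  shows "x \<oplus>\<^bsub>V\<^esub> (y \<oplus>\<^bsub>V\<^esub> \<ominus>\<^bsub>V\<^esub> x) = y" "\<ominus>\<^bsub>V\<^esub> x \<oplus>\<^bsub>V\<^esub> (y \<oplus>\<^bsub>V\<^esub> x) = y"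
    "x \<oplus>\<^bsub>V\<^esub> (\<ominus>\<^bsub>V\<^esub> x \<oplus>\<^bsub>V\<^esub> y) = y" "\<ominus>\<^bsub>V\<^esub> x \<oplus>\<^bsub>V\<^esub> (x \<oplus>\<^bsub>V\<^esub> y) = y"
proof -
  interpret V: module K V by fact
  show "x \<oplus>\<^bsub>V\<^esub> (\<ominus>\<^bsub>V\<^esub> x \<oplus>\<^bsub>V\<^esub> y) = y" "\<ominus>\<^bsub>V\<^esub> x \<oplus>\<^bsub>V\<^esub> (x \<oplus>\<^bsub>V\<^esub> y) = y"
    using assms(2,3) by (simp_all add: V.a_assoc[symmetric] V.r_neg V.l_neg)
  then show "x \<oplus>\<^bsub>V\<^esub> (y \<oplus>\<^bsub>V\<^esub> \<ominus>\<^bsub>V\<^esub> x) = y" "\<ominus>\<^bsub>V\<^esub> x \<oplus>\<^bsub>V\<^esub> (y \<oplus>\<^bsub>V\<^esub> x) = y"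
    using assms(2,3) by (simp_all add: V.a_comm)
qed

lemma linear_zero:
  assumes "module K V" "module K W" "linear_map K V W f"
  shows "f \<zero>\<^bsub>V\<^esub> = \<zero>\<^bsub>W\<^esub>"
proof -
  interpret V: module K V by fact
  interpret W: module K W by fact
  have "f (\<zero>\<^bsub>K\<^esub> \<odot>\<^bsub>V\<^esub> \<zero>\<^bsub>V\<^esub>) = \<zero>\<^bsub>K\<^esub> \<odot>\<^bsub>W\<^esub> f \<zero>\<^bsub>V\<^esub>"
    by (rule linear_smult[OF assms(3)]) auto
  then show ?thesis using linear_closed[OF assms(3)] by simp
qed

lemma linear_minus:
  assumes "module K V" "module K W" "linear_map K V W f" "x \<in> carrier V" "y \<in> carrier V"
  shows "f (x \<ominus>\<^bsub>V\<^esub> y) = f x \<ominus>\<^bsub>W\<^esub> f y"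
proof -
  interpret V: module K V by fact
  interpret W: module K W by fact
  have c: "f x \<in> carrier W" "f y \<in> carrier W" "f (x \<ominus>\<^bsub>V\<^esub> y) \<in> carrier W"
    using linear_closed[OF assms(3)] assms(4,5) by auto
  have "x = (x \<ominus>\<^bsub>V\<^esub> y) \<oplus>\<^bsub>V\<^esub> y" using assms(4,5) by (simp add: V.minus_eq V.a_assoc V.l_neg)
  then have "f x = f (x \<ominus>\<^bsub>V\<^esub> y) \<oplus>\<^bsub>W\<^esub> f y"
    using linear_add[OF assms(3), of "x \<ominus>\<^bsub>V\<^esub> y" y] assms(4,5) by auto
  then show ?thesis using c by (simp add: W.minus_eq W.a_assoc W.r_neg)
qed

lemma linear_id: "linear_map K V V (\<lambda>x. x)"
  by (auto intro: linear_mapI)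

lemma linear_comp:
  "linear_map K V W f \<Longrightarrow> linear_map K W U g \<Longrightarrow> linear_map K V U (\<lambda>x. g (f x))"
  unfolding linear_map_def by (auto simp: Pi_iff)

lemma linear_const_zero: "module K W \<Longrightarrow> linear_map K V W (\<lambda>x. \<zero>\<^bsub>W\<^esub>)"
proof -
  assume "module K W"
  then interpret W: module K W .
  show ?thesis by (auto intro: linear_mapI)
qed

lemma linear_sum:
  assumes "module K V" "module K W" "linear_map K V W f" "linear_map K V W g"
  shows "linear_map K V W (\<lambda>x. f x \<oplus>\<^bsub>W\<^esub> g x)"
proof -
  interpret V: module K V by fact
  interpret W: module K W by fact
  show ?thesis
    by (rule linear_mapI)
      (auto simp: linear_closed[OF assms(3)] linear_closed[OF assms(4)] linear_add[OF assms(3)]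
        linear_add[OF assms(4)] linear_smult[OF assms(3)] linear_smult[OF assms(4)] W.a_ac W.smult_r_distr)
qed

lemma linear_scaled:
  assumes "module K V" "module K W" "linear_map K V W f" "a \<in> carrier K"
  shows "linear_map K V W (\<lambda>x. a \<odot>\<^bsub>W\<^esub> f x)"
proof -
  interpret V: module K V by fact
  interpret W: module K W by fact
  show ?thesis using assms(4)
    by (auto intro!: linear_mapI simp: linear_closed[OF assms(3)] linear_add[OF assms(3)]
        linear_smult[OF assms(3)] W.smult_r_distr K.m_comm simp flip: W.smult_assoc1)
qed

lemma linear_diff:
  assumes "module K V" "module K W" "linear_map K V W f" "linear_map K V W g"
  shows "linear_map K V W (\<lambda>x. f x \<ominus>\<^bsub>W\<^esub> g x)"
proof -
  interpret V: module K V by fact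
  interpret W: module K W by fact
  have eq: "f x \<ominus>\<^bsub>W\<^esub> g x = f x \<oplus>\<^bsub>W\<^esub> (\<ominus>\<^bsub>K\<^esub> \<one>\<^bsub>K\<^esub>) \<odot>\<^bsub>W\<^esub> g x" if "x \<in> carrier V" for x
    using that linear_closed[OF assms(4)] by (simp add: W.minus_eq W.smult_l_minus)
  have "linear_map K V W (\<lambda>x. f x \<oplus>\<^bsub>W\<^esub> (\<ominus>\<^bsub>K\<^esub> \<one>\<^bsub>K\<^esub>) \<odot>\<^bsub>W\<^esub> g x)"
    by (intro linear_sum linear_scaled assms) auto
  then show ?thesis unfolding linear_map_def using eq by (auto simp: Pi_iff)
qed

lemma linear_finsum_maps:
  assumes "module K V" "module K W" "finite A" "\<And>i. i \<in> A \<Longrightarrow> linear_map K V W (f i)"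
  shows "linear_map K V W (\<lambda>x. \<Oplus>\<^bsub>W\<^esub>i\<in>A. f i x)"
proof -
  interpret V: module K V by fact
  interpret W: module K W by fact
  note c = linear_closed[OF assms(4)]
  show ?thesis
  proof (rule linear_mapI)
    fix x y assume "x \<in> carrier V" "y \<in> carrier V"
    note xy = this
    show "(\<Oplus>\<^bsub>W\<^esub>i\<in>A. f i (x \<oplus>\<^bsub>V\<^esub> y)) = (\<Oplus>\<^bsub>W\<^esub>i\<in>A. f i x) \<oplus>\<^bsub>W\<^esub> (\<Oplus>\<^bsub>W\<^esub>i\<in>A. f i y)"
    proof -
      have "(\<Oplus>\<^bsub>W\<^esub>i\<in>A. f i (x \<oplus>\<^bsub>V\<^esub> y)) = (\<Oplus>\<^bsub>W\<^esub>i\<in>A. f i x \<oplus>\<^bsub>W\<^esub> f i y)"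
        by (rule W.finsum_cong') (use xy c linear_add[OF assms(4)] in auto)
      then show ?thesis using xy c by (simp add: W.finsum_addf Pi_iff)
    qed
  next
    fix a x assume "a \<in> carrier K" "x \<in> carrier V"
    then show "(\<Oplus>\<^bsub>W\<^esub>i\<in>A. f i (a \<odot>\<^bsub>V\<^esub> x)) = a \<odot>\<^bsub>W\<^esub> (\<Oplus>\<^bsub>W\<^esub>i\<in>A. f i x)"
      using c assms(3) by (subst W.finsum_smult_ldistr) (auto intro!: W.finsum_cong' simp: linear_smult[OF assms(4)])
  qed (use c in \<open>auto intro!: W.finsum_closed\<close>)
qed

lemma linear_cong:
  assumes "linear_map K V W f" "\<And>x. x \<in> carrier V \<Longrightarrow> f x = g x" "module K V"
  shows "linear_map K V W g"
proof -
  interpret V: module K V by fact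
  show ?thesis using assms(1,2) unfolding linear_map_def by (auto simp: Pi_iff)
qed

lemma bilinear_mapI:
  assumes "\<And>v. v \<in> carrier V \<Longrightarrow> linear_map K W U (\<lambda>w. \<beta> v w)"
    and "\<And>w. w \<in> carrier W \<Longrightarrow> linear_map K V U (\<lambda>v. \<beta> v w)"
  shows "bilinear_map K V W U \<beta>"
  using assms unfolding bilinear_map_def by auto

lemma bilinear_right: "bilinear_map K V W U \<beta> \<Longrightarrow> v \<in> carrier V \<Longrightarrow> linear_map K W U (\<beta> v)"
  unfolding bilinear_map_def by auto

lemma bilinear_left: "bilinear_map K V W U \<beta> \<Longrightarrow> w \<in> carrier W \<Longrightarrow> linear_map K V U (\<lambda>v. \<beta> v w)"
  unfolding bilinear_map_def by auto

lemma bilinear_closed: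
  "bilinear_map K V W U \<beta> \<Longrightarrow> v \<in> carrier V \<Longrightarrow> w \<in> carrier W \<Longrightarrow> \<beta> v w \<in> carrier U"
  using bilinear_right linear_closed by metis

subsection \<open>Submodules\<close>

lemma submoduleD:
  assumes "submodule N K V" "module K V"
  shows "N \<subseteq> carrier V" "\<zero>\<^bsub>V\<^esub> \<in> N" "\<And>x y. x \<in> N \<Longrightarrow> y \<in> N \<Longrightarrow> x \<oplus>\<^bsub>V\<^esub> y \<in> N"
    "\<And>a x. a \<in> carrier K \<Longrightarrow> x \<in> N \<Longrightarrow> a \<odot>\<^bsub>V\<^esub> x \<in> N" "\<And>x. x \<in> N \<Longrightarrow> \<ominus>\<^bsub>V\<^esub> x \<in> N"
    "\<And>x y. x \<in> N \<Longrightarrow> y \<in> N \<Longrightarrow> x \<ominus>\<^bsub>V\<^esub> y \<in> N"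
proof -
  interpret V: module K V by fact
  note E = V.submoduleE[OF assms(1)]
  show *: "N \<subseteq> carrier V" "\<And>x y. x \<in> N \<Longrightarrow> y \<in> N \<Longrightarrow> x \<oplus>\<^bsub>V\<^esub> y \<in> N"
    "\<And>a x. a \<in> carrier K \<Longrightarrow> x \<in> N \<Longrightarrow> a \<odot>\<^bsub>V\<^esub> x \<in> N" "\<And>x. x \<in> N \<Longrightarrow> \<ominus>\<^bsub>V\<^esub> x \<in> N"
    using E by auto
  then show "\<And>x y. x \<in> N \<Longrightarrow> y \<in> N \<Longrightarrow> x \<ominus>\<^bsub>V\<^esub> y \<in> N" by (auto simp: V.minus_eq)
  from E(2) obtain x where "x \<in> N" by auto
  with *(1) *(3)[of "\<zero>\<^bsub>K\<^esub>" x] show "\<zero>\<^bsub>V\<^esub> \<in> N" by auto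
qed

lemma submodule_criterion:
  assumes "module K V" "N \<subseteq> carrier V" "\<zero>\<^bsub>V\<^esub> \<in> N"
    "\<And>x y. x \<in> N \<Longrightarrow> y \<in> N \<Longrightarrow> x \<oplus>\<^bsub>V\<^esub> y \<in> N"
    "\<And>a x. a \<in> carrier K \<Longrightarrow> x \<in> N \<Longrightarrow> a \<odot>\<^bsub>V\<^esub> x \<in> N"
  shows "submodule N K V"
proof -
  interpret V: module K V by fact
  have "\<ominus>\<^bsub>V\<^esub> x \<in> N" if "x \<in> N" for x
    using assms(5)[of "\<ominus>\<^bsub>K\<^esub> \<one>\<^bsub>K\<^esub>" x] that assms(2) by (auto simp: V.smult_l_minus)
  with assms show ?thesis by (intro V.submoduleI) auto
qed

lemma hull_submodule:
  assumes "module K V" "S \<subseteq> carrier V"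
  shows "submodule (subspace_hull K V S) K V"
proof -
  interpret V: module K V by fact
  have c: "submodule (carrier V) K V" by (rule V.carrier_is_submodule)
  note D = submoduleD[OF _ assms(1)]
  show ?thesis unfolding subspace_hull_def
  proof (rule submodule_criterion[OF assms(1)])
    show "\<Inter>{N. submodule N K V \<and> S \<subseteq> N} \<subseteq> carrier V" using c assms(2) by auto
  qed (use D(2-4) in \<open>blast+\<close>)
qed

lemma hull_subset: "S \<subseteq> subspace_hull K V S"
  unfolding subspace_hull_def by auto

lemma hull_least: "submodule N K V \<Longrightarrow> S \<subseteq> N \<Longrightarrow> subspace_hull K V S \<subseteq> N"
  unfolding subspace_hull_def by auto

lemma hull_mono: "S \<subseteq> T \<Longrightarrow> subspace_hull K V S \<subseteq> subspace_hull K V T"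
  unfolding subspace_hull_def by auto

lemma linear_vimage_submodule:
  assumes "module K V" "module K W" "linear_map K V W f" "submodule N K W"
  shows "submodule {x \<in> carrier V. f x \<in> N} K V"
proof -
  interpret V: module K V by fact
  show ?thesis
    by (rule submodule_criterion[OF assms(1)])
      (use submoduleD[OF assms(4,2)] in \<open>auto simp: linear_zero[OF assms(1-3)] linear_add[OF assms(3)] linear_smult[OF assms(3)]\<close>)
qed

lemma linear_image_submodule:
  assumes "module K V" "module K W" "linear_map K V W f"
  shows "submodule (f ` carrier V) K W"
proof -
  interpret V: module K V by fact
  interpret W: module K W by fact
  show ?thesis
  proof (rule submodule_criterion[OF assms(2)])
    show "f ` carrier V \<subseteq> carrier W" using linear_closed[OF assms(3)] by auto
    show "\<zero>\<^bsub>W\<^esub> \<in> f ` carrier V" using linear_zero[OF assms] by (metis V.zero_closed imageI)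
    show "x \<oplus>\<^bsub>W\<^esub> y \<in> f ` carrier V" if "x \<in> f ` carrier V" "y \<in> f ` carrier V" for x y
      using that by (auto simp flip: linear_add[OF assms(3)])
    show "a \<odot>\<^bsub>W\<^esub> x \<in> f ` carrier V" if "a \<in> carrier K" "x \<in> f ` carrier V" for a x
      using that by (auto simp flip: linear_smult[OF assms(3)])
  qed
qed

lemma zero_submodule: "module K V \<Longrightarrow> submodule {\<zero>\<^bsub>V\<^esub>} K V"
proof -
  assume "module K V"
  then interpret V: module K V .
  show ?thesis by (rule submodule_criterion) (auto intro: \<open>module K V\<close>)
qed

lemma linear_hull_cong:
  assumes "module K V" "module K W" "linear_map K V W f" "linear_map K V W g" "S \<subseteq> carrier V"
    and "\<And>x. x \<in> S \<Longrightarrow> f x = g x" and "x \<in> subspace_hull K V S"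
  shows "f x = g x"
proof -
  interpret V: module K V by fact
  have "submodule {x \<in> carrier V. f x = g x} K V"
    by (rule submodule_criterion[OF assms(1)])
      (auto simp: linear_zero[OF assms(1-3)] linear_zero[OF assms(1,2,4)] linear_add[OF assms(3)] linear_add[OF assms(4)]
       linear_smult[OF assms(3)] linear_smult[OF assms(4)])
  from hull_least[OF this, of S] show ?thesis using assms(5-7) by auto
qed

subsection \<open>Quotients\<close>

lemma coset_carrier_update: "N +>\<^bsub>V\<lparr>carrier := A\<rparr>\<^esub> x = N +>\<^bsub>V\<^esub> x"
  by (simp add: a_r_coset_def')

lemma submodule_abelian_subgroup:
  assumes "module K V" "submodule N K V" shows "abelian_subgroup N V"
proof -
  interpret V: module K V by fact
  have "additive_subgroup N V"
    using assms(2) unfolding submodule_def by (intro additive_subgroup.intro) auto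
  then show ?thesis using V.abelian_group_axioms by (rule abelian_subgroupI3)
qed

lemma diff_zero:
  assumes "module K V" "x \<in> carrier V" shows "x \<ominus>\<^bsub>V\<^esub> \<zero>\<^bsub>V\<^esub> = x"
proof -
  interpret V: module K V by fact
  have "\<ominus>\<^bsub>V\<^esub> \<zero>\<^bsub>V\<^esub> = \<zero>\<^bsub>V\<^esub>" using V.r_neg[OF V.zero_closed] by simp
  then show ?thesis using assms(2) by (simp add: V.minus_eq)
qed

lemma mem_coset:
  assumes "module K V" "submodule N K V" "x \<in> carrier V" "y \<in> carrier V"
  shows "y \<in> N +>\<^bsub>V\<^esub> x \<longleftrightarrow> y \<ominus>\<^bsub>V\<^esub> x \<in> N"
proof -
  interpret V: module K V by fact
  interpret N: abelian_subgroup N V by (rule submodule_abelian_subgroup[OF assms(1,2)])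
  show ?thesis using N.a_rcos_module[of x y] assms(3,4) by (simp add: V.minus_eq)
qed

lemma coset_eq_iff:
  assumes "module K V" "submodule N K V" "x \<in> carrier V" "y \<in> carrier V"
  shows "N +>\<^bsub>V\<^esub> x = N +>\<^bsub>V\<^esub> y \<longleftrightarrow> x \<ominus>\<^bsub>V\<^esub> y \<in> N"
proof -
  interpret V: module K V by fact
  interpret N: abelian_subgroup N V by (rule submodule_abelian_subgroup[OF assms(1,2)])
  show ?thesis
    using mem_coset[OF assms(1,2,4,3)] N.a_repr_independence'[of x y] N.a_rcos_self[of x] assms(3,4) by auto
qed

lemma coset_subset: "module K V \<Longrightarrow> submodule N K V \<Longrightarrow> x \<in> carrier V \<Longrightarrow> N +>\<^bsub>V\<^esub> x \<subseteq> carrier V"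
  by (rule abelian_monoid.a_r_coset_subset_G[OF abelian_group.axioms(1)[OF module.axioms(2)] submoduleD(1)])

lemma coset_self:
  assumes "module K V" "submodule N K V" "x \<in> carrier V" shows "x \<in> N +>\<^bsub>V\<^esub> x"
  using abelian_subgroup.a_rcos_self[OF submodule_abelian_subgroup] assms by metis

lemma coset_zero:
  assumes "module K V" "submodule N K V" shows "N +>\<^bsub>V\<^esub> \<zero>\<^bsub>V\<^esub> = N"
proof -
  interpret V: module K V by fact
  show ?thesis using submoduleD(1)[OF assms(2,1)] by simp
qed

lemma coset_eq_self_iff:
  assumes "module K V" "submodule N K V" "x \<in> carrier V" shows "N +>\<^bsub>V\<^esub> x = N \<longleftrightarrow> x \<in> N"
proof -
  interpret V: module K V by fact
  show ?thesis using coset_eq_iff[OF assms(1-3) V.zero_closed] assms(3)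
    by (simp add: coset_zero[OF assms(1,2)] diff_zero[OF assms(1)])
qed

lemma coset_add:
  assumes "module K V" "submodule N K V" "x \<in> carrier V" "y \<in> carrier V"
  shows "(N +>\<^bsub>V\<^esub> x) <+>\<^bsub>V\<^esub> (N +>\<^bsub>V\<^esub> y) = N +>\<^bsub>V\<^esub> (x \<oplus>\<^bsub>V\<^esub> y)"
  using abelian_subgroup.a_rcos_sum[OF submodule_abelian_subgroup] assms by metis

lemma coset_smult:
  assumes "module K V" "submodule N K V" "x \<in> carrier V" "a \<in> carrier K"
  shows "(\<Union>z\<in>N +>\<^bsub>V\<^esub> x. N +>\<^bsub>V\<^esub> (a \<odot>\<^bsub>V\<^esub> z)) = N +>\<^bsub>V\<^esub> (a \<odot>\<^bsub>V\<^esub> x)"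
proof -
  interpret V: module K V by fact
  have "N +>\<^bsub>V\<^esub> (a \<odot>\<^bsub>V\<^esub> z) = N +>\<^bsub>V\<^esub> (a \<odot>\<^bsub>V\<^esub> x)" if "z \<in> N +>\<^bsub>V\<^esub> x" for z
  proof -
    have z: "z \<in> carrier V" using that coset_subset[OF assms(1-3)] by auto
    then have "z \<ominus>\<^bsub>V\<^esub> x \<in> N" using that mem_coset[OF assms(1-3)] by auto
    then have "a \<odot>\<^bsub>V\<^esub> (z \<ominus>\<^bsub>V\<^esub> x) \<in> N" using submoduleD[OF assms(2,1)] assms(4) by auto
    moreover have "a \<odot>\<^bsub>V\<^esub> (z \<ominus>\<^bsub>V\<^esub> x) = a \<odot>\<^bsub>V\<^esub> z \<ominus>\<^bsub>V\<^esub> a \<odot>\<^bsub>V\<^esub> x"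
      using z assms(3,4) by (simp add: V.minus_eq V.smult_r_distr V.smult_r_minus)
    ultimately show ?thesis using coset_eq_iff[OF assms(1,2)] z assms(3,4) by auto
  qed
  then show ?thesis using coset_self[OF assms(1-3)] by blast
qed

lemma quotient_simps:
  "carrier (quotient_module V N) = {N +>\<^bsub>V\<^esub> x | x. x \<in> carrier V}"
  "zero (quotient_module V N) = N" "add (quotient_module V N) = (\<lambda>X Y. X <+>\<^bsub>V\<^esub> Y)"
  "smult (quotient_module V N) = (\<lambda>a X. \<Union>x\<in>X. N +>\<^bsub>V\<^esub> (a \<odot>\<^bsub>V\<^esub> x))"
  by (auto simp: quotient_module_def A_RCOSETS_def' a_r_coset_def')

lemma quotient_module:
  assumes "module K V" "submodule N K V"
  shows "module K (quotient_module V N)"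
proof -
  interpret V: module K V by fact
  have s: "a \<odot>\<^bsub>quotient_module V N\<^esub> (N +>\<^bsub>V\<^esub> x) = N +>\<^bsub>V\<^esub> (a \<odot>\<^bsub>V\<^esub> x)" if "a \<in> carrier K" "x \<in> carrier V" for a x
    using coset_smult[OF assms that(2,1)] by (simp add: quotient_simps)
  note [simp] = quotient_simps(1-3) coset_add[OF assms] s
  have z: "N = N +>\<^bsub>V\<^esub> \<zero>\<^bsub>V\<^esub>" using coset_zero[OF assms] by simp
  show ?thesis
  proof (rule moduleI)
    show "abelian_group (quotient_module V N)"
    proof (rule abelian_groupI)
      show "\<zero>\<^bsub>quotient_module V N\<^esub> \<in> carrier (quotient_module V N)" using z by auto
    next
      fix x assume "x \<in> carrier (quotient_module V N)"
      then obtain v where v: "x = N +>\<^bsub>V\<^esub> v" "v \<in> carrier V" by auto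
      show "\<zero>\<^bsub>quotient_module V N\<^esub> \<oplus>\<^bsub>quotient_module V N\<^esub> x = x"
        using v coset_add[OF assms, of "\<zero>\<^bsub>V\<^esub>" v] z by simp
      show "\<exists>y\<in>carrier (quotient_module V N). y \<oplus>\<^bsub>quotient_module V N\<^esub> x = \<zero>\<^bsub>quotient_module V N\<^esub>"
        by (rule bexI[of _ "N +>\<^bsub>V\<^esub> (\<ominus>\<^bsub>V\<^esub> v)"]) (use v z in \<open>auto simp: V.l_neg\<close>)
    qed (auto simp: V.a_ac intro: V.a_comm)
  qed (use K.is_cring in \<open>auto simp: V.smult_l_distr V.smult_r_distr V.smult_assoc1 intro: V.smult_closed\<close>)
qed

lemma quotient_proj_linear:
  assumes "module K V" "submodule N K V"
  shows "linear_map K V (quotient_module V N) (\<lambda>x. N +>\<^bsub>V\<^esub> x)"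
  by (rule linear_mapI) (auto simp: quotient_simps coset_add[OF assms] coset_smult[OF assms] simp del: UN_simps)

subsection \<open>Free modules\<close>

lemma free_simps:
  "carrier (free_module K S) = {f. (\<forall>s. f s \<in> carrier K) \<and> finite {s. f s \<noteq> \<zero>\<^bsub>K\<^esub>} \<and> {s. f s \<noteq> \<zero>\<^bsub>K\<^esub>} \<subseteq> S}"
  "zero (free_module K S) = (\<lambda>s. \<zero>\<^bsub>K\<^esub>)" "add (free_module K S) = (\<lambda>f g s. f s \<oplus>\<^bsub>K\<^esub> g s)"
  "smult (free_module K S) = (\<lambda>a f s. a \<otimes>\<^bsub>K\<^esub> f s)"
  by (auto simp: free_module_def)

lemma free_support_add:
  assumes "f \<in> carrier (free_module K S)" "g \<in> carrier (free_module K S)"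
  shows "{s. f s \<oplus>\<^bsub>K\<^esub> g s \<noteq> \<zero>\<^bsub>K\<^esub>} \<subseteq> {s. f s \<noteq> \<zero>\<^bsub>K\<^esub>} \<union> {s. g s \<noteq> \<zero>\<^bsub>K\<^esub>}"
  using assms by (auto simp: free_simps)

lemma free_support_smult:
  assumes "f \<in> carrier (free_module K S)" "a \<in> carrier K"
  shows "{s. a \<otimes>\<^bsub>K\<^esub> f s \<noteq> \<zero>\<^bsub>K\<^esub>} \<subseteq> {s. f s \<noteq> \<zero>\<^bsub>K\<^esub>}"
  using assms by (auto simp: free_simps)

lemma free_module: "module K (free_module K S)"
proof (rule moduleI)
  have add_closed: "(\<lambda>s. f s \<oplus>\<^bsub>K\<^esub> g s) \<in> carrier (free_module K S)"
    if "f \<in> carrier (free_module K S)" "g \<in> carrier (free_module K S)" for f g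
  proof -
    have "finite {s. f s \<oplus>\<^bsub>K\<^esub> g s \<noteq> \<zero>\<^bsub>K\<^esub>}"
      using free_support_add[OF that] that by (auto simp: free_simps intro: finite_subset)
    then show ?thesis using free_support_add[OF that] that by (auto simp: free_simps)
  qed
  have smult_closed: "(\<lambda>s. a \<otimes>\<^bsub>K\<^esub> f s) \<in> carrier (free_module K S)"
    if "f \<in> carrier (free_module K S)" "a \<in> carrier K" for f a
  proof -
    have "finite {s. a \<otimes>\<^bsub>K\<^esub> f s \<noteq> \<zero>\<^bsub>K\<^esub>}"
      using free_support_smult[OF that] that by (auto simp: free_simps intro: finite_subset)
    then show ?thesis using free_support_smult[OF that] that by (auto simp: free_simps)
  qed
  show "cring K" by (rule K.is_cring)
  show "abelian_group (free_module K S)"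
  proof (rule abelian_groupI)
    fix f assume f: "f \<in> carrier (free_module K S)"
    show "\<exists>g\<in>carrier (free_module K S). g \<oplus>\<^bsub>free_module K S\<^esub> f = \<zero>\<^bsub>free_module K S\<^esub>"
    proof (rule bexI)
      show "(\<lambda>s. (\<ominus>\<^bsub>K\<^esub> \<one>\<^bsub>K\<^esub>) \<otimes>\<^bsub>K\<^esub> f s) \<in> carrier (free_module K S)" by (rule smult_closed[OF f]) auto
      have "(\<ominus>\<^bsub>K\<^esub> \<one>\<^bsub>K\<^esub>) \<otimes>\<^bsub>K\<^esub> f s \<oplus>\<^bsub>K\<^esub> f s = \<zero>\<^bsub>K\<^esub>" for s
      proof -
        have "f s \<in> carrier K" using f by (auto simp: free_simps)
        then show ?thesis by (simp add: K.l_minus K.l_neg)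
      qed
      then show "(\<lambda>s. (\<ominus>\<^bsub>K\<^esub> \<one>\<^bsub>K\<^esub>) \<otimes>\<^bsub>K\<^esub> f s) \<oplus>\<^bsub>free_module K S\<^esub> f = \<zero>\<^bsub>free_module K S\<^esub>"
        by (simp add: free_simps)
    qed
  qed (use add_closed in \<open>auto simp: free_simps K.a_ac\<close>)
  show "a \<odot>\<^bsub>free_module K S\<^esub> f \<in> carrier (free_module K S)" if "a \<in> carrier K" "f \<in> carrier (free_module K S)" for a f
    using smult_closed[OF that(2,1)] by (simp add: free_simps)
qed (auto simp: free_simps K.l_distr K.r_distr K.m_assoc)

lemma free_gen_closed: "s \<in> S \<Longrightarrow> free_gen K s \<in> carrier (free_module K S)"
proof -
  assume "s \<in> S"
  moreover have "{t. free_gen K s t \<noteq> \<zero>\<^bsub>K\<^esub>} \<subseteq> {s}" by (auto simp: free_gen_def)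
  ultimately show ?thesis by (auto simp: free_simps free_gen_def)
qed

lemma free_induct [consumes 1, case_names zero step]:
  assumes f: "f \<in> carrier (free_module K S)" and 0: "P \<zero>\<^bsub>free_module K S\<^esub>"
    and step: "\<And>g a s. g \<in> carrier (free_module K S) \<Longrightarrow> P g \<Longrightarrow> a \<in> carrier K \<Longrightarrow> s \<in> S \<Longrightarrow>
      P (g \<oplus>\<^bsub>free_module K S\<^esub> a \<odot>\<^bsub>free_module K S\<^esub> free_gen K s)"
  shows "P f"
proof -
  have "finite {s. f s \<noteq> \<zero>\<^bsub>K\<^esub>}" using f by (auto simp: free_simps)
  then show ?thesis using f
  proof (induction "{s. f s \<noteq> \<zero>\<^bsub>K\<^esub>}" arbitrary: f rule: finite_induct)
    case empty
    then have "f = \<zero>\<^bsub>free_module K S\<^esub>" by (auto simp: free_simps)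
    then show ?case using 0 by simp
  next
    case (insert s F)
    let ?g = "f(s := \<zero>\<^bsub>K\<^esub>)"
    have F: "F = {s. ?g s \<noteq> \<zero>\<^bsub>K\<^esub>}" using insert.hyps(2,4) by auto
    have s: "s \<in> S" "f s \<in> carrier K" using insert.hyps(4) insert.prems by (auto simp: free_simps)
    have g: "?g \<in> carrier (free_module K S)"
      using insert.prems insert.hyps(1) F by (auto simp: free_simps)
    have "?g \<oplus>\<^bsub>free_module K S\<^esub> f s \<odot>\<^bsub>free_module K S\<^esub> free_gen K s = f"
      using insert.prems by (auto simp: free_simps free_gen_def)
    with step[OF g insert.hyps(3)[OF F g] s(2,1)] show ?case by simp
  qed
qed

definition free_lift :: "('k, 'u, 'c) module_scheme \<Rightarrow> ('s \<Rightarrow> 'u) \<Rightarrow> ('s \<Rightarrow> 'k) \<Rightarrow> 'u"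
  where "free_lift U \<phi> f = (\<Oplus>\<^bsub>U\<^esub>s\<in>{s. f s \<noteq> \<zero>\<^bsub>K\<^esub>}. f s \<odot>\<^bsub>U\<^esub> \<phi> s)"

text \<open>
  Summing over an arbitrary finite superset of the support lets two elements of the free module share one index
  set, which makes additivity of the extension a computation.
\<close>

lemma free_lift_superset:
  assumes "module K U" "\<phi> \<in> S \<rightarrow> carrier U" "f \<in> carrier (free_module K S)"
    "finite T" "{s. f s \<noteq> \<zero>\<^bsub>K\<^esub>} \<subseteq> T" "T \<subseteq> S"
  shows "free_lift U \<phi> f = (\<Oplus>\<^bsub>U\<^esub>s\<in>T. f s \<odot>\<^bsub>U\<^esub> \<phi> s)"
proof -
  interpret U: module K U by fact
  have "f s \<in> carrier K" for s using assms(3) by (auto simp: free_simps)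
  moreover have 2: "\<phi> s \<in> carrier U" if "s \<in> T" for s using that assms(2,6) by auto
  ultimately have 1: "f s \<odot>\<^bsub>U\<^esub> \<phi> s \<in> carrier U" if "s \<in> T" for s using that by auto
  show ?thesis unfolding free_lift_def
    by (rule U.add.finprod_mono_neutral_cong_left[OF assms(4,5)])
      (use 1 2 assms(5) in auto)
qed

lemma free_lift_linear:
  assumes "module K U" "\<phi> \<in> S \<rightarrow> carrier U"
  shows "linear_map K (free_module K S) U (free_lift U \<phi>)"
proof -
  interpret U: module K U by fact
  interpret F: module K "free_module K S" by (rule free_module)
  have fK: "f s \<in> carrier K" if "f \<in> carrier (free_module K S)" for f s using that by (auto simp: free_simps)
  have fin: "finite {s. f s \<noteq> \<zero>\<^bsub>K\<^esub>}" "{s. f s \<noteq> \<zero>\<^bsub>K\<^esub>} \<subseteq> S" if "f \<in> carrier (free_module K S)" for f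
    using that by (auto simp: free_simps)
  show ?thesis
  proof (rule linear_mapI)
    fix f assume f: "f \<in> carrier (free_module K S)"
    show "free_lift U \<phi> f \<in> carrier U" unfolding free_lift_def
      using f fK[OF f] fin[OF f] assms(2) by (intro U.finsum_closed) auto
  next
    fix f g assume fg: "f \<in> carrier (free_module K S)" "g \<in> carrier (free_module K S)"
    let ?T = "{s. f s \<noteq> \<zero>\<^bsub>K\<^esub>} \<union> {s. g s \<noteq> \<zero>\<^bsub>K\<^esub>}"
    have T: "finite ?T" "?T \<subseteq> S" using fin fg by auto
    have "free_lift U \<phi> (f \<oplus>\<^bsub>free_module K S\<^esub> g) = (\<Oplus>\<^bsub>U\<^esub>s\<in>?T. (f s \<oplus>\<^bsub>K\<^esub> g s) \<odot>\<^bsub>U\<^esub> \<phi> s)"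
      by (subst free_lift_superset[OF assms _ T(1) _ T(2)])
        (use fg F.a_closed free_support_add[OF fg] in \<open>auto simp: free_simps(3)\<close>)
    also have "\<dots> = (\<Oplus>\<^bsub>U\<^esub>s\<in>?T. f s \<odot>\<^bsub>U\<^esub> \<phi> s \<oplus>\<^bsub>U\<^esub> g s \<odot>\<^bsub>U\<^esub> \<phi> s)"
    proof (rule U.finsum_cong')
      have \<phi>: "\<phi> s \<in> carrier U" if "s \<in> ?T" for s using that T(2) assms(2) by blast
      then show "(f s \<oplus>\<^bsub>K\<^esub> g s) \<odot>\<^bsub>U\<^esub> \<phi> s = f s \<odot>\<^bsub>U\<^esub> \<phi> s \<oplus>\<^bsub>U\<^esub> g s \<odot>\<^bsub>U\<^esub> \<phi> s" if "s \<in> ?T" for s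
        using fg fK that by (intro U.smult_l_distr) auto
      show "(\<lambda>s. f s \<odot>\<^bsub>U\<^esub> \<phi> s \<oplus>\<^bsub>U\<^esub> g s \<odot>\<^bsub>U\<^esub> \<phi> s) \<in> ?T \<rightarrow> carrier U"
        using \<phi> fg fK by (intro Pi_I U.a_closed U.smult_closed) auto
    qed simp
    also have "\<dots> = free_lift U \<phi> f \<oplus>\<^bsub>U\<^esub> free_lift U \<phi> g"
    proof -
      have 1: "f s \<odot>\<^bsub>U\<^esub> \<phi> s \<in> carrier U" "g s \<odot>\<^bsub>U\<^esub> \<phi> s \<in> carrier U" if "s \<in> ?T" for s
        using that fg fK T(2) assms(2) by (meson Pi_mem U.smult_closed subsetD)+
      have "free_lift U \<phi> f = (\<Oplus>\<^bsub>U\<^esub>s\<in>?T. f s \<odot>\<^bsub>U\<^esub> \<phi> s)" "free_lift U \<phi> g = (\<Oplus>\<^bsub>U\<^esub>s\<in>?T. g s \<odot>\<^bsub>U\<^esub> \<phi> s)"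
        by (rule free_lift_superset[OF assms _ T(1) _ T(2)]; use fg in auto)+
      then show ?thesis using 1 by (simp add: U.finsum_addf Pi_iff)
    qed
    finally show "free_lift U \<phi> (f \<oplus>\<^bsub>free_module K S\<^esub> g) = free_lift U \<phi> f \<oplus>\<^bsub>U\<^esub> free_lift U \<phi> g" .
  next
    fix a f assume af: "a \<in> carrier K" "f \<in> carrier (free_module K S)"
    let ?T = "{s. f s \<noteq> \<zero>\<^bsub>K\<^esub>}"
    have T: "finite ?T" "?T \<subseteq> S" using fin af by auto
    have "free_lift U \<phi> (a \<odot>\<^bsub>free_module K S\<^esub> f) = (\<Oplus>\<^bsub>U\<^esub>s\<in>?T. (a \<otimes>\<^bsub>K\<^esub> f s) \<odot>\<^bsub>U\<^esub> \<phi> s)"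
      by (subst free_lift_superset[OF assms _ T(1) _ T(2)])
        (use af F.smult_closed free_support_smult[OF af(2,1)] in \<open>auto simp: free_simps(4)\<close>)
    also have "\<dots> = (\<Oplus>\<^bsub>U\<^esub>s\<in>?T. a \<odot>\<^bsub>U\<^esub> (f s \<odot>\<^bsub>U\<^esub> \<phi> s))"
    proof (rule U.finsum_cong')
      have \<phi>: "\<phi> s \<in> carrier U" if "s \<in> ?T" for s using that T(2) assms(2) by blast
      then show "(a \<otimes>\<^bsub>K\<^esub> f s) \<odot>\<^bsub>U\<^esub> \<phi> s = a \<odot>\<^bsub>U\<^esub> (f s \<odot>\<^bsub>U\<^esub> \<phi> s)" if "s \<in> ?T" for s
        using af fK that by (intro U.smult_assoc1) auto
      show "(\<lambda>s. a \<odot>\<^bsub>U\<^esub> (f s \<odot>\<^bsub>U\<^esub> \<phi> s)) \<in> ?T \<rightarrow> carrier U"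
        using \<phi> af fK by (intro Pi_I U.smult_closed) auto
    qed simp
    also have "\<dots> = a \<odot>\<^bsub>U\<^esub> free_lift U \<phi> f"
      unfolding free_lift_def
    proof (rule U.finsum_smult_ldistr[symmetric])
      show "(\<lambda>s. f s \<odot>\<^bsub>U\<^esub> \<phi> s) \<in> ?T \<rightarrow> carrier U"
        using af fK T(2) assms(2) by (intro Pi_I U.smult_closed) blast+
    qed (use af T in auto)
    finally show "free_lift U \<phi> (a \<odot>\<^bsub>free_module K S\<^esub> f) = a \<odot>\<^bsub>U\<^esub> free_lift U \<phi> f" .
  qed
qed

lemma free_lift_gen:
  assumes "module K U" "\<phi> \<in> S \<rightarrow> carrier U" "s \<in> S"
  shows "free_lift U \<phi> (free_gen K s) = \<phi> s"
proof -
  interpret U: module K U by fact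
  have "{t. free_gen K s t \<noteq> \<zero>\<^bsub>K\<^esub>} \<subseteq> {s}" by (auto simp: free_gen_def)
  then have "free_lift U \<phi> (free_gen K s) = (\<Oplus>\<^bsub>U\<^esub>t\<in>{s}. free_gen K s t \<odot>\<^bsub>U\<^esub> \<phi> t)"
    by (intro free_lift_superset[OF assms(1,2) free_gen_closed[OF assms(3)]]) (use assms in auto)
  also have "\<dots> = \<phi> s"
  proof -
    have "\<phi> s \<in> carrier U" using assms(2,3) by auto
    then show ?thesis by (simp add: free_gen_def)
  qed
  finally show ?thesis .
qed

end

section \<open>Tensor products\<close>

text \<open>
  The members of \<open>lin\<close> reduce linearity of a map, or membership of a term in a carrier, to the same statement about
  its parts. Applied repeatedly, they decide these statements for terms in Sweedler notation.
\<close>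

named_theorems lin

context vector_spaces
begin

lemma tensor_rels_submodule:
  assumes "module K V" "module K W"
  shows "submodule (tensor_rels K V W) K (free_module K (carrier V \<times> carrier W))"
proof -
  interpret V: module K V by fact
  interpret W: module K W by fact
  interpret F: module K "free_module K (carrier V \<times> carrier W)" by (rule free_module)
  show ?thesis unfolding tensor_rels_def Let_def
    by (rule hull_submodule[OF free_module]) (auto intro!: F.minus_closed free_gen_closed)
qed

lemma tensor_module [lin]: "module K V \<Longrightarrow> module K W \<Longrightarrow> module K (tensor_product K V W)"
  unfolding tensor_product_def by (rule quotient_module[OF free_module tensor_rels_submodule])

lemma pure_bilinear:
  assumes "module K V" "module K W"
  shows "bilinear_map K V W (tensor_product K V W) (pure_tensor K V W)"
proof -
  interpret V: module K V by fact
  interpret W: module K W by fact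
  let ?F = "free_module K (carrier V \<times> carrier W)" and ?N = "tensor_rels K V W"
  interpret F: module K ?F by (rule free_module)
  note N = tensor_rels_submodule[OF assms]
  have g: "free_gen K p \<in> carrier ?F" if "p \<in> carrier V \<times> carrier W" for p
    using that by (rule free_gen_closed)
  have pl: "linear_map K ?F (tensor_product K V W) (\<lambda>x. ?N +>\<^bsub>?F\<^esub> x)"
    unfolding tensor_product_def by (rule quotient_proj_linear[OF free_module N])
  have eq: "?N +>\<^bsub>?F\<^esub> x = ?N +>\<^bsub>?F\<^esub> y" if "x \<in> carrier ?F" "y \<in> carrier ?F" "x \<ominus>\<^bsub>?F\<^esub> y \<in> ?N" for x y
    using coset_eq_iff[OF free_module N that(1,2)] that(3) by simp
  note rels = tensor_rels_def Let_def
  show ?thesis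
  proof (intro bilinear_mapI linear_mapI)
    fix v w assume vw: "v \<in> carrier V" "w \<in> carrier W"
    then show c: "pure_tensor K V W v w \<in> carrier (tensor_product K V W)"
      and "pure_tensor K V W v w \<in> carrier (tensor_product K V W)"
      unfolding pure_tensor_def by (auto intro!: linear_closed[OF pl] g)
  next
    fix v x y assume vw: "v \<in> carrier V" "x \<in> carrier W" "y \<in> carrier W"
    have "?N +>\<^bsub>?F\<^esub> free_gen K (v, x \<oplus>\<^bsub>W\<^esub> y) = ?N +>\<^bsub>?F\<^esub> (free_gen K (v, x) \<oplus>\<^bsub>?F\<^esub> free_gen K (v, y))"
      by (rule eq) (use vw g in \<open>auto simp: rels intro!: subsetD[OF hull_subset]\<close>)
    then show "pure_tensor K V W v (x \<oplus>\<^bsub>W\<^esub> y) =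
        pure_tensor K V W v x \<oplus>\<^bsub>tensor_product K V W\<^esub> pure_tensor K V W v y"
      unfolding pure_tensor_def using vw g by (simp add: linear_add[OF pl])
  next
    fix v a x assume vw: "v \<in> carrier V" "a \<in> carrier K" "x \<in> carrier W"
    have "?N +>\<^bsub>?F\<^esub> free_gen K (v, a \<odot>\<^bsub>W\<^esub> x) = ?N +>\<^bsub>?F\<^esub> (a \<odot>\<^bsub>?F\<^esub> free_gen K (v, x))"
      by (rule eq) (use vw g in \<open>auto simp: rels intro!: subsetD[OF hull_subset]\<close>)
    then show "pure_tensor K V W v (a \<odot>\<^bsub>W\<^esub> x) = a \<odot>\<^bsub>tensor_product K V W\<^esub> pure_tensor K V W v x"
      unfolding pure_tensor_def using vw g by (simp add: linear_smult[OF pl])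
  next
    fix w x y assume vw: "w \<in> carrier W" "x \<in> carrier V" "y \<in> carrier V"
    have "?N +>\<^bsub>?F\<^esub> free_gen K (x \<oplus>\<^bsub>V\<^esub> y, w) = ?N +>\<^bsub>?F\<^esub> (free_gen K (x, w) \<oplus>\<^bsub>?F\<^esub> free_gen K (y, w))"
      by (rule eq) (use vw g in \<open>auto simp: rels intro!: subsetD[OF hull_subset]\<close>)
    then show "pure_tensor K V W (x \<oplus>\<^bsub>V\<^esub> y) w =
        pure_tensor K V W x w \<oplus>\<^bsub>tensor_product K V W\<^esub> pure_tensor K V W y w"
      unfolding pure_tensor_def using vw g by (simp add: linear_add[OF pl])
  next
    fix w a x assume vw: "w \<in> carrier W" "a \<in> carrier K" "x \<in> carrier V"
    have "?N +>\<^bsub>?F\<^esub> free_gen K (a \<odot>\<^bsub>V\<^esub> x, w) = ?N +>\<^bsub>?F\<^esub> (a \<odot>\<^bsub>?F\<^esub> free_gen K (x, w))"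
      by (rule eq) (use vw g in \<open>auto simp: rels intro!: subsetD[OF hull_subset]\<close>)
    then show "pure_tensor K V W (a \<odot>\<^bsub>V\<^esub> x) w = a \<odot>\<^bsub>tensor_product K V W\<^esub> pure_tensor K V W x w"
      unfolding pure_tensor_def using vw g by (simp add: linear_smult[OF pl])
  qed
qed

lemma pure_closed [lin]:
  "module K V \<Longrightarrow> module K W \<Longrightarrow> v \<in> carrier V \<Longrightarrow> w \<in> carrier W \<Longrightarrow>
    pure_tensor K V W v w \<in> carrier (tensor_product K V W)"
  using pure_bilinear bilinear_closed by metis

lemma pure_zero:
  assumes "module K V" "module K W"
  shows "w \<in> carrier W \<Longrightarrow> pure_tensor K V W \<zero>\<^bsub>V\<^esub> w = \<zero>\<^bsub>tensor_product K V W\<^esub>"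
    "v \<in> carrier V \<Longrightarrow> pure_tensor K V W v \<zero>\<^bsub>W\<^esub> = \<zero>\<^bsub>tensor_product K V W\<^esub>"
  using linear_zero[OF assms(1) tensor_module[OF assms] bilinear_left[OF pure_bilinear[OF assms]]]
    linear_zero[OF assms(2) tensor_module[OF assms] bilinear_right[OF pure_bilinear[OF assms]]] by blast+

lemma tensor_induct [consumes 3, case_names zero pure add]:
  assumes "module K V" "module K W" and t: "t \<in> carrier (tensor_product K V W)"
    and 0: "P \<zero>\<^bsub>tensor_product K V W\<^esub>"
    and pure: "\<And>v w. v \<in> carrier V \<Longrightarrow> w \<in> carrier W \<Longrightarrow> P (pure_tensor K V W v w)"
    and add: "\<And>s t. s \<in> carrier (tensor_product K V W) \<Longrightarrow> t \<in> carrier (tensor_product K V W) \<Longrightarrow>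
      P s \<Longrightarrow> P t \<Longrightarrow> P (s \<oplus>\<^bsub>tensor_product K V W\<^esub> t)"
  shows "P t"
proof -
  interpret V: module K V by fact
  let ?F = "free_module K (carrier V \<times> carrier W)" and ?N = "tensor_rels K V W"
  let ?T = "tensor_product K V W"
  interpret F: module K ?F by (rule free_module)
  have pl: "linear_map K ?F ?T (\<lambda>x. ?N +>\<^bsub>?F\<^esub> x)"
    unfolding tensor_product_def by (rule quotient_proj_linear[OF free_module tensor_rels_submodule[OF assms(1,2)]])
  from t obtain f where f: "f \<in> carrier ?F" and tf: "t = ?N +>\<^bsub>?F\<^esub> f"
    unfolding tensor_product_def quotient_simps by auto
  have "P (?N +>\<^bsub>?F\<^esub> f)" using f
  proof (induction f rule: free_induct)
    case zero then show ?case using 0 linear_zero[OF free_module tensor_module[OF assms(1,2)] pl] by simp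
  next
    case (step g a s)
    have 2: "g \<in> carrier ?F" "P (?N +>\<^bsub>?F\<^esub> g)" "a \<in> carrier K" "s \<in> carrier V \<times> carrier W" using step by auto
    from 2(4) obtain v w where s: "s = (v, w)" "v \<in> carrier V" "w \<in> carrier W" by auto
    have gs: "free_gen K s \<in> carrier ?F" using s by (auto intro: free_gen_closed)
    have "?N +>\<^bsub>?F\<^esub> (a \<odot>\<^bsub>?F\<^esub> free_gen K s) = pure_tensor K V W (a \<odot>\<^bsub>V\<^esub> v) w"
      using linear_smult[OF pl 2(3) gs] linear_smult[OF bilinear_left[OF pure_bilinear[OF assms(1,2)] s(3)] 2(3) s(2)]
      by (simp add: s(1) pure_tensor_def)
    then have "P (?N +>\<^bsub>?F\<^esub> (a \<odot>\<^bsub>?F\<^esub> free_gen K s))" using pure s 2(3) by simp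
    then have "P ((?N +>\<^bsub>?F\<^esub> g) \<oplus>\<^bsub>?T\<^esub> (?N +>\<^bsub>?F\<^esub> (a \<odot>\<^bsub>?F\<^esub> free_gen K s)))"
      by (intro add linear_closed[OF pl] 2 F.smult_closed gs)
    then show ?case using linear_add[OF pl 2(1) F.smult_closed[OF 2(3) gs]] by simp
  qed
  then show ?thesis by (simp add: tf)
qed

text \<open>
  \<open>tensor_lift\<close> evaluates an arbitrary representative. The choice does not matter because the linear extension of a
  bilinear map to the free module kills the four families of bilinearity relations.
\<close>

lemma tensor_lift_coset:
  assumes "module K V" "module K W" "module K U" and \<beta>: "bilinear_map K V W U \<beta>"
    and f: "f \<in> carrier (free_module K (carrier V \<times> carrier W))"
  shows "tensor_lift K U \<beta> (tensor_rels K V W +>\<^bsub>free_module K (carrier V \<times> carrier W)\<^esub> f)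
    = free_lift U (\<lambda>p. \<beta> (fst p) (snd p)) f"
proof -
  interpret V: module K V by fact
  interpret W: module K W by fact
  interpret U: module K U by fact
  let ?F = "free_module K (carrier V \<times> carrier W)" and ?N = "tensor_rels K V W"
  let ?\<phi> = "\<lambda>p. \<beta> (fst p) (snd p)"
  interpret F: module K ?F by (rule free_module)
  note N = tensor_rels_submodule[OF assms(1,2)]
  have \<phi>: "?\<phi> \<in> carrier V \<times> carrier W \<rightarrow> carrier U" using bilinear_closed[OF \<beta>] by auto
  note L = free_lift_linear[OF assms(3) \<phi>]
  have c: "\<And>v w. v \<in> carrier V \<Longrightarrow> w \<in> carrier W \<Longrightarrow> \<beta> v w \<in> carrier U" using bilinear_closed[OF \<beta>] .
  have g: "free_gen K p \<in> carrier ?F" if "p \<in> carrier V \<times> carrier W" for p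
    using that by (rule free_gen_closed)
  have Lg: "free_lift U ?\<phi> (free_gen K (v, w)) = \<beta> v w" if "v \<in> carrier V" "w \<in> carrier W" for v w
    using free_lift_gen[OF assms(3) \<phi>, of "(v, w)"] that by simp
  have ker: "?N \<subseteq> {h \<in> carrier ?F. free_lift U ?\<phi> h \<in> {\<zero>\<^bsub>U\<^esub>}}"
    unfolding tensor_rels_def Let_def
  proof (rule hull_least[OF linear_vimage_submodule[OF free_module assms(3) L zero_submodule[OF assms(3)]]], safe)
    note simps = linear_minus[OF free_module assms(3) L] linear_add[OF L] linear_smult[OF L] Lg g c
      U.minus_eq U.r_neg linear_add[OF bilinear_left[OF \<beta>]] linear_add[OF bilinear_right[OF \<beta>]]
      linear_smult[OF bilinear_left[OF \<beta>]] linear_smult[OF bilinear_right[OF \<beta>]]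
  qed (auto simp: linear_minus[OF free_module assms(3) L] linear_add[OF L] linear_smult[OF L] Lg g c
      U.minus_eq U.r_neg linear_add[OF bilinear_left[OF \<beta>]] linear_add[OF bilinear_right[OF \<beta>]]
      linear_smult[OF bilinear_left[OF \<beta>]] linear_smult[OF bilinear_right[OF \<beta>]] intro!: F.minus_closed)
  let ?X = "?N +>\<^bsub>?F\<^esub> f"
  define h where "h = (SOME h. h \<in> ?X)"
  have "h \<in> ?X" unfolding h_def using coset_self[OF free_module N f] by (rule someI[where P = "\<lambda>h. h \<in> ?X"])
  then have h: "h \<in> carrier ?F" "h \<ominus>\<^bsub>?F\<^esub> f \<in> ?N"
    using coset_subset[OF free_module N f] mem_coset[OF free_module N f] by auto
  then have "free_lift U ?\<phi> h \<ominus>\<^bsub>U\<^esub> free_lift U ?\<phi> f = \<zero>\<^bsub>U\<^esub>"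
    using ker linear_minus[OF free_module assms(3) L h(1) f] by auto
  then have "free_lift U ?\<phi> h = free_lift U ?\<phi> f"
    using diff_add_cancel(2)[OF assms(3) linear_closed[OF L h(1)] linear_closed[OF L f]] by simp
  then show ?thesis unfolding tensor_lift_def Let_def free_lift_def h_def by simp
qed

lemma tensor_lift_linear:
  assumes "module K V" "module K W" "module K U" "bilinear_map K V W U \<beta>"
  shows "linear_map K (tensor_product K V W) U (tensor_lift K U \<beta>)"
proof -
  let ?F = "free_module K (carrier V \<times> carrier W)" and ?N = "tensor_rels K V W"
  let ?T = "tensor_product K V W" and ?\<phi> = "\<lambda>p. \<beta> (fst p) (snd p)"
  interpret F: module K ?F by (rule free_module)
  note N = tensor_rels_submodule[OF assms(1,2)]
  have pl: "linear_map K ?F ?T (\<lambda>x. ?N +>\<^bsub>?F\<^esub> x)"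
    unfolding tensor_product_def by (rule quotient_proj_linear[OF free_module N])
  have "?\<phi> \<in> carrier V \<times> carrier W \<rightarrow> carrier U" using bilinear_closed[OF assms(4)] by auto
  note L = free_lift_linear[OF assms(3) this]
  have obt: "\<exists>f\<in>carrier ?F. x = ?N +>\<^bsub>?F\<^esub> f" if "x \<in> carrier ?T" for x
    using that unfolding tensor_product_def quotient_simps by auto
  show ?thesis
  proof (rule linear_mapI)
    fix x assume "x \<in> carrier ?T"
    then obtain f where "f \<in> carrier ?F" "x = ?N +>\<^bsub>?F\<^esub> f" using obt by metis
    then show "tensor_lift K U \<beta> x \<in> carrier U"
      using linear_closed[OF L] by (simp add: tensor_lift_coset[OF assms])
  next
    fix x y assume "x \<in> carrier ?T" "y \<in> carrier ?T"
    then obtain f g where "f \<in> carrier ?F" "x = ?N +>\<^bsub>?F\<^esub> f" "g \<in> carrier ?F" "y = ?N +>\<^bsub>?F\<^esub> g" using obt by metis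
    then show "tensor_lift K U \<beta> (x \<oplus>\<^bsub>?T\<^esub> y) = tensor_lift K U \<beta> x \<oplus>\<^bsub>U\<^esub> tensor_lift K U \<beta> y"
      by (simp only: tensor_lift_coset[OF assms] linear_add[OF L] F.a_closed linear_add[OF pl, symmetric])
  next
    fix a x assume "a \<in> carrier K" "x \<in> carrier ?T"
    then obtain f where "f \<in> carrier ?F" "x = ?N +>\<^bsub>?F\<^esub> f" "a \<in> carrier K" using obt by metis
    then show "tensor_lift K U \<beta> (a \<odot>\<^bsub>?T\<^esub> x) = a \<odot>\<^bsub>U\<^esub> tensor_lift K U \<beta> x"
      by (simp only: tensor_lift_coset[OF assms] linear_smult[OF L] F.smult_closed linear_smult[OF pl, symmetric])
  qed
qed

lemma tensor_lift_pure:
  assumes "module K V" "module K W" "module K U" "bilinear_map K V W U \<beta>" "v \<in> carrier V" "w \<in> carrier W"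
  shows "tensor_lift K U \<beta> (pure_tensor K V W v w) = \<beta> v w"
proof -
  have \<phi>: "(\<lambda>p. \<beta> (fst p) (snd p)) \<in> carrier V \<times> carrier W \<rightarrow> carrier U"
    using bilinear_closed[OF assms(4)] by auto
  have p: "(v, w) \<in> carrier V \<times> carrier W" using assms by auto
  show ?thesis unfolding pure_tensor_def tensor_lift_coset[OF assms(1-4) free_gen_closed[OF p]]
    using free_lift_gen[OF assms(3) \<phi> p] by simp
qed

lemma tensor_lift_closed [lin]:
  assumes "t \<in> carrier (tensor_product K V W)" "module K V" "module K W" "module K U" "bilinear_map K V W U \<beta>"
  shows "tensor_lift K U \<beta> t \<in> carrier U"
  using tensor_lift_linear[OF assms(2-5)] assms(1) linear_closed by metis

lemmas bilinear_map_lin [lin] = bilinear_mapI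

lemmas linear_id_lin [lin] = linear_id

lemma linear_pure_left [lin]:
  assumes "linear_map K X V f" "module K V" "module K W" "w \<in> carrier W"
  shows "linear_map K X (tensor_product K V W) (\<lambda>x. pure_tensor K V W (f x) w)"
  by (rule linear_comp[OF assms(1) bilinear_left[OF pure_bilinear[OF assms(2,3)] assms(4)]])

lemma linear_pure_right [lin]:
  assumes "linear_map K X W f" "module K V" "module K W" "v \<in> carrier V"
  shows "linear_map K X (tensor_product K V W) (\<lambda>x. pure_tensor K V W v (f x))"
  by (rule linear_comp[OF assms(1) bilinear_right[OF pure_bilinear[OF assms(2,3)] assms(4)]])

lemma linear_lift_arg [lin]:
  assumes "linear_map K X (tensor_product K V W) f" "module K V" "module K W" "module K U"
    "bilinear_map K V W U \<beta>"
  shows "linear_map K X U (\<lambda>x. tensor_lift K U \<beta> (f x))"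
  by (rule linear_comp[OF assms(1) tensor_lift_linear[OF assms(2-5)]])

lemma tensor_lift_zero:
  assumes "module K V" "module K W" "module K U" "bilinear_map K V W U \<beta>"
  shows "tensor_lift K U \<beta> \<zero>\<^bsub>tensor_product K V W\<^esub> = \<zero>\<^bsub>U\<^esub>"
  by (rule linear_zero[OF tensor_module[OF assms(1,2)] assms(3) tensor_lift_linear[OF assms]])

lemma tensor_lift_add:
  assumes "module K V" "module K W" "module K U" "bilinear_map K V W U \<beta>"
    "s \<in> carrier (tensor_product K V W)" "t \<in> carrier (tensor_product K V W)"
  shows "tensor_lift K U \<beta> (s \<oplus>\<^bsub>tensor_product K V W\<^esub> t) = tensor_lift K U \<beta> s \<oplus>\<^bsub>U\<^esub> tensor_lift K U \<beta> t"
  by (rule linear_add[OF tensor_lift_linear[OF assms(1-4)] assms(5,6)])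

text \<open>
  A lift also depends linearly on parameters of its bilinear map. This is the case of nested Sweedler sums in which an
  outer summation index occurs in the summands of an inner sum.
\<close>

lemma linear_lift_param [lin]:
  assumes t: "t \<in> carrier (tensor_product K V W)" and m: "module K V" "module K W" "module K U" "module K X"
    and b: "\<And>x. x \<in> carrier X \<Longrightarrow> bilinear_map K V W U (\<beta> x)"
    and l: "\<And>v w. v \<in> carrier V \<Longrightarrow> w \<in> carrier W \<Longrightarrow> linear_map K X U (\<lambda>x. \<beta> x v w)"
  shows "linear_map K X U (\<lambda>x. tensor_lift K U (\<beta> x) t)"
  using m(1,2) t
proof (induction rule: tensor_induct)
  case zero then show ?case
    by (rule linear_cong[OF linear_const_zero[OF m(3)] _ m(4)]) (simp add: tensor_lift_zero[OF m(1-3) b])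
next
  case (pure v w) then show ?case
    by (intro linear_cong[OF l _ m(4)]) (simp_all add: tensor_lift_pure[OF m(1-3) b])
next
  case (add s t) then show ?case
    by (intro linear_cong[OF linear_sum[OF m(4,3) add(3,4)] _ m(4)]) (simp add: tensor_lift_add[OF m(1-3) b])
qed

lemma tensor_ext:
  assumes "module K V" "module K W" "module K U" "linear_map K (tensor_product K V W) U f"
    "linear_map K (tensor_product K V W) U g"
    "\<And>v w. v \<in> carrier V \<Longrightarrow> w \<in> carrier W \<Longrightarrow> f (pure_tensor K V W v w) = g (pure_tensor K V W v w)"
    "t \<in> carrier (tensor_product K V W)"
  shows "f t = g t"
  using assms(1,2,7)
proof (induction rule: tensor_induct)
  case zero then show ?case
    using linear_zero[OF tensor_module[OF assms(1,2)] assms(3)] assms(4,5) by metis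
qed (use assms in \<open>auto simp: linear_add\<close>)

lemma linear_lift_commute:
  assumes "module K V" "module K W" "module K U" "module K X" "bilinear_map K V W U \<beta>" "linear_map K U X f"
    "t \<in> carrier (tensor_product K V W)"
  shows "f (tensor_lift K U \<beta> t) = tensor_lift K X (\<lambda>v w. f (\<beta> v w)) t"
proof (rule tensor_ext[OF assms(1,2,4) _ _ _ assms(7)])
  have b: "bilinear_map K V W X (\<lambda>v w. f (\<beta> v w))"
    using assms(5,6) unfolding bilinear_map_def by (auto intro: linear_comp)
  then show "linear_map K (tensor_product K V W) X (\<lambda>t. tensor_lift K X (\<lambda>v w. f (\<beta> v w)) t)"
    by (rule tensor_lift_linear[OF assms(1,2,4)])
  show "linear_map K (tensor_product K V W) X (\<lambda>t. f (tensor_lift K U \<beta> t))"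
    by (rule linear_comp[OF tensor_lift_linear[OF assms(1,2,3,5)] assms(6)])
  show "f (tensor_lift K U \<beta> (pure_tensor K V W v w)) = tensor_lift K X (\<lambda>v w. f (\<beta> v w)) (pure_tensor K V W v w)"
    if "v \<in> carrier V" "w \<in> carrier W" for v w
    using that b assms by (simp add: tensor_lift_pure)
qed

lemma tensor_lift_cong:
  assumes "module K V" "module K W" "module K U" "bilinear_map K V W U \<beta>" "t \<in> carrier (tensor_product K V W)"
    "\<And>v w. v \<in> carrier V \<Longrightarrow> w \<in> carrier W \<Longrightarrow> \<beta> v w = \<gamma> v w"
  shows "tensor_lift K U \<beta> t = tensor_lift K U \<gamma> t"
proof -
  have b: "bilinear_map K V W U \<gamma>"
  proof (rule bilinear_mapI)
    fix v assume v: "v \<in> carrier V"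
    show "linear_map K W U (\<gamma> v)"
      by (rule linear_cong[OF bilinear_right[OF assms(4) v] _ assms(2)]) (use assms(6) v in auto)
  next
    fix w assume w: "w \<in> carrier W"
    show "linear_map K V U (\<lambda>v. \<gamma> v w)"
      by (rule linear_cong[OF bilinear_left[OF assms(4) w] _ assms(1)]) (use assms(6) w in auto)
  qed
  show ?thesis
    by (rule tensor_ext[OF assms(1-3) tensor_lift_linear[OF assms(1-4)] tensor_lift_linear[OF assms(1-3) b] _ assms(5)])
      (use assms b in \<open>simp add: tensor_lift_pure\<close>)
qed

lemma tensor_map_linear [lin]:
  assumes "linear_map K Z (tensor_product K X Y) e" "linear_map K X V f" "linear_map K Y W g"
    "module K V" "module K W" "module K X" "module K Y"
  shows "linear_map K Z (tensor_product K V W) (\<lambda>z. tensor_map K V W f g (e z))"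
  unfolding tensor_map_def
  by (intro linear_lift_arg[OF assms(1)] bilinear_mapI linear_pure_left linear_pure_right tensor_module assms)
    (auto intro: linear_closed assms)

lemma tensor_map_pure:
  assumes "linear_map K X V f" "linear_map K Y W g" "module K V" "module K W" "module K X" "module K Y"
    "x \<in> carrier X" "y \<in> carrier Y"
  shows "tensor_map K V W f g (pure_tensor K X Y x y) = pure_tensor K V W (f x) (g y)"
  unfolding tensor_map_def
  by (rule tensor_lift_pure[OF assms(5,6) tensor_module[OF assms(3,4)] _ assms(7,8)];
      intro bilinear_mapI linear_pure_left linear_pure_right assms)
    (auto intro: linear_closed assms)

lemma lift_tensor_map:
  assumes "linear_map K X V f" "linear_map K Y W g" "module K V" "module K W" "module K X" "module K Y"
    "module K U" "bilinear_map K V W U \<beta>" "t \<in> carrier (tensor_product K X Y)"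
  shows "tensor_lift K U \<beta> (tensor_map K V W f g t) = tensor_lift K U (\<lambda>x y. \<beta> (f x) (g y)) t"
  unfolding tensor_map_def
  using linear_lift_commute[OF assms(5,6) tensor_module[OF assms(3,4)] assms(7) _ tensor_lift_linear[OF assms(3,4,7,8)] assms(9)]
  apply (subst linear_lift_commute[OF assms(5,6) tensor_module[OF assms(3,4)] assms(7) _ tensor_lift_linear[OF assms(3,4,7,8)] assms(9)])
   apply (intro bilinear_mapI linear_pure_left linear_pure_right assms; auto intro: linear_closed assms)
  apply (rule tensor_lift_cong[OF assms(5,6,7) _ assms(9)])
   apply (intro bilinear_mapI linear_lift_arg[OF _ assms(3,4,7,8)] linear_pure_left linear_pure_right assms; auto intro: linear_closed assms)
  apply (rule tensor_lift_pure[OF assms(3,4,7,8)])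
   apply (auto intro: linear_closed assms)
  done

text \<open>
  Tensor products and linear maps only see carriers, addition and scalar multiplication. This identifies
  constructions on records that differ in other fields.
\<close>

lemma tensor_rels_cong:
  assumes "carrier V = carrier V'" "carrier W = carrier W'" "add V = add V'" "add W = add W'"
    "smult V = smult V'" "smult W = smult W'"
  shows "tensor_rels K V W = tensor_rels K V' W'"
  unfolding tensor_rels_def assms ..

lemma tensor_product_cong:
  assumes "carrier V = carrier V'" "carrier W = carrier W'" "add V = add V'" "add W = add W'"
    "smult V = smult V'" "smult W = smult W'"
  shows "tensor_product K V W = tensor_product K V' W'" "pure_tensor K V W = pure_tensor K V' W'"
  unfolding tensor_product_def tensor_rels_cong[OF assms] assms pure_tensor_def[abs_def] by simp_all

lemma linear_map_cong_record:
  assumes "carrier V = carrier V'" "carrier W = carrier W'" "add V = add V'" "add W = add W'"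
    "smult V = smult V'" "smult W = smult W'"
  shows "linear_map K V W = linear_map K V' W'"
  unfolding linear_map_def[abs_def] assms ..

end

section \<open>Complements and kernels\<close>

context vector_spaces
begin

lemma set_add_submodule:
  assumes "module K V" "submodule M K V" "submodule N K V"
  shows "submodule (M <+>\<^bsub>V\<^esub> N) K V"
proof -
  interpret V: module K V by fact
  note M = submoduleD[OF assms(2,1)] and N = submoduleD[OF assms(3,1)]
  have mem: "x \<in> M <+>\<^bsub>V\<^esub> N \<longleftrightarrow> (\<exists>m\<in>M. \<exists>n\<in>N. x = m \<oplus>\<^bsub>V\<^esub> n)" for x by (auto simp: set_add_def')
  show ?thesis
  proof (rule submodule_criterion[OF assms(1)])
    show "M <+>\<^bsub>V\<^esub> N \<subseteq> carrier V" using M(1) N(1) by (auto simp: mem subset_iff)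
    show "\<zero>\<^bsub>V\<^esub> \<in> M <+>\<^bsub>V\<^esub> N" unfolding mem using M(2) N(2) by (metis V.l_zero V.zero_closed)
  next
    fix x y assume "x \<in> M <+>\<^bsub>V\<^esub> N" "y \<in> M <+>\<^bsub>V\<^esub> N"
    then obtain m n m' n' where *: "m \<in> M" "n \<in> N" "m' \<in> M" "n' \<in> N" "x = m \<oplus>\<^bsub>V\<^esub> n" "y = m' \<oplus>\<^bsub>V\<^esub> n'"
      by (auto simp: mem)
    then have "x \<oplus>\<^bsub>V\<^esub> y = (m \<oplus>\<^bsub>V\<^esub> m') \<oplus>\<^bsub>V\<^esub> (n \<oplus>\<^bsub>V\<^esub> n')" using M(1) N(1) by (auto simp: V.a_ac subset_iff)
    then show "x \<oplus>\<^bsub>V\<^esub> y \<in> M <+>\<^bsub>V\<^esub> N" unfolding mem using * M(3) N(3) by blast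
  next
    fix a x assume a: "a \<in> carrier K" "x \<in> M <+>\<^bsub>V\<^esub> N"
    then obtain m n where *: "m \<in> M" "n \<in> N" "x = m \<oplus>\<^bsub>V\<^esub> n" by (auto simp: mem)
    then have "a \<odot>\<^bsub>V\<^esub> x = a \<odot>\<^bsub>V\<^esub> m \<oplus>\<^bsub>V\<^esub> a \<odot>\<^bsub>V\<^esub> n" using M(1) N(1) a by (auto simp: V.smult_r_distr subset_iff)
    then show "a \<odot>\<^bsub>V\<^esub> x \<in> M <+>\<^bsub>V\<^esub> N" unfolding mem using * M(4) N(4) a by blast
  qed
qed

lemma set_addI: "m \<in> M \<Longrightarrow> n \<in> N \<Longrightarrow> m \<oplus>\<^bsub>V\<^esub> n \<in> M <+>\<^bsub>V\<^esub> N"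
  by (auto simp: set_add_def')

lemma set_addE:
  assumes "x \<in> M <+>\<^bsub>V\<^esub> N" obtains m n where "m \<in> M" "n \<in> N" "x = m \<oplus>\<^bsub>V\<^esub> n"
  using assms by (auto simp: set_add_def')

lemma set_add_supset:
  assumes "module K V" "submodule M K V" "submodule N K V"
  shows "M \<subseteq> M <+>\<^bsub>V\<^esub> N" "N \<subseteq> M <+>\<^bsub>V\<^esub> N"
proof -
  interpret V: module K V by fact
  note M = submoduleD[OF assms(2,1)] and N = submoduleD[OF assms(3,1)]
  show "M \<subseteq> M <+>\<^bsub>V\<^esub> N"
  proof
    fix x assume "x \<in> M"
    then show "x \<in> M <+>\<^bsub>V\<^esub> N" using set_addI[OF _ N(2), of x M V] M(1) by auto
  qed
  show "N \<subseteq> M <+>\<^bsub>V\<^esub> N"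
  proof
    fix x assume "x \<in> N"
    then show "x \<in> M <+>\<^bsub>V\<^esub> N" using set_addI[OF M(2), of x N V] N(1) by auto
  qed
qed

text \<open>
  By Zorn's lemma there is a maximal subspace \<open>M\<close> that meets \<open>N\<close> trivially. A vector outside \<open>M + N\<close> could be adjoined to
  \<open>M\<close>.
\<close>

lemma complement_exists:
  assumes "module K V" "submodule N K V"
  obtains M where "submodule M K V" "M \<inter> N = {\<zero>\<^bsub>V\<^esub>}" "M <+>\<^bsub>V\<^esub> N = carrier V"
proof -
  interpret V: module K V by fact
  note N = submoduleD[OF assms(2,1)]
  let ?A = "{M. submodule M K V \<and> M \<inter> N = {\<zero>\<^bsub>V\<^esub>}}"
  have "\<exists>M\<in>?A. \<forall>X\<in>?A. M \<subseteq> X \<longrightarrow> X = M"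
  proof (rule subset_Zorn_nonempty)
    show "?A \<noteq> {}" using zero_submodule[OF assms(1)] N(2) by blast
    fix C assume C: "C \<noteq> {}" "subset.chain ?A C"
    then have CA: "submodule X K V" "X \<inter> N = {\<zero>\<^bsub>V\<^esub>}" if "X \<in> C" for X
      using that by (auto simp: subset.chain_def)
    have lin: "X \<subseteq> Y \<or> Y \<subseteq> X" if "X \<in> C" "Y \<in> C" for X Y
      using C(2) that by (auto simp: subset.chain_def)
    note D = submoduleD[OF CA(1) assms(1)]
    have "submodule (\<Union>C) K V"
    proof (rule submodule_criterion[OF assms(1)])
      show "\<Union>C \<subseteq> carrier V" using D(1) by blast
      show "\<zero>\<^bsub>V\<^esub> \<in> \<Union>C" using C(1) D(2) by blast
      show "x \<oplus>\<^bsub>V\<^esub> y \<in> \<Union>C" if "x \<in> \<Union>C" "y \<in> \<Union>C" for x y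
      proof -
        from that obtain X Y where "X \<in> C" "Y \<in> C" "x \<in> X" "y \<in> Y" by auto
        with lin[of X Y] D(3) show ?thesis by (meson Union_iff subsetD)
      qed
      show "a \<odot>\<^bsub>V\<^esub> x \<in> \<Union>C" if "a \<in> carrier K" "x \<in> \<Union>C" for a x
        using that D(4) by blast
    qed
    moreover have "\<Union>C \<inter> N = (\<Union>X\<in>C. X \<inter> N)" by auto
    then have "\<Union>C \<inter> N = {\<zero>\<^bsub>V\<^esub>}" using CA(2) C(1) by simp
    ultimately show "\<Union>C \<in> ?A" by simp
  qed
  then obtain M where "M \<in> ?A" and mx: "\<forall>X\<in>?A. M \<subseteq> X \<longrightarrow> X = M" by (rule bexE)
  then have M: "submodule M K V" "M \<inter> N = {\<zero>\<^bsub>V\<^esub>}" by simp_all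
  have max: "X = M" if "submodule X K V" "X \<inter> N = {\<zero>\<^bsub>V\<^esub>}" "M \<subseteq> X" for X
    using mx that by simp
  note MD = submoduleD[OF M(1) assms(1)]
  have sum: "submodule (M <+>\<^bsub>V\<^esub> N) K V" by (rule set_add_submodule[OF assms(1) M(1) assms(2)])
  note SD = submoduleD[OF sum assms(1)]
  note NS = set_add_supset(2)[OF assms(1) M(1) assms(2)] and MS = set_add_supset(1)[OF assms(1) M(1) assms(2)]
  have "v \<in> M <+>\<^bsub>V\<^esub> N" if v: "v \<in> carrier V" for v
  proof (rule ccontr)
    assume nv: "v \<notin> M <+>\<^bsub>V\<^esub> N"
    let ?L = "(\<lambda>a. a \<odot>\<^bsub>V\<^esub> v) ` carrier K"
    have L: "submodule ?L K V"
    proof (rule submodule_criterion[OF assms(1)])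
      show "?L \<subseteq> carrier V" using v by auto
      show "\<zero>\<^bsub>V\<^esub> \<in> ?L" using v by (auto intro!: image_eqI[of _ _ "\<zero>\<^bsub>K\<^esub>"])
      show "x \<oplus>\<^bsub>V\<^esub> y \<in> ?L" if "x \<in> ?L" "y \<in> ?L" for x y using that v by (auto simp flip: V.smult_l_distr)
      show "a \<odot>\<^bsub>V\<^esub> x \<in> ?L" if "a \<in> carrier K" "x \<in> ?L" for a x using that v by (auto simp flip: V.smult_assoc1)
    qed
    have "x = \<zero>\<^bsub>V\<^esub>" if "x \<in> M <+>\<^bsub>V\<^esub> ?L" "x \<in> N" for x
    proof -
      from that(1) obtain m a where x: "m \<in> M" "a \<in> carrier K" "x = m \<oplus>\<^bsub>V\<^esub> a \<odot>\<^bsub>V\<^esub> v" by (auto elim!: set_addE)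
      show ?thesis
      proof (cases "a = \<zero>\<^bsub>K\<^esub>")
        case True
        then have "x = m" using x v MD(1) by (auto simp: subset_iff)
        then show ?thesis using x(1) that(2) M(2) by blast
      next
        case False
        have mV: "m \<in> carrier V" using x(1) MD(1) by auto
        have "a \<odot>\<^bsub>V\<^esub> v = x \<ominus>\<^bsub>V\<^esub> m" using x mV v by (simp add: V.minus_eq V.a_ac V.r_neg V.r_neg1 add_cancel_inner[OF assms(1)])
        then have "a \<odot>\<^bsub>V\<^esub> v \<in> M <+>\<^bsub>V\<^esub> N" using SD(6) NS MS that(2) x(1) by auto
        then have "inv\<^bsub>K\<^esub> a \<odot>\<^bsub>V\<^esub> (a \<odot>\<^bsub>V\<^esub> v) \<in> M <+>\<^bsub>V\<^esub> N" using SD(4) x(2) False K.field_Units by auto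
        moreover have "inv\<^bsub>K\<^esub> a \<odot>\<^bsub>V\<^esub> (a \<odot>\<^bsub>V\<^esub> v) = v" using x(2) False K.field_Units v
          by (simp flip: V.smult_assoc1)
        ultimately show ?thesis using nv by simp
      qed
    qed
    moreover have "\<zero>\<^bsub>V\<^esub> \<in> M <+>\<^bsub>V\<^esub> ?L"
      using submoduleD(2)[OF set_add_submodule[OF assms(1) M(1) L] assms(1)] .
    ultimately have "(M <+>\<^bsub>V\<^esub> ?L) \<inter> N = {\<zero>\<^bsub>V\<^esub>}" using N(2) by blast
    moreover have "M \<subseteq> M <+>\<^bsub>V\<^esub> ?L"
      by (rule set_add_supset(1)[OF assms(1) M(1) L])
    ultimately have "M <+>\<^bsub>V\<^esub> ?L = M" by (intro max set_add_submodule[OF assms(1) M(1) L])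
    moreover have "v \<in> M <+>\<^bsub>V\<^esub> ?L"
      using set_add_supset(2)[OF assms(1) M(1) L] v by (auto intro!: image_eqI[of _ _ "\<one>\<^bsub>K\<^esub>"])
    ultimately show False using nv MS by auto
  qed
  then show ?thesis using that M SD(1) by blast
qed

text \<open>
  The projection onto a complement along \<open>N\<close>. Membership in \<open>N\<close> becomes the vanishing of a linear map, a condition that is
  convenient in tensor products.
\<close>

lemma killer_exists:
  assumes "module K V" "submodule N K V"
  obtains e where "linear_map K V V e" "\<And>x. x \<in> carrier V \<Longrightarrow> e x = \<zero>\<^bsub>V\<^esub> \<longleftrightarrow> x \<in> N"
    "\<And>x. x \<in> carrier V \<Longrightarrow> x \<ominus>\<^bsub>V\<^esub> e x \<in> N"
proof -
  interpret V: module K V by fact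
  obtain M where M: "submodule M K V" "M \<inter> N = {\<zero>\<^bsub>V\<^esub>}" "M <+>\<^bsub>V\<^esub> N = carrier V"
    using complement_exists[OF assms] .
  note MD = submoduleD[OF M(1) assms(1)] and ND = submoduleD[OF assms(2,1)]
  have uniq: "m = m'" if "m \<in> M" "m' \<in> M" "x \<in> carrier V" "x \<ominus>\<^bsub>V\<^esub> m \<in> N" "x \<ominus>\<^bsub>V\<^esub> m' \<in> N" for x m m'
  proof -
    have c: "m \<in> carrier V" "m' \<in> carrier V" using that MD(1) by auto
    have "(x \<ominus>\<^bsub>V\<^esub> m') \<ominus>\<^bsub>V\<^esub> (x \<ominus>\<^bsub>V\<^esub> m) = m \<ominus>\<^bsub>V\<^esub> m'"
      using that(3) c by (simp add: V.minus_eq V.minus_add V.a_ac V.r_neg V.r_neg1 add_cancel_inner[OF assms(1)])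
    then have "m \<ominus>\<^bsub>V\<^esub> m' \<in> M \<inter> N" using that ND(6) MD(6) by (metis IntI)
    then show ?thesis using M(2) diff_add_cancel(2)[OF assms(1) c] by auto
  qed
  have ex: "\<exists>m\<in>M. x \<ominus>\<^bsub>V\<^esub> m \<in> N" if "x \<in> carrier V" for x
  proof -
    have "x \<in> M <+>\<^bsub>V\<^esub> N" using that M(3) by simp
    then obtain m n where x: "m \<in> M" "n \<in> N" "x = m \<oplus>\<^bsub>V\<^esub> n" by (rule set_addE)
    then have "x \<ominus>\<^bsub>V\<^esub> m = n" using MD(1) ND(1) by (auto simp: V.minus_eq V.a_ac V.r_neg V.r_neg1 add_cancel_inner[OF assms(1)] subset_iff)
    then show ?thesis using x by (intro bexI[of _ m]) auto
  qed
  define e where "e x = (SOME m. m \<in> M \<and> x \<ominus>\<^bsub>V\<^esub> m \<in> N)" for x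
  have e: "e x \<in> M" "x \<ominus>\<^bsub>V\<^esub> e x \<in> N" if "x \<in> carrier V" for x
    using someI_ex[of "\<lambda>m. m \<in> M \<and> x \<ominus>\<^bsub>V\<^esub> m \<in> N"] ex[OF that] unfolding e_def by auto
  have eV: "e x \<in> carrier V" if "x \<in> carrier V" for x using e(1)[OF that] MD(1) by auto
  have "linear_map K V V e"
  proof (rule linear_mapI)
    fix x y assume xy: "x \<in> carrier V" "y \<in> carrier V"
    have "(x \<oplus>\<^bsub>V\<^esub> y) \<ominus>\<^bsub>V\<^esub> (e x \<oplus>\<^bsub>V\<^esub> e y) = (x \<ominus>\<^bsub>V\<^esub> e x) \<oplus>\<^bsub>V\<^esub> (y \<ominus>\<^bsub>V\<^esub> e y)"
      using xy eV by (simp add: V.minus_eq V.minus_add V.a_ac)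
    then show "e (x \<oplus>\<^bsub>V\<^esub> y) = e x \<oplus>\<^bsub>V\<^esub> e y"
      using xy e MD(3) ND(3) by (intro uniq[of _ _ "x \<oplus>\<^bsub>V\<^esub> y"]) auto
  next
    fix a x assume ax: "a \<in> carrier K" "x \<in> carrier V"
    have "(a \<odot>\<^bsub>V\<^esub> x) \<ominus>\<^bsub>V\<^esub> (a \<odot>\<^bsub>V\<^esub> e x) = a \<odot>\<^bsub>V\<^esub> (x \<ominus>\<^bsub>V\<^esub> e x)"
      using ax eV by (simp add: V.minus_eq V.smult_r_distr V.smult_r_minus)
    then show "e (a \<odot>\<^bsub>V\<^esub> x) = a \<odot>\<^bsub>V\<^esub> e x"
      using ax e MD(4) ND(4) by (intro uniq[of _ _ "a \<odot>\<^bsub>V\<^esub> x"]) auto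
  qed (rule eV)
  moreover have "e x = \<zero>\<^bsub>V\<^esub> \<longleftrightarrow> x \<in> N" if "x \<in> carrier V" for x
  proof
    assume "e x = \<zero>\<^bsub>V\<^esub>" then show "x \<in> N" using e(2)[OF that] diff_zero[OF assms(1) that] by simp
  next
    assume "x \<in> N" then show "e x = \<zero>\<^bsub>V\<^esub>"
      using that e MD(2) diff_zero[OF assms(1) that] by (intro uniq[of _ _ x]) auto
  qed
  ultimately show ?thesis using that e(2) by blast
qed

text \<open>
  The factorization is defined on the image of \<open>f\<close> by the kernel condition, and on all of \<open>W\<close> by composing with
  a projection onto this image.
\<close>

lemma linear_factor:
  assumes "module K V" "module K W" "module K U" "linear_map K V W f" "linear_map K V U e"
    and ker: "\<And>x. x \<in> carrier V \<Longrightarrow> f x = \<zero>\<^bsub>W\<^esub> \<Longrightarrow> e x = \<zero>\<^bsub>U\<^esub>"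
  obtains \<psi> where "linear_map K W U \<psi>" "\<And>x. x \<in> carrier V \<Longrightarrow> \<psi> (f x) = e x"
proof -
  interpret V: module K V by fact
  interpret W: module K W by fact
  interpret U: module K U by fact
  let ?N = "f ` carrier V"
  have N: "submodule ?N K W" by (rule linear_image_submodule[OF assms(1,2,4)])
  obtain k where k: "linear_map K W W k" "\<And>x. x \<in> carrier W \<Longrightarrow> k x = \<zero>\<^bsub>W\<^esub> \<longleftrightarrow> x \<in> ?N"
    "\<And>x. x \<in> carrier W \<Longrightarrow> x \<ominus>\<^bsub>W\<^esub> k x \<in> ?N" using killer_exists[OF assms(2) N] by blast
  have p: "linear_map K W W (\<lambda>x. x \<ominus>\<^bsub>W\<^esub> k x)" by (intro linear_diff assms linear_id k)
  define s where "s w = (SOME x. x \<in> carrier V \<and> f x = w \<ominus>\<^bsub>W\<^esub> k w)" for w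
  have s: "s w \<in> carrier V" "f (s w) = w \<ominus>\<^bsub>W\<^esub> k w" if "w \<in> carrier W" for w
  proof -
    have "\<exists>x. x \<in> carrier V \<and> f x = w \<ominus>\<^bsub>W\<^esub> k w" using k(3)[OF that] by auto
    from someI_ex[OF this] show "s w \<in> carrier V" "f (s w) = w \<ominus>\<^bsub>W\<^esub> k w" unfolding s_def by auto
  qed
  have eq: "e x = e y" if "x \<in> carrier V" "y \<in> carrier V" "f x = f y" for x y
  proof -
    have "f (x \<ominus>\<^bsub>V\<^esub> y) = \<zero>\<^bsub>W\<^esub>"
      using that linear_minus[OF assms(1,2,4) that(1,2)] diff_add_cancel(2)[OF assms(2)] linear_closed[OF assms(4)] by metis
    then have "e (x \<ominus>\<^bsub>V\<^esub> y) = \<zero>\<^bsub>U\<^esub>" using ker that by auto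
    then show ?thesis
      using that linear_minus[OF assms(1,3,5) that(1,2)] diff_add_cancel(2)[OF assms(3)] linear_closed[OF assms(5)] by metis
  qed
  note ec = linear_closed[OF assms(5)]
  have "linear_map K W U (\<lambda>w. e (s w))"
  proof (rule linear_mapI)
    show "e (s w) \<in> carrier U" if "w \<in> carrier W" for w using s that ec by auto
    show "e (s (x \<oplus>\<^bsub>W\<^esub> y)) = e (s x) \<oplus>\<^bsub>U\<^esub> e (s y)" if "x \<in> carrier W" "y \<in> carrier W" for x y
      using that s by (subst linear_add[OF assms(5), symmetric])
        (auto intro!: eq simp: linear_add[OF assms(4)] linear_add[OF p])
    show "e (s (a \<odot>\<^bsub>W\<^esub> x)) = a \<odot>\<^bsub>U\<^esub> e (s x)" if "a \<in> carrier K" "x \<in> carrier W" for a x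
      using that s by (subst linear_smult[OF assms(5), symmetric])
        (auto intro!: eq simp: linear_smult[OF assms(4)] linear_smult[OF p])
  qed
  moreover have "e (s (f x)) = e x" if "x \<in> carrier V" for x
  proof (rule eq)
    have fx: "f x \<in> carrier W" using that linear_closed[OF assms(4)] by auto
    show "s (f x) \<in> carrier V" using s fx by auto
    have "k (f x) = \<zero>\<^bsub>W\<^esub>" using k(2)[OF fx] that by auto
    then show "f (s (f x)) = f x" using s(2)[OF fx] diff_zero[OF assms(2) fx] by simp
  qed (use that in auto)
  ultimately show ?thesis using that by blast
qed

lemma linear_extend:
  assumes "module K V" "module K U" "submodule N K V" "linear_map K (V\<lparr>carrier := N\<rparr>) U f"
  obtains g where "linear_map K V U g" "\<And>x. x \<in> N \<Longrightarrow> g x = f x"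
proof -
  let ?N = "V\<lparr>carrier := N\<rparr>"
  have m: "module K ?N" by (rule submodule.submodule_is_module[OF assms(3,1)])
  have l: "linear_map K ?N V (\<lambda>x. x)" using submoduleD(1)[OF assms(3,1)] by (auto simp: linear_map_def)
  obtain \<psi> where "linear_map K V U \<psi>" "\<And>x. x \<in> carrier ?N \<Longrightarrow> \<psi> x = f x"
    using linear_factor[OF m assms(1,2) l assms(4)] linear_zero[OF m assms(2,4)] by auto
  then show ?thesis using that by auto
qed

subsection \<open>Subspaces of tensor products\<close>

lemma tensor_map_zero:
  assumes "linear_map K X V f" "linear_map K Y W g" "module K V" "module K W" "module K X" "module K Y"
  shows "tensor_map K V W f g \<zero>\<^bsub>tensor_product K X Y\<^esub> = \<zero>\<^bsub>tensor_product K V W\<^esub>"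
  by (rule linear_zero[OF tensor_module tensor_module tensor_map_linear[OF linear_id]]) (use assms in auto)

lemma tensor_map_comp:
  assumes "linear_map K X V f" "linear_map K Y W g" "linear_map K V V' f'" "linear_map K W W' g'"
    "module K V" "module K W" "module K X" "module K Y" "module K V'" "module K W'"
    "t \<in> carrier (tensor_product K X Y)"
  shows "tensor_map K V' W' f' g' (tensor_map K V W f g t) = tensor_map K V' W' (\<lambda>x. f' (f x)) (\<lambda>y. g' (g y)) t"
  unfolding tensor_map_def[of K V' W']
  by (rule lift_tensor_map[OF assms(1,2,5-8) tensor_module[OF assms(9,10)] _ assms(11)])
    (intro bilinear_mapI linear_pure_left linear_pure_right assms; auto intro: linear_closed assms)

lemma sub_tensor_submodule:
  assumes "module K V" "module K W" "A \<subseteq> carrier V" "B \<subseteq> carrier W"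
  shows "submodule (sub_tensor K V W A B) K (tensor_product K V W)"
  unfolding sub_tensor_def by (rule hull_submodule[OF tensor_module]) (use assms in \<open>auto intro!: pure_closed\<close>)

lemma sub_tensor_pure: "x \<in> A \<Longrightarrow> y \<in> B \<Longrightarrow> pure_tensor K V W x y \<in> sub_tensor K V W A B"
  unfolding sub_tensor_def by (rule subsetD[OF hull_subset]) auto

lemma sub_tensor_mono: "A \<subseteq> A' \<Longrightarrow> B \<subseteq> B' \<Longrightarrow> sub_tensor K V W A B \<subseteq> sub_tensor K V W A' B'"
  unfolding sub_tensor_def by (rule hull_mono) auto

lemma sub_tensor_in_carrier:
  "module K V \<Longrightarrow> module K W \<Longrightarrow> A \<subseteq> carrier V \<Longrightarrow> B \<subseteq> carrier W \<Longrightarrow>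
    sub_tensor K V W A B \<subseteq> carrier (tensor_product K V W)"
  using submoduleD(1)[OF sub_tensor_submodule tensor_module] .

lemma linear_sub_tensor:
  assumes "module K V" "module K W" "module K U" "linear_map K (tensor_product K V W) U f" "submodule N K U"
    "A \<subseteq> carrier V" "B \<subseteq> carrier W" "\<And>a b. a \<in> A \<Longrightarrow> b \<in> B \<Longrightarrow> f (pure_tensor K V W a b) \<in> N"
    "t \<in> sub_tensor K V W A B"
  shows "f t \<in> N"
proof -
  have "sub_tensor K V W A B \<subseteq> {t \<in> carrier (tensor_product K V W). f t \<in> N}"
    unfolding sub_tensor_def
    by (rule hull_least[OF linear_vimage_submodule[OF tensor_module[OF assms(1,2)] assms(3-5)]])
      (use assms(1,2,6-8) in \<open>auto intro!: pure_closed\<close>)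
  then show ?thesis using assms(9) by auto
qed

lemma lift_sub_tensor:
  assumes "module K V" "module K W" "module K U" "bilinear_map K V W U \<beta>" "submodule N K U"
    "A \<subseteq> carrier V" "B \<subseteq> carrier W" "\<And>a b. a \<in> A \<Longrightarrow> b \<in> B \<Longrightarrow> \<beta> a b \<in> N"
    "t \<in> sub_tensor K V W A B"
  shows "tensor_lift K U \<beta> t \<in> N"
  by (rule linear_sub_tensor[OF assms(1-3) tensor_lift_linear[OF assms(1-4)] assms(5-7) _ assms(9)])
    (use assms in \<open>auto simp: tensor_lift_pure subset_iff\<close>)

text \<open>
  As \<open>e\<close> and \<open>e'\<close> are the identity modulo their kernels \<open>A\<close> and \<open>B\<close>, so is \<open>e \<otimes> e'\<close> modulo \<open>V \<otimes> B + A \<otimes> W\<close>, which \<open>e \<otimes> e'\<close> kills.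
\<close>

lemma tensor_kernel_sum:
  assumes m: "module K V" "module K W" and A: "submodule A K V" and B: "submodule B K W"
    and e: "linear_map K V V e" "\<And>x. x \<in> carrier V \<Longrightarrow> e x = \<zero>\<^bsub>V\<^esub> \<longleftrightarrow> x \<in> A" "\<And>x. x \<in> carrier V \<Longrightarrow> x \<ominus>\<^bsub>V\<^esub> e x \<in> A"
    and e': "linear_map K W W e'" "\<And>x. x \<in> carrier W \<Longrightarrow> e' x = \<zero>\<^bsub>W\<^esub> \<longleftrightarrow> x \<in> B" "\<And>x. x \<in> carrier W \<Longrightarrow> x \<ominus>\<^bsub>W\<^esub> e' x \<in> B"
    and t: "t \<in> carrier (tensor_product K V W)"
  shows "tensor_map K V W e e' t = \<zero>\<^bsub>tensor_product K V W\<^esub> \<longleftrightarrow>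
    t \<in> sub_tensor K V W (carrier V) B <+>\<^bsub>tensor_product K V W\<^esub> sub_tensor K V W A (carrier W)"
    (is "_ \<longleftrightarrow> t \<in> ?S")
proof -
  let ?T = "tensor_product K V W"
  interpret V: module K V by fact
  interpret W: module K W by fact
  have T: "module K ?T" by (rule tensor_module[OF m])
  interpret T: module K ?T by fact
  note AD = submoduleD[OF A m(1)] and BD = submoduleD[OF B m(2)]
  have S1: "submodule (sub_tensor K V W (carrier V) B) K ?T" by (rule sub_tensor_submodule[OF m _ BD(1)]) auto
  have S2: "submodule (sub_tensor K V W A (carrier W)) K ?T" by (rule sub_tensor_submodule[OF m AD(1)]) auto
  have S: "submodule ?S K ?T" by (rule set_add_submodule[OF T S1 S2])
  note SD = submoduleD[OF S T]
  let ?f = "tensor_map K V W e e'"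
  have f: "linear_map K ?T ?T ?f" by (rule tensor_map_linear[OF linear_id e(1) e'(1) m m])
  have ecl: "\<And>x. x \<in> carrier V \<Longrightarrow> e x \<in> carrier V" "\<And>x. x \<in> carrier W \<Longrightarrow> e' x \<in> carrier W"
    using linear_closed[OF e(1)] linear_closed[OF e'(1)] by auto
  have fp: "?f (pure_tensor K V W v w) = pure_tensor K V W (e v) (e' w)" if "v \<in> carrier V" "w \<in> carrier W" for v w
    by (rule tensor_map_pure[OF e(1) e'(1) m m that])
  have mod: "t \<ominus>\<^bsub>?T\<^esub> ?f t \<in> ?S"
    using m t
  proof (induction rule: tensor_induct)
    case zero
    then show ?case using SD(2) linear_zero[OF T T f] T.zero_closed diff_zero[OF T T.zero_closed] by simp
  next
    case (pure v w)
    let ?p = "pure_tensor K V W"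
    have c: "?p v w \<in> carrier ?T" "?p (e v) w \<in> carrier ?T" "?p (e v) (e' w) \<in> carrier ?T"
      using pure ecl by (auto intro: pure_closed m)
    have 1: "?p v w \<ominus>\<^bsub>?T\<^esub> ?p (e v) w \<in> sub_tensor K V W A (carrier W)"
      using sub_tensor_pure[OF e(3)[OF pure(1)] pure(2), of V W]
        linear_minus[OF m(1) T bilinear_left[OF pure_bilinear[OF m] pure(2)] pure(1) ecl(1)[OF pure(1)]] by simp
    have 2: "?p (e v) w \<ominus>\<^bsub>?T\<^esub> ?p (e v) (e' w) \<in> sub_tensor K V W (carrier V) B"
      using sub_tensor_pure[OF ecl(1)[OF pure(1)] e'(3)[OF pure(2)], of V W]
        linear_minus[OF m(2) T bilinear_right[OF pure_bilinear[OF m] ecl(1)[OF pure(1)]] pure(2) ecl(2)[OF pure(2)]] by simp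
    have "?p v w \<ominus>\<^bsub>?T\<^esub> ?p (e v) (e' w) =
        (?p (e v) w \<ominus>\<^bsub>?T\<^esub> ?p (e v) (e' w)) \<oplus>\<^bsub>?T\<^esub> (?p v w \<ominus>\<^bsub>?T\<^esub> ?p (e v) w)"
      using c by (simp add: T.minus_eq T.a_ac T.r_neg T.r_neg1 add_cancel_inner[OF T])
    then show ?case using fp[OF pure] set_addI[OF 2 1] by metis
  next
    case (add s t)
    have c: "?f s \<in> carrier ?T" "?f t \<in> carrier ?T" using add linear_closed[OF f] by auto
    have "(s \<oplus>\<^bsub>?T\<^esub> t) \<ominus>\<^bsub>?T\<^esub> ?f (s \<oplus>\<^bsub>?T\<^esub> t) = (s \<ominus>\<^bsub>?T\<^esub> ?f s) \<oplus>\<^bsub>?T\<^esub> (t \<ominus>\<^bsub>?T\<^esub> ?f t)"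
      using add c by (simp add: linear_add[OF f] T.minus_eq T.minus_add T.a_ac)
    then show ?case using SD(3)[OF add(3,4)] by simp
  qed
  show ?thesis
  proof
    assume "?f t = \<zero>\<^bsub>?T\<^esub>" then show "t \<in> ?S" using mod diff_zero[OF T t] by simp
  next
    assume "t \<in> ?S"
    then obtain s1 s2 where s: "s1 \<in> sub_tensor K V W (carrier V) B" "s2 \<in> sub_tensor K V W A (carrier W)" "t = s1 \<oplus>\<^bsub>?T\<^esub> s2"
      by (rule set_addE)
    note z = zero_submodule[OF T]
    have A0: "e a = \<zero>\<^bsub>V\<^esub>" if "a \<in> A" for a using that e(2) AD(1) by auto
    have B0: "e' b = \<zero>\<^bsub>W\<^esub>" if "b \<in> B" for b using that e'(2) BD(1) by auto
    have "?f s1 \<in> {\<zero>\<^bsub>?T\<^esub>}"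
      by (rule linear_sub_tensor[OF m T f z _ BD(1) _ s(1)])
        (use fp ecl B0 BD(1) in \<open>simp_all add: subset_iff pure_zero[OF m]\<close>)
    moreover have "?f s2 \<in> {\<zero>\<^bsub>?T\<^esub>}"
      by (rule linear_sub_tensor[OF m T f z AD(1) _ _ s(2)])
        (use fp ecl A0 AD(1) in \<open>simp_all add: subset_iff pure_zero[OF m]\<close>)
    moreover have "s1 \<in> carrier ?T" "s2 \<in> carrier ?T" using s submoduleD(1)[OF S1 T] submoduleD(1)[OF S2 T] by auto
    ultimately show "?f t = \<zero>\<^bsub>?T\<^esub>" using s(3) by (simp add: linear_add[OF f])
  qed
qed

lemma tensor_kernel_right:
  assumes m: "module K V" "module K W" and B: "submodule B K W"
    and e': "linear_map K W W e'" "\<And>x. x \<in> carrier W \<Longrightarrow> e' x = \<zero>\<^bsub>W\<^esub> \<longleftrightarrow> x \<in> B" "\<And>x. x \<in> carrier W \<Longrightarrow> x \<ominus>\<^bsub>W\<^esub> e' x \<in> B"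
    and t: "t \<in> carrier (tensor_product K V W)"
  shows "tensor_map K V W (\<lambda>x. x) e' t = \<zero>\<^bsub>tensor_product K V W\<^esub> \<longleftrightarrow> t \<in> sub_tensor K V W (carrier V) B"
proof -
  let ?T = "tensor_product K V W"
  interpret V: module K V by fact
  have T: "module K ?T" by (rule tensor_module[OF m])
  interpret T: module K ?T by fact
  have sub: "submodule (sub_tensor K V W (carrier V) B) K ?T"
    by (rule sub_tensor_submodule[OF m _ submoduleD(1)[OF B m(2)]]) auto
  have "sub_tensor K V W {\<zero>\<^bsub>V\<^esub>} (carrier W) \<subseteq> {\<zero>\<^bsub>?T\<^esub>}"
    unfolding sub_tensor_def by (rule hull_least[OF zero_submodule[OF T]])
      (use pure_zero(1)[OF m] in blast)
  moreover have "\<zero>\<^bsub>?T\<^esub> \<in> sub_tensor K V W {\<zero>\<^bsub>V\<^esub>} (carrier W)"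
    using submoduleD(2)[OF sub_tensor_submodule[OF m] T] by auto
  ultimately have z: "sub_tensor K V W {\<zero>\<^bsub>V\<^esub>} (carrier W) = {\<zero>\<^bsub>?T\<^esub>}" by auto
  have "sub_tensor K V W (carrier V) B <+>\<^bsub>?T\<^esub> {\<zero>\<^bsub>?T\<^esub>} = sub_tensor K V W (carrier V) B"
    using submoduleD(1)[OF sub T] by (auto simp: set_add_def' subset_iff)
  moreover have "x \<ominus>\<^bsub>V\<^esub> x \<in> {\<zero>\<^bsub>V\<^esub>}" if "x \<in> carrier V" for x using that by (simp add: V.minus_eq V.r_neg)
  moreover have "tensor_map K V W (\<lambda>x. x) e' t = \<zero>\<^bsub>?T\<^esub> \<longleftrightarrow>
      t \<in> sub_tensor K V W (carrier V) B <+>\<^bsub>?T\<^esub> sub_tensor K V W {\<zero>\<^bsub>V\<^esub>} (carrier W)"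
    by (rule tensor_kernel_sum[OF m zero_submodule[OF m(1)] B linear_id _ _ e' t]) (use calculation(2) in auto)
  ultimately show ?thesis unfolding z by simp
qed

end

section \<open>Symbols of filtered spaces\<close>

text \<open>
  The members of \<open>rel\<close> derive that two terms are related in degree \<open>n\<close> from relations between their parts; the
  degrees of the parts are found by unification and add up.
\<close>

named_theorems rel

context vector_spaces
begin

text \<open>
  \<open>R n x g\<close> reads: \<open>x\<close> lies in the \<open>n\<close>-th filtration term and has the symbol \<open>g\<close> there. The linear map \<open>P n\<close> is defined on
  the whole space, which is possible over a field, and computes symbols in degree \<open>n\<close>; in particular it kills the
  terms of lower degree.
\<close>

definition symbol_projections ::
  "('k, 'v, 'a) module_scheme \<Rightarrow> ('k, 'g, 'b) module_scheme \<Rightarrow> (nat \<Rightarrow> 'v \<Rightarrow> 'g \<Rightarrow> bool) \<Rightarrow> (nat \<Rightarrow> 'v \<Rightarrow> 'g) \<Rightarrow> bool"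
  where "symbol_projections V G R P \<longleftrightarrow> (\<forall>n. linear_map K V G (P n)) \<and>
    (\<forall>n x g. R n x g \<longrightarrow> P n x = g \<and> (\<forall>m>n. P m x = \<zero>\<^bsub>G\<^esub>))"

lemma symbol_projectionsD:
  assumes "symbol_projections V G R P"
  shows "\<And>n. linear_map K V G (P n)" "\<And>n x g. R n x g \<Longrightarrow> P n x = g"
    "\<And>n x g m. R n x g \<Longrightarrow> n < m \<Longrightarrow> P m x = \<zero>\<^bsub>G\<^esub>"
  using assms unfolding symbol_projections_def by simp_all

text \<open>
  The projections make symbols unique. The last clause says that the graded space is spanned by symbols, so that
  linear maps on it are determined by their values on symbols.
\<close>

definition filtered_symbols ::
  "('k, 'v, 'a) module_scheme \<Rightarrow> ('k, 'g, 'b) module_scheme \<Rightarrow> (nat \<Rightarrow> 'v \<Rightarrow> 'g \<Rightarrow> bool) \<Rightarrow> bool"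
  where "filtered_symbols V G R \<longleftrightarrow> module K V \<and> module K G \<and>
    (\<forall>n x g. R n x g \<longrightarrow> x \<in> carrier V \<and> g \<in> carrier G) \<and>
    (\<forall>n. R n \<zero>\<^bsub>V\<^esub> \<zero>\<^bsub>G\<^esub>) \<and>
    (\<forall>n x g y h. R n x g \<longrightarrow> R n y h \<longrightarrow> R n (x \<oplus>\<^bsub>V\<^esub> y) (g \<oplus>\<^bsub>G\<^esub> h)) \<and>
    (\<exists>P. symbol_projections V G R P) \<and>
    carrier G \<subseteq> subspace_hull K G {g. \<exists>n x. R n x g}"

lemma filtered_symbolsI:
  assumes "module K V" "module K G" "\<And>n x g. R n x g \<Longrightarrow> x \<in> carrier V" "\<And>n x g. R n x g \<Longrightarrow> g \<in> carrier G"
    "\<And>n. R n \<zero>\<^bsub>V\<^esub> \<zero>\<^bsub>G\<^esub>" "\<And>n x g y h. R n x g \<Longrightarrow> R n y h \<Longrightarrow> R n (x \<oplus>\<^bsub>V\<^esub> y) (g \<oplus>\<^bsub>G\<^esub> h)"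
    "symbol_projections V G R P" "carrier G \<subseteq> subspace_hull K G {g. \<exists>n x. R n x g}"
  shows "filtered_symbols V G R"
  using assms(1-6,8) exI[of "symbol_projections V G R", OF assms(7)] unfolding filtered_symbols_def by simp

lemma filtered_symbolsD:
  assumes "filtered_symbols V G R"
  shows "module K V" "module K G" "\<And>n x g. R n x g \<Longrightarrow> x \<in> carrier V" "\<And>n x g. R n x g \<Longrightarrow> g \<in> carrier G"
    "\<And>n. R n \<zero>\<^bsub>V\<^esub> \<zero>\<^bsub>G\<^esub>" "\<And>n x g y h. R n x g \<Longrightarrow> R n y h \<Longrightarrow> R n (x \<oplus>\<^bsub>V\<^esub> y) (g \<oplus>\<^bsub>G\<^esub> h)"
    "carrier G \<subseteq> subspace_hull K G {g. \<exists>n x. R n x g}"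
  using assms unfolding filtered_symbols_def by blast+

lemma filtered_symbols_projections: "filtered_symbols V G R \<Longrightarrow> \<exists>P. symbol_projections V G R P"
  unfolding filtered_symbols_def by (elim conjE)

lemma symbol_unique:
  assumes "filtered_symbols V G R" "R n x g" "R n x h" shows "g = h"
proof -
  obtain P where "symbol_projections V G R P" using filtered_symbols_projections[OF assms(1)] ..
  note P = symbol_projectionsD[OF this]
  show ?thesis using P(2)[OF assms(2)] P(2)[OF assms(3)] by simp
qed

lemma symbol_ext:
  assumes "filtered_symbols V G R" "module K U" "linear_map K G U f" "linear_map K G U f'"
    "\<And>n x g. R n x g \<Longrightarrow> x \<in> carrier V \<Longrightarrow> g \<in> carrier G \<Longrightarrow> f g = f' g" "g \<in> carrier G"
  shows "f g = f' g"
  by (rule linear_hull_cong[OF filtered_symbolsD(2)[OF assms(1)] assms(2-4), of "{g. \<exists>n x. R n x g}"])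
    (use assms(5,6) filtered_symbolsD(3,4,7)[OF assms(1)] in blast)+

text \<open>
  The tensor product filtration has the terms \<open>\<Sum> V\<^sub>i \<otimes> W\<^sub>n\<^sub>-\<^sub>i\<close>, and the symbol of \<open>x \<otimes> y\<close> is the tensor product of the symbols.
  That this is well defined is the content of \<open>filtered_tensor\<close> below.
\<close>

inductive tensor_rel ::
  "('k, 'v, 'a) module_scheme \<Rightarrow> ('k, 'g, 'b) module_scheme \<Rightarrow> (nat \<Rightarrow> 'v \<Rightarrow> 'g \<Rightarrow> bool) \<Rightarrow>
   ('k, 'w, 'c) module_scheme \<Rightarrow> ('k, 'h, 'd) module_scheme \<Rightarrow> (nat \<Rightarrow> 'w \<Rightarrow> 'h \<Rightarrow> bool) \<Rightarrow>
   nat \<Rightarrow> ('k, 'v, 'w) tensor \<Rightarrow> ('k, 'g, 'h) tensor \<Rightarrow> bool"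
  for V :: "('k, 'v, 'a) module_scheme" and G :: "('k, 'g, 'b) module_scheme" and R
    and W :: "('k, 'w, 'c) module_scheme" and G' :: "('k, 'h, 'd) module_scheme" and R' and n :: nat
  where
    tensor_rel_zero: "tensor_rel V G R W G' R' n \<zero>\<^bsub>tensor_product K V W\<^esub> \<zero>\<^bsub>tensor_product K G G'\<^esub>"
  | tensor_rel_pure: "R a x g \<Longrightarrow> R' b y h \<Longrightarrow> n = a + b \<Longrightarrow>
      tensor_rel V G R W G' R' n (pure_tensor K V W x y) (pure_tensor K G G' g h)"
  | tensor_rel_add: "tensor_rel V G R W G' R' n s s' \<Longrightarrow> tensor_rel V G R W G' R' n t t' \<Longrightarrow>
      tensor_rel V G R W G' R' n (s \<oplus>\<^bsub>tensor_product K V W\<^esub> t) (s' \<oplus>\<^bsub>tensor_product K G G'\<^esub> t')"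

lemmas [rel] = tensor_rel_pure

lemma tensor_rel_carrier:
  assumes "filtered_symbols V G R" "filtered_symbols W G' R'" "tensor_rel V G R W G' R' n t s"
  shows "t \<in> carrier (tensor_product K V W)" "s \<in> carrier (tensor_product K G G')"
proof -
  note F = filtered_symbolsD[OF assms(1)] and F' = filtered_symbolsD[OF assms(2)]
  interpret T: module K "tensor_product K V W" by (rule tensor_module[OF F(1) F'(1)])
  interpret S: module K "tensor_product K G G'" by (rule tensor_module[OF F(2) F'(2)])
  have "t \<in> carrier (tensor_product K V W) \<and> s \<in> carrier (tensor_product K G G')"
    using assms(3)
  proof induction
    case (tensor_rel_pure a x g b y h)
    show ?case
      using pure_closed[OF F(1) F'(1) F(3)[OF tensor_rel_pure(1)] F'(3)[OF tensor_rel_pure(2)]]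
        pure_closed[OF F(2) F'(2) F(4)[OF tensor_rel_pure(1)] F'(4)[OF tensor_rel_pure(2)]] by simp
  qed simp_all
  then show "t \<in> carrier (tensor_product K V W)" "s \<in> carrier (tensor_product K G G')" by auto
qed

text \<open>
  Sweedler sums of related summands over related tensors are related. The target degree \<open>n\<close> may differ from the
  degree \<open>m\<close> of the tensors, as further factors may occur in the summands.
\<close>

lemma rel_lift:
  assumes t: "tensor_rel V G R W G' R' m t s"
    and F: "filtered_symbols V G R" "filtered_symbols W G' R'" "filtered_symbols U GU RU"
    and b: "bilinear_map K V W U \<beta>" "bilinear_map K G G' GU \<beta>'"
    and step: "\<And>a b x g y h. R a x g \<Longrightarrow> R' b y h \<Longrightarrow> a + b = m \<Longrightarrow> x \<in> carrier V \<Longrightarrow> g \<in> carrier G \<Longrightarrow>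
      y \<in> carrier W \<Longrightarrow> h \<in> carrier G' \<Longrightarrow> RU n (\<beta> x y) (\<beta>' g h)"
  shows "RU n (tensor_lift K U \<beta> t) (tensor_lift K GU \<beta>' s)"
proof -
  note D1 = filtered_symbolsD[OF F(1)] and D2 = filtered_symbolsD[OF F(2)] and D3 = filtered_symbolsD[OF F(3)]
  show ?thesis using t
  proof induction
    case tensor_rel_zero then show ?case
      by (simp add: tensor_lift_zero[OF D1(1) D2(1) D3(1) b(1)] tensor_lift_zero[OF D1(2) D2(2) D3(2) b(2)] D3(5))
  next
    case (tensor_rel_pure a x g b y h)
    have c: "x \<in> carrier V" "g \<in> carrier G" "y \<in> carrier W" "h \<in> carrier G'"
      using D1(3,4)[OF tensor_rel_pure(1)] D2(3,4)[OF tensor_rel_pure(2)] by simp_all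
    show ?case unfolding tensor_lift_pure[OF D1(1) D2(1) D3(1) b(1) c(1,3)] tensor_lift_pure[OF D1(2) D2(2) D3(2) b(2) c(2,4)]
      by (rule step) (use tensor_rel_pure c in auto)
  next
    case (tensor_rel_add s s' t t')
    note c = tensor_rel_carrier[OF F(1,2)]
    show ?case
      unfolding tensor_lift_add[OF D1(1) D2(1) D3(1) b(1) c(1)[OF tensor_rel_add(1)] c(1)[OF tensor_rel_add(2)]]
        tensor_lift_add[OF D1(2) D2(2) D3(2) b(2) c(2)[OF tensor_rel_add(1)] c(2)[OF tensor_rel_add(2)]]
      by (rule D3(6)) (use tensor_rel_add in auto)
  qed
qed

text \<open>
  The variant of \<open>rel_lift\<close> for linear maps on a tensor product that are not literally given as lifts.
\<close>

lemma rel_linear: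
  assumes t: "tensor_rel V G R W G' R' m t s"
    and F: "filtered_symbols V G R" "filtered_symbols W G' R'" "filtered_symbols U GU RU"
    and l: "linear_map K (tensor_product K V W) U f" "linear_map K (tensor_product K G G') GU f'"
    and step: "\<And>a b x g y h. R a x g \<Longrightarrow> R' b y h \<Longrightarrow> a + b = m \<Longrightarrow> x \<in> carrier V \<Longrightarrow> g \<in> carrier G \<Longrightarrow>
      y \<in> carrier W \<Longrightarrow> h \<in> carrier G' \<Longrightarrow> RU n (f (pure_tensor K V W x y)) (f' (pure_tensor K G G' g h))"
  shows "RU n (f t) (f' s)"
proof -
  note D1 = filtered_symbolsD[OF F(1)] and D2 = filtered_symbolsD[OF F(2)] and D3 = filtered_symbolsD[OF F(3)]
  show ?thesis using t
  proof induction
    case tensor_rel_zero then show ?case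
      by (simp add: linear_zero[OF tensor_module[OF D1(1) D2(1)] D3(1) l(1)]
          linear_zero[OF tensor_module[OF D1(2) D2(2)] D3(2) l(2)] D3(5))
  next
    case (tensor_rel_pure a x g b y h)
    then show ?case by (intro step) (use D1(3,4)[OF tensor_rel_pure(1)] D2(3,4)[OF tensor_rel_pure(2)] in auto)
  next
    case (tensor_rel_add s s' t t')
    note c = tensor_rel_carrier[OF F(1,2)]
    show ?case
      unfolding linear_add[OF l(1) c(1)[OF tensor_rel_add(1)] c(1)[OF tensor_rel_add(2)]]
        linear_add[OF l(2) c(2)[OF tensor_rel_add(1)] c(2)[OF tensor_rel_add(2)]]
      by (rule D3(6)) (use tensor_rel_add in auto)
  qed
qed

text \<open>
  The symbol in degree \<open>m\<close> is computed by \<open>\<Sum>\<^sub>i P i \<otimes> P' (m - i)\<close>, where \<open>i\<close> runs from \<open>0\<close> to \<open>m\<close>. On \<open>x \<otimes> y\<close> with \<open>x\<close> and \<open>y\<close> of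
  degrees \<open>a\<close> and \<open>b\<close>, each other index than \<open>i = a\<close> meets a factor of too low degree, and for \<open>m > a + b\<close> so does
  every index. This expresses that \<open>gr(V \<otimes> W) = gr V \<otimes> gr W\<close>.
\<close>

lemma filtered_tensor [rel]:
  assumes F: "filtered_symbols V G R" "filtered_symbols W G' R'"
  shows "filtered_symbols (tensor_product K V W) (tensor_product K G G') (tensor_rel V G R W G' R')"
proof -
  note D1 = filtered_symbolsD[OF F(1)] and D2 = filtered_symbolsD[OF F(2)]
  let ?T = "tensor_product K V W" and ?S = "tensor_product K G G'"
  have T: "module K ?T" and S: "module K ?S" using D1 D2 by (auto intro: tensor_module)
  interpret G: module K G by (rule D1(2))
  interpret G': module K G' by (rule D2(2))
  interpret S: module K ?S by fact
  obtain P where "symbol_projections V G R P" using filtered_symbols_projections[OF F(1)] ..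
  note P = symbol_projectionsD[OF this]
  obtain P' where "symbol_projections W G' R' P'" using filtered_symbols_projections[OF F(2)] ..
  note P' = symbol_projectionsD[OF this]
  have tm: "linear_map K ?T ?S (tensor_map K G G' (P i) (P' j))" for i j
    by (rule tensor_map_linear[OF linear_id P(1) P'(1) D1(2) D2(2) D1(1) D2(1)])
  \<comment> \<open>the projection to total degree \<open>m\<close>\<close>
  define PP where "PP m t = (\<Oplus>\<^bsub>?S\<^esub>i\<in>{..m}. tensor_map K G G' (P i) (P' (m - i)) t)" for m t
  have PPl: "linear_map K ?T ?S (PP m)" for m
    unfolding PP_def by (rule linear_finsum_maps[OF T S]) (auto intro: tm)
  have PPp: "PP m (pure_tensor K V W x y) = (if m = a + b then pure_tensor K G G' g h else \<zero>\<^bsub>?S\<^esub>)"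
    if R: "R a x g" "R' b y h" "a + b \<le> m" for m a b x g y h
  proof -
    have c: "x \<in> carrier V" "g \<in> carrier G" "y \<in> carrier W" "h \<in> carrier G'" using D1(3,4)[OF R(1)] D2(3,4)[OF R(2)] by simp_all
    have cP: "P i x \<in> carrier G" "P' i y \<in> carrier G'" for i
      using linear_closed[OF P(1) c(1)] linear_closed[OF P'(1) c(3)] by auto
    have z: "tensor_map K G G' (P i) (P' (m - i)) (pure_tensor K V W x y) = (if i = a \<and> m = a + b then pure_tensor K G G' g h else \<zero>\<^bsub>?S\<^esub>)"
      if "i \<le> m" for i
    proof -
      consider "i > a" | "m - i > b" | "i = a" "m - i = b" using \<open>a + b \<le> m\<close> that by linarith
      then show ?thesis
        unfolding tensor_map_pure[OF P(1) P'(1) D1(2) D2(2) D1(1) D2(1) c(1,3)]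
        using that P(2)[OF R(1)] P'(2)[OF R(2)] cP
        by cases (auto simp: P(3)[OF R(1)] P'(3)[OF R(2)] pure_zero[OF D1(2) D2(2)])
    qed
    have pc: "pure_tensor K G G' g h \<in> carrier ?S" using c D1 D2 by (auto intro: pure_closed)
    have "PP m (pure_tensor K V W x y) = (\<Oplus>\<^bsub>?S\<^esub>i\<in>{..m}. if i = a \<and> m = a + b then pure_tensor K G G' g h else \<zero>\<^bsub>?S\<^esub>)"
      unfolding PP_def by (rule S.finsum_cong') (use z pc in auto)
    also have "\<dots> = (if m = a + b then pure_tensor K G G' g h else \<zero>\<^bsub>?S\<^esub>)"
    proof (cases "m = a + b")
      case True
      have "(\<Oplus>\<^bsub>?S\<^esub>i\<in>{..m}. if i = a \<and> m = a + b then pure_tensor K G G' g h else \<zero>\<^bsub>?S\<^esub>)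
         = (\<Oplus>\<^bsub>?S\<^esub>i\<in>{..m}. if a = i then pure_tensor K G G' g h else \<zero>\<^bsub>?S\<^esub>)"
        by (rule S.finsum_cong') (use True pc in auto)
      also have "\<dots> = pure_tensor K G G' g h" by (rule S.finsum_singleton) (use True pc in auto)
      finally show ?thesis using True by simp
    qed simp
    finally show ?thesis .
  qed
  have PPr: "PP n t = s \<and> (\<forall>m>n. PP m t = \<zero>\<^bsub>?S\<^esub>)" if "tensor_rel V G R W G' R' n t s" for n t s
    using that
  proof induction
    case tensor_rel_zero then show ?case using linear_zero[OF T S PPl] by simp
  next
    case (tensor_rel_pure a x g b y h) then show ?case using PPp[OF tensor_rel_pure(1,2)] by auto
  next
    case (tensor_rel_add s s' t t')
    then show ?case using tensor_rel_carrier[OF F(1,2)] by (simp add: linear_add[OF PPl])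
  qed
  let ?X = "{s. \<exists>n t. tensor_rel V G R W G' R' n t s}"
  have X: "?X \<subseteq> carrier ?S" using tensor_rel_carrier[OF F(1,2)] by auto
  note H = submoduleD[OF hull_submodule[OF S X] S]
  have span: "s \<in> subspace_hull K ?S ?X" if s: "s \<in> carrier ?S" for s
    using D1(2) D2(2) s
  proof (induction rule: tensor_induct)
    case (pure g h)
    have l: "linear_map K G ?S (\<lambda>g. pure_tensor K G G' g h)" if "h \<in> carrier G'" for h
      by (rule bilinear_left[OF pure_bilinear[OF D1(2) D2(2)] that])
    have r: "linear_map K G' ?S (pure_tensor K G G' g)" if "g \<in> carrier G" for g
      by (rule bilinear_right[OF pure_bilinear[OF D1(2) D2(2)] that])
    have 1: "pure_tensor K G G' g h \<in> subspace_hull K ?S ?X" if gh: "R a x g" "h \<in> carrier G'" for a x g h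
    proof -
      have gc: "g \<in> carrier G" using gh D1(4) by blast
      have "subspace_hull K G' {h. \<exists>n x. R' n x h} \<subseteq> {h \<in> carrier G'. pure_tensor K G G' g h \<in> subspace_hull K ?S ?X}"
      proof (rule hull_least[OF linear_vimage_submodule[OF D2(2) S r[OF gc] hull_submodule[OF S X]]], safe)
        fix h n y assume h: "R' n y h"
        then show "h \<in> carrier G'" using D2(4) by blast
        have "tensor_rel V G R W G' R' (a + n) (pure_tensor K V W x y) (pure_tensor K G G' g h)"
          by (rule tensor_rel.tensor_rel_pure) (rule gh(1), rule h, simp)
        then show "pure_tensor K G G' g h \<in> subspace_hull K ?S ?X"
          by (intro subsetD[OF hull_subset]) blast
      qed
      then show ?thesis using D2(7) gh(2) by blast
    qed
    have "subspace_hull K G {g. \<exists>n x. R n x g} \<subseteq> {g \<in> carrier G. pure_tensor K G G' g h \<in> subspace_hull K ?S ?X}"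
      by (rule hull_least[OF linear_vimage_submodule[OF D1(2) S l[OF pure(2)] hull_submodule[OF S X]]])
        (use 1 pure D1(4) in blast)
    then show ?case using D1(7) pure(1) by blast
  qed (use H(2,3) in auto)
  have "symbol_projections ?T ?S (tensor_rel V G R W G' R') PP"
    unfolding symbol_projections_def using PPl PPr by simp
  note PP = this
  show ?thesis
  proof (rule filtered_symbolsI[OF T S _ _ _ _ PP])
    show "carrier ?S \<subseteq> subspace_hull K ?S ?X" using span by (rule subsetI)
  qed (assumption | erule tensor_rel_carrier[OF F] | rule tensor_rel_zero | erule (1) tensor_rel_add)+
qed

text \<open>
  The target relation is fixed up to its parameters here and in the analogous instances below, since the conclusion
  of the general rule unifies with every goal.
\<close>

lemmas rel_lift_tensor [rel] = rel_lift[where RU = "tensor_rel A B S A' B' S'" for A B S A' B' S']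

text \<open>
  A space without filtration, regarded as concentrated in degree \<open>0\<close>: every element lies in all filtration terms, with
  symbol \<open>0\<close> in positive degrees. This is the filtration of the field, the target of counits and of \<open>\<omega>\<close>.
\<close>

definition triv_rel :: "('k, 'v, 'a) module_scheme \<Rightarrow> nat \<Rightarrow> 'v \<Rightarrow> 'v \<Rightarrow> bool"
  where "triv_rel V n x g \<longleftrightarrow> x \<in> carrier V \<and> g = (if n = 0 then x else \<zero>\<^bsub>V\<^esub>)"

lemma filtered_triv [rel]:
  assumes "module K V" shows "filtered_symbols V V (triv_rel V)"
proof -
  interpret V: module K V by fact
  have P: "symbol_projections V V (triv_rel V) (\<lambda>n. if n = 0 then (\<lambda>x. x) else (\<lambda>x. \<zero>\<^bsub>V\<^esub>))"
    unfolding symbol_projections_def triv_rel_def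
    using linear_id[of V] linear_const_zero[OF assms, of V] by (simp split: if_split cong: if_cong)
  have "carrier V \<subseteq> {g. \<exists>n x. triv_rel V n x g}" by (auto simp: triv_rel_def)
  then have s: "carrier V \<subseteq> subspace_hull K V {g. \<exists>n x. triv_rel V n x g}" by (rule subset_trans[OF _ hull_subset])
  show ?thesis
    by (rule filtered_symbolsI[OF assms assms _ _ _ _ P s]) (auto simp: triv_rel_def)
qed

lemmas rel_lift_triv [rel] = rel_lift[where RU = "triv_rel A" for A]

lemma triv_rel_degree_zero [rel]: "x \<in> carrier V \<Longrightarrow> n = 0 \<Longrightarrow> triv_rel V n x x"
  by (simp add: triv_rel_def)

end

section \<open>Structures over a Hopf algebra and their tensor products\<close>

locale hopf_base = vector_spaces K + H: hopf_algebra K H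
  for K :: "('k, 'm) ring_scheme" and H :: "('k, 'h, 'a) hopf_algebra_scheme"
begin

lemma ground_simps [simp]:
  "carrier (ground_module K) = carrier K" "zero (ground_module K) = \<zero>\<^bsub>K\<^esub>"
  "add (ground_module K) = add K" "smult (ground_module K) = mult K"
  by (simp_all add: ground_module_def)

lemma ground_module [lin]: "module K (ground_module K)"
proof (rule moduleI)
  show "abelian_group (ground_module K)"
  proof (rule abelian_groupI)
    show "\<exists>y\<in>carrier (ground_module K). y \<oplus>\<^bsub>ground_module K\<^esub> x = \<zero>\<^bsub>ground_module K\<^esub>"
      if "x \<in> carrier (ground_module K)" for x
      using that K.l_neg[of x] by (auto intro!: bexI[of _ "\<ominus>\<^bsub>K\<^esub> x"])
  qed (auto simp: K.a_ac)
qed (auto simp: K.l_distr K.r_distr K.m_assoc K.is_cring)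

lemma module_H [lin]: "module K H" by (rule H.C.module_axioms)

lemma comult_H_linear [lin]: "linear_map K X H e \<Longrightarrow> linear_map K X (tensor_product K H H) (\<lambda>x. comult H (e x))"
  by (rule linear_comp[OF _ H.comult_linear])

lemma comult_H_closed [lin]: "h \<in> carrier H \<Longrightarrow> comult H h \<in> carrier (tensor_product K H H)"
  by (rule linear_closed[OF H.comult_linear])

lemma counit_H_linear [lin]: "linear_map K X H e \<Longrightarrow> linear_map K X (ground_module K) (\<lambda>x. counit H (e x))"
  by (rule linear_comp[OF _ H.counit_linear])

lemma counit_H_closed [lin]: "h \<in> carrier H \<Longrightarrow> counit H h \<in> carrier (ground_module K)"
  by (rule linear_closed[OF H.counit_linear])

lemma mult_H_left [lin]: "linear_map K X H e \<Longrightarrow> h \<in> carrier H \<Longrightarrow> linear_map K X H (\<lambda>x. e x \<otimes>\<^bsub>H\<^esub> h)"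
  by (rule linear_comp[OF _ bilinear_left[OF H.mult_bilinear]])

lemma mult_H_right [lin]: "linear_map K X H e \<Longrightarrow> h \<in> carrier H \<Longrightarrow> linear_map K X H (\<lambda>x. h \<otimes>\<^bsub>H\<^esub> e x)"
  by (rule linear_comp[OF _ bilinear_right[OF H.mult_bilinear]])

lemma mult_H_closed [lin]: "g \<in> carrier H \<Longrightarrow> h \<in> carrier H \<Longrightarrow> g \<otimes>\<^bsub>H\<^esub> h \<in> carrier H"
  by simp

lemma one_H_closed [lin]: "\<one>\<^bsub>H\<^esub> \<in> carrier H" by simp

lemma mult_K_left [lin]: "linear_map K X (ground_module K) e \<Longrightarrow> a \<in> carrier (ground_module K) \<Longrightarrow>
    linear_map K X (ground_module K) (\<lambda>x. e x \<otimes>\<^bsub>K\<^esub> a)"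
  unfolding linear_map_def by (auto simp: K.l_distr K.m_assoc Pi_iff)

lemma mult_K_right [lin]: "linear_map K X (ground_module K) e \<Longrightarrow> a \<in> carrier (ground_module K) \<Longrightarrow>
    linear_map K X (ground_module K) (\<lambda>x. a \<otimes>\<^bsub>K\<^esub> e x)"
  unfolding linear_map_def by (auto simp: K.r_distr K.m_ac Pi_iff)

lemma mult_K_closed [lin]: "a \<in> carrier (ground_module K) \<Longrightarrow> b \<in> carrier (ground_module K) \<Longrightarrow>
    a \<otimes>\<^bsub>K\<^esub> b \<in> carrier (ground_module K)"
  by simp

lemma smult_left [lin]: "linear_map K X (ground_module K) e \<Longrightarrow> module K V \<Longrightarrow> v \<in> carrier V \<Longrightarrow>
    linear_map K X V (\<lambda>x. e x \<odot>\<^bsub>V\<^esub> v)"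
  unfolding linear_map_def by (auto simp: module.smult_l_distr module.smult_assoc1 module.smult_closed Pi_iff)

lemma smult_right [lin]: "linear_map K X V e \<Longrightarrow> module K V \<Longrightarrow> module K X \<Longrightarrow> a \<in> carrier (ground_module K) \<Longrightarrow>
    linear_map K X V (\<lambda>x. a \<odot>\<^bsub>V\<^esub> e x)"
  by (rule linear_scaled) auto

lemma smult_in [lin]: "a \<in> carrier (ground_module K) \<Longrightarrow> module K V \<Longrightarrow> v \<in> carrier V \<Longrightarrow> a \<odot>\<^bsub>V\<^esub> v \<in> carrier V"
  by (simp add: module.smult_closed)

text \<open>
  The structure maps of a coalgebra in the category without their axioms. Linearity suffices to form tensor products and
  to speak of symbols, and in this generality it is available for tensor products and for \<open>gr Q\<close> before any axiom
  is known.
\<close>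

definition yd_pre :: "('k, 'h, 'v, 'b) yd_coalgebra_scheme \<Rightarrow> bool"
  where "yd_pre V \<longleftrightarrow> module K V \<and> bilinear_map K H V V (act V) \<and>
    linear_map K V (tensor_product K H V) (coact V) \<and> linear_map K V (tensor_product K V V) (comult V) \<and>
    linear_map K V (ground_module K) (counit V)"

lemma yd_pre_module [lin]: "yd_pre V \<Longrightarrow> module K V" by (simp add: yd_pre_def)

lemma act_left [lin]: "linear_map K X H e \<Longrightarrow> yd_pre V \<Longrightarrow> v \<in> carrier V \<Longrightarrow> linear_map K X V (\<lambda>x. act V (e x) v)"
  unfolding yd_pre_def by (elim conjE) (rule linear_comp[OF _ bilinear_left])

lemma act_right [lin]: "linear_map K X V e \<Longrightarrow> yd_pre V \<Longrightarrow> h \<in> carrier H \<Longrightarrow> linear_map K X V (\<lambda>x. act V h (e x))"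
  unfolding yd_pre_def by (elim conjE) (rule linear_comp[OF _ bilinear_right])

lemma act_in [lin]: "yd_pre V \<Longrightarrow> h \<in> carrier H \<Longrightarrow> v \<in> carrier V \<Longrightarrow> act V h v \<in> carrier V"
  unfolding yd_pre_def by (elim conjE) (rule bilinear_closed)

lemma coact_lin [lin]: "linear_map K X V e \<Longrightarrow> yd_pre V \<Longrightarrow> linear_map K X (tensor_product K H V) (\<lambda>x. coact V (e x))"
  unfolding yd_pre_def by (elim conjE) (rule linear_comp)

lemma coact_in [lin]: "yd_pre V \<Longrightarrow> v \<in> carrier V \<Longrightarrow> coact V v \<in> carrier (tensor_product K H V)"
  unfolding yd_pre_def by (elim conjE) (rule linear_closed)

lemma comult_lin [lin]: "linear_map K X V e \<Longrightarrow> yd_pre V \<Longrightarrow> linear_map K X (tensor_product K V V) (\<lambda>x. comult V (e x))"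
  unfolding yd_pre_def by (elim conjE) (rule linear_comp)

lemma comult_in [lin]: "yd_pre V \<Longrightarrow> v \<in> carrier V \<Longrightarrow> comult V v \<in> carrier (tensor_product K V V)"
  unfolding yd_pre_def by (elim conjE) (rule linear_closed)

lemma counit_lin [lin]: "linear_map K X V e \<Longrightarrow> yd_pre V \<Longrightarrow> linear_map K X (ground_module K) (\<lambda>x. counit V (e x))"
  unfolding yd_pre_def by (elim conjE) (rule linear_comp)

lemma counit_in [lin]: "yd_pre V \<Longrightarrow> v \<in> carrier V \<Longrightarrow> counit V v \<in> carrier (ground_module K)"
  unfolding yd_pre_def by (elim conjE) (rule linear_closed)

lemma yd_tensor_module_simps [simp]:
  "carrier (yd_tensor K H C D) = carrier (tensor_product K C D)"
  "zero (yd_tensor K H C D) = zero (tensor_product K C D)"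
  "add (yd_tensor K H C D) = add (tensor_product K C D)"
  "smult (yd_tensor K H C D) = smult (tensor_product K C D)"
  by (simp_all add: yd_tensor_def Let_def)

lemma yd_tensor_product_simps [simp]:
  "tensor_product K (yd_tensor K H C D) W = tensor_product K (tensor_product K C D) W"
  "tensor_product K W (yd_tensor K H C D) = tensor_product K W (tensor_product K C D)"
  "pure_tensor K (yd_tensor K H C D) W = pure_tensor K (tensor_product K C D) W"
  "pure_tensor K W (yd_tensor K H C D) = pure_tensor K W (tensor_product K C D)"
  by (rule tensor_product_cong; simp)+

lemma yd_tensor_linear_simps [simp]:
  "linear_map K (yd_tensor K H C D) W = linear_map K (tensor_product K C D) W"
  "linear_map K W (yd_tensor K H C D) = linear_map K W (tensor_product K C D)"
  by (rule linear_map_cong_record; simp)+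

lemma yd_tensor_bilinear_simps [simp]:
  "bilinear_map K (yd_tensor K H C D) W U = bilinear_map K (tensor_product K C D) W U"
  "bilinear_map K W (yd_tensor K H C D) U = bilinear_map K W (tensor_product K C D) U"
  "bilinear_map K W U (yd_tensor K H C D) = bilinear_map K W U (tensor_product K C D)"
  unfolding bilinear_map_def[abs_def] by simp_all

lemma module_cong:
  assumes "module K V" "carrier V = carrier W" "add V = add W" "zero V = zero W" "smult V = smult W"
  shows "module K W"
proof -
  interpret V: module K V by fact
  show ?thesis
    by (rule moduleI; (rule K.is_cring abelian_groupI)?; unfold assms(2-5)[symmetric])
      (auto simp: V.a_ac V.smult_l_distr V.smult_r_distr V.smult_assoc1 intro: V.l_neg bexI[of _ "\<ominus>\<^bsub>V\<^esub> _"])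
qed

lemma yd_tensor_module: "module K C \<Longrightarrow> module K D \<Longrightarrow> module K (yd_tensor K H C D)"
  by (rule module_cong[OF tensor_module]) auto

lemma yd_tensor_maps:
  "comult (yd_tensor K H C D) = (let T2 = tensor_product K (tensor_product K C D) (tensor_product K C D) in
    tensor_lift K T2
       (\<lambda>c d. tensor_lift K T2
         (\<lambda>c1 c2. tensor_lift K T2
           (\<lambda>d1 d2. tensor_lift K T2
             (\<lambda>d1' c2'. pure_tensor K (tensor_product K C D) (tensor_product K C D) (pure_tensor K C D c1 d1') (pure_tensor K C D c2' d2))
             (tensor_lift K (tensor_product K D C)
               (\<lambda>v w. tensor_lift K (tensor_product K D C) (\<lambda>g y. pure_tensor K D C (act D g w) y) (coact C v))
               (pure_tensor K C D c2 d1)))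
           (comult D d))
         (comult C c)))"
  "counit (yd_tensor K H C D) = tensor_lift K (ground_module K) (\<lambda>c d. counit C c \<otimes>\<^bsub>K\<^esub> counit D d)"
  "act (yd_tensor K H C D) = (\<lambda>h t. tensor_lift K (tensor_product K C D)
     (\<lambda>h1 h2. tensor_lift K (tensor_product K C D) (\<lambda>c d. pure_tensor K C D (act C h1 c) (act D h2 d)) t) (comult H h))"
  "coact (yd_tensor K H C D) = (let T = tensor_product K C D in tensor_lift K (tensor_product K H T)
       (\<lambda>c d. tensor_lift K (tensor_product K H T)
         (\<lambda>g c0. tensor_lift K (tensor_product K H T)
           (\<lambda>h d0. pure_tensor K H T (g \<otimes>\<^bsub>H\<^esub> h) (pure_tensor K C D c0 d0))
           (coact D d))
         (coact C c)))"
  by (simp_all add: yd_tensor_def yd_braiding_def tensor_map_def Let_def)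

lemma yd_pre_tensor [lin]:
  assumes C: "yd_pre C" and D: "yd_pre D"
  shows "yd_pre (yd_tensor K H C D)"
proof -
  note [lin] = C D
  show ?thesis unfolding yd_pre_def yd_tensor_linear_simps yd_tensor_bilinear_simps yd_tensor_product_simps
  proof (intro conjI)
    show "module K (yd_tensor K H C D)" by (rule yd_tensor_module) (rule lin)+
    show "bilinear_map K H (tensor_product K C D) (tensor_product K C D) (act (yd_tensor K H C D))"
      unfolding yd_tensor_maps Let_def by (rule lin | assumption)+
    show "linear_map K (tensor_product K C D) (ground_module K) (counit (yd_tensor K H C D))"
      unfolding yd_tensor_maps Let_def by (rule tensor_lift_linear) (rule lin | assumption)+
    show "linear_map K (tensor_product K C D) (tensor_product K H (tensor_product K C D)) (coact (yd_tensor K H C D))"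
      unfolding yd_tensor_maps Let_def by (rule tensor_lift_linear) (rule lin | assumption)+
    show "linear_map K (tensor_product K C D) (tensor_product K (tensor_product K C D) (tensor_product K C D))
        (comult (yd_tensor K H C D))"
      unfolding yd_tensor_maps Let_def by (rule tensor_lift_linear) (rule lin | assumption)+
  qed
qed

text \<open>
  In Sweedler notation, \<open>\<Delta>(c \<otimes> d) = c\<^sub>1 \<otimes> (c\<^sub>2)\<^sub>-\<^sub>1 d\<^sub>1 \<otimes> (c\<^sub>2)\<^sub>0 \<otimes> d\<^sub>2\<close>: the braiding moves \<open>c\<^sub>2\<close> past \<open>d\<^sub>1\<close>.
\<close>

lemma comult_tensor_pure:
  assumes C: "yd_pre C" and D: "yd_pre D" and c: "c \<in> carrier C" and d: "d \<in> carrier D"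
  defines "T \<equiv> tensor_product K C D"
  shows "comult (yd_tensor K H C D) (pure_tensor K C D c d) =
    tensor_lift K (tensor_product K T T) (\<lambda>c1 c2. tensor_lift K (tensor_product K T T)
      (\<lambda>d1 d2. tensor_lift K (tensor_product K T T)
        (\<lambda>g y. pure_tensor K T T (pure_tensor K C D c1 (act D g d1)) (pure_tensor K C D y d2))
        (coact C c2)) (comult D d)) (comult C c)"
proof -
  note [lin] = assms(1-4)
  have inner: "tensor_lift K (tensor_product K T T) (\<lambda>d1' c2'. pure_tensor K T T (pure_tensor K C D c1 d1') (pure_tensor K C D c2' d2))
      (tensor_lift K (tensor_product K D C) (\<lambda>v w. tensor_lift K (tensor_product K D C) (\<lambda>g y. pure_tensor K D C (act D g w) y) (coact C v))
        (pure_tensor K C D c2 d1))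
     = tensor_lift K (tensor_product K T T)
        (\<lambda>g y. pure_tensor K T T (pure_tensor K C D c1 (act D g d1)) (pure_tensor K C D y d2)) (coact C c2)"
    if [lin]: "c1 \<in> carrier C" "c2 \<in> carrier C" "d1 \<in> carrier D" "d2 \<in> carrier D" for c1 c2 d1 d2
    unfolding T_def
    apply (subst tensor_lift_pure, (rule lin | assumption)+)
    apply (subst linear_lift_commute[OF _ _ _ _ _ tensor_lift_linear], (rule lin | assumption)+)
    apply (rule tensor_lift_cong, (rule lin | assumption)+)
    apply (subst tensor_lift_pure, (rule lin | assumption)+)
    apply (rule refl)
    done
  show ?thesis
    unfolding yd_tensor_maps Let_def
    apply (rule trans, rule tensor_lift_pure, (rule lin | assumption)+)
    apply (unfold T_def)
    apply (rule tensor_lift_cong, (rule lin | assumption)+)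
    apply (rule tensor_lift_cong, (rule lin | assumption)+)
    apply (rule inner[unfolded T_def], assumption+)
    done
qed

lemma counit_tensor_pure:
  assumes [lin]: "yd_pre C" "yd_pre D" "c \<in> carrier C" "d \<in> carrier D"
  shows "counit (yd_tensor K H C D) (pure_tensor K C D c d) = counit C c \<otimes>\<^bsub>K\<^esub> counit D d"
  unfolding yd_tensor_maps by (rule trans, rule tensor_lift_pure, (rule lin | assumption)+, rule refl)

lemma act_tensor_pure:
  assumes [lin]: "yd_pre C" "yd_pre D" "c \<in> carrier C" "d \<in> carrier D" "h \<in> carrier H"
  shows "act (yd_tensor K H C D) h (pure_tensor K C D c d) =
    tensor_lift K (tensor_product K C D) (\<lambda>h1 h2. pure_tensor K C D (act C h1 c) (act D h2 d)) (comult H h)"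
  unfolding yd_tensor_maps
  apply (rule tensor_lift_cong, (rule lin | assumption)+)
  apply (subst tensor_lift_pure, (rule lin | assumption)+)
  apply (rule refl)
  done

lemma coact_tensor_pure:
  assumes [lin]: "yd_pre C" "yd_pre D" "c \<in> carrier C" "d \<in> carrier D"
  defines "T \<equiv> tensor_product K C D"
  shows "coact (yd_tensor K H C D) (pure_tensor K C D c d) =
    tensor_lift K (tensor_product K H T) (\<lambda>g c0. tensor_lift K (tensor_product K H T)
      (\<lambda>h d0. pure_tensor K H T (g \<otimes>\<^bsub>H\<^esub> h) (pure_tensor K C D c0 d0)) (coact D d)) (coact C c)"
  unfolding yd_tensor_maps Let_def T_def by (rule trans, rule tensor_lift_pure, (rule lin | assumption)+, rule refl)

subsection \<open>Symbols of structure maps\<close>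

text \<open>
  In contrast to \<open>triv_rel\<close>, a nonzero element is related in degree \<open>0\<close> only. This is the reading needed for the factor \<open>H\<close>
  in \<open>H \<otimes> V\<close>, where the degree of \<open>h \<otimes> x\<close> has to be that of \<open>x\<close>.
\<close>

definition deg0_rel :: "('k, 'v, 'c) module_scheme \<Rightarrow> nat \<Rightarrow> 'v \<Rightarrow> 'v \<Rightarrow> bool"
  where "deg0_rel V n x g \<longleftrightarrow> x \<in> carrier V \<and> g = x \<and> (n = 0 \<or> x = \<zero>\<^bsub>V\<^esub>)"

lemma filtered_deg0 [rel]:
  assumes "module K V" shows "filtered_symbols V V (deg0_rel V)"
proof -
  interpret V: module K V by fact
  have P: "symbol_projections V V (deg0_rel V) (\<lambda>n. if n = 0 then (\<lambda>x. x) else (\<lambda>x. \<zero>\<^bsub>V\<^esub>))"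
    unfolding symbol_projections_def deg0_rel_def
    using linear_id[of V] linear_const_zero[OF assms, of V] by auto
  have "carrier V \<subseteq> {g. \<exists>n x. deg0_rel V n x g}" by (auto simp: deg0_rel_def)
  then have s: "carrier V \<subseteq> subspace_hull K V {g. \<exists>n x. deg0_rel V n x g}" by (rule subset_trans[OF _ hull_subset])
  show ?thesis
    by (rule filtered_symbolsI[OF assms assms _ _ _ _ P s]) (auto simp: deg0_rel_def)
qed

abbreviation rel_H where "rel_H \<equiv> deg0_rel H"
abbreviation rel_HH where "rel_HH \<equiv> tensor_rel H H rel_H H H rel_H"
abbreviation rel_K where "rel_K \<equiv> triv_rel (ground_module K)"

lemma rel_H_zero [rel]: "h \<in> carrier H \<Longrightarrow> n = 0 \<Longrightarrow> rel_H n h h"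
  by (simp add: deg0_rel_def)

lemma rel_HH_zero:
  assumes "t \<in> carrier (tensor_product K H H)" shows "rel_HH 0 t t"
  using module_H module_H assms
proof (induction rule: tensor_induct)
  case zero then show ?case by (rule tensor_rel_zero)
next
  case (pure g h) then show ?case by (intro tensor_rel_pure[where R = rel_H and R' = rel_H and a = 0 and b = 0] rel_H_zero) auto
next
  case (add s t) show ?case by (rule tensor_rel_add[OF add(3,4)])
qed

lemma rel_comult_H [rel]: "rel_H n h h' \<Longrightarrow> rel_HH n (comult H h) (comult H h')"
proof -
  assume a: "rel_H n h h'"
  then have h: "h' = h" "h \<in> carrier H" "n = 0 \<or> h = \<zero>\<^bsub>H\<^esub>" by (auto simp: deg0_rel_def)
  show ?thesis
  proof (cases "n = 0")
    case True then show ?thesis using rel_HH_zero[OF comult_H_closed[OF h(2)]] h(1) by simp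
  next
    case False
    then have "comult H h = \<zero>\<^bsub>tensor_product K H H\<^esub>"
      using linear_zero[OF module_H tensor_module[OF module_H module_H] H.comult_linear] h(3) by simp
    then show ?thesis using h(1) tensor_rel_zero by simp
  qed
qed

lemma rel_mult_H [rel]: "rel_H a g g' \<Longrightarrow> rel_H b h h' \<Longrightarrow> n = a + b \<Longrightarrow> rel_H n (g \<otimes>\<^bsub>H\<^esub> h) (g' \<otimes>\<^bsub>H\<^esub> h')"
  by (auto simp: deg0_rel_def)

lemma rel_mult_K [rel]: "rel_K a x x' \<Longrightarrow> rel_K b y y' \<Longrightarrow> n = a + b \<Longrightarrow> rel_K n (x \<otimes>\<^bsub>K\<^esub> y) (x' \<otimes>\<^bsub>K\<^esub> y')"
  by (auto simp: triv_rel_def)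

lemma rel_counit_H [rel]: "rel_H a h h' \<Longrightarrow> rel_K a (counit H h) (counit H h')"
  using counit_H_closed linear_zero[OF module_H ground_module H.counit_linear] by (auto simp: deg0_rel_def triv_rel_def)

text \<open>
  The structure maps of \<open>G\<close> are induced by those of \<open>C\<close> on symbols.
\<close>

definition yd_rel :: "('k, 'h, 'v, 'b) yd_coalgebra_scheme \<Rightarrow> ('k, 'h, 'g, 'c) yd_coalgebra_scheme \<Rightarrow> (nat \<Rightarrow> 'v \<Rightarrow> 'g \<Rightarrow> bool) \<Rightarrow> bool"
  where "yd_rel C G R \<longleftrightarrow> filtered_symbols C G R \<and> yd_pre C \<and> yd_pre G \<and>
    (\<forall>a h h' b x g n. rel_H a h h' \<longrightarrow> R b x g \<longrightarrow> n = a + b \<longrightarrow> R n (act C h x) (act G h' g)) \<and>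
    (\<forall>n x g. R n x g \<longrightarrow> tensor_rel H H rel_H C G R n (coact C x) (coact G g)) \<and>
    (\<forall>n x g. R n x g \<longrightarrow> tensor_rel C G R C G R n (comult C x) (comult G g)) \<and>
    (\<forall>n x g. R n x g \<longrightarrow> rel_K n (counit C x) (counit G g))"

lemma yd_relD:
  assumes "yd_rel C G R"
  shows "filtered_symbols C G R" "yd_pre C" "yd_pre G"
    "\<And>a h h' b x g n. rel_H a h h' \<Longrightarrow> R b x g \<Longrightarrow> n = a + b \<Longrightarrow> R n (act C h x) (act G h' g)"
    "\<And>n x g. R n x g \<Longrightarrow> tensor_rel H H rel_H C G R n (coact C x) (coact G g)"
    "\<And>n x g. R n x g \<Longrightarrow> tensor_rel C G R C G R n (comult C x) (comult G g)"
    "\<And>n x g. R n x g \<Longrightarrow> rel_K n (counit C x) (counit G g)"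
  using assms unfolding yd_rel_def by simp_all

text \<open>
  The relation sees nothing of its modules but the tensor products and the pure tensors formed from them.
\<close>

lemma tensor_rel_cong:
  assumes "tensor_product K V W = tensor_product K V' W'" "pure_tensor K V W = pure_tensor K V' W'"
    "tensor_product K G F = tensor_product K G' F'" "pure_tensor K G F = pure_tensor K G' F'"
  shows "tensor_rel V G R W F S = tensor_rel V' G' R W' F' S"
proof (intro ext iffI)
  fix n t s
  show "tensor_rel V' G' R W' F' S n t s" if "tensor_rel V G R W F S n t s"
    using that
  proof induction
    case tensor_rel_zero show ?case unfolding assms by (rule tensor_rel.tensor_rel_zero)
  next
    case (tensor_rel_pure a x g b y h) then show ?case
      unfolding assms by (intro tensor_rel.tensor_rel_pure[where R = R and R' = S])
  next
    case (tensor_rel_add s s' t t') then show ?case unfolding assms by (intro tensor_rel.tensor_rel_add)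
  qed
  show "tensor_rel V G R W F S n t s" if "tensor_rel V' G' R W' F' S n t s"
    using that
  proof induction
    case tensor_rel_zero show ?case unfolding assms[symmetric] by (rule tensor_rel.tensor_rel_zero)
  next
    case (tensor_rel_pure a x g b y h) then show ?case
      unfolding assms[symmetric] by (intro tensor_rel.tensor_rel_pure[where R = R and R' = S])
  next
    case (tensor_rel_add s s' t t') then show ?case unfolding assms[symmetric] by (intro tensor_rel.tensor_rel_add)
  qed
qed

lemma tensor_rel_yd_tensor [simp]:
  "tensor_rel (yd_tensor K H C D) (yd_tensor K H C' D') R W W' S =
    tensor_rel (tensor_product K C D) (tensor_product K C' D') R W W' S"
  "tensor_rel W W' S (yd_tensor K H C D) (yd_tensor K H C' D') R =
    tensor_rel W W' S (tensor_product K C D) (tensor_product K C' D') R"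
  by (rule tensor_rel_cong; simp)+

lemma submodule_record_cong:
  assumes "module K V" "module K V'" "carrier V = carrier V'" "add V = add V'" "zero V = zero V'" "smult V = smult V'"
  shows "submodule N K V \<longleftrightarrow> submodule N K V'"
proof
  assume "submodule N K V"
  note N = submoduleD(1-4)[OF this assms(1), unfolded assms(3-6)]
  show "submodule N K V'" by (rule submodule_criterion[OF assms(2) N])
next
  assume "submodule N K V'"
  note N = submoduleD(1-4)[OF this assms(2), folded assms(3-6)]
  show "submodule N K V" by (rule submodule_criterion[OF assms(1) N])
qed

lemma filtered_symbols_yd_tensor:
  assumes "module K C" "module K D" "module K C'" "module K D'"
    and F: "filtered_symbols (tensor_product K C D) (tensor_product K C' D') R"
  shows "filtered_symbols (yd_tensor K H C D) (yd_tensor K H C' D') R"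
proof -
  note D = filtered_symbolsD[OF F]
  obtain P where "symbol_projections (tensor_product K C D) (tensor_product K C' D') R P"
    using filtered_symbols_projections[OF F] ..
  then have P: "symbol_projections (yd_tensor K H C D) (yd_tensor K H C' D') R P"
    by (simp add: symbol_projections_def)
  have "subspace_hull K (yd_tensor K H C' D') S = subspace_hull K (tensor_product K C' D') S" for S
    unfolding subspace_hull_def
    by (subst submodule_record_cong[OF yd_tensor_module tensor_module]) (use assms in auto)
  then show ?thesis
    by (intro filtered_symbolsI[OF yd_tensor_module yd_tensor_module _ _ _ _ P] assms)
      (use D in \<open>auto\<close>)
qed

text \<open>
  As the structure maps of a tensor product are Sweedler expressions in those of the factors, it suffices to
  have the relations for \<open>Q\<close>; those for \<open>Q \<otimes> Q\<close> and \<open>Q \<otimes> Q \<otimes> Q\<close> follow.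
\<close>

lemma yd_rel_tensor:
  assumes C: "yd_rel C G R" and D: "yd_rel D G' R'"
  shows "yd_rel (yd_tensor K H C D) (yd_tensor K H G G') (tensor_rel C G R D G' R')"
proof -
  note [lin] = yd_relD(2,3)[OF C] yd_relD(2,3)[OF D]
  note [rel] = yd_relD(1,4-7)[OF C] yd_relD(1,4-7)[OF D]
  have F: "filtered_symbols (tensor_product K C D) (tensor_product K G G') (tensor_rel C G R D G' R')"
    by (rule rel)+
  then have F': "filtered_symbols (yd_tensor K H C D) (yd_tensor K H G G') (tensor_rel C G R D G' R')"
    by (intro filtered_symbols_yd_tensor) (rule lin | assumption)+
  show ?thesis unfolding yd_rel_def tensor_rel_yd_tensor
  proof (intro conjI allI impI F')
    fix a h h' b x g n assume *: "rel_H a h h'" "tensor_rel C G R D G' R' b x g" "n = a + b"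
    have [lin]: "h \<in> carrier H" "h' \<in> carrier H" "x \<in> carrier (tensor_product K C D)" "g \<in> carrier (tensor_product K G G')"
      using *(1) tensor_rel_carrier[OF yd_relD(1)[OF C] yd_relD(1)[OF D] *(2)] by (auto simp: deg0_rel_def)
    show "tensor_rel C G R D G' R' n (act (yd_tensor K H C D) h x) (act (yd_tensor K H G G') h' g)"
      unfolding yd_tensor_maps using *
      by - (rule refl | assumption | rule rel lin | arith)+
  next
    fix n x g assume *: "tensor_rel C G R D G' R' n x g"
    show "tensor_rel H H rel_H (tensor_product K C D) (tensor_product K G G') (tensor_rel C G R D G' R') n
        (coact (yd_tensor K H C D) x) (coact (yd_tensor K H G G') g)"
      unfolding yd_tensor_maps Let_def using *
      by - (rule refl | assumption | rule rel lin | arith)+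
    have l: "linear_map K (tensor_product K C D) (tensor_product K (tensor_product K C D) (tensor_product K C D))
        (comult (yd_tensor K H C D))"
      "linear_map K (tensor_product K G G') (tensor_product K (tensor_product K G G') (tensor_product K G G'))
        (comult (yd_tensor K H G G'))"
      using yd_pre_tensor yd_relD(2,3)[OF C] yd_relD(2,3)[OF D] by (auto simp: yd_pre_def)
    show "tensor_rel (tensor_product K C D) (tensor_product K G G') (tensor_rel C G R D G' R')
        (tensor_product K C D) (tensor_product K G G') (tensor_rel C G R D G' R') n
        (comult (yd_tensor K H C D) x) (comult (yd_tensor K H G G') g)"
    proof (rule rel_linear[OF *, where n = n and
        RU = "tensor_rel (tensor_product K C D) (tensor_product K G G') (tensor_rel C G R D G' R')
        (tensor_product K C D) (tensor_product K G G') (tensor_rel C G R D G' R')"])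
      fix a b x g y h
      assume *: "R a x g" "R' b y h" "a + b = n" and [lin]: "x \<in> carrier C" "g \<in> carrier G" "y \<in> carrier D" "h \<in> carrier G'"
      show "tensor_rel (tensor_product K C D) (tensor_product K G G') (tensor_rel C G R D G' R')
        (tensor_product K C D) (tensor_product K G G') (tensor_rel C G R D G' R') n
        (comult (yd_tensor K H C D) (pure_tensor K C D x y)) (comult (yd_tensor K H G G') (pure_tensor K G G' g h))"
        apply (subst comult_tensor_pure, (rule lin | assumption)+)
        apply (subst comult_tensor_pure, (rule lin | assumption)+)
        using *
        by - (rule refl | assumption | rule rel lin | arith)+
    qed (rule l rel)+
    show "rel_K n (counit (yd_tensor K H C D) x) (counit (yd_tensor K H G G') g)"
      unfolding yd_tensor_maps Let_def using *
      by - (rule refl | assumption | rule rel lin | arith)+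
  qed (rule lin)+
qed

end

section \<open>Filtered tensor products\<close>

context vector_spaces
begin

definition fil_tensor ::
  "('k, 'v, 'a) module_scheme \<Rightarrow> ('k, 'w, 'b) module_scheme \<Rightarrow> (nat \<Rightarrow> 'v set) \<Rightarrow> (nat \<Rightarrow> 'w set) \<Rightarrow> nat \<Rightarrow>
    ('k, 'v, 'w) tensor set"
  where "fil_tensor V W A B n = subspace_hull K (tensor_product K V W)
    {pure_tensor K V W x y | x y i j. x \<in> A i \<and> y \<in> B j \<and> i + j = n}"

lemma linear_fil_tensor:
  assumes "module K V" "module K W" "module K U" "linear_map K (tensor_product K V W) U f" "submodule N K U"
    "\<And>n. A n \<subseteq> carrier V" "\<And>n. B n \<subseteq> carrier W"
    "\<And>i j x y. x \<in> A i \<Longrightarrow> y \<in> B j \<Longrightarrow> i + j = n \<Longrightarrow> f (pure_tensor K V W x y) \<in> N"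
    "t \<in> fil_tensor V W A B n"
  shows "f t \<in> N"
proof -
  have "fil_tensor V W A B n \<subseteq> {t \<in> carrier (tensor_product K V W). f t \<in> N}"
    unfolding fil_tensor_def
  proof (rule hull_least[OF linear_vimage_submodule[OF tensor_module[OF assms(1,2)] assms(3-5)]], safe)
    fix x y i j assume "x \<in> A i" "y \<in> B j" "n = i + j"
    then show "pure_tensor K V W x y \<in> carrier (tensor_product K V W)" "f (pure_tensor K V W x y) \<in> N"
      using pure_closed[OF assms(1,2) subsetD[OF assms(6)] subsetD[OF assms(7)]] assms(8) by auto
  qed
  then show ?thesis using assms(9) by auto
qed

lemma linear_in_submodule:
  assumes "module K V" "module K W" "module K U" "linear_map K (tensor_product K V W) U f" "submodule N K U"
    "\<And>x y. x \<in> carrier V \<Longrightarrow> y \<in> carrier W \<Longrightarrow> f (pure_tensor K V W x y) \<in> N" "t \<in> carrier (tensor_product K V W)"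
  shows "f t \<in> N"
  using assms(1,2,7)
proof (induction rule: tensor_induct)
  case zero then show ?case
    using linear_zero[OF tensor_module[OF assms(1,2)] assms(3,4)] submoduleD(2)[OF assms(5,3)] by simp
next
  case (add s t) then show ?case using linear_add[OF assms(4)] submoduleD(3)[OF assms(5,3)] by simp
qed (rule assms(6))

lemma linear_set_add:
  assumes "module K V" "module K U" "linear_map K V U f" "submodule N K U" "A \<subseteq> carrier V" "B \<subseteq> carrier V"
    "\<And>x. x \<in> A \<Longrightarrow> f x \<in> N" "\<And>x. x \<in> B \<Longrightarrow> f x \<in> N" "x \<in> A <+>\<^bsub>V\<^esub> B"
  shows "f x \<in> N"
proof -
  obtain a b where ab: "a \<in> A" "b \<in> B" "x = a \<oplus>\<^bsub>V\<^esub> b" using assms(9) by (rule set_addE)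
  then have "f x = f a \<oplus>\<^bsub>U\<^esub> f b" using assms(5,6) linear_add[OF assms(3)] by auto
  then show ?thesis using submoduleD(3)[OF assms(4,2)] assms(7,8) ab by simp
qed

text \<open>
  The maps \<open>e i \<otimes> e' j\<close> with \<open>i + j = n - 1\<close>, where \<open>e (-1)\<close> and \<open>e' (-1)\<close> are to be read as the identity, cut out
  the \<open>n\<close>-th term of the tensor product filtration. One peels off the parts in \<open>A\<^sub>0 \<otimes> B\<^sub>n\<close>, \<open>A\<^sub>1 \<otimes> B\<^sub>n\<^sub>-\<^sub>1\<close>, \<open>\<dots>\<close> one after
  the other: modulo \<open>A\<^sub>k \<otimes> B\<^sub>n\<^sub>-\<^sub>k\<close>, the identity on \<open>V \<otimes> B\<^sub>n\<^sub>-\<^sub>k\<close> is \<open>e k \<otimes> W\<close>, and the result lies in \<open>V \<otimes> B\<^sub>n\<^sub>-\<^sub>k\<^sub>-\<^sub>1\<close> because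
  \<open>e k \<otimes> e' (n - k - 1)\<close> kills it.
\<close>

lemma kernels_fil_tensor:
  assumes m: "module K V" "module K W"
    and A: "\<And>n. submodule (A n) K V" "\<And>n. A n \<subseteq> A (Suc n)" and B: "\<And>n. submodule (B n) K W"
    and e: "\<And>n. linear_map K V V (e n)" "\<And>n x. x \<in> carrier V \<Longrightarrow> e n x = \<zero>\<^bsub>V\<^esub> \<longleftrightarrow> x \<in> A n"
      "\<And>n x. x \<in> carrier V \<Longrightarrow> x \<ominus>\<^bsub>V\<^esub> e n x \<in> A n"
    and e': "\<And>n. linear_map K W W (e' n)" "\<And>n x. x \<in> carrier W \<Longrightarrow> e' n x = \<zero>\<^bsub>W\<^esub> \<longleftrightarrow> x \<in> B n"
      "\<And>n x. x \<in> carrier W \<Longrightarrow> x \<ominus>\<^bsub>W\<^esub> e' n x \<in> B n"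
    and t: "t \<in> carrier (tensor_product K V W)"
    and R: "tensor_map K V W (\<lambda>x. x) (e' n) t = \<zero>\<^bsub>tensor_product K V W\<^esub>"
    and L: "tensor_map K V W (e n) (\<lambda>x. x) t = \<zero>\<^bsub>tensor_product K V W\<^esub>"
    and M: "\<And>i j. Suc (i + j) = n \<Longrightarrow> tensor_map K V W (e i) (e' j) t = \<zero>\<^bsub>tensor_product K V W\<^esub>"
  shows "t \<in> fil_tensor V W A B n"
proof -
  let ?T = "tensor_product K V W"
  have T: "module K ?T" by (rule tensor_module[OF m])
  interpret T: module K ?T by fact
  note AD = submoduleD[OF A(1) m(1)] and BD = submoduleD[OF B m(2)]
  have mono: "A i \<subseteq> A j" if "i \<le> j" for i j using lift_Suc_mono_le[of A, OF A(2) that] .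
  \<comment> \<open>the parts peeled off before step \<open>k\<close>\<close>
  let ?X = "\<lambda>k. subspace_hull K ?T {pure_tensor K V W x y | x y i j. x \<in> A i \<and> y \<in> B j \<and> i + j = n \<and> i < k}"
  have Xc: "{pure_tensor K V W x y | x y i j. x \<in> A i \<and> y \<in> B j \<and> i + j = n \<and> i < k} \<subseteq> carrier ?T" for k
    using pure_closed[OF m subsetD[OF AD(1)] subsetD[OF BD(1)]] by blast
  have X: "submodule (?X k) K ?T" for k by (rule hull_submodule[OF T Xc])
  note XD = submoduleD[OF X T]
  have Xmono: "?X k \<subseteq> ?X (Suc k)" for k by (rule hull_mono) (use less_SucI in blast)
  have Xn: "?X (Suc n) \<subseteq> fil_tensor V W A B n" unfolding fil_tensor_def by (rule hull_mono) blast
  have tml: "linear_map K ?T ?T (tensor_map K V W f g)" if "linear_map K V V f" "linear_map K W W g" for f g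
    by (rule tensor_map_linear[OF linear_id that m m])
  have Xkill: "tensor_map K V W (e k) g x = \<zero>\<^bsub>?T\<^esub>" if g: "linear_map K W W g" and x: "x \<in> ?X k" for k g x
  proof -
    have "?X k \<subseteq> {x \<in> carrier ?T. tensor_map K V W (e k) g x \<in> {\<zero>\<^bsub>?T\<^esub>}}"
    proof (rule hull_least[OF linear_vimage_submodule[OF T T tml[OF e(1) g] zero_submodule[OF T]]], rule subsetI)
      fix z assume "z \<in> {pure_tensor K V W x y | x y i j. x \<in> A i \<and> y \<in> B j \<and> i + j = n \<and> i < k}"
      then obtain x y i j where *: "x \<in> A i" "y \<in> B j" "i < k" and z: "z = pure_tensor K V W x y" by blast
      then have c: "x \<in> carrier V" "y \<in> carrier W" using AD(1) BD(1) by auto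
      then have "pure_tensor K V W x y \<in> carrier ?T" by (rule pure_closed[OF m])
      moreover have "e k x = \<zero>\<^bsub>V\<^esub>" using mono[of i k] * e(2)[OF c(1)] by auto
      then have "tensor_map K V W (e k) g (pure_tensor K V W x y) = \<zero>\<^bsub>?T\<^esub>"
        using c linear_closed[OF g c(2)] by (simp add: tensor_map_pure[OF e(1) g m m] pure_zero[OF m])
      ultimately show "z \<in> {x \<in> carrier ?T. tensor_map K V W (e k) g x \<in> {\<zero>\<^bsub>?T\<^esub>}}" by (simp add: z)
    qed
    then show ?thesis using x by auto
  qed
  have split: "\<exists>y\<in>?X (Suc k). s = y \<oplus>\<^bsub>?T\<^esub> tensor_map K V W (e k) (\<lambda>x. x) s"
    if s: "s \<in> sub_tensor K V W (carrier V) (B (n - k))" and k: "k \<le> n" for s k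
  proof -
    have st: "submodule (sub_tensor K V W (carrier V) (B (n - k))) K ?T"
      by (rule sub_tensor_submodule[OF m _ BD(1)]) auto
    have sT: "s \<in> carrier ?T" using s submoduleD(1)[OF st T] by auto
    have l: "linear_map K ?T ?T (\<lambda>s. s \<ominus>\<^bsub>?T\<^esub> tensor_map K V W (e k) (\<lambda>x. x) s)"
      by (intro linear_diff T linear_id tml e(1))
    have "s \<ominus>\<^bsub>?T\<^esub> tensor_map K V W (e k) (\<lambda>x. x) s \<in> ?X (Suc k)"
    proof (rule linear_sub_tensor[OF m T l X _ BD(1) _ s])
      fix a b assume ab: "a \<in> carrier V" "b \<in> B (n - k)"
      then have b: "b \<in> carrier W" using BD(1) by auto
      have "pure_tensor K V W a b \<ominus>\<^bsub>?T\<^esub> pure_tensor K V W (e k a) b = pure_tensor K V W (a \<ominus>\<^bsub>V\<^esub> e k a) b"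
        using linear_minus[OF m(1) T bilinear_left[OF pure_bilinear[OF m] b] ab(1) linear_closed[OF e(1) ab(1)]] by simp
      moreover have "\<dots> \<in> ?X (Suc k)"
        using e(3)[OF ab(1), of k] ab(2) k by (intro subsetD[OF hull_subset]) force
      ultimately show "pure_tensor K V W a b \<ominus>\<^bsub>?T\<^esub> tensor_map K V W (e k) (\<lambda>x. x) (pure_tensor K V W a b) \<in> ?X (Suc k)"
        using ab(1) b by (simp add: tensor_map_pure[OF e(1) linear_id m m])
    qed simp
    moreover have "s = (s \<ominus>\<^bsub>?T\<^esub> tensor_map K V W (e k) (\<lambda>x. x) s) \<oplus>\<^bsub>?T\<^esub> tensor_map K V W (e k) (\<lambda>x. x) s"
      using diff_add_cancel(1)[OF T sT linear_closed[OF tml[OF e(1) linear_id] sT]] by simp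
    ultimately show ?thesis by (rule bexI[rotated])
  qed
  have "k \<le> n \<Longrightarrow> \<exists>x s. x \<in> ?X k \<and> s \<in> sub_tensor K V W (carrier V) (B (n - k)) \<and> t = x \<oplus>\<^bsub>?T\<^esub> s" for k
  proof (induction k)
    case 0
    have "t \<in> sub_tensor K V W (carrier V) (B n)" using tensor_kernel_right[OF m B e' t] R by auto
    then show ?case using XD(2)[of 0] t by (intro exI[of _ "\<zero>\<^bsub>?T\<^esub>"] exI[of _ t]) auto
  next
    case (Suc k)
    then obtain x s where xs: "x \<in> ?X k" "s \<in> sub_tensor K V W (carrier V) (B (n - k))" "t = x \<oplus>\<^bsub>?T\<^esub> s" by auto
    have sT: "s \<in> carrier ?T" using xs(2) submoduleD(1)[OF sub_tensor_submodule[OF m _ BD(1)] T] by auto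
    have xT: "x \<in> carrier ?T" using xs(1) XD(1) by auto
    let ?s = "tensor_map K V W (e k) (\<lambda>x. x) s"
    have s'T: "?s \<in> carrier ?T" by (rule linear_closed[OF tml[OF e(1) linear_id] sT])
    obtain y where y: "y \<in> ?X (Suc k)" "s = y \<oplus>\<^bsub>?T\<^esub> ?s" using split[OF xs(2)] Suc(2) by auto
    have "tensor_map K V W (\<lambda>x. x) (e' (n - Suc k)) ?s = tensor_map K V W (e k) (e' (n - Suc k)) s"
      by (rule tensor_map_comp[OF e(1) linear_id linear_id e'(1) m m m sT])
    also have "\<dots> = \<zero>\<^bsub>?T\<^esub>"
    proof -
      have "\<zero>\<^bsub>?T\<^esub> = tensor_map K V W (e k) (e' (n - Suc k)) t" by (rule M[symmetric]) (use Suc(2) in auto)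
      also have "\<dots> = tensor_map K V W (e k) (e' (n - Suc k)) x \<oplus>\<^bsub>?T\<^esub> tensor_map K V W (e k) (e' (n - Suc k)) s"
        unfolding xs(3) by (rule linear_add[OF tml[OF e(1) e'(1)] xT sT])
      finally show ?thesis using Xkill[OF e'(1) xs(1)] linear_closed[OF tml[OF e(1) e'(1)] sT] by simp
    qed
    finally have "?s \<in> sub_tensor K V W (carrier V) (B (n - Suc k))"
      using tensor_kernel_right[OF m B e' s'T] by auto
    moreover have "x \<oplus>\<^bsub>?T\<^esub> y \<in> ?X (Suc k)" using XD(3)[OF _ y(1)] Xmono[of k] xs(1) by blast
    moreover have "t = (x \<oplus>\<^bsub>?T\<^esub> y) \<oplus>\<^bsub>?T\<^esub> ?s"
      using xs(3) y(2) xT s'T XD(1)[of "Suc k"] y(1) T.a_assoc[of x y ?s] by auto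
    ultimately show ?case by blast
  qed
  from this[of n] obtain x s where xs: "x \<in> ?X n" "s \<in> sub_tensor K V W (carrier V) (B (n - n))" "t = x \<oplus>\<^bsub>?T\<^esub> s" by auto
  have sT: "s \<in> carrier ?T" using xs(2) submoduleD(1)[OF sub_tensor_submodule[OF m _ BD(1)] T] by auto
  have xT: "x \<in> carrier ?T" using xs(1) XD(1) by auto
  have "tensor_map K V W (e n) (\<lambda>x. x) s = \<zero>\<^bsub>?T\<^esub>"
    using L Xkill[OF linear_id xs(1)] linear_closed[OF tml[OF e(1) linear_id] sT]
    unfolding xs(3) linear_add[OF tml[OF e(1) linear_id] xT sT] by simp
  then obtain y where y: "y \<in> ?X (Suc n)" "s = y \<oplus>\<^bsub>?T\<^esub> \<zero>\<^bsub>?T\<^esub>" using split[OF xs(2)] by auto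
  then have "s \<in> ?X (Suc n)" using XD(1)[of "Suc n"] by auto
  then have "t \<in> ?X (Suc n)" unfolding xs(3) using XD(3)[of _ "Suc n"] Xmono[of n] xs(1) by blast
  then show ?thesis using Xn by auto
qed

end

section \<open>The coradical filtration of a connected coquasi-bialgebra\<close>

context hopf_base
begin

lemma yd_coalgebra_pre:
  assumes "yd_coalgebra K H C" shows "yd_pre C"
proof -
  interpret C: yd_coalgebra K H C by fact
  show ?thesis unfolding yd_pre_def
    using C.V.module_axioms C.act_bilinear C.coact_linear C.C.comult_linear C.C.counit_linear by simp
qed

lemma yd_unit_simps [simp]:
  "carrier (yd_unit K H) = carrier K" "add (yd_unit K H) = add K" "smult (yd_unit K H) = mult K"
  "zero (yd_unit K H) = \<zero>\<^bsub>K\<^esub>"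
  by (simp_all add: yd_unit_def)

lemma yd_unit_structure:
  "act (yd_unit K H) h a = counit H h \<otimes>\<^bsub>K\<^esub> a" "counit (yd_unit K H) a = a"
  "coact (yd_unit K H) a = pure_tensor K H (ground_module K) \<one>\<^bsub>H\<^esub> a"
  "comult (yd_unit K H) a = pure_tensor K (ground_module K) (ground_module K) a \<one>\<^bsub>K\<^esub>"
  by (simp_all add: yd_unit_def)

lemma yd_unit_linear_simps [simp]:
  "linear_map K (yd_unit K H) W = linear_map K (ground_module K) W"
  "linear_map K W (yd_unit K H) = linear_map K W (ground_module K)"
  by (rule linear_map_cong_record; simp)+

lemma yd_unit_product_simps [simp]:
  "tensor_product K W (yd_unit K H) = tensor_product K W (ground_module K)"
  "pure_tensor K W (yd_unit K H) = pure_tensor K W (ground_module K)"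
  by (rule tensor_product_cong; simp)+

end

locale connected_coquasi = hopf_base K H + Q: yd_coquasi_bialgebra K H Q \<omega>
  for K :: "('k, 'm) ring_scheme" and H :: "('k, 'h, 'a) hopf_algebra_scheme"
    and Q :: "('k, 'h, 'q, 'b) yd_coalgebra_scheme" and \<omega> +
  assumes connected: "connected_yd K Q"
begin

abbreviation QQ where "QQ \<equiv> tensor_product K Q Q"
abbreviation QQQ where "QQQ \<equiv> tensor_product K Q QQ"
abbreviation F where "F \<equiv> coradical_filtration K Q"

declare coradical_filtration.simps [simp del]

lemma Q_pre [lin]: "yd_pre Q"
  by (rule yd_coalgebra_pre) (rule Q.yd_coalgebra_axioms)

lemma module_Q [lin]: "module K Q" by (rule yd_pre_module[OF Q_pre])

lemma one_Q [lin, simp]: "\<one>\<^bsub>Q\<^esub> \<in> carrier Q" by (rule Q.unit_closed)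

lemma mult_Q_left [lin]: "linear_map K X Q e \<Longrightarrow> q \<in> carrier Q \<Longrightarrow> linear_map K X Q (\<lambda>x. e x \<otimes>\<^bsub>Q\<^esub> q)"
  by (rule linear_comp[OF _ bilinear_left[OF Q.product_bilinear]])

lemma mult_Q_right [lin]: "linear_map K X Q e \<Longrightarrow> q \<in> carrier Q \<Longrightarrow> linear_map K X Q (\<lambda>x. q \<otimes>\<^bsub>Q\<^esub> e x)"
  by (rule linear_comp[OF _ bilinear_right[OF Q.product_bilinear]])

lemma mult_Q_closed [lin]: "p \<in> carrier Q \<Longrightarrow> q \<in> carrier Q \<Longrightarrow> p \<otimes>\<^bsub>Q\<^esub> q \<in> carrier Q"
  by (rule bilinear_closed[OF Q.product_bilinear])

lemma unit_map_one: "unit_map Q \<one>\<^bsub>K\<^esub> = \<one>\<^bsub>Q\<^esub>"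
  by (simp add: unit_map_def)

lemma unit_map_linear: "linear_map K (ground_module K) Q (unit_map Q)"
  using Q.unit_map_morphism by (simp add: yd_coalgebra_morphism_def yd_morphism_def)

lemma act_one: "h \<in> carrier H \<Longrightarrow> act Q h \<one>\<^bsub>Q\<^esub> = counit H h \<odot>\<^bsub>Q\<^esub> \<one>\<^bsub>Q\<^esub>"
proof -
  assume h: "h \<in> carrier H"
  have "unit_map Q (act (yd_unit K H) h \<one>\<^bsub>K\<^esub>) = act Q h (unit_map Q \<one>\<^bsub>K\<^esub>)"
    using Q.unit_map_morphism h by (auto simp: yd_coalgebra_morphism_def yd_morphism_def)
  then show ?thesis using counit_H_closed[OF h] by (simp add: unit_map_one unit_map_def yd_unit_def)
qed

lemma coact_one: "coact Q \<one>\<^bsub>Q\<^esub> = pure_tensor K H Q \<one>\<^bsub>H\<^esub> \<one>\<^bsub>Q\<^esub>"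
proof -
  have "coact Q (unit_map Q \<one>\<^bsub>K\<^esub>) = tensor_map K H Q (\<lambda>h. h) (unit_map Q) (coact (yd_unit K H) \<one>\<^bsub>K\<^esub>)"
    using Q.unit_map_morphism by (auto simp: yd_coalgebra_morphism_def yd_morphism_def)
  also have "coact (yd_unit K H) \<one>\<^bsub>K\<^esub> = pure_tensor K H (ground_module K) \<one>\<^bsub>H\<^esub> \<one>\<^bsub>K\<^esub>" by (simp add: yd_unit_def)
  also have "tensor_map K H Q (\<lambda>h. h) (unit_map Q) \<dots> = pure_tensor K H Q \<one>\<^bsub>H\<^esub> (unit_map Q \<one>\<^bsub>K\<^esub>)"
    by (rule tensor_map_pure[OF linear_id unit_map_linear]; (rule lin)?) simp_all
  finally show ?thesis by (simp add: unit_map_one)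
qed

lemma comult_one: "comult Q \<one>\<^bsub>Q\<^esub> = pure_tensor K Q Q \<one>\<^bsub>Q\<^esub> \<one>\<^bsub>Q\<^esub>"
proof -
  have "comult Q (unit_map Q \<one>\<^bsub>K\<^esub>) = tensor_map K Q Q (unit_map Q) (unit_map Q) (comult (yd_unit K H) \<one>\<^bsub>K\<^esub>)"
    using Q.unit_map_morphism by (auto simp: yd_coalgebra_morphism_def)
  also have "comult (yd_unit K H) \<one>\<^bsub>K\<^esub> = pure_tensor K (ground_module K) (ground_module K) \<one>\<^bsub>K\<^esub> \<one>\<^bsub>K\<^esub>"
    by (simp add: yd_unit_def)
  also have "tensor_map K Q Q (unit_map Q) (unit_map Q) \<dots> = pure_tensor K Q Q (unit_map Q \<one>\<^bsub>K\<^esub>) (unit_map Q \<one>\<^bsub>K\<^esub>)"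
    by (rule tensor_map_pure[OF unit_map_linear unit_map_linear]; (rule lin)?) simp_all
  finally show ?thesis by (simp add: unit_map_one)
qed

lemma counit_one: "counit Q \<one>\<^bsub>Q\<^esub> = \<one>\<^bsub>K\<^esub>"
proof -
  have "counit Q (unit_map Q \<one>\<^bsub>K\<^esub>) = counit (yd_unit K H) \<one>\<^bsub>K\<^esub>"
    using Q.unit_map_morphism by (auto simp: yd_coalgebra_morphism_def)
  then show ?thesis by (simp add: unit_map_one yd_unit_def)
qed

subsection \<open>The filtration consists of subspaces\<close>

lemma F_0: "F 0 = {a \<odot>\<^bsub>Q\<^esub> \<one>\<^bsub>Q\<^esub> | a. a \<in> carrier K}"
  using connected by (simp add: connected_yd_def coradical_filtration.simps)

lemma one_in_F: "\<one>\<^bsub>Q\<^esub> \<in> F 0"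
proof -
  have "\<one>\<^bsub>Q\<^esub> = \<one>\<^bsub>K\<^esub> \<odot>\<^bsub>Q\<^esub> \<one>\<^bsub>Q\<^esub>" by simp
  then show ?thesis unfolding F_0 by blast
qed

lemma F_submodule: "submodule (F n) K Q"
proof (induction n)
  case 0
  show ?case unfolding F_0
  proof (rule submodule_criterion[OF module_Q])
    show "\<zero>\<^bsub>Q\<^esub> \<in> {a \<odot>\<^bsub>Q\<^esub> \<one>\<^bsub>Q\<^esub> | a. a \<in> carrier K}"
      using module.smult_l_null[OF module_Q one_Q] by (metis (mono_tags, lifting) K.zero_closed mem_Collect_eq)
    show "x \<oplus>\<^bsub>Q\<^esub> y \<in> {a \<odot>\<^bsub>Q\<^esub> \<one>\<^bsub>Q\<^esub> | a. a \<in> carrier K}"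
      if "x \<in> {a \<odot>\<^bsub>Q\<^esub> \<one>\<^bsub>Q\<^esub> | a. a \<in> carrier K}" "y \<in> {a \<odot>\<^bsub>Q\<^esub> \<one>\<^bsub>Q\<^esub> | a. a \<in> carrier K}" for x y
      using that by (auto simp flip: module.smult_l_distr[OF module_Q])
    show "a \<odot>\<^bsub>Q\<^esub> x \<in> {a \<odot>\<^bsub>Q\<^esub> \<one>\<^bsub>Q\<^esub> | a. a \<in> carrier K}"
      if "a \<in> carrier K" "x \<in> {a \<odot>\<^bsub>Q\<^esub> \<one>\<^bsub>Q\<^esub> | a. a \<in> carrier K}" for a x
      using that by (auto simp flip: module.smult_assoc1[OF module_Q])
  qed auto
next
  case (Suc n)
  have F0: "submodule (coradical K Q) K Q"
  proof -
    have "\<Union>{D. simple_subcoalgebra K Q D} \<subseteq> carrier Q"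
      using submoduleD(1)[OF _ module_Q] by (auto simp: simple_subcoalgebra_def subcoalgebra_def)
    then show ?thesis unfolding coradical_def by (rule hull_submodule[OF module_Q])
  qed
  have QQ: "module K QQ" by (rule lin)+
  show ?case unfolding coradical_filtration.simps(2)
    by (rule linear_vimage_submodule[OF module_Q QQ Q.C.comult_linear set_add_submodule[OF QQ]];
        rule sub_tensor_submodule[OF module_Q module_Q])
      (use submoduleD(1)[OF F0 module_Q] submoduleD(1)[OF Suc module_Q] in auto)
qed

lemmas F_D = submoduleD[OF F_submodule module_Q]

text \<open>
  The subspace of which \<open>Q\<^sub>n\<^sub>+\<^sub>1\<close> is the preimage under \<open>\<Delta>\<close>.
\<close>

definition S where "S n = sub_tensor K Q Q (carrier Q) (F n) <+>\<^bsub>QQ\<^esub> sub_tensor K Q Q (F 0) (carrier Q)"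

lemma S_submodule: "submodule (S n) K QQ"
proof -
  have "module K QQ" by (rule lin)+
  then show ?thesis unfolding S_def
    by (rule set_add_submodule; intro sub_tensor_submodule[OF module_Q module_Q] F_D(1) subset_refl)
qed

lemma mem_F_Suc: "x \<in> F (Suc n) \<longleftrightarrow> x \<in> carrier Q \<and> comult Q x \<in> S n"
  unfolding S_def by (simp add: coradical_filtration.simps)

lemma linear_S:
  assumes "module K U" "linear_map K QQ U f" "submodule N K U" "t \<in> S n"
    "\<And>x y. x \<in> carrier Q \<Longrightarrow> y \<in> F n \<Longrightarrow> f (pure_tensor K Q Q x y) \<in> N"
    "\<And>x y. x \<in> F 0 \<Longrightarrow> y \<in> carrier Q \<Longrightarrow> f (pure_tensor K Q Q x y) \<in> N"
  shows "f t \<in> N"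
proof (rule linear_set_add[OF tensor_module[OF module_Q module_Q] assms(1-3) _ _ _ _ assms(4)[unfolded S_def]])
  show "sub_tensor K Q Q (carrier Q) (F n) \<subseteq> carrier QQ" "sub_tensor K Q Q (F 0) (carrier Q) \<subseteq> carrier QQ"
    by (intro sub_tensor_in_carrier module_Q F_D(1) subset_refl)+
  show "f x \<in> N" if "x \<in> sub_tensor K Q Q (carrier Q) (F n)" for x
    by (rule linear_sub_tensor[OF module_Q module_Q assms(1-3) _ F_D(1) assms(5) that]) auto
  show "f x \<in> N" if "x \<in> sub_tensor K Q Q (F 0) (carrier Q)" for x
    by (rule linear_sub_tensor[OF module_Q module_Q assms(1-3) F_D(1) _ assms(6) that]) auto
qed

lemma S_pure: "x \<in> carrier Q \<Longrightarrow> y \<in> F n \<Longrightarrow> pure_tensor K Q Q x y \<in> S n"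
  "x \<in> F 0 \<Longrightarrow> y \<in> carrier Q \<Longrightarrow> pure_tensor K Q Q x y \<in> S n"
proof -
  have "sub_tensor K Q Q (carrier Q) (F n) \<subseteq> S n" "sub_tensor K Q Q (F 0) (carrier Q) \<subseteq> S n"
    unfolding S_def
    by (rule set_add_supset[OF tensor_module[OF module_Q module_Q]];
        intro sub_tensor_submodule[OF module_Q module_Q] F_D(1) subset_refl)+
  then show "x \<in> carrier Q \<Longrightarrow> y \<in> F n \<Longrightarrow> pure_tensor K Q Q x y \<in> S n"
    "x \<in> F 0 \<Longrightarrow> y \<in> carrier Q \<Longrightarrow> pure_tensor K Q Q x y \<in> S n"
    using sub_tensor_pure[of x _ y _ Q Q] by blast+
qed

lemma comult_F_0: "x \<in> F 0 \<Longrightarrow> comult Q x = pure_tensor K Q Q x \<one>\<^bsub>Q\<^esub>"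
  unfolding F_0 using linear_smult[OF Q.C.comult_linear]
    linear_smult[OF bilinear_left[OF pure_bilinear[OF module_Q module_Q] one_Q]]
  by (auto simp: comult_one)

lemma F_mono_Suc: "F n \<subseteq> F (Suc n)"
proof (induction n)
  case 0
  show ?case using F_D(1)[of 0] S_pure(1)[OF _ one_in_F] by (auto simp: mem_F_Suc comult_F_0)
next
  case (Suc n)
  have "S n \<subseteq> S (Suc n)" unfolding S_def set_add_def' using sub_tensor_mono[OF subset_refl Suc, of Q Q "carrier Q"] by blast
  then show ?case by (auto simp: mem_F_Suc)
qed

lemma F_mono: "i \<le> j \<Longrightarrow> F i \<subseteq> F j"
  using lift_Suc_mono_le[of F, OF F_mono_Suc] .

subsection \<open>The comultiplication and the filtration\<close>

definition kill where "kill n = (SOME e. linear_map K Q Q e \<and> (\<forall>x\<in>carrier Q. e x = \<zero>\<^bsub>Q\<^esub> \<longleftrightarrow> x \<in> F n) \<and>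
  (\<forall>x\<in>carrier Q. x \<ominus>\<^bsub>Q\<^esub> e x \<in> F n))"

lemma kill: "linear_map K Q Q (kill n)" "x \<in> carrier Q \<Longrightarrow> kill n x = \<zero>\<^bsub>Q\<^esub> \<longleftrightarrow> x \<in> F n"
  "x \<in> carrier Q \<Longrightarrow> x \<ominus>\<^bsub>Q\<^esub> kill n x \<in> F n"
proof -
  have "\<exists>e. linear_map K Q Q e \<and> (\<forall>x\<in>carrier Q. e x = \<zero>\<^bsub>Q\<^esub> \<longleftrightarrow> x \<in> F n) \<and> (\<forall>x\<in>carrier Q. x \<ominus>\<^bsub>Q\<^esub> e x \<in> F n)"
    by (rule killer_exists[OF module_Q F_submodule[of n]]) blast
  note k = someI_ex[OF this, folded kill_def]
  show "linear_map K Q Q (kill n)" using k by blast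
  show "x \<in> carrier Q \<Longrightarrow> kill n x = \<zero>\<^bsub>Q\<^esub> \<longleftrightarrow> x \<in> F n" using k by blast
  show "x \<in> carrier Q \<Longrightarrow> x \<ominus>\<^bsub>Q\<^esub> kill n x \<in> F n" using k by blast
qed

lemma kill_zero: "x \<in> F n \<Longrightarrow> kill n x = \<zero>\<^bsub>Q\<^esub>"
  using kill(2) F_D(1) by blast

lemma kill_lin [lin]: "linear_map K X Q e \<Longrightarrow> linear_map K X Q (\<lambda>x. kill n (e x))"
  by (rule linear_comp[OF _ kill(1)])

lemma kill_closed [lin]: "x \<in> carrier Q \<Longrightarrow> kill n x \<in> carrier Q"
  by (rule linear_closed[OF kill(1)])

text \<open>
  \<open>Q \<otimes> Q\<^sub>n + Q\<^sub>0 \<otimes> Q\<close> is the kernel of \<open>kill 0 \<otimes> kill n\<close>.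
\<close>

lemma mem_F_Suc_kill:
  "x \<in> carrier Q \<Longrightarrow> x \<in> F (Suc n) \<longleftrightarrow> tensor_map K Q Q (kill 0) (kill n) (comult Q x) = \<zero>\<^bsub>QQ\<^esub>"
  unfolding mem_F_Suc S_def
  using tensor_kernel_sum[OF module_Q module_Q F_submodule[of 0] F_submodule[of n] kill(1-3)[where n = 0] kill(1-3)[where n = n] comult_in[OF Q_pre, of x]]
  by auto

text \<open>
  Both \<open>kill (Suc n)\<close> and \<open>(kill 0 \<otimes> kill n) \<Delta>\<close> have the kernel \<open>Q\<^sub>n\<^sub>+\<^sub>1\<close>, so the former factors through the latter. This
  brings a further \<open>\<Delta>\<close> into play, to which coassociativity or colinearity can be applied.
\<close>

lemma kill_Suc_factor:
  obtains \<psi> where "linear_map K QQ Q \<psi>"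
    "\<And>x. x \<in> carrier Q \<Longrightarrow> \<psi> (tensor_map K Q Q (kill 0) (kill n) (comult Q x)) = kill (Suc n) x"
proof (rule linear_factor[OF module_Q tensor_module[OF module_Q module_Q] module_Q _ kill(1)[of "Suc n"],
      of "\<lambda>x. tensor_map K Q Q (kill 0) (kill n) (comult Q x)"])
  show "linear_map K Q QQ (\<lambda>x. tensor_map K Q Q (kill 0) (kill n) (comult Q x))"
    by (rule lin)+
  show "kill (Suc n) x = \<zero>\<^bsub>Q\<^esub>" if "x \<in> carrier Q" "tensor_map K Q Q (kill 0) (kill n) (comult Q x) = \<zero>\<^bsub>QQ\<^esub>" for x
    using mem_F_Suc_kill[OF that(1)] that(2) by (intro kill_zero) simp
qed (rule that)

lemma lift_zero:
  assumes "module K V" "module K W" "module K U" "bilinear_map K V W U \<beta>" "t \<in> carrier (tensor_product K V W)"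
    "\<And>x y. x \<in> carrier V \<Longrightarrow> y \<in> carrier W \<Longrightarrow> \<beta> x y = \<zero>\<^bsub>U\<^esub>"
  shows "tensor_lift K U \<beta> t = \<zero>\<^bsub>U\<^esub>"
proof -
  have "tensor_lift K U \<beta> t \<in> {\<zero>\<^bsub>U\<^esub>}"
    by (rule linear_in_submodule[OF assms(1-3) tensor_lift_linear[OF assms(1-4)] zero_submodule[OF assms(3)] _ assms(5)])
      (simp add: tensor_lift_pure[OF assms(1-4)] assms(6))
  then show ?thesis by simp
qed

text \<open>
  Write \<open>kill (Suc j) = \<psi> (kill 0 \<otimes> kill j) \<Delta>\<close>. By coassociativity, \<open>(kill (Suc j) \<otimes> g) \<Delta> x\<close> is the image of
  \<open>(kill 0 \<otimes> (kill j \<otimes> g) \<Delta>) \<Delta> x\<close> under \<open>\<psi> \<otimes> Q\<close>, where \<open>\<Delta> x\<close> lies in \<open>Q \<otimes> Q\<^sub>n + Q\<^sub>0 \<otimes> Q\<close>. The first summand is killed by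
  \<open>(kill j \<otimes> g) \<Delta>\<close> in the right factor, by hypothesis, and the second one by \<open>kill 0\<close> in the left factor.
\<close>

lemma comult_kill_left:
  assumes g: "linear_map K Q Q g" and IH: "\<And>y. y \<in> F n \<Longrightarrow> tensor_map K Q Q (kill j) g (comult Q y) = \<zero>\<^bsub>QQ\<^esub>"
    and x: "x \<in> F (Suc n)"
  shows "tensor_map K Q Q (kill (Suc j)) g (comult Q x) = \<zero>\<^bsub>QQ\<^esub>"
proof -
  obtain \<psi> where \<psi>: "linear_map K QQ Q \<psi>"
    "\<And>x. x \<in> carrier Q \<Longrightarrow> \<psi> (tensor_map K Q Q (kill 0) (kill j) (comult Q x)) = kill (Suc j) x"
    using kill_Suc_factor[of j] by blast
  note [lin] = linear_comp[OF _ \<psi>(1)] linear_closed[OF \<psi>(1)] linear_comp[OF _ g] linear_closed[OF g]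
  have xQ [lin]: "x \<in> carrier Q" and xS: "comult Q x \<in> S n" using x mem_F_Suc by auto
  have m [lin]: "module K QQ" "module K QQQ" by (rule lin)+
  \<comment> \<open>\<open>a \<otimes> b \<otimes> c \<mapsto> \<psi> (kill 0 a \<otimes> kill j b) \<otimes> g c\<close>\<close>
  define \<Lambda> where "\<Lambda> = tensor_lift K QQ (\<lambda>a. tensor_lift K QQ
    (\<lambda>b c. pure_tensor K Q Q (\<psi> (pure_tensor K Q Q (kill 0 a) (kill j b))) (g c)))"
  have \<Lambda>: "linear_map K QQQ QQ \<Lambda>"
    unfolding \<Lambda>_def by (rule tensor_lift_linear) (rule lin | assumption)+
  note [lin] = linear_comp[OF _ \<Lambda>] linear_closed[OF \<Lambda>]
  have \<Lambda>p: "\<Lambda> (pure_tensor K Q QQ a t) = tensor_lift K QQ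
    (\<lambda>b c. pure_tensor K Q Q (\<psi> (pure_tensor K Q Q (kill 0 a) (kill j b))) (g c)) t"
    if [lin]: "a \<in> carrier Q" "t \<in> carrier QQ" for a t
    unfolding \<Lambda>_def by (rule tensor_lift_pure) (rule lin | assumption)+
  have \<Lambda>pp: "\<Lambda> (pure_tensor K Q QQ a (pure_tensor K Q Q b c)) =
      pure_tensor K Q Q (\<psi> (pure_tensor K Q Q (kill 0 a) (kill j b))) (g c)"
    if [lin]: "a \<in> carrier Q" "b \<in> carrier Q" "c \<in> carrier Q" for a b c
    apply (rule trans, rule \<Lambda>p, (rule lin)+)
    apply (rule tensor_lift_pure, (rule lin | assumption)+)
    done
  have "tensor_map K Q Q (kill (Suc j)) g (comult Q x) =
    tensor_lift K QQ (\<lambda>z y. \<Lambda> (tensor_lift K QQQ (\<lambda>x1 x2. pure_tensor K Q QQ x1 (pure_tensor K Q Q x2 y)) (comult Q z))) (comult Q x)"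
    unfolding tensor_map_def
  proof (rule tensor_lift_cong)
    fix z y assume [lin]: "z \<in> carrier Q" "y \<in> carrier Q"
    have "\<Lambda> (tensor_lift K QQQ (\<lambda>x1 x2. pure_tensor K Q QQ x1 (pure_tensor K Q Q x2 y)) (comult Q z)) =
        tensor_lift K QQ (\<lambda>x1 x2. \<Lambda> (pure_tensor K Q QQ x1 (pure_tensor K Q Q x2 y))) (comult Q z)"
      by (rule linear_lift_commute[OF _ _ _ _ _ \<Lambda>]) (rule lin | assumption)+
    also have "\<dots> = tensor_lift K QQ (\<lambda>x1 x2. pure_tensor K Q Q (\<psi> (pure_tensor K Q Q (kill 0 x1) (kill j x2))) (g y)) (comult Q z)"
      by (rule tensor_lift_cong, (rule lin | assumption)+, rule \<Lambda>pp, (rule lin | assumption)+)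
    also have "\<dots> = pure_tensor K Q Q (\<psi> (tensor_map K Q Q (kill 0) (kill j) (comult Q z))) (g y)"
      unfolding tensor_map_def
      by (rule linear_lift_commute[where f = "\<lambda>t. pure_tensor K Q Q (\<psi> t) (g y)", symmetric]) (rule lin | assumption)+
    also have "\<psi> (tensor_map K Q Q (kill 0) (kill j) (comult Q z)) = kill (Suc j) z" by (rule \<psi>(2)) (rule lin)
    finally show "pure_tensor K Q Q (kill (Suc j) z) (g y) =
      \<Lambda> (tensor_lift K QQQ (\<lambda>x1 x2. pure_tensor K Q QQ x1 (pure_tensor K Q Q x2 y)) (comult Q z))" by simp
  qed (rule lin | assumption)+
  also have "\<dots> = \<Lambda> (tensor_lift K QQQ (\<lambda>z y. tensor_lift K QQQ (\<lambda>x1 x2. pure_tensor K Q QQ x1 (pure_tensor K Q Q x2 y)) (comult Q z)) (comult Q x))"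
    by (rule linear_lift_commute[OF _ _ _ _ _ \<Lambda>, symmetric]) (rule lin | assumption)+
  also have "\<dots> = \<Lambda> (tensor_map K Q QQ (\<lambda>x. x) (comult Q) (comult Q x))"
    by (simp only: Q.C.coassoc[OF xQ])
  also have "\<dots> \<in> {\<zero>\<^bsub>QQ\<^esub>}"
  proof (rule linear_S[OF m(1) _ zero_submodule[OF m(1)] xS, where f = "\<lambda>t. \<Lambda> (tensor_map K Q QQ (\<lambda>x. x) (comult Q) t)"])
    show "linear_map K QQ QQ (\<lambda>t. \<Lambda> (tensor_map K Q QQ (\<lambda>x. x) (comult Q) t))"
      by (rule lin | assumption)+
    have p: "\<Lambda> (tensor_map K Q QQ (\<lambda>x. x) (comult Q) (pure_tensor K Q Q a y)) = tensor_lift K QQ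
        (\<lambda>b c. pure_tensor K Q Q (\<psi> (pure_tensor K Q Q (kill 0 a) (kill j b))) (g c)) (comult Q y)"
      if [lin]: "a \<in> carrier Q" "y \<in> carrier Q" for a y
      by (subst tensor_map_pure, (rule lin | assumption)+) (rule \<Lambda>p, (rule lin)+)
    show "\<Lambda> (tensor_map K Q QQ (\<lambda>x. x) (comult Q) (pure_tensor K Q Q a y)) \<in> {\<zero>\<^bsub>QQ\<^esub>}"
      if "a \<in> F 0" "y \<in> carrier Q" for a y
    proof -
      have [lin]: "a \<in> carrier Q" "y \<in> carrier Q" using that F_D(1) by auto
      have [lin]: "\<zero>\<^bsub>Q\<^esub> \<in> carrier Q" by simp
      have \<psi>0: "\<psi> (pure_tensor K Q Q \<zero>\<^bsub>Q\<^esub> (kill j b)) = \<zero>\<^bsub>Q\<^esub>" if "b \<in> carrier Q" for b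
        using pure_zero(1)[OF module_Q module_Q kill_closed[OF that]] linear_zero[OF m(1) module_Q \<psi>(1)] by simp
      show ?thesis unfolding p[OF \<open>a \<in> carrier Q\<close> \<open>y \<in> carrier Q\<close>] kill_zero[OF that(1)] singleton_iff
        apply (rule lift_zero, (rule lin | assumption)+)
        using \<psi>0 pure_zero(1)[OF module_Q module_Q] linear_closed[OF g] by simp
    qed
    show "\<Lambda> (tensor_map K Q QQ (\<lambda>x. x) (comult Q) (pure_tensor K Q Q a y)) \<in> {\<zero>\<^bsub>QQ\<^esub>}"
      if "a \<in> carrier Q" "y \<in> F n" for a y
    proof -
      have [lin]: "a \<in> carrier Q" "y \<in> carrier Q" using that F_D(1) by auto
      let ?\<Xi> = "tensor_lift K QQ (\<lambda>b c. pure_tensor K Q Q (\<psi> (pure_tensor K Q Q (kill 0 a) b)) c)"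
      have "tensor_lift K QQ (\<lambda>b c. pure_tensor K Q Q (\<psi> (pure_tensor K Q Q (kill 0 a) (kill j b))) (g c)) (comult Q y)
         = ?\<Xi> (tensor_map K Q Q (kill j) g (comult Q y))"
        by (rule lift_tensor_map[OF kill(1) g, symmetric]) (rule lin | assumption)+
      also have "\<dots> = \<zero>\<^bsub>QQ\<^esub>" unfolding IH[OF that(2)]
        by (rule tensor_lift_zero) (rule lin | assumption)+
      finally show ?thesis using p[OF \<open>a \<in> carrier Q\<close> \<open>y \<in> carrier Q\<close>] by simp
    qed
  qed
  finally show ?thesis by simp
qed

text \<open>
  Here the right factor of \<open>\<Delta> x\<close> is expanded with \<open>kill (Suc n) = \<psi> (kill 0 \<otimes> kill n) \<Delta>\<close>, and coassociativity moves the second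
  \<open>\<Delta>\<close> to the left factor. Then \<open>kill n\<close> kills the summand in \<open>Q \<otimes> Q\<^sub>n\<close>. For the summand in \<open>Q\<^sub>0 \<otimes> Q\<close> one has \<open>\<Delta> z = z \<otimes> 1\<close>
  for \<open>z\<close> in \<open>Q\<^sub>0\<close>, and \<open>kill 0\<close> kills \<open>1\<close>.
\<close>

lemma comult_kill_right:
  assumes x: "x \<in> F (Suc n)"
  shows "tensor_map K Q Q (\<lambda>x. x) (kill (Suc n)) (comult Q x) = \<zero>\<^bsub>QQ\<^esub>"
proof -
  obtain \<psi> where \<psi>: "linear_map K QQ Q \<psi>"
    "\<And>x. x \<in> carrier Q \<Longrightarrow> \<psi> (tensor_map K Q Q (kill 0) (kill n) (comult Q x)) = kill (Suc n) x"
    using kill_Suc_factor[of n] by blast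
  note [lin] = linear_comp[OF _ \<psi>(1)] linear_closed[OF \<psi>(1)]
  have xQ [lin]: "x \<in> carrier Q" and xS: "comult Q x \<in> S n" using x mem_F_Suc by auto
  have m [lin]: "module K QQ" "module K QQQ" by (rule lin)+
  let ?g = "\<lambda>t. \<psi> (tensor_map K Q Q (kill 0) (kill n) t)"
  have gl: "linear_map K QQ Q ?g" by (rule lin)+
  define \<Lambda> where "\<Lambda> = tensor_map K Q Q (\<lambda>x. x) ?g"
  have \<Lambda>: "linear_map K QQQ QQ \<Lambda>" unfolding \<Lambda>_def by (rule tensor_map_linear) (rule lin | assumption)+
  have gp: "?g (pure_tensor K Q Q a b) = \<psi> (pure_tensor K Q Q (kill 0 a) (kill n b))"
    if [lin]: "a \<in> carrier Q" "b \<in> carrier Q" for a b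
    by (subst tensor_map_pure, (rule lin | assumption)+) (rule refl)
  have \<Lambda>p: "\<Lambda> (pure_tensor K Q QQ a t) = pure_tensor K Q Q a (?g t)"
    if [lin]: "a \<in> carrier Q" "t \<in> carrier QQ" for a t
    unfolding \<Lambda>_def by (rule tensor_map_pure[OF linear_id gl]) (rule lin | assumption)+
  have "tensor_map K Q Q (\<lambda>x. x) (kill (Suc n)) (comult Q x) = \<Lambda> (tensor_map K Q QQ (\<lambda>x. x) (comult Q) (comult Q x))"
    unfolding \<Lambda>_def
    apply (subst tensor_map_comp[OF linear_id _ linear_id gl], (rule lin | assumption)+)
    unfolding tensor_map_def[of K Q Q "\<lambda>x. x"]
    apply (rule tensor_lift_cong, (rule lin | assumption)+)
    apply (simp add: \<psi>(2))
    done
  also have "\<dots> = \<Lambda> (tensor_lift K QQQ (\<lambda>z y. tensor_lift K QQQ (\<lambda>x1 x2. pure_tensor K Q QQ x1 (pure_tensor K Q Q x2 y)) (comult Q z)) (comult Q x))"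
    by (simp only: Q.C.coassoc[OF xQ])
  also have "\<dots> \<in> {\<zero>\<^bsub>QQ\<^esub>}"
  proof (rule linear_S[OF m(1) _ zero_submodule[OF m(1)] xS, where f = "\<lambda>t. \<Lambda> (tensor_lift K QQQ
      (\<lambda>z y. tensor_lift K QQQ (\<lambda>x1 x2. pure_tensor K Q QQ x1 (pure_tensor K Q Q x2 y)) (comult Q z)) t)"])
    show "linear_map K QQ QQ (\<lambda>t. \<Lambda> (tensor_lift K QQQ
      (\<lambda>z y. tensor_lift K QQQ (\<lambda>x1 x2. pure_tensor K Q QQ x1 (pure_tensor K Q Q x2 y)) (comult Q z)) t))"
      by (rule linear_comp[OF _ \<Lambda>]) (rule lin | assumption)+
    have p: "\<Lambda> (tensor_lift K QQQ (\<lambda>z y. tensor_lift K QQQ (\<lambda>x1 x2. pure_tensor K Q QQ x1 (pure_tensor K Q Q x2 y)) (comult Q z))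
        (pure_tensor K Q Q z y)) = tensor_lift K QQ (\<lambda>x1 x2. pure_tensor K Q Q x1 (\<psi> (pure_tensor K Q Q (kill 0 x2) (kill n y)))) (comult Q z)"
      if [lin]: "z \<in> carrier Q" "y \<in> carrier Q" for z y
    proof -
      have "tensor_lift K QQQ (\<lambda>z y. tensor_lift K QQQ (\<lambda>x1 x2. pure_tensor K Q QQ x1 (pure_tensor K Q Q x2 y)) (comult Q z)) (pure_tensor K Q Q z y)
        = tensor_lift K QQQ (\<lambda>x1 x2. pure_tensor K Q QQ x1 (pure_tensor K Q Q x2 y)) (comult Q z)"
        by (rule tensor_lift_pure) (rule lin | assumption)+
      also have "\<Lambda> \<dots> = tensor_lift K QQ (\<lambda>x1 x2. \<Lambda> (pure_tensor K Q QQ x1 (pure_tensor K Q Q x2 y))) (comult Q z)"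
        by (rule linear_lift_commute[OF _ _ _ _ _ \<Lambda>]) (rule lin | assumption)+
      also have "\<dots> = tensor_lift K QQ (\<lambda>x1 x2. pure_tensor K Q Q x1 (\<psi> (pure_tensor K Q Q (kill 0 x2) (kill n y)))) (comult Q z)"
        apply (rule tensor_lift_cong)
             apply ((rule linear_comp[OF _ \<Lambda>] lin | assumption)+)[5]
        apply (rule trans, rule \<Lambda>p, (rule lin | assumption)+)
        apply (subst gp, (rule lin | assumption | rule refl)+)
        done
      finally show ?thesis .
    qed
    have \<psi>0: "\<psi> \<zero>\<^bsub>QQ\<^esub> = \<zero>\<^bsub>Q\<^esub>" by (rule linear_zero[OF m(1) module_Q \<psi>(1)])
    show "\<Lambda> (tensor_lift K QQQ (\<lambda>z y. tensor_lift K QQQ (\<lambda>x1 x2. pure_tensor K Q QQ x1 (pure_tensor K Q Q x2 y)) (comult Q z))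
        (pure_tensor K Q Q z y)) \<in> {\<zero>\<^bsub>QQ\<^esub>}" if "z \<in> carrier Q" "y \<in> F n" for z y
    proof -
      have [lin]: "z \<in> carrier Q" "y \<in> carrier Q" "\<zero>\<^bsub>Q\<^esub> \<in> carrier Q" using that F_D(1) by auto
      show ?thesis unfolding p[OF \<open>z \<in> carrier Q\<close> \<open>y \<in> carrier Q\<close>] kill_zero[OF that(2)] singleton_iff
        apply (rule lift_zero, (rule lin | assumption)+)
        using \<psi>0 pure_zero(2)[OF module_Q module_Q] kill_closed by simp
    qed
    show "\<Lambda> (tensor_lift K QQQ (\<lambda>z y. tensor_lift K QQQ (\<lambda>x1 x2. pure_tensor K Q QQ x1 (pure_tensor K Q Q x2 y)) (comult Q z))
        (pure_tensor K Q Q z y)) \<in> {\<zero>\<^bsub>QQ\<^esub>}" if "z \<in> F 0" "y \<in> carrier Q" for z y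
    proof -
      have [lin]: "z \<in> carrier Q" "y \<in> carrier Q" using that F_D(1) by auto
      have "tensor_lift K QQ (\<lambda>x1 x2. pure_tensor K Q Q x1 (\<psi> (pure_tensor K Q Q (kill 0 x2) (kill n y)))) (pure_tensor K Q Q z \<one>\<^bsub>Q\<^esub>)
        = pure_tensor K Q Q z (\<psi> (pure_tensor K Q Q (kill 0 \<one>\<^bsub>Q\<^esub>) (kill n y)))"
        by (rule tensor_lift_pure) (rule lin | assumption)+
      then show ?thesis unfolding p[OF \<open>z \<in> carrier Q\<close> \<open>y \<in> carrier Q\<close>] comult_F_0[OF that(1)]
        using \<psi>0 pure_zero[OF module_Q module_Q] kill_closed[OF \<open>y \<in> carrier Q\<close>] kill_zero[OF one_in_F] \<open>z \<in> carrier Q\<close> by simp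
    qed
  qed
  finally show ?thesis by simp
qed

lemma comult_kill_id: "x \<in> F n \<Longrightarrow> tensor_map K Q Q (kill n) (\<lambda>x. x) (comult Q x) = \<zero>\<^bsub>QQ\<^esub>"
proof (induction n arbitrary: x)
  case 0
  have "x \<in> carrier Q" using 0 F_D(1) by auto
  then show ?case unfolding comult_F_0[OF 0]
    by (simp add: tensor_map_pure[OF kill(1) linear_id module_Q module_Q module_Q module_Q] kill_zero[OF 0]
        pure_zero[OF module_Q module_Q])
next
  case (Suc n) then show ?case by (intro comult_kill_left[OF linear_id])
qed

lemma comult_kill_kill:
  "x \<in> F (Suc (i + j)) \<Longrightarrow> tensor_map K Q Q (kill i) (kill j) (comult Q x) = \<zero>\<^bsub>QQ\<^esub>"
proof (induction i arbitrary: x)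
  case 0 then show ?case using mem_F_Suc_kill[of x j] mem_F_Suc[of x j] by simp
next
  case (Suc i)
  show ?case by (rule comult_kill_left[OF kill(1) Suc.IH Suc.prems]) simp
qed

text \<open>
  The maps \<open>kill i \<otimes> kill j\<close> with \<open>i + j = n - 1\<close> cut out the \<open>n\<close>-th term of the filtration of \<open>Q \<otimes> Q\<close>.
\<close>

lemma comult_F: "x \<in> F n \<Longrightarrow> comult Q x \<in> fil_tensor Q Q F F n"
proof -
  assume x: "x \<in> F n"
  have xQ: "x \<in> carrier Q" using x F_D(1) by auto
  have R: "tensor_map K Q Q (\<lambda>x. x) (kill n) (comult Q x) = \<zero>\<^bsub>QQ\<^esub>"
  proof (cases n)
    case 0
    then show ?thesis using x xQ kill_zero[OF one_in_F]
      by (simp add: comult_F_0 tensor_map_pure[OF linear_id kill(1) module_Q module_Q module_Q module_Q] pure_zero[OF module_Q module_Q])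
  next
    case (Suc k) then show ?thesis using comult_kill_right[of x k] x by simp
  qed
  show ?thesis
  proof (rule kernels_fil_tensor[where A = F and B = F and e = kill and e' = kill, OF module_Q module_Q F_submodule F_mono_Suc F_submodule kill kill comult_in[OF Q_pre xQ] R comult_kill_id[OF x]])
    show "tensor_map K Q Q (kill i) (kill j) (comult Q x) = \<zero>\<^bsub>QQ\<^esub>" if "Suc (i + j) = n" for i j
      by (rule comult_kill_kill) (use x that in simp)
  qed
qed

subsection \<open>The Yetter-Drinfeld structure, the multiplication and the filtration\<close>

lemma act_F_0: "h \<in> carrier H \<Longrightarrow> x \<in> F 0 \<Longrightarrow> act Q h x \<in> F 0"
proof -
  assume h: "h \<in> carrier H" and "x \<in> F 0"
  then obtain a where a: "a \<in> carrier K" "x = a \<odot>\<^bsub>Q\<^esub> \<one>\<^bsub>Q\<^esub>" by (auto simp: F_0)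
  have "act Q h x = a \<odot>\<^bsub>Q\<^esub> (counit H h \<odot>\<^bsub>Q\<^esub> \<one>\<^bsub>Q\<^esub>)"
    using linear_smult[OF act_right[OF linear_id Q_pre h] a(1) one_Q] a(2) act_one[OF h] by simp
  then show ?thesis using F_D(4) one_in_F a(1) counit_H_closed[OF h] by simp
qed

lemma act_comult:
  assumes "h \<in> carrier H" "x \<in> carrier Q"
  shows "comult Q (act Q h x) = tensor_lift K QQ (\<lambda>h1 h2. tensor_map K Q Q (act Q h1) (act Q h2) (comult Q x)) (comult H h)"
  using Q.comult_yd assms by (simp add: yd_morphism_def yd_tensor_maps tensor_map_def)

text \<open>
  \<open>\<Delta>(h x) = h\<^sub>1 x\<^sub>1 \<otimes> h\<^sub>2 x\<^sub>2\<close>, and \<open>h\<^sub>1 \<otimes> h\<^sub>2\<close> preserves \<open>Q \<otimes> Q\<^sub>n + Q\<^sub>0 \<otimes> Q\<close> by induction.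
\<close>

lemma act_F: "h \<in> carrier H \<Longrightarrow> x \<in> F n \<Longrightarrow> act Q h x \<in> F n"
proof (induction n arbitrary: h x)
  case 0 then show ?case by (rule act_F_0)
next
  case (Suc n)
  have [lin]: "h \<in> carrier H" "x \<in> carrier Q" and xS: "comult Q x \<in> S n" using Suc.prems mem_F_Suc by auto
  have m [lin]: "module K QQ" by (rule lin)+
  note [lin] = act_right[OF linear_id]
  have b: "bilinear_map K H H QQ (\<lambda>h1 h2. tensor_map K Q Q (act Q h1) (act Q h2) (comult Q x))"
    unfolding tensor_map_def by (rule lin | assumption)+
  have "tensor_lift K QQ (\<lambda>h1 h2. tensor_map K Q Q (act Q h1) (act Q h2) (comult Q x)) (comult H h) \<in> S n"
  proof (rule linear_in_submodule[OF module_H module_H m tensor_lift_linear[OF module_H module_H m b] S_submodule])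
    show "comult H h \<in> carrier (tensor_product K H H)" by (rule lin)+
    fix h1 h2 assume [lin]: "h1 \<in> carrier H" "h2 \<in> carrier H"
    have l: "linear_map K Q Q (act Q h1)" "linear_map K Q Q (act Q h2)" by (rule lin)+
    note p = tensor_map_pure[OF l module_Q module_Q module_Q module_Q]
    have "tensor_map K Q Q (act Q h1) (act Q h2) (comult Q x) \<in> S n"
    proof (rule linear_S[OF m _ S_submodule xS])
      show "linear_map K QQ QQ (tensor_map K Q Q (act Q h1) (act Q h2))" by (rule tensor_map_linear[OF linear_id l]) (rule lin)+
      show "tensor_map K Q Q (act Q h1) (act Q h2) (pure_tensor K Q Q x y) \<in> S n" if "x \<in> carrier Q" "y \<in> F n" for x y
      proof -
        have [lin]: "x \<in> carrier Q" "y \<in> carrier Q" using that F_D(1) by auto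
        show ?thesis by (subst p, (rule lin)+) (intro S_pure(1) Suc.IH that(2), (rule lin)+)
      qed
      show "tensor_map K Q Q (act Q h1) (act Q h2) (pure_tensor K Q Q x y) \<in> S n" if "x \<in> F 0" "y \<in> carrier Q" for x y
      proof -
        have [lin]: "x \<in> carrier Q" "y \<in> carrier Q" using that F_D(1) by auto
        show ?thesis by (subst p, (rule lin)+) (intro S_pure(2) act_F_0 that(1), (rule lin)+)
      qed
    qed
    then show "tensor_lift K QQ (\<lambda>h1 h2. tensor_map K Q Q (act Q h1) (act Q h2) (comult Q x)) (pure_tensor K H H h1 h2) \<in> S n"
      by (subst tensor_lift_pure[OF module_H module_H m b]) (rule lin | assumption)+
  qed
  then show ?case unfolding mem_F_Suc by (subst act_comult) (rule conjI lin | assumption)+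
qed

lemma coact_comult:
  "x \<in> carrier Q \<Longrightarrow> coact (yd_tensor K H Q Q) (comult Q x) = tensor_map K H QQ (\<lambda>h. h) (comult Q) (coact Q x)"
  using Q.comult_yd by (simp add: yd_morphism_def tensor_map_def)

text \<open>
  The argument of \<open>comult_kill_right\<close> with the coaction in place of the left factor of \<open>\<Delta>\<close>: writing
  \<open>kill (Suc n) = \<psi> (kill 0 \<otimes> kill n) \<Delta>\<close>, colinearity of \<open>\<Delta>\<close> expresses \<open>x\<^sub>-\<^sub>1 \<otimes> kill (Suc n) x\<^sub>0\<close> by the codiagonal coaction on
  \<open>\<Delta> x\<close>, whose two summands are treated by induction.
\<close>

lemma coact_F: "x \<in> F n \<Longrightarrow> coact Q x \<in> sub_tensor K H Q (carrier H) (F n)"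
proof (induction n arbitrary: x)
  case 0
  then obtain a where a: "a \<in> carrier K" "x = a \<odot>\<^bsub>Q\<^esub> \<one>\<^bsub>Q\<^esub>" by (auto simp: F_0)
  have "coact Q x = a \<odot>\<^bsub>tensor_product K H Q\<^esub> pure_tensor K H Q \<one>\<^bsub>H\<^esub> \<one>\<^bsub>Q\<^esub>"
    using linear_smult[OF Q.coact_linear a(1) one_Q] a(2) coact_one by simp
  moreover have "submodule (sub_tensor K H Q (carrier H) (F 0)) K (tensor_product K H Q)"
    by (intro sub_tensor_submodule module_H module_Q F_D(1) subset_refl)
  ultimately show ?case
    using submoduleD(4)[OF _ tensor_module[OF module_H module_Q] a(1) sub_tensor_pure[OF one_H_closed one_in_F]] by simp
next
  case (Suc n)
  obtain \<psi> where \<psi>: "linear_map K QQ Q \<psi>"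
    "\<And>x. x \<in> carrier Q \<Longrightarrow> \<psi> (tensor_map K Q Q (kill 0) (kill n) (comult Q x)) = kill (Suc n) x"
    using kill_Suc_factor[of n] by blast
  note [lin] = linear_comp[OF _ \<psi>(1)] linear_closed[OF \<psi>(1)]
  let ?HQ = "tensor_product K H Q" and ?HQQ = "tensor_product K H QQ"
  have xQ [lin]: "x \<in> carrier Q" and xS: "comult Q x \<in> S n" using Suc.prems mem_F_Suc by auto
  have m [lin]: "module K QQ" "module K ?HQ" "module K ?HQQ" by (rule lin)+
  let ?g = "\<lambda>t. \<psi> (tensor_map K Q Q (kill 0) (kill n) t)"
  have gl: "linear_map K QQ Q ?g" by (rule lin)+
  define \<Lambda> where "\<Lambda> = tensor_map K H Q (\<lambda>x. x) ?g"
  have \<Lambda>: "linear_map K ?HQQ ?HQ \<Lambda>" unfolding \<Lambda>_def by (rule tensor_map_linear) (rule lin | assumption)+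
  have \<psi>0: "\<psi> \<zero>\<^bsub>QQ\<^esub> = \<zero>\<^bsub>Q\<^esub>" by (rule linear_zero[OF m(1) module_Q \<psi>(1)])
  have \<Lambda>p: "\<Lambda> (pure_tensor K H QQ h (pure_tensor K Q Q a b)) = pure_tensor K H Q h (\<psi> (pure_tensor K Q Q (kill 0 a) (kill n b)))"
    if [lin]: "h \<in> carrier H" "a \<in> carrier Q" "b \<in> carrier Q" for h a b
    unfolding \<Lambda>_def
    apply (subst tensor_map_pure[OF linear_id gl], (rule lin | assumption)+)
    apply (subst tensor_map_pure, (rule lin | assumption)+)
    apply (rule refl)
    done
  have "tensor_map K H Q (\<lambda>x. x) (kill (Suc n)) (coact Q x) = \<Lambda> (tensor_map K H QQ (\<lambda>x. x) (comult Q) (coact Q x))"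
    unfolding \<Lambda>_def
    apply (subst tensor_map_comp[OF linear_id _ linear_id gl], (rule lin | assumption)+)
    unfolding tensor_map_def[of K H Q "\<lambda>x. x"]
    apply (rule tensor_lift_cong, (rule lin | assumption)+)
    apply (simp add: \<psi>(2))
    done
  also have "\<dots> = \<Lambda> (coact (yd_tensor K H Q Q) (comult Q x))"
    by (simp only: coact_comult[OF xQ])
  also have "\<dots> \<in> {\<zero>\<^bsub>?HQ\<^esub>}"
  proof (rule linear_S[OF m(2) _ zero_submodule[OF m(2)] xS, where f = "\<lambda>t. \<Lambda> (coact (yd_tensor K H Q Q) t)"])
    have "linear_map K QQ ?HQQ (coact (yd_tensor K H Q Q))"
      using yd_pre_tensor[OF Q_pre Q_pre] by (simp add: yd_pre_def)
    then show "linear_map K QQ ?HQ (\<lambda>t. \<Lambda> (coact (yd_tensor K H Q Q) t))" by (rule linear_comp[OF _ \<Lambda>])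
    have p: "\<Lambda> (coact (yd_tensor K H Q Q) (pure_tensor K Q Q c d)) =
        tensor_lift K ?HQ (\<lambda>g c0. tensor_lift K ?HQ
          (\<lambda>h d0. pure_tensor K H Q (g \<otimes>\<^bsub>H\<^esub> h) (\<psi> (pure_tensor K Q Q (kill 0 c0) (kill n d0)))) (coact Q d)) (coact Q c)"
      if [lin]: "c \<in> carrier Q" "d \<in> carrier Q" for c d
    proof -
      have "\<Lambda> (coact (yd_tensor K H Q Q) (pure_tensor K Q Q c d)) =
        \<Lambda> (tensor_lift K ?HQQ (\<lambda>g c0. tensor_lift K ?HQQ
          (\<lambda>h d0. pure_tensor K H QQ (g \<otimes>\<^bsub>H\<^esub> h) (pure_tensor K Q Q c0 d0)) (coact Q d)) (coact Q c))"
        by (subst coact_tensor_pure) (rule lin | rule refl)+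
      also have "\<dots> = tensor_lift K ?HQ (\<lambda>g c0. \<Lambda> (tensor_lift K ?HQQ
          (\<lambda>h d0. pure_tensor K H QQ (g \<otimes>\<^bsub>H\<^esub> h) (pure_tensor K Q Q c0 d0)) (coact Q d))) (coact Q c)"
        by (rule linear_lift_commute[OF _ _ _ _ _ \<Lambda>]) (rule lin | assumption)+
      also have "\<dots> = tensor_lift K ?HQ (\<lambda>g c0. tensor_lift K ?HQ
          (\<lambda>h d0. pure_tensor K H Q (g \<otimes>\<^bsub>H\<^esub> h) (\<psi> (pure_tensor K Q Q (kill 0 c0) (kill n d0)))) (coact Q d)) (coact Q c)"
      proof (rule tensor_lift_cong)
        show "bilinear_map K H Q ?HQ (\<lambda>g c0. \<Lambda> (tensor_lift K ?HQQ
          (\<lambda>h d0. pure_tensor K H QQ (g \<otimes>\<^bsub>H\<^esub> h) (pure_tensor K Q Q c0 d0)) (coact Q d)))"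
          by (rule linear_comp[OF _ \<Lambda>] bilinear_mapI | rule lin | assumption)+
        fix g c0 assume [lin]: "g \<in> carrier H" "c0 \<in> carrier Q"
        have "\<Lambda> (tensor_lift K ?HQQ (\<lambda>h d0. pure_tensor K H QQ (g \<otimes>\<^bsub>H\<^esub> h) (pure_tensor K Q Q c0 d0)) (coact Q d))
          = tensor_lift K ?HQ (\<lambda>h d0. \<Lambda> (pure_tensor K H QQ (g \<otimes>\<^bsub>H\<^esub> h) (pure_tensor K Q Q c0 d0))) (coact Q d)"
          by (rule linear_lift_commute[OF _ _ _ _ _ \<Lambda>]) (rule lin | assumption)+
        also have "\<dots> = tensor_lift K ?HQ (\<lambda>h d0. pure_tensor K H Q (g \<otimes>\<^bsub>H\<^esub> h) (\<psi> (pure_tensor K Q Q (kill 0 c0) (kill n d0)))) (coact Q d)"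
          apply (rule tensor_lift_cong)
               apply ((rule linear_comp[OF _ \<Lambda>] bilinear_mapI | rule lin | assumption)+)[5]
          apply (rule \<Lambda>p, (rule lin | assumption)+)
          done
        finally show "\<Lambda> (tensor_lift K ?HQQ (\<lambda>h d0. pure_tensor K H QQ (g \<otimes>\<^bsub>H\<^esub> h) (pure_tensor K Q Q c0 d0)) (coact Q d))
          = tensor_lift K ?HQ (\<lambda>h d0. pure_tensor K H Q (g \<otimes>\<^bsub>H\<^esub> h) (\<psi> (pure_tensor K Q Q (kill 0 c0) (kill n d0)))) (coact Q d)" .
      qed (rule lin)+
      finally show ?thesis .
    qed
    note z = zero_submodule[OF m(2)]
    show "\<Lambda> (coact (yd_tensor K H Q Q) (pure_tensor K Q Q c d)) \<in> {\<zero>\<^bsub>?HQ\<^esub>}" if "c \<in> carrier Q" "d \<in> F n" for c d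
    proof -
      have [lin]: "c \<in> carrier Q" "d \<in> carrier Q" using that F_D(1) by auto
      show ?thesis unfolding p[OF \<open>c \<in> carrier Q\<close> \<open>d \<in> carrier Q\<close>] singleton_iff
      proof (rule lift_zero[OF module_H module_Q m(2)])
        show "coact Q c \<in> carrier ?HQ" by (rule lin)+
        show "bilinear_map K H Q ?HQ (\<lambda>g c0. tensor_lift K ?HQ
          (\<lambda>h d0. pure_tensor K H Q (g \<otimes>\<^bsub>H\<^esub> h) (\<psi> (pure_tensor K Q Q (kill 0 c0) (kill n d0)))) (coact Q d))"
          by (rule lin | assumption)+
        fix g c0 assume 6 [lin]: "g \<in> carrier H" "c0 \<in> carrier Q"
        have "tensor_lift K ?HQ (\<lambda>h d0. pure_tensor K H Q (g \<otimes>\<^bsub>H\<^esub> h) (\<psi> (pure_tensor K Q Q (kill 0 c0) (kill n d0)))) (coact Q d) \<in> {\<zero>\<^bsub>?HQ\<^esub>}"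
        proof (rule lift_sub_tensor[OF module_H module_Q m(2) _ z subset_refl F_D(1) _ Suc.IH[OF that(2)]])
          show "bilinear_map K H Q ?HQ (\<lambda>h d0. pure_tensor K H Q (g \<otimes>\<^bsub>H\<^esub> h) (\<psi> (pure_tensor K Q Q (kill 0 c0) (kill n d0))))"
            by (rule lin | assumption)+
          show "pure_tensor K H Q (g \<otimes>\<^bsub>H\<^esub> h) (\<psi> (pure_tensor K Q Q (kill 0 c0) (kill n d0))) \<in> {\<zero>\<^bsub>?HQ\<^esub>}" if "h \<in> carrier H" "d0 \<in> F n" for h d0
            using that 6 kill_closed[OF 6(2)] \<psi>0 by (simp add: kill_zero pure_zero[OF module_Q module_Q] pure_zero[OF module_H module_Q])
        qed
        then show "tensor_lift K ?HQ (\<lambda>h d0. pure_tensor K H Q (g \<otimes>\<^bsub>H\<^esub> h) (\<psi> (pure_tensor K Q Q (kill 0 c0) (kill n d0)))) (coact Q d) = \<zero>\<^bsub>?HQ\<^esub>"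
          by simp
      qed
    qed
    show "\<Lambda> (coact (yd_tensor K H Q Q) (pure_tensor K Q Q c d)) \<in> {\<zero>\<^bsub>?HQ\<^esub>}" if "c \<in> F 0" "d \<in> carrier Q" for c d
    proof -
      have [lin]: "c \<in> carrier Q" "d \<in> carrier Q" using that F_D(1) by auto
      have c0: "coact Q c \<in> sub_tensor K H Q (carrier H) (F 0)"
      proof -
        from that(1) obtain a where a: "a \<in> carrier K" "c = a \<odot>\<^bsub>Q\<^esub> \<one>\<^bsub>Q\<^esub>" by (auto simp: F_0)
        have "coact Q c = a \<odot>\<^bsub>tensor_product K H Q\<^esub> pure_tensor K H Q \<one>\<^bsub>H\<^esub> \<one>\<^bsub>Q\<^esub>"
          using linear_smult[OF Q.coact_linear a(1) one_Q] a(2) coact_one by simp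
        moreover have "submodule (sub_tensor K H Q (carrier H) (F 0)) K (tensor_product K H Q)"
          by (intro sub_tensor_submodule module_H module_Q F_D(1) subset_refl)
        ultimately show ?thesis
          using submoduleD(4)[OF _ tensor_module[OF module_H module_Q] a(1) sub_tensor_pure[OF one_H_closed one_in_F]] by simp
      qed
      show ?thesis unfolding p[OF \<open>c \<in> carrier Q\<close> \<open>d \<in> carrier Q\<close>]
      proof (rule lift_sub_tensor[OF module_H module_Q m(2) _ z subset_refl F_D(1) _ c0])
        show "bilinear_map K H Q ?HQ (\<lambda>g c0. tensor_lift K ?HQ
          (\<lambda>h d0. pure_tensor K H Q (g \<otimes>\<^bsub>H\<^esub> h) (\<psi> (pure_tensor K Q Q (kill 0 c0) (kill n d0)))) (coact Q d))"
          by (rule lin | assumption)+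
        fix g c0 assume c0: "g \<in> carrier H" "c0 \<in> F 0"
        then have [lin]: "g \<in> carrier H" "c0 \<in> carrier Q" using F_D(1) by auto
        have "tensor_lift K ?HQ (\<lambda>h d0. pure_tensor K H Q (g \<otimes>\<^bsub>H\<^esub> h) (\<psi> (pure_tensor K Q Q (kill 0 c0) (kill n d0)))) (coact Q d) = \<zero>\<^bsub>?HQ\<^esub>"
          apply (rule lift_zero, (rule lin | assumption)+)
          using kill_zero[OF c0(2)] c0(1) \<psi>0 kill_closed by (simp add: pure_zero[OF module_Q module_Q] pure_zero[OF module_H module_Q])
        then show "tensor_lift K ?HQ (\<lambda>h d0. pure_tensor K H Q (g \<otimes>\<^bsub>H\<^esub> h) (\<psi> (pure_tensor K Q Q (kill 0 c0) (kill n d0)))) (coact Q d) \<in> {\<zero>\<^bsub>?HQ\<^esub>}"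
          by simp
      qed
    qed
  qed
  finally have "tensor_map K H Q (\<lambda>x. x) (kill (Suc n)) (coact Q x) = \<zero>\<^bsub>?HQ\<^esub>" by simp
  then show ?case using tensor_kernel_right[OF module_H module_Q F_submodule kill coact_in[OF Q_pre xQ]] by simp
qed

lemma mult_comult:
  assumes [lin]: "x \<in> carrier Q" "y \<in> carrier Q"
  shows "comult Q (x \<otimes>\<^bsub>Q\<^esub> y) = tensor_map K Q Q (mult_map K Q) (mult_map K Q) (comult (yd_tensor K H Q Q) (pure_tensor K Q Q x y))"
proof -
  have "mult_map K Q (pure_tensor K Q Q x y) = x \<otimes>\<^bsub>Q\<^esub> y"
    unfolding mult_map_def by (rule tensor_lift_pure) (rule lin | assumption)+
  moreover have "pure_tensor K Q Q x y \<in> carrier QQ" by (rule lin)+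
  ultimately show ?thesis using Q.mult_map_morphism by (auto simp: yd_coalgebra_morphism_def)
qed

lemma mult_map_linear: "linear_map K QQ Q (mult_map K Q)"
  unfolding mult_map_def by (rule tensor_lift_linear) (rule lin | assumption)+

lemma mult_map_pure: "x \<in> carrier Q \<Longrightarrow> y \<in> carrier Q \<Longrightarrow> mult_map K Q (pure_tensor K Q Q x y) = x \<otimes>\<^bsub>Q\<^esub> y"
  unfolding mult_map_def by (rule tensor_lift_pure[OF module_Q module_Q module_Q Q.product_bilinear])

lemma mult_F_0: "x \<in> F 0 \<Longrightarrow> y \<in> F 0 \<Longrightarrow> x \<otimes>\<^bsub>Q\<^esub> y \<in> F 0"
proof -
  assume "x \<in> F 0" "y \<in> F 0"
  then obtain a where a: "a \<in> carrier K" "x = a \<odot>\<^bsub>Q\<^esub> \<one>\<^bsub>Q\<^esub>" and y: "y \<in> F 0" "y \<in> carrier Q" using F_D(1) by (auto simp: F_0)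
  then have "x \<otimes>\<^bsub>Q\<^esub> y = a \<odot>\<^bsub>Q\<^esub> y"
    using linear_smult[OF bilinear_left[OF Q.product_bilinear y(2)] a(1) one_Q] Q.unit_left[OF y(2)] by simp
  then show ?thesis using F_D(4)[OF a(1) y(1)] by simp
qed

text \<open>
  \<open>\<Delta>(x y)\<close> is a sum of terms \<open>x\<^sub>1 (g y\<^sub>1) \<otimes> c y\<^sub>2\<close> with \<open>x\<^sub>1, y\<^sub>1, c, y\<^sub>2\<close> of degrees \<open>i, j, k, l\<close>, where \<open>i + k = a\<close> and \<open>j + l = b\<close>,
  because \<open>c\<close> comes from the coaction on \<open>x\<^sub>2\<close>. For \<open>i = j = 0\<close> the left factor lies in \<open>Q\<^sub>0\<close>. Otherwise \<open>k + l < a + b\<close>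
  and the right factor lies in \<open>Q\<^sub>k\<^sub>+\<^sub>l\<close> by induction on \<open>a + b\<close>. Either way \<open>x y\<close> lies in \<open>Q\<^sub>a\<^sub>+\<^sub>b\<close>.
\<close>

lemma mult_F: "x \<in> F a \<Longrightarrow> y \<in> F b \<Longrightarrow> x \<otimes>\<^bsub>Q\<^esub> y \<in> F (a + b)"
proof (induction "a + b" arbitrary: a b x y rule: less_induct)
  case less
  show ?case
  proof (cases "a + b")
    case 0 then show ?thesis using less.prems mult_F_0 by simp
  next
    case (Suc n)
    have [lin]: "x \<in> carrier Q" "y \<in> carrier Q" using less.prems F_D(1) by auto
    have m [lin]: "module K QQ" by (rule lin)+
    let ?QQQQ = "tensor_product K QQ QQ"
    have m4 [lin]: "module K ?QQQQ" by (rule lin)+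
    let ?M = "tensor_map K Q Q (mult_map K Q) (mult_map K Q)"
    have M: "linear_map K ?QQQQ QQ ?M" by (rule tensor_map_linear[OF linear_id mult_map_linear mult_map_linear]) (rule lin)+
    \<comment> \<open>It is to be shown that \<open>\<Delta> (x \<otimes> y)\<close> lies in the preimage of \<open>S n\<close> under \<open>m \<otimes> m\<close>.\<close>
    let ?N = "{t \<in> carrier ?QQQQ. ?M t \<in> S n}"
    have N: "submodule ?N K ?QQQQ" by (rule linear_vimage_submodule[OF m4 m M S_submodule])
    have base: "pure_tensor K QQ QQ (pure_tensor K Q Q x1 (act Q g y1)) (pure_tensor K Q Q c y2) \<in> ?N"
      if "x1 \<in> F i" "y1 \<in> F j" "g \<in> carrier H" "c \<in> F k" "y2 \<in> F l" "i + k = a" "j + l = b" for x1 y1 g c y2 i j k l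
    proof -
      have [lin]: "x1 \<in> carrier Q" "y1 \<in> carrier Q" "g \<in> carrier H" "c \<in> carrier Q" "y2 \<in> carrier Q" using that F_D(1) by auto
      have c: "pure_tensor K Q Q x1 (act Q g y1) \<in> carrier QQ" "pure_tensor K Q Q c y2 \<in> carrier QQ"
        by (rule lin)+
      have "?M (pure_tensor K QQ QQ (pure_tensor K Q Q x1 (act Q g y1)) (pure_tensor K Q Q c y2))
        = pure_tensor K Q Q (mult_map K Q (pure_tensor K Q Q x1 (act Q g y1))) (mult_map K Q (pure_tensor K Q Q c y2))"
        by (rule tensor_map_pure[OF mult_map_linear mult_map_linear module_Q module_Q m m c])
      also have "\<dots> = pure_tensor K Q Q (x1 \<otimes>\<^bsub>Q\<^esub> act Q g y1) (c \<otimes>\<^bsub>Q\<^esub> y2)"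
        by (subst (1 2) mult_map_pure) (rule lin refl)+
      also have "\<dots> \<in> S n"
      proof (cases "i + j = 0")
        case True
        then have "x1 \<otimes>\<^bsub>Q\<^esub> act Q g y1 \<in> F 0" using that act_F_0 mult_F_0 by simp
        then show ?thesis by (rule S_pure(2)) (rule lin)+
      next
        case False
        then have "c \<otimes>\<^bsub>Q\<^esub> y2 \<in> F (k + l)" using that by (intro less.hyps) auto
        moreover have "F (k + l) \<subseteq> F n" by (rule F_mono) (use False that Suc in auto)
        ultimately show ?thesis by (intro S_pure(1)) (rule lin | blast)+
      qed
      finally show ?thesis using pure_closed[OF m m c] by simp
    qed
    have "comult (yd_tensor K H Q Q) (pure_tensor K Q Q x y) \<in> ?N"
    proof (subst comult_tensor_pure, (rule lin)+,
        rule linear_fil_tensor[OF module_Q module_Q m4 tensor_lift_linear[OF module_Q module_Q m4] N F_D(1) F_D(1) _ comult_F[OF less.prems(1)]])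
      show b1: "bilinear_map K Q Q ?QQQQ (\<lambda>c1 c2. tensor_lift K ?QQQQ (\<lambda>d1 d2. tensor_lift K ?QQQQ
        (\<lambda>g y. pure_tensor K QQ QQ (pure_tensor K Q Q c1 (act Q g d1)) (pure_tensor K Q Q y d2))
        (coact Q c2)) (comult Q y))"
        by (rule lin | assumption)+
      fix i k x1 x2 assume x12: "x1 \<in> F i" "x2 \<in> F k" "i + k = a"
      then have [lin]: "x1 \<in> carrier Q" "x2 \<in> carrier Q" using F_D(1) by auto
      have "tensor_lift K ?QQQQ (\<lambda>d1 d2. tensor_lift K ?QQQQ
        (\<lambda>g y. pure_tensor K QQ QQ (pure_tensor K Q Q x1 (act Q g d1)) (pure_tensor K Q Q y d2))
        (coact Q x2)) (comult Q y) \<in> ?N"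
      proof (rule linear_fil_tensor[OF module_Q module_Q m4 tensor_lift_linear[OF module_Q module_Q m4] N F_D(1) F_D(1) _ comult_F[OF less.prems(2)]])
        show b2: "bilinear_map K Q Q ?QQQQ (\<lambda>d1 d2. tensor_lift K ?QQQQ
          (\<lambda>g y. pure_tensor K QQ QQ (pure_tensor K Q Q x1 (act Q g d1)) (pure_tensor K Q Q y d2)) (coact Q x2))"
          by (rule lin | assumption)+
        fix j l y1 y2 assume y12: "y1 \<in> F j" "y2 \<in> F l" "j + l = b"
        then have [lin]: "y1 \<in> carrier Q" "y2 \<in> carrier Q" using F_D(1) by auto
        have "tensor_lift K ?QQQQ (\<lambda>g y. pure_tensor K QQ QQ (pure_tensor K Q Q x1 (act Q g y1)) (pure_tensor K Q Q y y2)) (coact Q x2) \<in> ?N"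
        proof (rule lift_sub_tensor[OF module_H module_Q m4 _ N subset_refl F_D(1) _ coact_F[OF x12(2)]])
          show "bilinear_map K H Q ?QQQQ (\<lambda>g y. pure_tensor K QQ QQ (pure_tensor K Q Q x1 (act Q g y1)) (pure_tensor K Q Q y y2))"
            by (rule lin | assumption)+
        qed (use base x12 y12 in blast)
        then show "tensor_lift K ?QQQQ (\<lambda>d1 d2. tensor_lift K ?QQQQ
          (\<lambda>g y. pure_tensor K QQ QQ (pure_tensor K Q Q x1 (act Q g d1)) (pure_tensor K Q Q y d2)) (coact Q x2)) (pure_tensor K Q Q y1 y2) \<in> ?N"
          by (subst tensor_lift_pure[OF module_Q module_Q m4 b2]) (rule lin | assumption)+
      qed
      then show "tensor_lift K ?QQQQ (\<lambda>c1 c2. tensor_lift K ?QQQQ (\<lambda>d1 d2. tensor_lift K ?QQQQ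
        (\<lambda>g y. pure_tensor K QQ QQ (pure_tensor K Q Q c1 (act Q g d1)) (pure_tensor K Q Q y d2))
        (coact Q c2)) (comult Q y)) (pure_tensor K Q Q x1 x2) \<in> ?N"
        by (subst tensor_lift_pure[OF module_Q module_Q m4 b1]) (rule lin | assumption)+
    qed
    then have "comult Q (x \<otimes>\<^bsub>Q\<^esub> y) \<in> S n" by (subst mult_comult) (rule lin | simp)+
    moreover have "x \<otimes>\<^bsub>Q\<^esub> y \<in> carrier Q" by (rule lin)+
    ultimately show ?thesis unfolding Suc mem_F_Suc by simp
  qed
qed

end

section \<open>The associated graded structure\<close>

context vector_spaces
begin

lemma direct_sum_simps:
  "carrier (direct_sum M) = {f. (\<forall>n. f n \<in> carrier (M n)) \<and> finite {n. f n \<noteq> \<zero>\<^bsub>M n\<^esub>}}"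
  "zero (direct_sum M) = (\<lambda>n. \<zero>\<^bsub>M n\<^esub>)" "add (direct_sum M) = (\<lambda>f g n. f n \<oplus>\<^bsub>M n\<^esub> g n)"
  "smult (direct_sum M) = (\<lambda>a f n. a \<odot>\<^bsub>M n\<^esub> f n)"
  by (simp_all add: direct_sum_def)

lemma direct_sum_module:
  assumes m: "\<And>n. module K (M n)" shows "module K (direct_sum M)"
proof -
  note ag = module.axioms(2)[OF m]
  note am = abelian_group.axioms(1)[OF ag]
  have add: "(\<lambda>n. f n \<oplus>\<^bsub>M n\<^esub> g n) \<in> carrier (direct_sum M)" if "f \<in> carrier (direct_sum M)" "g \<in> carrier (direct_sum M)" for f g
  proof -
    have "{n. f n \<oplus>\<^bsub>M n\<^esub> g n \<noteq> \<zero>\<^bsub>M n\<^esub>} \<subseteq> {n. f n \<noteq> \<zero>\<^bsub>M n\<^esub>} \<union> {n. g n \<noteq> \<zero>\<^bsub>M n\<^esub>}"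
      using abelian_monoid.l_zero[OF am] abelian_monoid.zero_closed[OF am] by auto
    then show ?thesis using that abelian_monoid.a_closed[OF am] by (auto simp: direct_sum_simps intro: finite_subset)
  qed
  have smult: "(\<lambda>n. a \<odot>\<^bsub>M n\<^esub> f n) \<in> carrier (direct_sum M)" if "a \<in> carrier K" "f \<in> carrier (direct_sum M)" for a f
  proof -
    have "{n. a \<odot>\<^bsub>M n\<^esub> f n \<noteq> \<zero>\<^bsub>M n\<^esub>} \<subseteq> {n. f n \<noteq> \<zero>\<^bsub>M n\<^esub>}"
      using module.smult_r_null[OF m that(1)] by auto
    then show ?thesis using that module.smult_closed[OF m] by (auto simp: direct_sum_simps intro: finite_subset)
  qed
  show ?thesis
  proof (rule moduleI)
    show "abelian_group (direct_sum M)"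
    proof (rule abelian_groupI)
      fix f assume f: "f \<in> carrier (direct_sum M)"
      show "\<exists>g\<in>carrier (direct_sum M). g \<oplus>\<^bsub>direct_sum M\<^esub> f = \<zero>\<^bsub>direct_sum M\<^esub>"
      proof (rule bexI)
        show "(\<lambda>n. (\<ominus>\<^bsub>K\<^esub> \<one>\<^bsub>K\<^esub>) \<odot>\<^bsub>M n\<^esub> f n) \<in> carrier (direct_sum M)" by (rule smult[OF _ f]) simp
        show "(\<lambda>n. (\<ominus>\<^bsub>K\<^esub> \<one>\<^bsub>K\<^esub>) \<odot>\<^bsub>M n\<^esub> f n) \<oplus>\<^bsub>direct_sum M\<^esub> f = \<zero>\<^bsub>direct_sum M\<^esub>"
          using f module.smult_l_minus[OF m] module.smult_one[OF m] abelian_group.l_neg[OF ag]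
          by (auto simp: direct_sum_simps)
      qed
    next
      fix f g assume "f \<in> carrier (direct_sum M)" "g \<in> carrier (direct_sum M)"
      then show "f \<oplus>\<^bsub>direct_sum M\<^esub> g = g \<oplus>\<^bsub>direct_sum M\<^esub> f"
        by (simp add: direct_sum_simps abelian_monoid.a_comm[OF am])
    qed (use add abelian_monoid.zero_closed[OF am] abelian_monoid.a_assoc[OF am]
        abelian_monoid.l_zero[OF am] in \<open>auto simp: direct_sum_simps\<close>)
  qed (use smult module.smult_l_distr[OF m] module.smult_r_distr[OF m] module.smult_assoc1[OF m] module.smult_one[OF m]
      K.is_cring in \<open>auto simp: direct_sum_simps\<close>)
qed

lemma direct_sum_eval: "linear_map K (direct_sum M) (M n) (\<lambda>f. f n)"
  by (rule linear_mapI) (auto simp: direct_sum_simps)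

lemma linear_into_direct_sum:
  assumes "\<And>n. linear_map K X (M n) (c n)" "\<And>x. x \<in> carrier X \<Longrightarrow> finite {n. c n x \<noteq> \<zero>\<^bsub>M n\<^esub>}"
  shows "linear_map K X (direct_sum M) (\<lambda>x n. c n x)"
  by (rule linear_mapI)
    (use assms(2) linear_closed[OF assms(1)] linear_add[OF assms(1)] linear_smult[OF assms(1)] in \<open>auto simp: direct_sum_simps\<close>)

lemma linear_from_direct_sum:
  assumes m: "\<And>n. module K (M n)" "module K U" and c: "\<And>n. linear_map K (M n) U (c n)"
  shows "linear_map K (direct_sum M) U (\<lambda>f. \<Oplus>\<^bsub>U\<^esub>n\<in>{n. f n \<noteq> \<zero>\<^bsub>M n\<^esub>}. c n (f n))"
proof -
  interpret U: module K U by fact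
  interpret D: module K "direct_sum M" by (rule direct_sum_module[OF m(1)])
  let ?L = "\<lambda>f. \<Oplus>\<^bsub>U\<^esub>n\<in>{n. f n \<noteq> \<zero>\<^bsub>M n\<^esub>}. c n (f n)"
  have c0: "c n \<zero>\<^bsub>M n\<^esub> = \<zero>\<^bsub>U\<^esub>" for n by (rule linear_zero[OF m c])
  have cU: "c n (f n) \<in> carrier U" if "f \<in> carrier (direct_sum M)" for f n
    using that linear_closed[OF c] by (auto simp: direct_sum_simps)
  have sup: "?L f = (\<Oplus>\<^bsub>U\<^esub>n\<in>T. c n (f n))" if "f \<in> carrier (direct_sum M)" "finite T" "{n. f n \<noteq> \<zero>\<^bsub>M n\<^esub>} \<subseteq> T" for f T
    by (rule U.add.finprod_mono_neutral_cong_left[OF that(2,3)]) (use c0 cU[OF that(1)] in auto)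
  have lin: "linear_map K (direct_sum M) U (\<lambda>f. \<Oplus>\<^bsub>U\<^esub>n\<in>T. c n (f n))" if "finite T" for T
    by (rule linear_finsum_maps[OF direct_sum_module[OF m(1)] m(2) that]) (rule linear_comp[OF direct_sum_eval c])
  have fin: "finite {n. f n \<noteq> \<zero>\<^bsub>M n\<^esub>}" if "f \<in> carrier (direct_sum M)" for f using that by (auto simp: direct_sum_simps)
  show ?thesis
  proof (rule linear_mapI)
    fix f g assume fg: "f \<in> carrier (direct_sum M)" "g \<in> carrier (direct_sum M)"
    let ?T = "{n. f n \<noteq> \<zero>\<^bsub>M n\<^esub>} \<union> {n. g n \<noteq> \<zero>\<^bsub>M n\<^esub>} \<union> {n. (f \<oplus>\<^bsub>direct_sum M\<^esub> g) n \<noteq> \<zero>\<^bsub>M n\<^esub>}"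
    have T: "finite ?T" using fin fg D.a_closed[OF fg] by auto
    show "?L (f \<oplus>\<^bsub>direct_sum M\<^esub> g) = ?L f \<oplus>\<^bsub>U\<^esub> ?L g"
      unfolding sup[OF fg(1) T, OF Un_upper1[THEN subset_trans, OF Un_upper1]]
      using linear_add[OF lin[OF T] fg] sup[OF fg(1) T] sup[OF fg(2) T] sup[OF D.a_closed[OF fg] T] by (auto simp: subset_iff)
  next
    fix a f assume af: "a \<in> carrier K" "f \<in> carrier (direct_sum M)"
    let ?T = "{n. f n \<noteq> \<zero>\<^bsub>M n\<^esub>} \<union> {n. (a \<odot>\<^bsub>direct_sum M\<^esub> f) n \<noteq> \<zero>\<^bsub>M n\<^esub>}"
    have T: "finite ?T" using fin af D.smult_closed[OF af] by auto
    show "?L (a \<odot>\<^bsub>direct_sum M\<^esub> f) = a \<odot>\<^bsub>U\<^esub> ?L f"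
      using linear_smult[OF lin[OF T] af] sup[OF af(2) T] sup[OF D.smult_closed[OF af] T] by (auto simp: subset_iff)
  qed (use cU in \<open>auto intro!: U.finsum_closed\<close>)
qed

lemma direct_sum_induct:
  assumes m: "\<And>n. module K (M n)" and f: "f \<in> carrier (direct_sum M)" and 0: "P \<zero>\<^bsub>direct_sum M\<^esub>"
    and step: "\<And>g n x. g \<in> carrier (direct_sum M) \<Longrightarrow> P g \<Longrightarrow> x \<in> carrier (M n) \<Longrightarrow>
      P (g \<oplus>\<^bsub>direct_sum M\<^esub> (\<lambda>i. if i = n then x else \<zero>\<^bsub>M i\<^esub>))"
  shows "P f"
proof -
  note am = abelian_group.axioms(1)[OF module.axioms(2)[OF m]]
  have "finite {n. f n \<noteq> \<zero>\<^bsub>M n\<^esub>}" using f by (auto simp: direct_sum_simps)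
  then show ?thesis using f
  proof (induction "{n. f n \<noteq> \<zero>\<^bsub>M n\<^esub>}" arbitrary: f rule: finite_induct)
    case empty
    then have "f = \<zero>\<^bsub>direct_sum M\<^esub>" by (auto simp: direct_sum_simps)
    then show ?case using 0 by simp
  next
    case (insert n S)
    let ?g = "f(n := \<zero>\<^bsub>M n\<^esub>)"
    have S: "S = {n. ?g n \<noteq> \<zero>\<^bsub>M n\<^esub>}" using insert.hyps(2,4) by auto
    have fn: "f n \<in> carrier (M n)" for n using insert.prems by (auto simp: direct_sum_simps)
    have g: "?g \<in> carrier (direct_sum M)"
      using fn insert.hyps(1) S abelian_monoid.zero_closed[OF am] by (auto simp: direct_sum_simps)
    have "?g \<oplus>\<^bsub>direct_sum M\<^esub> (\<lambda>i. if i = n then f n else \<zero>\<^bsub>M i\<^esub>) = f"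
      using fn abelian_monoid.l_zero[OF am] abelian_monoid.r_zero[OF am] by (auto simp: direct_sum_simps)
    with step[OF g insert.hyps(3)[OF S g] fn[of n]] show ?case by simp
  qed
qed

lemma coset_rep:
  assumes "module K V" "submodule N K V" "X \<in> carrier (quotient_module V N)"
  shows "coset_rep X \<in> carrier V" "N +>\<^bsub>V\<^esub> coset_rep X = X"
proof -
  obtain x where x: "x \<in> carrier V" "X = N +>\<^bsub>V\<^esub> x" using assms(3) by (auto simp: quotient_simps)
  then have "coset_rep X \<in> X" using coset_self[OF assms(1,2)] someI[of "\<lambda>y. y \<in> X"] by (auto simp: coset_rep_def)
  then show 1: "coset_rep X \<in> carrier V" using coset_subset[OF assms(1,2)] x by auto
  show "N +>\<^bsub>V\<^esub> coset_rep X = X"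
    using coset_eq_iff[OF assms(1,2) 1 x(1)] mem_coset[OF assms(1,2) x(1) 1] \<open>coset_rep X \<in> X\<close> x(2) by auto
qed

lemma quotient_lift:
  assumes m: "module K V" "submodule N K V" "module K U" and D: "linear_map K V U D" "\<And>x. x \<in> N \<Longrightarrow> D x = \<zero>\<^bsub>U\<^esub>"
  shows "linear_map K (quotient_module V N) U (\<lambda>X. D (coset_rep X))"
    and "x \<in> carrier V \<Longrightarrow> D (coset_rep (N +>\<^bsub>V\<^esub> x)) = D x"
proof -
  interpret V: module K V by fact
  interpret U: module K U by fact
  note pl = quotient_proj_linear[OF m(1,2)]
  have eq: "D (coset_rep (N +>\<^bsub>V\<^esub> x)) = D x" if x: "x \<in> carrier V" for x
  proof -
    have r: "coset_rep (N +>\<^bsub>V\<^esub> x) \<in> carrier V" "N +>\<^bsub>V\<^esub> coset_rep (N +>\<^bsub>V\<^esub> x) = N +>\<^bsub>V\<^esub> x"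
      using coset_rep[OF m(1,2) linear_closed[OF pl x]] by auto
    then have "coset_rep (N +>\<^bsub>V\<^esub> x) \<ominus>\<^bsub>V\<^esub> x \<in> N" using coset_eq_iff[OF m(1,2) r(1) x] by simp
    then show ?thesis using D(2) linear_minus[OF m(1,3) D(1) r(1) x]
        diff_add_cancel(2)[OF m(3) linear_closed[OF D(1) r(1)] linear_closed[OF D(1) x]] by simp
  qed
  then show "x \<in> carrier V \<Longrightarrow> D (coset_rep (N +>\<^bsub>V\<^esub> x)) = D x" .
  show "linear_map K (quotient_module V N) U (\<lambda>X. D (coset_rep X))"
  proof (rule linear_mapI)
    fix X assume "X \<in> carrier (quotient_module V N)"
    then show "D (coset_rep X) \<in> carrier U" using coset_rep[OF m(1,2)] linear_closed[OF D(1)] by auto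
  next
    fix X Y assume "X \<in> carrier (quotient_module V N)" "Y \<in> carrier (quotient_module V N)"
    then obtain x y where *: "x \<in> carrier V" "X = N +>\<^bsub>V\<^esub> x" "y \<in> carrier V" "Y = N +>\<^bsub>V\<^esub> y" by (auto simp: quotient_simps)
    have "D (coset_rep (X \<oplus>\<^bsub>quotient_module V N\<^esub> Y)) = D (coset_rep (N +>\<^bsub>V\<^esub> (x \<oplus>\<^bsub>V\<^esub> y)))"
      using linear_add[OF pl *(1,3)] *(2,4) by simp
    then show "D (coset_rep (X \<oplus>\<^bsub>quotient_module V N\<^esub> Y)) = D (coset_rep X) \<oplus>\<^bsub>U\<^esub> D (coset_rep Y)"
      using * by (simp add: eq linear_add[OF D(1)])
  next
    fix a X assume "a \<in> carrier K" "X \<in> carrier (quotient_module V N)"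
    then obtain x where *: "a \<in> carrier K" "x \<in> carrier V" "X = N +>\<^bsub>V\<^esub> x" by (auto simp: quotient_simps)
    have "D (coset_rep (a \<odot>\<^bsub>quotient_module V N\<^esub> X)) = D (coset_rep (N +>\<^bsub>V\<^esub> (a \<odot>\<^bsub>V\<^esub> x)))"
      using linear_smult[OF pl *(1,2)] *(3) by simp
    then show "D (coset_rep (a \<odot>\<^bsub>quotient_module V N\<^esub> X)) = a \<odot>\<^bsub>U\<^esub> D (coset_rep X)"
      using * by (simp add: eq linear_smult[OF D(1)])
  qed
qed

lemma tensor_rel_finsum:
  assumes F: "filtered_symbols V G R" "filtered_symbols W G' R'" and "finite A"
    "\<And>i. i \<in> A \<Longrightarrow> tensor_rel V G R W G' R' n (f i) (g i)"
  shows "tensor_rel V G R W G' R' n (\<Oplus>\<^bsub>tensor_product K V W\<^esub>i\<in>A. f i) (\<Oplus>\<^bsub>tensor_product K G G'\<^esub>i\<in>A. g i)"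
proof -
  note D1 = filtered_symbolsD[OF F(1)] and D2 = filtered_symbolsD[OF F(2)]
  interpret T: module K "tensor_product K V W" by (rule tensor_module[OF D1(1) D2(1)])
  interpret S: module K "tensor_product K G G'" by (rule tensor_module[OF D1(2) D2(2)])
  note c = tensor_rel_carrier[OF F]
  show ?thesis using assms(3,4)
  proof (induction A rule: finite_induct)
    case empty then show ?case using tensor_rel_zero by simp
  next
    case (insert i A)
    have r: "tensor_rel V G R W G' R' n (f j) (g j)" if "j = i \<or> j \<in> A" for j using insert.prems that by auto
    have "f j \<in> carrier (tensor_product K V W) \<and> g j \<in> carrier (tensor_product K G G')" if "j = i \<or> j \<in> A" for j
      using c[OF r[OF that]] by simp
    then have "f \<in> A \<rightarrow> carrier (tensor_product K V W)" "f i \<in> carrier (tensor_product K V W)"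
      "g \<in> A \<rightarrow> carrier (tensor_product K G G')" "g i \<in> carrier (tensor_product K G G')" by auto
    then show ?case using insert.hyps(1,2) insert.IH r by (simp add: tensor_rel_add)
  qed
qed

lemma tensor_rel_smult:
  assumes F: "filtered_symbols V G R" "filtered_symbols W G' R'"
    and sm: "\<And>n x g. R n x g \<Longrightarrow> R n (a \<odot>\<^bsub>V\<^esub> x) (a \<odot>\<^bsub>G\<^esub> g)" and a: "a \<in> carrier K"
    and t: "tensor_rel V G R W G' R' n t s"
  shows "tensor_rel V G R W G' R' n (a \<odot>\<^bsub>tensor_product K V W\<^esub> t) (a \<odot>\<^bsub>tensor_product K G G'\<^esub> s)"
proof -
  note D1 = filtered_symbolsD[OF F(1)] and D2 = filtered_symbolsD[OF F(2)]
  interpret T: module K "tensor_product K V W" by (rule tensor_module[OF D1(1) D2(1)])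
  interpret S: module K "tensor_product K G G'" by (rule tensor_module[OF D1(2) D2(2)])
  show ?thesis using t
  proof induction
    case tensor_rel_zero then show ?case using a tensor_rel.tensor_rel_zero by simp
  next
    case (tensor_rel_pure b x g c y h)
    note c = D1(3,4)[OF tensor_rel_pure(1)] D2(3,4)[OF tensor_rel_pure(2)]
    show ?case
      unfolding linear_smult[OF bilinear_left[OF pure_bilinear[OF D1(1) D2(1)] c(3)] a c(1), symmetric]
        linear_smult[OF bilinear_left[OF pure_bilinear[OF D1(2) D2(2)] c(4)] a c(2), symmetric]
      by (rule tensor_rel.tensor_rel_pure) (rule sm tensor_rel_pure)+
  next
    case (tensor_rel_add s s' t t')
    then show ?case using a tensor_rel_carrier[OF F]
      by (simp add: T.smult_r_distr S.smult_r_distr tensor_rel.tensor_rel_add)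
  qed
qed

end

context connected_coquasi
begin

abbreviation B where "B \<equiv> corad_below K Q"
abbreviation M where "M n \<equiv> Q\<lparr>carrier := F n\<rparr>"
abbreviation C where "C \<equiv> gr_component K Q"
abbreviation G where "G \<equiv> gr K H Q"
abbreviation cls where "cls \<equiv> gr_class K Q"

subsection \<open>Components and classes\<close>

lemma B_simps: "B 0 = {\<zero>\<^bsub>Q\<^esub>}" "B (Suc n) = F n"
  by (simp_all add: corad_below_def)

lemma B_submodule: "submodule (B n) K Q"
  by (cases n) (simp_all add: B_simps zero_submodule[OF module_Q] F_submodule)

lemmas B_D = submoduleD[OF B_submodule module_Q]

lemma B_F: "B n \<subseteq> F n"
  by (cases n) (use F_D(2)[of 0] F_mono_Suc in \<open>auto simp: B_simps\<close>)

lemma F_B: "m < n \<Longrightarrow> F m \<subseteq> B n"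
  by (cases n) (simp_all add: B_simps F_mono)

lemma M_module: "module K (M n)"
  by (rule submodule.submodule_is_module[OF F_submodule module_Q])

lemma B_submodule_M: "submodule (B n) K (M n)"
  by (rule submodule_criterion[OF M_module]) (use B_D B_F in auto)

lemma linear_M: "linear_map K Q U f \<Longrightarrow> linear_map K (M n) U f"
  using F_D(1) unfolding linear_map_def by (auto simp: Pi_iff subset_iff)

lemma C_def: "C n = quotient_module (M n) (B n)"
  by (simp add: gr_component_def)

lemma C_module: "module K (C n)"
  unfolding C_def by (rule quotient_module[OF M_module B_submodule_M])

lemma C_zero: "\<zero>\<^bsub>C n\<^esub> = B n"
  by (simp add: C_def quotient_simps)

lemma C_proj: "linear_map K (M n) (C n) (\<lambda>x. B n +>\<^bsub>Q\<^esub> x)"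
  using quotient_proj_linear[OF M_module B_submodule_M, of n] by (simp add: C_def coset_carrier_update)

lemma coset_zero_iff: "x \<in> F n \<Longrightarrow> B n +>\<^bsub>Q\<^esub> x = \<zero>\<^bsub>C n\<^esub> \<longleftrightarrow> x \<in> B n"
  using coset_eq_self_iff[OF M_module B_submodule_M, of x n] by (simp add: C_zero coset_carrier_update)

lemma rep_C:
  assumes "X \<in> carrier (C n)" shows "coset_rep X \<in> F n" "B n +>\<^bsub>Q\<^esub> coset_rep X = X"
  using coset_rep[OF M_module B_submodule_M, of X n] assms by (simp_all add: C_def coset_carrier_update)

lemma C_lift:
  assumes "module K U" "linear_map K (M n) U D" "\<And>x. x \<in> B n \<Longrightarrow> D x = \<zero>\<^bsub>U\<^esub>"
  shows "linear_map K (C n) U (\<lambda>X. D (coset_rep X))"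
    and "x \<in> F n \<Longrightarrow> D (coset_rep (B n +>\<^bsub>Q\<^esub> x)) = D x"
  using quotient_lift[OF M_module B_submodule_M assms] by (simp_all add: C_def coset_carrier_update)

lemma gr_module_def': "gr_module K Q = direct_sum C"
  by (simp add: gr_module_def)

lemma G_simps: "carrier G = carrier (direct_sum C)" "zero G = zero (direct_sum C)" "add G = add (direct_sum C)"
  "smult G = smult (direct_sum C)"
  by (simp_all add: gr_def Let_def gr_module_def')

lemma G_module [lin]: "module K G"
  by (rule module_cong[OF direct_sum_module[OF C_module]]) (simp_all add: G_simps)

sublocale Gm: module K G by (rule G_module)

lemma G_linear_simps:
  "linear_map K (direct_sum C) W = linear_map K G W" "linear_map K W (direct_sum C) = linear_map K W G"
  by (rule linear_map_cong_record; simp add: G_simps)+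

lemma G_product_simps:
  "tensor_product K (gr_module K Q) W = tensor_product K G W" "tensor_product K W (gr_module K Q) = tensor_product K W G"
  "pure_tensor K (gr_module K Q) W = pure_tensor K G W" "pure_tensor K W (gr_module K Q) = pure_tensor K W G"
  by (rule tensor_product_cong; simp add: G_simps gr_module_def')+

lemma G_eval: "linear_map K G (C n) (\<lambda>f. f n)"
  using direct_sum_eval[of C n] by (simp add: G_linear_simps)

lemma linear_into_G:
  assumes "\<And>n. linear_map K X (C n) (c n)" "\<And>x. x \<in> carrier X \<Longrightarrow> finite {n. c n x \<noteq> \<zero>\<^bsub>C n\<^esub>}"
  shows "linear_map K X G (\<lambda>x n. c n x)"
  using linear_into_direct_sum[where M = C, OF assms] by (simp add: G_linear_simps)

lemma cls_linear: "linear_map K (M n) G (cls n)"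
proof -
  have "linear_map K (M n) G (\<lambda>x i. if i = n then B n +>\<^bsub>Q\<^esub> x else \<zero>\<^bsub>C i\<^esub>)"
  proof (rule linear_into_G)
    show "linear_map K (M n) (C i) (\<lambda>x. if i = n then B n +>\<^bsub>Q\<^esub> x else \<zero>\<^bsub>C i\<^esub>)" for i
      using C_proj[of n] linear_const_zero[OF C_module] by (cases "i = n") simp_all
    show "finite {i. (if i = n then B n +>\<^bsub>Q\<^esub> x else \<zero>\<^bsub>C i\<^esub>) \<noteq> \<zero>\<^bsub>C i\<^esub>}" for x
      by (rule finite_subset[of _ "{n}"]) auto
  qed
  then show ?thesis unfolding gr_class_def[abs_def] .
qed

lemma cls_closed: "x \<in> F n \<Longrightarrow> cls n x \<in> carrier G"
  using linear_closed[OF cls_linear] by simp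

lemma cls_add: "x \<in> F n \<Longrightarrow> y \<in> F n \<Longrightarrow> cls n (x \<oplus>\<^bsub>Q\<^esub> y) = cls n x \<oplus>\<^bsub>G\<^esub> cls n y"
  using linear_add[OF cls_linear, of x n y] by simp

lemma cls_smult: "a \<in> carrier K \<Longrightarrow> x \<in> F n \<Longrightarrow> cls n (a \<odot>\<^bsub>Q\<^esub> x) = a \<odot>\<^bsub>G\<^esub> cls n x"
  using linear_smult[OF cls_linear, of a x n] by simp

lemma cls_eq_zero: "x \<in> B n \<Longrightarrow> cls n x = \<zero>\<^bsub>G\<^esub>"
proof -
  assume x: "x \<in> B n"
  then have "x \<in> F n" using B_F by blast
  then show ?thesis using coset_zero_iff[of x n] x by (simp add: gr_class_def G_simps direct_sum_simps fun_eq_iff)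
qed

lemma cls_apply: "cls n x n = B n +>\<^bsub>Q\<^esub> x" "i \<noteq> n \<Longrightarrow> cls n x i = \<zero>\<^bsub>C i\<^esub>"
  by (simp_all add: gr_class_def)

lemma G_component: "f \<in> carrier G \<Longrightarrow> f n \<in> carrier (C n)"
  by (auto simp: G_simps direct_sum_simps)

lemma G_rep: "f \<in> carrier G \<Longrightarrow> coset_rep (f n) \<in> F n" "f \<in> carrier G \<Longrightarrow> B n +>\<^bsub>Q\<^esub> coset_rep (f n) = f n"
  using rep_C[OF G_component] by auto

definition grel :: "nat \<Rightarrow> 'q \<Rightarrow> (nat \<Rightarrow> 'q set) \<Rightarrow> bool"
  where "grel n x g \<longleftrightarrow> x \<in> F n \<and> g = cls n x"

lemma grelI: "x \<in> F n \<Longrightarrow> grel n x (cls n x)"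
  by (simp add: grel_def)

lemma filtered_G [rel]: "filtered_symbols Q G grel"
proof -
  \<comment> \<open>The projections are arbitrary linear extensions of the class maps from \<open>Q\<^sub>n\<close> to \<open>Q\<close>.\<close>
  have "\<exists>p. linear_map K Q G p \<and> (\<forall>x\<in>F n. p x = cls n x)" for n
    by (rule linear_extend[OF module_Q G_module F_submodule cls_linear[of n]]) blast
  then obtain P where P: "\<And>n. linear_map K Q G (P n)" "\<And>n x. x \<in> F n \<Longrightarrow> P n x = cls n x" by metis
  have proj: "symbol_projections Q G grel P"
    unfolding symbol_projections_def grel_def
  proof (intro conjI allI impI P(1))
    fix n x g assume x: "x \<in> F n \<and> g = cls n x"
    then show "P n x = g" using P(2) by simp
    fix m assume "n < m"
    then have "x \<in> B m" using F_B x by blast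
    then show "P m x = \<zero>\<^bsub>G\<^esub>" using P(2)[of x m] B_F cls_eq_zero by auto
  qed
  show ?thesis
  proof (rule filtered_symbolsI[OF module_Q G_module _ _ _ _ proj])
    show "grel n \<zero>\<^bsub>Q\<^esub> \<zero>\<^bsub>G\<^esub>" for n
      using F_D(2)[of n] cls_eq_zero[OF B_D(2), of n] by (simp add: grel_def)
    show "grel n (x \<oplus>\<^bsub>Q\<^esub> y) (g \<oplus>\<^bsub>G\<^esub> h)" if "grel n x g" "grel n y h" for n x g y h
      using that F_D(3)[of x n y] cls_add by (simp add: grel_def)
    let ?X = "{g. \<exists>n x. grel n x g}"
    have X: "?X \<subseteq> carrier G" using cls_closed by (auto simp: grel_def)
    note D = submoduleD[OF hull_submodule[OF G_module X] G_module]
    show "carrier G \<subseteq> subspace_hull K G ?X"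
    proof
      fix f assume "f \<in> carrier G"
      then have "f \<in> carrier (direct_sum C)" by (simp add: G_simps)
      then show "f \<in> subspace_hull K G ?X"
      proof (rule direct_sum_induct[OF C_module, where P = "\<lambda>f. f \<in> subspace_hull K G ?X"])
        show "\<zero>\<^bsub>direct_sum C\<^esub> \<in> subspace_hull K G ?X" using D(2) by (simp add: G_simps)
        fix g n x assume "g \<in> subspace_hull K G ?X" "x \<in> carrier (C n)"
        moreover have "(\<lambda>i. if i = n then x else \<zero>\<^bsub>C i\<^esub>) = cls n (coset_rep x)"
          using rep_C[OF \<open>x \<in> carrier (C n)\<close>] by (auto simp: gr_class_def intro!: ext)
        moreover have "cls n (coset_rep x) \<in> subspace_hull K G ?X"
          by (rule subsetD[OF hull_subset]) (use rep_C[OF \<open>x \<in> carrier (C n)\<close>] grelI in blast)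
        ultimately show "g \<oplus>\<^bsub>direct_sum C\<^esub> (\<lambda>i. if i = n then x else \<zero>\<^bsub>C i\<^esub>) \<in> subspace_hull K G ?X"
          using D(3) by (simp add: G_simps)
      qed
    qed
  qed (use F_D(1) cls_closed in \<open>auto simp: grel_def\<close>)
qed

lemma gr_support_eq: "gr_support K Q f = {n. f n \<noteq> \<zero>\<^bsub>C n\<^esub>}"
  by (simp add: gr_support_def)

text \<open>
  Maps out of \<open>gr Q\<close> are glued from maps \<open>D n\<close> on \<open>Q\<close> that vanish on \<open>Q\<^sub>n\<^sub>-\<^sub>1\<close>; on classes of degree \<open>n\<close> they have the expected
  value.
\<close>

lemma gr_lift:
  assumes U: "module K U" and D: "\<And>n. linear_map K Q U (D n)" "\<And>n x. x \<in> B n \<Longrightarrow> D n x = \<zero>\<^bsub>U\<^esub>"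
  shows "linear_map K G U (\<lambda>f. \<Oplus>\<^bsub>U\<^esub>n\<in>gr_support K Q f. D n (coset_rep (f n)))"
    and "x \<in> F n \<Longrightarrow> (\<Oplus>\<^bsub>U\<^esub>i\<in>gr_support K Q (cls n x). D i (coset_rep (cls n x i))) = D n x"
proof -
  interpret U: module K U by fact
  have l1: "linear_map K (C n) U (\<lambda>X. D n (coset_rep X))" for n
    by (rule C_lift(1)[OF U linear_M[OF D(1)] D(2)])
  have l2: "D n (coset_rep (B n +>\<^bsub>Q\<^esub> x)) = D n x" if "x \<in> F n" for n x
    by (rule C_lift(2)[OF U linear_M[OF D(1)] D(2) that])
  show "linear_map K G U (\<lambda>f. \<Oplus>\<^bsub>U\<^esub>n\<in>gr_support K Q f. D n (coset_rep (f n)))"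
    using linear_from_direct_sum[of C U "\<lambda>n X. D n (coset_rep X)", OF C_module U l1]
    unfolding gr_support_eq G_linear_simps .
  assume x: "x \<in> F n"
  have xQ: "x \<in> carrier Q" using x F_D(1) by auto
  show "(\<Oplus>\<^bsub>U\<^esub>i\<in>gr_support K Q (cls n x). D i (coset_rep (cls n x i))) = D n x"
  proof (cases "x \<in> B n")
    case True
    then have "gr_support K Q (cls n x) = {}"
      using cls_eq_zero[OF True] by (auto simp: gr_support_eq G_simps direct_sum_simps)
    then show ?thesis using D(2)[OF True] by simp
  next
    case False
    then have "gr_support K Q (cls n x) = {n}"
      using coset_zero_iff[OF x] by (auto simp: gr_support_eq gr_class_def split: if_splits)
    then show ?thesis using l2[OF x] linear_closed[OF D(1) xQ] by (simp add: cls_apply)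
  qed
qed

subsection \<open>Comultiplication and coaction\<close>

abbreviation grel2 where "grel2 \<equiv> tensor_rel Q G grel Q G grel"
abbreviation grelH where "grelH \<equiv> tensor_rel H H rel_H Q G grel"
abbreviation GG where "GG \<equiv> tensor_product K G G"
abbreviation HQ where "HQ \<equiv> tensor_product K H Q"
abbreviation HG where "HG \<equiv> tensor_product K H G"

lemma finsum_split:
  fixes N L :: nat
  assumes "module K V" "\<And>j. j < N + L \<Longrightarrow> f j \<in> carrier V"
  shows "(\<Oplus>\<^bsub>V\<^esub>j\<in>{..<N + L}. f j) = (\<Oplus>\<^bsub>V\<^esub>j\<in>{..<N}. f j) \<oplus>\<^bsub>V\<^esub> (\<Oplus>\<^bsub>V\<^esub>j\<in>{..<L}. f (N + j))"
proof -
  interpret V: module K V by fact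
  show ?thesis using assms(2)
  proof (induction L)
    case 0
    then have "(\<Oplus>\<^bsub>V\<^esub>j\<in>{..<N}. f j) \<in> carrier V" by (intro V.finsum_closed) auto
    then show ?case by simp
  next
    case (Suc L)
    have c: "(\<Oplus>\<^bsub>V\<^esub>j\<in>{..<N}. f j) \<in> carrier V" "(\<Oplus>\<^bsub>V\<^esub>j\<in>{..<L}. f (N + j)) \<in> carrier V" "f (N + L) \<in> carrier V"
      using Suc.prems by (auto intro!: V.finsum_closed)
    have "(\<Oplus>\<^bsub>V\<^esub>j\<in>{..<N + Suc L}. f j) = f (N + L) \<oplus>\<^bsub>V\<^esub> (\<Oplus>\<^bsub>V\<^esub>j\<in>{..<N + L}. f j)"
      using Suc.prems by (simp add: lessThan_Suc V.finsum_insert Pi_iff)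
    moreover have "(\<Oplus>\<^bsub>V\<^esub>j\<in>{..<Suc L}. f (N + j)) = f (N + L) \<oplus>\<^bsub>V\<^esub> (\<Oplus>\<^bsub>V\<^esub>j\<in>{..<L}. f (N + j))"
      using Suc.prems by (simp add: lessThan_Suc V.finsum_insert Pi_iff)
    ultimately show ?case using Suc c by (simp add: V.a_ac)
  qed
qed

text \<open>
  An explicit form of the symbol relation on \<open>Q \<otimes> Q\<close>: all degrees share the number \<open>N\<close> of summands. This is the condition
  that singles out the comultiplication of a class.
\<close>

definition comult_decomposition where
  "comult_decomposition n t T \<longleftrightarrow> (\<exists>(N::nat) a b.
    (\<forall>i\<le>n. \<forall>j<N. a i j \<in> F i \<and> b i j \<in> F (n - i)) \<and>
    t = (\<Oplus>\<^bsub>QQ\<^esub>i\<in>{..n}. \<Oplus>\<^bsub>QQ\<^esub>j\<in>{..<N}. pure_tensor K Q Q (a i j) (b i j)) \<and>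
    T = (\<Oplus>\<^bsub>GG\<^esub>i\<in>{..n}. \<Oplus>\<^bsub>GG\<^esub>j\<in>{..<N}. pure_tensor K G G (cls i (a i j)) (cls (n - i) (b i j))))"

lemma comult_decomposition_iff: "comult_decomposition n t T \<longleftrightarrow> grel2 n t T"
proof
  interpret QQ: module K QQ by (rule lin)+
  interpret GG: module K GG by (rule lin)+
  assume "comult_decomposition n t T"
  then obtain N :: nat and a b where *: "\<forall>i\<le>n. \<forall>j<N. a i j \<in> F i \<and> b i j \<in> F (n - i)"
    "t = (\<Oplus>\<^bsub>QQ\<^esub>i\<in>{..n}. \<Oplus>\<^bsub>QQ\<^esub>j\<in>{..<N}. pure_tensor K Q Q (a i j) (b i j))"
    "T = (\<Oplus>\<^bsub>GG\<^esub>i\<in>{..n}. \<Oplus>\<^bsub>GG\<^esub>j\<in>{..<N}. pure_tensor K G G (cls i (a i j)) (cls (n - i) (b i j)))"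
    unfolding comult_decomposition_def by blast
  show "grel2 n t T" unfolding *(2,3)
  proof (intro tensor_rel_finsum filtered_G)
    fix i j assume ij: "i \<in> {..n}" "j \<in> {..<N}"
    show "grel2 n (pure_tensor K Q Q (a i j) (b i j)) (pure_tensor K G G (cls i (a i j)) (cls (n - i) (b i j)))"
      by (rule tensor_rel_pure[where R = grel and R' = grel, OF grelI grelI]) (use * ij in auto)
  qed auto
next
  interpret QQ: module K QQ by (rule lin)+
  interpret GG: module K GG by (rule lin)+
  have cQ: "pure_tensor K Q Q x y \<in> carrier QQ" if "x \<in> F i" "y \<in> F j" for x y i j
    using that F_D(1) by (intro pure_closed module_Q) auto
  have cG: "pure_tensor K G G (cls i x) (cls j y) \<in> carrier GG" if "x \<in> F i" "y \<in> F j" for x y i j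
    using that cls_closed by (intro pure_closed G_module) auto
  assume "grel2 n t T"
  then show "comult_decomposition n t T"
  proof induction
    case tensor_rel_zero
    show ?case unfolding comult_decomposition_def by (rule exI[of _ 0]) simp
  next
    case (tensor_rel_pure k x g l y h)
    then have x: "x \<in> F k" "g = cls k x" and y: "y \<in> F l" "h = cls l y" and n: "n = k + l" by (auto simp: grel_def)
    define a where "a = (\<lambda>i j::nat. if i = k then x else \<zero>\<^bsub>Q\<^esub>)"
    define b where "b = (\<lambda>i j::nat. if i = k then y else \<zero>\<^bsub>Q\<^esub>)"
    have ab: "a i j \<in> F i" "b i j \<in> F (n - i)" for i j using x y n F_D(2) by (auto simp: a_def b_def)
    have cls0: "cls i \<zero>\<^bsub>Q\<^esub> = \<zero>\<^bsub>G\<^esub>" for i by (rule cls_eq_zero[OF B_D(2)])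
    have "(\<Oplus>\<^bsub>QQ\<^esub>i\<in>{..n}. \<Oplus>\<^bsub>QQ\<^esub>j\<in>{..<1}. pure_tensor K Q Q (a i j) (b i j)) =
      (\<Oplus>\<^bsub>QQ\<^esub>i\<in>{..n}. if k = i then pure_tensor K Q Q x y else \<zero>\<^bsub>QQ\<^esub>)"
      by (rule QQ.finsum_cong')
        (use cQ[OF ab] cQ[OF x(1) y(1)] in \<open>auto simp: a_def b_def pure_zero[OF module_Q module_Q] lessThan_Suc\<close>)
    also have "\<dots> = pure_tensor K Q Q x y" by (rule QQ.finsum_singleton) (use n cQ[OF x(1) y(1)] in auto)
    finally have 1: "pure_tensor K Q Q x y = (\<Oplus>\<^bsub>QQ\<^esub>i\<in>{..n}. \<Oplus>\<^bsub>QQ\<^esub>j\<in>{..<1}. pure_tensor K Q Q (a i j) (b i j))" by simp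
    have "(\<Oplus>\<^bsub>GG\<^esub>i\<in>{..n}. \<Oplus>\<^bsub>GG\<^esub>j\<in>{..<1}. pure_tensor K G G (cls i (a i j)) (cls (n - i) (b i j))) =
      (\<Oplus>\<^bsub>GG\<^esub>i\<in>{..n}. if k = i then pure_tensor K G G g h else \<zero>\<^bsub>GG\<^esub>)"
      by (rule GG.finsum_cong')
        (use cG[OF ab] cG[OF x(1) y(1)] n in \<open>auto simp: a_def b_def cls0 pure_zero[OF G_module G_module] lessThan_Suc x(2) y(2)\<close>)
    also have "\<dots> = pure_tensor K G G g h" by (rule GG.finsum_singleton) (use n cG[OF x(1) y(1)] x y in auto)
    finally have 2: "pure_tensor K G G g h = (\<Oplus>\<^bsub>GG\<^esub>i\<in>{..n}. \<Oplus>\<^bsub>GG\<^esub>j\<in>{..<1}. pure_tensor K G G (cls i (a i j)) (cls (n - i) (b i j)))" by simp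
    show ?case unfolding comult_decomposition_def
      by (rule exI[of _ 1], rule exI[of _ a], rule exI[of _ b]) (use ab 1 2 in simp)
  next
    case (tensor_rel_add s s' t t')
    from tensor_rel_add(3) obtain N :: nat and a b where 1: "\<forall>i\<le>n. \<forall>j<N. a i j \<in> F i \<and> b i j \<in> F (n - i)"
      "s = (\<Oplus>\<^bsub>QQ\<^esub>i\<in>{..n}. \<Oplus>\<^bsub>QQ\<^esub>j\<in>{..<N}. pure_tensor K Q Q (a i j) (b i j))"
      "s' = (\<Oplus>\<^bsub>GG\<^esub>i\<in>{..n}. \<Oplus>\<^bsub>GG\<^esub>j\<in>{..<N}. pure_tensor K G G (cls i (a i j)) (cls (n - i) (b i j)))"
      unfolding comult_decomposition_def by blast
    from tensor_rel_add(4) obtain L :: nat and c d where 2: "\<forall>i\<le>n. \<forall>j<L. c i j \<in> F i \<and> d i j \<in> F (n - i)"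
      "t = (\<Oplus>\<^bsub>QQ\<^esub>i\<in>{..n}. \<Oplus>\<^bsub>QQ\<^esub>j\<in>{..<L}. pure_tensor K Q Q (c i j) (d i j))"
      "t' = (\<Oplus>\<^bsub>GG\<^esub>i\<in>{..n}. \<Oplus>\<^bsub>GG\<^esub>j\<in>{..<L}. pure_tensor K G G (cls i (c i j)) (cls (n - i) (d i j)))"
      unfolding comult_decomposition_def by blast
    define p where "p i j = (if j < N then a i j else c i (j - N))" for i j
    define q where "q i j = (if j < N then b i j else d i (j - N))" for i j
    have pq: "p i j \<in> F i" "q i j \<in> F (n - i)" if "i \<le> n" "j < N + L" for i j
      using 1(1) 2(1) that by (auto simp: p_def q_def)
    have sum: "(\<Oplus>\<^bsub>V\<^esub>i\<in>{..n}. \<Oplus>\<^bsub>V\<^esub>j\<in>{..<N + L}. f i (p i j) (q i j)) =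
        (\<Oplus>\<^bsub>V\<^esub>i\<in>{..n}. \<Oplus>\<^bsub>V\<^esub>j\<in>{..<N}. f i (a i j) (b i j)) \<oplus>\<^bsub>V\<^esub> (\<Oplus>\<^bsub>V\<^esub>i\<in>{..n}. \<Oplus>\<^bsub>V\<^esub>j\<in>{..<L}. f i (c i j) (d i j))"
      if V: "module K V" and f: "\<And>i x y. i \<le> n \<Longrightarrow> x \<in> F i \<Longrightarrow> y \<in> F (n - i) \<Longrightarrow> f i x y \<in> carrier V"
      for f :: "nat \<Rightarrow> 'q \<Rightarrow> 'q \<Rightarrow> 'v" and V :: "('k, 'v) module"
    proof -
      interpret V: module K V by fact
      have cab: "f i (a i j) (b i j) \<in> carrier V" if "i \<le> n" "j < N" for i j using f 1(1) that by simp
      have ccd: "f i (c i j) (d i j) \<in> carrier V" if "i \<le> n" "j < L" for i j using f 2(1) that by simp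
      have "(\<Oplus>\<^bsub>V\<^esub>i\<in>{..n}. \<Oplus>\<^bsub>V\<^esub>j\<in>{..<N + L}. f i (p i j) (q i j)) =
        (\<Oplus>\<^bsub>V\<^esub>i\<in>{..n}. (\<Oplus>\<^bsub>V\<^esub>j\<in>{..<N}. f i (a i j) (b i j)) \<oplus>\<^bsub>V\<^esub> (\<Oplus>\<^bsub>V\<^esub>j\<in>{..<L}. f i (c i j) (d i j)))"
      proof (rule V.finsum_cong')
        fix i assume i: "i \<in> {..n}"
        have "(\<Oplus>\<^bsub>V\<^esub>j\<in>{..<N + L}. f i (p i j) (q i j)) =
          (\<Oplus>\<^bsub>V\<^esub>j\<in>{..<N}. f i (p i j) (q i j)) \<oplus>\<^bsub>V\<^esub> (\<Oplus>\<^bsub>V\<^esub>j\<in>{..<L}. f i (p i (N + j)) (q i (N + j)))"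
          by (rule finsum_split[OF V]) (use i f pq in auto)
        moreover have "(\<Oplus>\<^bsub>V\<^esub>j\<in>{..<N}. f i (p i j) (q i j)) = (\<Oplus>\<^bsub>V\<^esub>j\<in>{..<N}. f i (a i j) (b i j))"
          by (rule V.finsum_cong') (use i cab in \<open>auto simp: p_def q_def\<close>)
        ultimately show "(\<Oplus>\<^bsub>V\<^esub>j\<in>{..<N + L}. f i (p i j) (q i j)) =
          (\<Oplus>\<^bsub>V\<^esub>j\<in>{..<N}. f i (a i j) (b i j)) \<oplus>\<^bsub>V\<^esub> (\<Oplus>\<^bsub>V\<^esub>j\<in>{..<L}. f i (c i j) (d i j))"
          by (simp add: p_def q_def)
      qed (use cab ccd in \<open>auto intro!: V.finsum_closed V.a_closed\<close>)
      also have "\<dots> = (\<Oplus>\<^bsub>V\<^esub>i\<in>{..n}. \<Oplus>\<^bsub>V\<^esub>j\<in>{..<N}. f i (a i j) (b i j)) \<oplus>\<^bsub>V\<^esub> (\<Oplus>\<^bsub>V\<^esub>i\<in>{..n}. \<Oplus>\<^bsub>V\<^esub>j\<in>{..<L}. f i (c i j) (d i j))"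
        by (rule V.finsum_addf) (use cab ccd in \<open>auto intro!: V.finsum_closed\<close>)
      finally show ?thesis .
    qed
    show ?case unfolding comult_decomposition_def 1(2,3) 2(2,3)
      by (rule exI[of _ "N + L"], rule exI[of _ p], rule exI[of _ q])
        (use pq sum[of QQ "\<lambda>i. pure_tensor K Q Q", OF QQ.module_axioms cQ]
          sum[of GG "\<lambda>i x y. pure_tensor K G G (cls i x) (cls (n - i) y)", OF GG.module_axioms cG] in simp)
  qed
qed

text \<open>
  By \<open>comult_F\<close> the tensor \<open>\<Delta> x\<close> has a symbol of degree \<open>n\<close>, and symbols are unique, so the definite description has a value.
\<close>

lemma gr_comult_class: "x \<in> F n \<Longrightarrow> grel2 n (comult Q x) (gr_comult_class K Q n x)"
proof -
  assume x: "x \<in> F n"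
  have F2: "filtered_symbols QQ GG grel2" by (rule rel)+
  note D = filtered_symbolsD[OF F2]
  have "submodule {t \<in> carrier QQ. \<exists>s. grel2 n t s} K QQ"
  proof (rule submodule_criterion[OF D(1)])
    show "\<zero>\<^bsub>QQ\<^esub> \<in> {t \<in> carrier QQ. \<exists>s. grel2 n t s}" using D(3,5) by blast
    show "s \<oplus>\<^bsub>QQ\<^esub> t \<in> {t \<in> carrier QQ. \<exists>s. grel2 n t s}"
      if "s \<in> {t \<in> carrier QQ. \<exists>s. grel2 n t s}" "t \<in> {t \<in> carrier QQ. \<exists>s. grel2 n t s}" for s t
    proof -
      from that obtain s' t' where "grel2 n s s'" "grel2 n t t'" by blast
      then have "grel2 n (s \<oplus>\<^bsub>QQ\<^esub> t) (s' \<oplus>\<^bsub>GG\<^esub> t')" by (rule D(6))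
      then show ?thesis using D(3) by blast
    qed
    show "a \<odot>\<^bsub>QQ\<^esub> t \<in> {t \<in> carrier QQ. \<exists>s. grel2 n t s}"
      if a: "a \<in> carrier K" and "t \<in> {t \<in> carrier QQ. \<exists>s. grel2 n t s}" for a t
    proof -
      from that obtain s where "grel2 n t s" by blast
      then have "grel2 n (a \<odot>\<^bsub>QQ\<^esub> t) (a \<odot>\<^bsub>GG\<^esub> s)"
        by (rule tensor_rel_smult[OF filtered_G filtered_G _ a, rotated]) (use a F_D(4) cls_smult in \<open>simp add: grel_def\<close>)
      then show ?thesis using D(3) by blast
    qed
  qed auto
  moreover have "{pure_tensor K Q Q x y | x y i j. x \<in> F i \<and> y \<in> F j \<and> i + j = n} \<subseteq> {t \<in> carrier QQ. \<exists>s. grel2 n t s}"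
  proof
    fix z assume "z \<in> {pure_tensor K Q Q x y | x y i j. x \<in> F i \<and> y \<in> F j \<and> i + j = n}"
    then obtain x y i j where z: "z = pure_tensor K Q Q x y" "x \<in> F i" "y \<in> F j" "n = i + j" by blast
    have "grel2 n z (pure_tensor K G G (cls i x) (cls j y))" unfolding z(1)
      by (rule tensor_rel_pure[where R = grel and R' = grel, OF grelI grelI]) (use z in auto)
    then show "z \<in> {t \<in> carrier QQ. \<exists>s. grel2 n t s}" using D(3) by blast
  qed
  ultimately have "fil_tensor Q Q F F n \<subseteq> {t \<in> carrier QQ. \<exists>s. grel2 n t s}"
    unfolding fil_tensor_def by (rule hull_least)
  then obtain s where s: "grel2 n (comult Q x) s" using comult_F[OF x] by blast
  have "gr_comult_class K Q n x = (THE T. comult_decomposition n (comult Q x) T)"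
    unfolding gr_comult_class_def comult_decomposition_def G_product_simps ..
  also have "\<dots> = s" unfolding comult_decomposition_iff
    by (rule the_equality[where P = "grel2 n (comult Q x)", OF s]) (rule symbol_unique[OF F2 _ s])
  finally show ?thesis using s by simp
qed

definition coact_decomposition where
  "coact_decomposition n t T \<longleftrightarrow> (\<exists>(N::nat) h b.
    (\<forall>j<N. h j \<in> carrier H \<and> b j \<in> F n) \<and>
    t = (\<Oplus>\<^bsub>HQ\<^esub>j\<in>{..<N}. pure_tensor K H Q (h j) (b j)) \<and>
    T = (\<Oplus>\<^bsub>HG\<^esub>j\<in>{..<N}. pure_tensor K H G (h j) (cls n (b j))))"

lemma coact_decomposition_iff: "coact_decomposition n t T \<longleftrightarrow> grelH n t T"
proof
  assume "coact_decomposition n t T"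
  then obtain N :: nat and h b where *: "\<forall>j<N. h j \<in> carrier H \<and> b j \<in> F n"
    "t = (\<Oplus>\<^bsub>HQ\<^esub>j\<in>{..<N}. pure_tensor K H Q (h j) (b j))"
    "T = (\<Oplus>\<^bsub>HG\<^esub>j\<in>{..<N}. pure_tensor K H G (h j) (cls n (b j)))"
    unfolding coact_decomposition_def by blast
  show "grelH n t T" unfolding *(2,3)
  proof (intro tensor_rel_finsum filtered_G filtered_deg0 module_H)
    fix j assume j: "j \<in> {..<N}"
    show "grelH n (pure_tensor K H Q (h j) (b j)) (pure_tensor K H G (h j) (cls n (b j)))"
      by (rule tensor_rel_pure[where R = rel_H and R' = grel, OF rel_H_zero[OF _ refl] grelI]) (use * j in auto)
  qed auto
next
  interpret HQ: module K HQ by (rule lin)+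
  interpret HG: module K HG by (rule lin)+
  have cQ: "pure_tensor K H Q h y \<in> carrier HQ" if "h \<in> carrier H" "y \<in> F j" for h y j
    using that F_D(1) by (intro pure_closed module_Q module_H) auto
  have cG: "pure_tensor K H G h (cls j y) \<in> carrier HG" if "h \<in> carrier H" "y \<in> F j" for h y j
    using that cls_closed by (intro pure_closed G_module module_H) auto
  assume "grelH n t T"
  then show "coact_decomposition n t T"
  proof induction
    case tensor_rel_zero
    show ?case unfolding coact_decomposition_def by (rule exI[of _ 0]) simp
  next
    case (tensor_rel_pure k h h' l y g)
    then have h: "h \<in> carrier H" "h' = h" "k = 0 \<or> h = \<zero>\<^bsub>H\<^esub>" and y: "y \<in> F l" "g = cls l y" and n: "n = k + l"
      by (auto simp: grel_def deg0_rel_def)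
    have yQ: "y \<in> carrier Q" "g \<in> carrier G" using y F_D(1) cls_closed by auto
    show ?case
    proof (cases "k = 0")
      case True
      then show ?thesis unfolding coact_decomposition_def
        by (intro exI[of _ 1] exI[of _ "\<lambda>_. h"] exI[of _ "\<lambda>_. y"])
          (use h y n cQ[OF h(1) y(1)] cG[OF h(1) y(1)] in \<open>auto simp: lessThan_Suc\<close>)
    next
      case False
      then have "pure_tensor K H Q h y = \<zero>\<^bsub>HQ\<^esub>" "pure_tensor K H G h' g = \<zero>\<^bsub>HG\<^esub>"
        using h yQ pure_zero(1)[OF module_H module_Q] pure_zero(1)[OF module_H G_module] by auto
      then show ?thesis unfolding coact_decomposition_def by (intro exI[of _ 0]) simp
    qed
  next
    case (tensor_rel_add s s' t t')
    from tensor_rel_add(3) obtain N :: nat and a b where 1: "\<forall>j<N. a j \<in> carrier H \<and> b j \<in> F n"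
      "s = (\<Oplus>\<^bsub>HQ\<^esub>j\<in>{..<N}. pure_tensor K H Q (a j) (b j))"
      "s' = (\<Oplus>\<^bsub>HG\<^esub>j\<in>{..<N}. pure_tensor K H G (a j) (cls n (b j)))"
      unfolding coact_decomposition_def by blast
    from tensor_rel_add(4) obtain L :: nat and c d where 2: "\<forall>j<L. c j \<in> carrier H \<and> d j \<in> F n"
      "t = (\<Oplus>\<^bsub>HQ\<^esub>j\<in>{..<L}. pure_tensor K H Q (c j) (d j))"
      "t' = (\<Oplus>\<^bsub>HG\<^esub>j\<in>{..<L}. pure_tensor K H G (c j) (cls n (d j)))"
      unfolding coact_decomposition_def by blast
    define p where "p j = (if j < N then a j else c (j - N))" for j
    define q where "q j = (if j < N then b j else d (j - N))" for j
    have pq: "p j \<in> carrier H" "q j \<in> F n" if "j < N + L" for j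
      using 1(1) 2(1) that by (auto simp: p_def q_def)
    have sum: "(\<Oplus>\<^bsub>V\<^esub>j\<in>{..<N + L}. f (p j) (q j)) =
        (\<Oplus>\<^bsub>V\<^esub>j\<in>{..<N}. f (a j) (b j)) \<oplus>\<^bsub>V\<^esub> (\<Oplus>\<^bsub>V\<^esub>j\<in>{..<L}. f (c j) (d j))"
      if V: "module K V" and f: "\<And>x y. x \<in> carrier H \<Longrightarrow> y \<in> F n \<Longrightarrow> f x y \<in> carrier V"
      for f :: "'h \<Rightarrow> 'q \<Rightarrow> 'v" and V :: "('k, 'v) module"
    proof -
      interpret V: module K V by fact
      have "(\<Oplus>\<^bsub>V\<^esub>j\<in>{..<N + L}. f (p j) (q j)) =
          (\<Oplus>\<^bsub>V\<^esub>j\<in>{..<N}. f (p j) (q j)) \<oplus>\<^bsub>V\<^esub> (\<Oplus>\<^bsub>V\<^esub>j\<in>{..<L}. f (p (N + j)) (q (N + j)))"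
        by (rule finsum_split[OF V]) (use f pq in auto)
      moreover have "(\<Oplus>\<^bsub>V\<^esub>j\<in>{..<N}. f (p j) (q j)) = (\<Oplus>\<^bsub>V\<^esub>j\<in>{..<N}. f (a j) (b j))"
        by (rule V.finsum_cong') (use 1(1) f in \<open>auto simp: p_def q_def\<close>)
      ultimately show ?thesis by (simp add: p_def q_def)
    qed
    show ?case unfolding coact_decomposition_def 1(2,3) 2(2,3)
      by (rule exI[of _ "N + L"], rule exI[of _ p], rule exI[of _ q])
        (use pq sum[of HQ "pure_tensor K H Q", OF HQ.module_axioms cQ]
          sum[of HG "\<lambda>h y. pure_tensor K H G h (cls n y)", OF HG.module_axioms cG] in simp)
  qed
qed

text \<open>
  The analogue of \<open>gr_comult_class\<close> for the coaction, with \<open>coact_F\<close> as the source of the symbol.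
\<close>

lemma gr_coact_class: "x \<in> F n \<Longrightarrow> grelH n (coact Q x) (gr_coact_class K H Q n x)"
proof -
  assume x: "x \<in> F n"
  have F2: "filtered_symbols HQ HG grelH" by (rule rel lin)+
  note D = filtered_symbolsD[OF F2]
  have "submodule {t \<in> carrier HQ. \<exists>s. grelH n t s} K HQ"
  proof (rule submodule_criterion[OF D(1)])
    show "\<zero>\<^bsub>HQ\<^esub> \<in> {t \<in> carrier HQ. \<exists>s. grelH n t s}" using D(3,5) by blast
    show "s \<oplus>\<^bsub>HQ\<^esub> t \<in> {t \<in> carrier HQ. \<exists>s. grelH n t s}"
      if "s \<in> {t \<in> carrier HQ. \<exists>s. grelH n t s}" "t \<in> {t \<in> carrier HQ. \<exists>s. grelH n t s}" for s t
    proof -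
      from that obtain s' t' where "grelH n s s'" "grelH n t t'" by blast
      then have "grelH n (s \<oplus>\<^bsub>HQ\<^esub> t) (s' \<oplus>\<^bsub>HG\<^esub> t')" by (rule D(6))
      then show ?thesis using D(3) by blast
    qed
    show "a \<odot>\<^bsub>HQ\<^esub> t \<in> {t \<in> carrier HQ. \<exists>s. grelH n t s}"
      if a: "a \<in> carrier K" and "t \<in> {t \<in> carrier HQ. \<exists>s. grelH n t s}" for a t
    proof -
      from that obtain s where "grelH n t s" by blast
      then have "grelH n (a \<odot>\<^bsub>HQ\<^esub> t) (a \<odot>\<^bsub>HG\<^esub> s)"
        by (rule tensor_rel_smult[OF filtered_deg0[OF module_H] filtered_G _ a, rotated])
          (use a module.smult_closed[OF module_H] module.smult_r_null[OF module_H] in \<open>auto simp: deg0_rel_def\<close>)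
      then show ?thesis using D(3) by blast
    qed
  qed auto
  moreover have "{pure_tensor K H Q x y | x y. x \<in> carrier H \<and> y \<in> F n} \<subseteq> {t \<in> carrier HQ. \<exists>s. grelH n t s}"
  proof
    fix z assume "z \<in> {pure_tensor K H Q x y | x y. x \<in> carrier H \<and> y \<in> F n}"
    then obtain x y where z: "z = pure_tensor K H Q x y" "x \<in> carrier H" "y \<in> F n" by blast
    have "grelH n z (pure_tensor K H G x (cls n y))" unfolding z(1)
      by (rule tensor_rel_pure[where R = rel_H and R' = grel, OF rel_H_zero[OF _ refl] grelI]) (use z in auto)
    then show "z \<in> {t \<in> carrier HQ. \<exists>s. grelH n t s}" using D(3) by blast
  qed
  ultimately have "sub_tensor K H Q (carrier H) (F n) \<subseteq> {t \<in> carrier HQ. \<exists>s. grelH n t s}"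
    unfolding sub_tensor_def by (rule hull_least)
  then obtain s where s: "grelH n (coact Q x) s" using coact_F[OF x] by blast
  have "gr_coact_class K H Q n x = (THE T. coact_decomposition n (coact Q x) T)"
    unfolding gr_coact_class_def coact_decomposition_def G_product_simps ..
  also have "\<dots> = s" unfolding coact_decomposition_iff
    by (rule the_equality[where P = "grelH n (coact Q x)", OF s]) (rule symbol_unique[OF F2 _ s])
  finally show ?thesis using s by simp
qed

subsection \<open>Linearity and symbols of the structure maps\<close>

lemma G_maps:
  "mult G = (\<lambda>f g n. \<Oplus>\<^bsub>C n\<^esub>a\<in>{..n}. B n +>\<^bsub>Q\<^esub> (coset_rep (f a) \<otimes>\<^bsub>Q\<^esub> coset_rep (g (n - a))))"
  "one G = cls 0 \<one>\<^bsub>Q\<^esub>"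
  "comult G = (\<lambda>f. \<Oplus>\<^bsub>GG\<^esub>n\<in>gr_support K Q f. gr_comult_class K Q n (coset_rep (f n)))"
  "counit G = (\<lambda>f. counit Q (coset_rep (f 0)))"
  "act G = (\<lambda>h f n. B n +>\<^bsub>Q\<^esub> act Q h (coset_rep (f n)))"
  "coact G = (\<lambda>f. \<Oplus>\<^bsub>HG\<^esub>n\<in>gr_support K Q f. gr_coact_class K H Q n (coset_rep (f n)))"
proof -
  have 1: "GG = tensor_product K (gr_module K Q) (gr_module K Q)" "HG = tensor_product K H (gr_module K Q)"
    by (simp_all only: G_product_simps)
  show "mult G = (\<lambda>f g n. \<Oplus>\<^bsub>C n\<^esub>a\<in>{..n}. B n +>\<^bsub>Q\<^esub> (coset_rep (f a) \<otimes>\<^bsub>Q\<^esub> coset_rep (g (n - a))))"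
    "one G = cls 0 \<one>\<^bsub>Q\<^esub>" "counit G = (\<lambda>f. counit Q (coset_rep (f 0)))"
    "act G = (\<lambda>h f n. B n +>\<^bsub>Q\<^esub> act Q h (coset_rep (f n)))"
    by (simp_all add: gr_def Let_def)
  show "comult G = (\<lambda>f. \<Oplus>\<^bsub>GG\<^esub>n\<in>gr_support K Q f. gr_comult_class K Q n (coset_rep (f n)))"
    "coact G = (\<lambda>f. \<Oplus>\<^bsub>HG\<^esub>n\<in>gr_support K Q f. gr_coact_class K H Q n (coset_rep (f n)))"
    unfolding 1 by (simp_all add: gr_def Let_def)
qed

text \<open>
  The symbols \<open>c n x\<close> of \<open>d x\<close> for \<open>x\<close> in \<open>Q\<^sub>n\<close> extend to a linear map on all of \<open>Q\<close>, namely \<open>d\<close> followed by the projection to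
  degree \<open>n\<close>. It kills \<open>Q\<^sub>n\<^sub>-\<^sub>1\<close>, so that the values on coset representatives do not depend on the representatives.
\<close>

lemma symbol_lift:
  assumes F2: "filtered_symbols U V R" and d: "linear_map K Q U d" and r: "\<And>n x. x \<in> F n \<Longrightarrow> R n (d x) (c n x)"
  shows "linear_map K G V (\<lambda>f. \<Oplus>\<^bsub>V\<^esub>n\<in>gr_support K Q f. c n (coset_rep (f n)))"
    and "x \<in> F n \<Longrightarrow> (\<Oplus>\<^bsub>V\<^esub>i\<in>gr_support K Q (cls n x). c i (coset_rep (cls n x i))) = c n x"
proof -
  note D = filtered_symbolsD[OF F2]
  interpret V: module K V by (rule D(2))
  obtain P where "symbol_projections U V R P" using filtered_symbols_projections[OF F2] ..
  note P = symbol_projectionsD[OF this]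
  define D' where "D' n x = P n (d x)" for n x
  have l: "linear_map K Q V (D' n)" for n
    using linear_comp[OF d P(1)[of n]] unfolding D'_def[abs_def] .
  have c: "D' n x = c n x" if "x \<in> F n" for n x unfolding D'_def by (rule P(2)[OF r[OF that]])
  have z: "D' n x = \<zero>\<^bsub>V\<^esub>" if "x \<in> B n" for n x
  proof (cases n)
    case 0 then show ?thesis using that linear_zero[OF module_Q D(2) l] by (simp add: B_simps)
  next
    case (Suc k)
    then have "x \<in> F k" using that by (simp add: B_simps)
    then show ?thesis unfolding D'_def by (rule P(3)[OF r]) (simp add: Suc)
  qed
  have cong: "(\<Oplus>\<^bsub>V\<^esub>n\<in>gr_support K Q f. c n (coset_rep (f n))) = (\<Oplus>\<^bsub>V\<^esub>n\<in>gr_support K Q f. D' n (coset_rep (f n)))"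
    if "f \<in> carrier G" for f
    by (rule V.finsum_cong') (use G_rep(1)[OF that] c D(4)[OF r] in auto)
  show "linear_map K G V (\<lambda>f. \<Oplus>\<^bsub>V\<^esub>n\<in>gr_support K Q f. c n (coset_rep (f n)))"
    by (rule linear_cong[OF gr_lift(1)[where D = D', OF D(2) l z] _ G_module]) (assumption | rule cong[symmetric])+
  assume x: "x \<in> F n"
  show "(\<Oplus>\<^bsub>V\<^esub>i\<in>gr_support K Q (cls n x). c i (coset_rep (cls n x i))) = c n x"
    unfolding cong[OF cls_closed[OF x]] c[OF x, symmetric]
    by (rule gr_lift(2)[where D = D', OF D(2) l _ x]) (rule z)
qed

lemma filtered_grel2 [rel]: "filtered_symbols QQ GG grel2" by (rule rel)+

lemma filtered_grelH [rel]: "filtered_symbols HQ HG grelH" by (rule rel lin)+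

lemma comult_G: "linear_map K G GG (comult G)" "x \<in> F n \<Longrightarrow> comult G (cls n x) = gr_comult_class K Q n x"
  unfolding G_maps by (rule symbol_lift[OF filtered_grel2 Q.C.comult_linear gr_comult_class]; assumption)+

lemma coact_G: "linear_map K G HG (coact G)" "x \<in> F n \<Longrightarrow> coact G (cls n x) = gr_coact_class K H Q n x"
  unfolding G_maps by (rule symbol_lift[OF filtered_grelH Q.coact_linear gr_coact_class]; assumption)+

lemma counit_G: "linear_map K G (ground_module K) (counit G)"
  "x \<in> F n \<Longrightarrow> counit G (cls n x) = (if n = 0 then counit Q x else \<zero>\<^bsub>K\<^esub>)"
proof -
  have l: "linear_map K Q (ground_module K) (counit Q)" by (rule Q.C.counit_linear)
  have z: "counit Q x = \<zero>\<^bsub>ground_module K\<^esub>" if "x \<in> B 0" for x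
    using that linear_zero[OF module_Q ground_module l] by (simp add: B_simps)
  note C = C_lift[OF ground_module linear_M[OF l] z]
  show "linear_map K G (ground_module K) (counit G)"
    unfolding G_maps by (rule linear_comp[OF G_eval C(1)])
  assume x: "x \<in> F n"
  show "counit G (cls n x) = (if n = 0 then counit Q x else \<zero>\<^bsub>K\<^esub>)"
  proof (cases "n = 0")
    case True then show ?thesis using C(2) x by (simp add: G_maps cls_apply)
  next
    case False
    then show ?thesis using linear_zero[OF C_module ground_module C(1)] by (simp add: G_maps cls_apply)
  qed
qed

lemma linear_restrict:
  assumes f: "linear_map K Q Q f" "\<And>x. x \<in> F a \<Longrightarrow> f x \<in> F n"
  shows "linear_map K (M a) (M n) f"
proof (rule linear_mapI)
  fix x y assume "x \<in> carrier (M a)" "y \<in> carrier (M a)"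
  then show "f (x \<oplus>\<^bsub>M a\<^esub> y) = f x \<oplus>\<^bsub>M n\<^esub> f y" using linear_add[OF f(1), of x y] F_D(1) by auto
next
  fix k x assume "k \<in> carrier K" "x \<in> carrier (M a)"
  then show "f (k \<odot>\<^bsub>M a\<^esub> x) = k \<odot>\<^bsub>M n\<^esub> f x" using linear_smult[OF f(1), of k x] F_D(1) by auto
qed (use f(2) in auto)

lemma act_B: "h \<in> carrier H \<Longrightarrow> x \<in> B n \<Longrightarrow> act Q h x \<in> B n"
proof (cases n)
  case 0
  moreover assume "h \<in> carrier H" "x \<in> B n"
  ultimately show ?thesis
    using linear_zero[OF module_Q module_Q act_right[OF linear_id Q_pre]] by (simp add: B_simps)
qed (use act_F in \<open>simp add: B_simps\<close>)

lemma act_component: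
  assumes h: "h \<in> carrier H"
  shows "linear_map K (C n) (C n) (\<lambda>X. B n +>\<^bsub>Q\<^esub> act Q h (coset_rep X))"
    and "x \<in> F n \<Longrightarrow> B n +>\<^bsub>Q\<^esub> act Q h (coset_rep (B n +>\<^bsub>Q\<^esub> x)) = B n +>\<^bsub>Q\<^esub> act Q h x"
proof -
  have l: "linear_map K Q Q (act Q h)" by (rule act_right[OF linear_id Q_pre h])
  have "linear_map K (M n) (M n) (act Q h)"
    by (rule linear_restrict[OF l act_F[OF h]])
  from linear_comp[OF this C_proj] have "linear_map K (M n) (C n) (\<lambda>x. B n +>\<^bsub>Q\<^esub> act Q h x)" .
  note C = C_lift[OF C_module this]
  have z: "B n +>\<^bsub>Q\<^esub> act Q h x = \<zero>\<^bsub>C n\<^esub>" if "x \<in> B n" for x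
    using coset_zero_iff act_B[OF h that] B_F by blast
  show "linear_map K (C n) (C n) (\<lambda>X. B n +>\<^bsub>Q\<^esub> act Q h (coset_rep X))" by (rule C(1)[OF z])
  show "x \<in> F n \<Longrightarrow> B n +>\<^bsub>Q\<^esub> act Q h (coset_rep (B n +>\<^bsub>Q\<^esub> x)) = B n +>\<^bsub>Q\<^esub> act Q h x" by (rule C(2)[OF z])
qed

lemma act_G_cls: "h \<in> carrier H \<Longrightarrow> x \<in> F n \<Longrightarrow> act G h (cls n x) = cls n (act Q h x)"
proof (rule ext)
  fix i assume hx: "h \<in> carrier H" "x \<in> F n"
  show "act G h (cls n x) i = cls n (act Q h x) i"
    using act_component(2)[OF hx] linear_zero[OF C_module C_module act_component(1)[OF hx(1)]]
    by (cases "i = n") (simp_all add: G_maps cls_apply)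
qed

lemma act_G_bilinear: "bilinear_map K H G G (act G)"
proof (rule bilinear_mapI)
  have supp: "finite {n. act G h f n \<noteq> \<zero>\<^bsub>C n\<^esub>}" if "h \<in> carrier H" "f \<in> carrier G" for h f
  proof (rule finite_subset)
    show "finite {n. f n \<noteq> \<zero>\<^bsub>C n\<^esub>}" using that by (simp add: G_simps direct_sum_simps)
    show "{n. act G h f n \<noteq> \<zero>\<^bsub>C n\<^esub>} \<subseteq> {n. f n \<noteq> \<zero>\<^bsub>C n\<^esub>}"
      using linear_zero[OF C_module C_module act_component(1)[OF that(1)]] by (auto simp: G_maps)
  qed
  show "linear_map K G G (\<lambda>f. act G h f)" if h: "h \<in> carrier H" for h
  proof (rule linear_into_G[where c = "\<lambda>n f. act G h f n", OF _ supp[OF h]])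
    show "linear_map K G (C n) (\<lambda>f. act G h f n)" for n
      unfolding G_maps by (rule linear_comp[OF G_eval act_component(1)[OF h]])
  qed
  show "linear_map K H G (\<lambda>h. act G h f)" if f: "f \<in> carrier G" for f
  proof -
    have "linear_map K H (C n) (\<lambda>h. act G h f n)" for n
    proof -
      have r: "coset_rep (f n) \<in> F n" "coset_rep (f n) \<in> carrier Q" using G_rep(1)[OF f] F_D(1) by auto
      have "linear_map K H Q (\<lambda>h. act Q h (coset_rep (f n)))" by (rule act_left[OF linear_id Q_pre r(2)])
      then have "linear_map K H (M n) (\<lambda>h. act Q h (coset_rep (f n)))"
        using act_F[OF _ r(1)] unfolding linear_map_def by auto
      from linear_comp[OF this C_proj] show ?thesis unfolding G_maps .
    qed
    then show ?thesis by (rule linear_into_G[where c = "\<lambda>n h. act G h f n", OF _ supp[OF _ f]])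
  qed
qed

lemma G_pre [lin]: "yd_pre G"
  unfolding yd_pre_def using G_module act_G_bilinear coact_G(1) comult_G(1) counit_G(1) by simp

lemma grel_yd: "yd_rel Q G grel"
  unfolding yd_rel_def
proof (intro conjI allI impI filtered_G Q_pre G_pre)
  fix a h h' b x g n assume *: "rel_H a h h'" "grel b x g" "n = a + b"
  then have h: "h \<in> carrier H" "h' = h" and x: "x \<in> F b" "g = cls b x" by (auto simp: deg0_rel_def grel_def)
  show "grel n (act Q h x) (act G h' g)"
  proof (cases "a = 0")
    case True then show ?thesis using * h x act_F act_G_cls by (simp add: grel_def)
  next
    case False
    then have h0: "h = \<zero>\<^bsub>H\<^esub>" using *(1) by (simp add: deg0_rel_def)
    have "x \<in> carrier Q" "g \<in> carrier G" using x F_D(1) cls_closed by auto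
    then have "act Q h x = \<zero>\<^bsub>Q\<^esub>" "act G h' g = \<zero>\<^bsub>G\<^esub>"
      using linear_zero[OF module_H module_Q act_left[OF linear_id Q_pre]]
        linear_zero[OF module_H G_module act_left[OF linear_id G_pre]] h0 h(2) by auto
    then show ?thesis using filtered_symbolsD(5)[OF filtered_G] by simp
  qed
next
  fix n x g assume "grel n x g"
  then have x: "x \<in> F n" "g = cls n x" by (auto simp: grel_def)
  show "grelH n (coact Q x) (coact G g)" using gr_coact_class coact_G(2) x by simp
  show "grel2 n (comult Q x) (comult G g)" using gr_comult_class comult_G(2) x by simp
  have "counit Q x \<in> carrier K" using counit_in[OF Q_pre, of x] x F_D(1) by auto
  then show "rel_K n (counit Q x) (counit G g)" using counit_G(2) x by (simp add: triv_rel_def)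
qed

lemmas grel_lemmas [rel] = yd_relD(4-7)[OF grel_yd]

lemma mult_B: "x \<in> B a \<Longrightarrow> y \<in> F b \<Longrightarrow> x \<otimes>\<^bsub>Q\<^esub> y \<in> B (a + b)" "x \<in> F a \<Longrightarrow> y \<in> B b \<Longrightarrow> x \<otimes>\<^bsub>Q\<^esub> y \<in> B (a + b)"
proof -
  show "x \<otimes>\<^bsub>Q\<^esub> y \<in> B (a + b)" if "x \<in> B a" "y \<in> F b"
  proof (cases a)
    case 0
    have "y \<in> carrier Q" using that F_D(1) by auto
    then show ?thesis using 0 that linear_zero[OF module_Q module_Q bilinear_left[OF Q.product_bilinear]] B_D(2) by (simp add: B_simps)
  next
    case (Suc k) then show ?thesis using that mult_F[of x k y b] by (simp add: B_simps)
  qed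
  show "x \<otimes>\<^bsub>Q\<^esub> y \<in> B (a + b)" if "x \<in> F a" "y \<in> B b"
  proof (cases b)
    case 0
    have "x \<in> carrier Q" using that F_D(1) by auto
    then show ?thesis using 0 that linear_zero[OF module_Q module_Q bilinear_right[OF Q.product_bilinear]] B_D(2) by (simp add: B_simps)
  next
    case (Suc k) then show ?thesis using that mult_F[of x a y k] by (simp add: B_simps)
  qed
qed

lemma mult_component:
  assumes a: "a + b = n"
  shows "bilinear_map K (C a) (C b) (C n) (\<lambda>X Y. B n +>\<^bsub>Q\<^esub> (coset_rep X \<otimes>\<^bsub>Q\<^esub> coset_rep Y))"
    and "x \<in> F a \<Longrightarrow> y \<in> F b \<Longrightarrow>
      B n +>\<^bsub>Q\<^esub> (coset_rep (B a +>\<^bsub>Q\<^esub> x) \<otimes>\<^bsub>Q\<^esub> coset_rep (B b +>\<^bsub>Q\<^esub> y)) = B n +>\<^bsub>Q\<^esub> (x \<otimes>\<^bsub>Q\<^esub> y)"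
proof -
  have F: "x \<otimes>\<^bsub>Q\<^esub> y \<in> F n" if "x \<in> F a" "y \<in> F b" for x y using mult_F[OF that] a by simp
  have l: "linear_map K (M a) (C n) (\<lambda>x. B n +>\<^bsub>Q\<^esub> (x \<otimes>\<^bsub>Q\<^esub> y))" if y: "y \<in> F b" for y
  proof -
    have "linear_map K Q Q (\<lambda>x. x \<otimes>\<^bsub>Q\<^esub> y)" using y F_D(1) by (intro bilinear_left[OF Q.product_bilinear]) auto
    then have "linear_map K (M a) (M n) (\<lambda>x. x \<otimes>\<^bsub>Q\<^esub> y)"
      by (rule linear_restrict) (rule F[OF _ y])
    from linear_comp[OF this C_proj] show ?thesis .
  qed
  have r: "linear_map K (M b) (C n) (\<lambda>y. B n +>\<^bsub>Q\<^esub> (x \<otimes>\<^bsub>Q\<^esub> y))" if x: "x \<in> F a" for x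
  proof -
    have "linear_map K Q Q (\<lambda>y. x \<otimes>\<^bsub>Q\<^esub> y)" using x F_D(1) by (intro bilinear_right[OF Q.product_bilinear]) auto
    then have "linear_map K (M b) (M n) (\<lambda>y. x \<otimes>\<^bsub>Q\<^esub> y)"
      by (rule linear_restrict) (rule F[OF x])
    from linear_comp[OF this C_proj] show ?thesis .
  qed
  have lz: "B n +>\<^bsub>Q\<^esub> (x \<otimes>\<^bsub>Q\<^esub> y) = \<zero>\<^bsub>C n\<^esub>" if "x \<in> B a" "y \<in> F b" for x y
    using coset_zero_iff[OF F] mult_B(1)[OF that] B_F[of a] that a by auto
  have rz: "B n +>\<^bsub>Q\<^esub> (x \<otimes>\<^bsub>Q\<^esub> y) = \<zero>\<^bsub>C n\<^esub>" if "x \<in> F a" "y \<in> B b" for x y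
    using coset_zero_iff[OF F] mult_B(2)[OF that] B_F[of b] that a by auto
  show "bilinear_map K (C a) (C b) (C n) (\<lambda>X Y. B n +>\<^bsub>Q\<^esub> (coset_rep X \<otimes>\<^bsub>Q\<^esub> coset_rep Y))"
  proof (rule bilinear_mapI)
    show "linear_map K (C b) (C n) (\<lambda>Y. B n +>\<^bsub>Q\<^esub> (coset_rep X \<otimes>\<^bsub>Q\<^esub> coset_rep Y))" if "X \<in> carrier (C a)" for X
      by (rule C_lift(1)[OF C_module r rz]) (use rep_C(1)[OF that] in auto)
    show "linear_map K (C a) (C n) (\<lambda>X. B n +>\<^bsub>Q\<^esub> (coset_rep X \<otimes>\<^bsub>Q\<^esub> coset_rep Y))" if "Y \<in> carrier (C b)" for Y
      by (rule C_lift(1)[OF C_module l lz]) (use rep_C(1)[OF that] in auto)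
  qed
  assume xy: "x \<in> F a" "y \<in> F b"
  have "coset_rep (B b +>\<^bsub>Q\<^esub> y) \<in> F b"
    by (rule rep_C(1)) (use linear_closed[OF C_proj, of y b] xy in simp)
  then have "B n +>\<^bsub>Q\<^esub> (coset_rep (B a +>\<^bsub>Q\<^esub> x) \<otimes>\<^bsub>Q\<^esub> coset_rep (B b +>\<^bsub>Q\<^esub> y)) = B n +>\<^bsub>Q\<^esub> (x \<otimes>\<^bsub>Q\<^esub> coset_rep (B b +>\<^bsub>Q\<^esub> y))"
    by (intro C_lift(2)[OF C_module l lz xy(1)]) auto
  also have "\<dots> = B n +>\<^bsub>Q\<^esub> (x \<otimes>\<^bsub>Q\<^esub> y)" by (rule C_lift(2)[OF C_module r rz xy(2)]) (use xy in auto)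
  finally show "B n +>\<^bsub>Q\<^esub> (coset_rep (B a +>\<^bsub>Q\<^esub> x) \<otimes>\<^bsub>Q\<^esub> coset_rep (B b +>\<^bsub>Q\<^esub> y)) = B n +>\<^bsub>Q\<^esub> (x \<otimes>\<^bsub>Q\<^esub> y)" .
qed

lemma mult_G_component: "(f \<otimes>\<^bsub>G\<^esub> g) n = (\<Oplus>\<^bsub>C n\<^esub>a\<in>{..n}. B n +>\<^bsub>Q\<^esub> (coset_rep (f a) \<otimes>\<^bsub>Q\<^esub> coset_rep (g (n - a))))"
  by (simp add: G_maps)

lemma mult_G_bilinear: "bilinear_map K G G G (mult G)"
proof (rule bilinear_mapI)
  have z: "B n +>\<^bsub>Q\<^esub> (coset_rep X \<otimes>\<^bsub>Q\<^esub> coset_rep Y) = \<zero>\<^bsub>C n\<^esub>"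
    if "a + b = n" "X \<in> carrier (C a)" "Y \<in> carrier (C b)" "X = \<zero>\<^bsub>C a\<^esub> \<or> Y = \<zero>\<^bsub>C b\<^esub>" for a b n X Y
    using that(4)
      linear_zero[OF C_module C_module bilinear_left[OF mult_component(1)[OF that(1)] that(3)]]
      linear_zero[OF C_module C_module bilinear_right[OF mult_component(1)[OF that(1)] that(2)]] by auto
  have supp: "finite {n. (f \<otimes>\<^bsub>G\<^esub> g) n \<noteq> \<zero>\<^bsub>C n\<^esub>}" if fg: "f \<in> carrier G" "g \<in> carrier G" for f g
  proof (rule finite_subset)
    let ?S = "(\<lambda>(a, b). a + b) ` ({n. f n \<noteq> \<zero>\<^bsub>C n\<^esub>} \<times> {n. g n \<noteq> \<zero>\<^bsub>C n\<^esub>})"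
    show "finite ?S" using fg by (simp add: G_simps direct_sum_simps)
    show "{n. (f \<otimes>\<^bsub>G\<^esub> g) n \<noteq> \<zero>\<^bsub>C n\<^esub>} \<subseteq> ?S"
    proof
      fix n assume n: "n \<in> {n. (f \<otimes>\<^bsub>G\<^esub> g) n \<noteq> \<zero>\<^bsub>C n\<^esub>}"
      interpret C: module K "C n" by (rule C_module)
      have "\<exists>a\<le>n. f a \<noteq> \<zero>\<^bsub>C a\<^esub> \<and> g (n - a) \<noteq> \<zero>\<^bsub>C (n - a)\<^esub>"
      proof (rule ccontr)
        assume "\<not> ?thesis"
        then have 0: "B n +>\<^bsub>Q\<^esub> (coset_rep (f a) \<otimes>\<^bsub>Q\<^esub> coset_rep (g (n - a))) = \<zero>\<^bsub>C n\<^esub>" if "a \<le> n" for a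
          using z[of a "n - a" n "f a" "g (n - a)"] G_component fg that by auto
        have "(f \<otimes>\<^bsub>G\<^esub> g) n = (\<Oplus>\<^bsub>C n\<^esub>a\<in>{..n}. \<zero>\<^bsub>C n\<^esub>)"
          unfolding mult_G_component by (rule C.finsum_cong') (use 0 in auto)
        then show False using n by simp
      qed
      then obtain a where "a \<le> n" "f a \<noteq> \<zero>\<^bsub>C a\<^esub>" "g (n - a) \<noteq> \<zero>\<^bsub>C (n - a)\<^esub>" by blast
      then show "n \<in> ?S" by (intro image_eqI[of _ _ "(a, n - a)"]) auto
    qed
  qed
  show "linear_map K G G (\<lambda>f. f \<otimes>\<^bsub>G\<^esub> g)" if g: "g \<in> carrier G" for g
  proof (rule linear_into_G[where c = "\<lambda>n f. (f \<otimes>\<^bsub>G\<^esub> g) n", OF _ supp[OF _ g]])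
    show "linear_map K G (C n) (\<lambda>f. (f \<otimes>\<^bsub>G\<^esub> g) n)" for n
      unfolding mult_G_component
      by (rule linear_finsum_maps[OF G_module C_module]; (rule linear_comp[OF G_eval bilinear_left[OF mult_component(1) G_component[OF g]]])?) auto
  qed
  show "linear_map K G G (\<lambda>g. f \<otimes>\<^bsub>G\<^esub> g)" if f: "f \<in> carrier G" for f
  proof (rule linear_into_G[where c = "\<lambda>n g. (f \<otimes>\<^bsub>G\<^esub> g) n", OF _ supp[OF f]])
    show "linear_map K G (C n) (\<lambda>g. (f \<otimes>\<^bsub>G\<^esub> g) n)" for n
      unfolding mult_G_component
      by (rule linear_finsum_maps[OF G_module C_module]; (rule linear_comp[OF G_eval bilinear_right[OF mult_component(1) G_component[OF f]]])?) auto
  qed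
qed

lemma mult_G_cls: "x \<in> F a \<Longrightarrow> y \<in> F b \<Longrightarrow> cls a x \<otimes>\<^bsub>G\<^esub> cls b y = cls (a + b) (x \<otimes>\<^bsub>Q\<^esub> y)"
proof (rule ext)
  fix n assume xy: "x \<in> F a" "y \<in> F b"
  interpret C: module K "C n" by (rule C_module)
  have c: "B (a + b) +>\<^bsub>Q\<^esub> (x \<otimes>\<^bsub>Q\<^esub> y) \<in> carrier (C (a + b))"
    using linear_closed[OF C_proj, of "x \<otimes>\<^bsub>Q\<^esub> y" "a + b"] mult_F[OF xy] by simp
  have "(cls a x \<otimes>\<^bsub>G\<^esub> cls b y) n = (\<Oplus>\<^bsub>C n\<^esub>i\<in>{..n}. if a = i \<and> n = a + b then B n +>\<^bsub>Q\<^esub> (x \<otimes>\<^bsub>Q\<^esub> y) else \<zero>\<^bsub>C n\<^esub>)"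
    unfolding mult_G_component
  proof (rule C.finsum_cong')
    fix i assume i: "i \<in> {..n}"
    then have b: "bilinear_map K (C i) (C (n - i)) (C n) (\<lambda>X Y. B n +>\<^bsub>Q\<^esub> (coset_rep X \<otimes>\<^bsub>Q\<^esub> coset_rep Y))"
      by (intro mult_component(1)) auto
    note g = G_component[OF cls_closed[OF xy(1)], of i] G_component[OF cls_closed[OF xy(2)], of "n - i"]
    show "B n +>\<^bsub>Q\<^esub> (coset_rep (cls a x i) \<otimes>\<^bsub>Q\<^esub> coset_rep (cls b y (n - i))) =
        (if a = i \<and> n = a + b then B n +>\<^bsub>Q\<^esub> (x \<otimes>\<^bsub>Q\<^esub> y) else \<zero>\<^bsub>C n\<^esub>)"
    proof (cases "a = i \<and> n = a + b")
      case True then show ?thesis using mult_component(2)[of a b n x y] xy by (auto simp: cls_apply)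
    next
      case False
      then have "cls a x i = \<zero>\<^bsub>C i\<^esub> \<or> cls b y (n - i) = \<zero>\<^bsub>C (n - i)\<^esub>"
        using i by (auto simp: gr_class_def)
      then show ?thesis
        using False linear_zero[OF C_module C_module bilinear_left[OF b g(2)]] linear_zero[OF C_module C_module bilinear_right[OF b g(1)]]
        by auto
    qed
  qed (use c C.zero_closed in auto)
  also have "\<dots> = cls (a + b) (x \<otimes>\<^bsub>Q\<^esub> y) n"
  proof (cases "n = a + b")
    case True
    have "(\<Oplus>\<^bsub>C n\<^esub>i\<in>{..n}. if a = i \<and> n = a + b then B n +>\<^bsub>Q\<^esub> (x \<otimes>\<^bsub>Q\<^esub> y) else \<zero>\<^bsub>C n\<^esub>) =
        (\<Oplus>\<^bsub>C n\<^esub>i\<in>{..n}. if a = i then B n +>\<^bsub>Q\<^esub> (x \<otimes>\<^bsub>Q\<^esub> y) else \<zero>\<^bsub>C n\<^esub>)"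
      by (rule C.finsum_cong') (use True c C.zero_closed in auto)
    also have "\<dots> = B n +>\<^bsub>Q\<^esub> (x \<otimes>\<^bsub>Q\<^esub> y)" by (rule C.finsum_singleton) (use True c in auto)
    finally show ?thesis using True by (simp add: cls_apply)
  next
    case False then show ?thesis by (simp add: cls_apply)
  qed
  finally show "(cls a x \<otimes>\<^bsub>G\<^esub> cls b y) n = cls (a + b) (x \<otimes>\<^bsub>Q\<^esub> y) n" .
qed

lemma rel_mult [rel]: "grel a x g \<Longrightarrow> grel b y h \<Longrightarrow> n = a + b \<Longrightarrow> grel n (x \<otimes>\<^bsub>Q\<^esub> y) (g \<otimes>\<^bsub>G\<^esub> h)"
  using mult_F mult_G_cls by (auto simp: grel_def)

lemma rel_smult [rel]: "rel_K a k k' \<Longrightarrow> grel b x g \<Longrightarrow> n = a + b \<Longrightarrow> grel n (k \<odot>\<^bsub>Q\<^esub> x) (k' \<odot>\<^bsub>G\<^esub> g)"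
proof -
  assume *: "rel_K a k k'" "grel b x g" "n = a + b"
  then have k: "k \<in> carrier K" "k' = (if a = 0 then k else \<zero>\<^bsub>K\<^esub>)" and x: "x \<in> F b" "g = cls b x"
    by (auto simp: triv_rel_def grel_def)
  show ?thesis
  proof (cases "a = 0")
    case True then show ?thesis using * k x F_D(4) cls_smult by (simp add: grel_def)
  next
    case False
    have kx: "k \<odot>\<^bsub>Q\<^esub> x \<in> F b" using F_D(4) k x by simp
    then have "k \<odot>\<^bsub>Q\<^esub> x \<in> B n" using F_B[of b n] False *(3) by auto
    then have "cls n (k \<odot>\<^bsub>Q\<^esub> x) = \<zero>\<^bsub>G\<^esub>" by (rule cls_eq_zero)
    moreover have "\<zero>\<^bsub>K\<^esub> \<odot>\<^bsub>G\<^esub> g = \<zero>\<^bsub>G\<^esub>" using module.smult_l_null[OF G_module] cls_closed x by simp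
    moreover have "k \<odot>\<^bsub>Q\<^esub> x \<in> F n" using kx F_mono[of b n] *(3) by auto
    ultimately show ?thesis using k(2) False by (simp add: grel_def)
  qed
qed

lemma rel_one [rel]: "n = 0 \<Longrightarrow> grel n \<one>\<^bsub>Q\<^esub> \<one>\<^bsub>G\<^esub>"
  using one_in_F by (simp add: grel_def G_maps)

lemmas rel_lift_grel [rel] = rel_lift[where RU = grel]

lemma one_G [lin]: "\<one>\<^bsub>G\<^esub> \<in> carrier G"
  using cls_closed[OF one_in_F] by (simp add: G_maps)

lemma mult_G_left [lin]: "linear_map K X G e \<Longrightarrow> q \<in> carrier G \<Longrightarrow> linear_map K X G (\<lambda>x. e x \<otimes>\<^bsub>G\<^esub> q)"
  by (rule linear_comp[OF _ bilinear_left[OF mult_G_bilinear]])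

lemma mult_G_right [lin]: "linear_map K X G e \<Longrightarrow> q \<in> carrier G \<Longrightarrow> linear_map K X G (\<lambda>x. q \<otimes>\<^bsub>G\<^esub> e x)"
  by (rule linear_comp[OF _ bilinear_right[OF mult_G_bilinear]])

lemma mult_G_closed [lin]: "p \<in> carrier G \<Longrightarrow> q \<in> carrier G \<Longrightarrow> p \<otimes>\<^bsub>G\<^esub> q \<in> carrier G"
  by (rule bilinear_closed[OF mult_G_bilinear])

end

section \<open>Transfer of identities to the associated graded object\<close>

context vector_spaces
begin

text \<open>
  If both sides of an identity \<open>l x = r x\<close> have symbols that are linear functions \<open>f\<close> and \<open>f'\<close> of the symbol of \<open>x\<close>, then
  these functions agree: they do so on symbols, which are unique, and symbols span.
\<close>

lemma symbol_transfer:
  assumes F: "filtered_symbols V G R" "filtered_symbols U GU RU" "linear_map K G GU f" "linear_map K G GU f'"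
    and l: "\<And>n x g. R n x g \<Longrightarrow> x \<in> carrier V \<Longrightarrow> g \<in> carrier G \<Longrightarrow> RU n (l x) (f g)"
    and r: "\<And>n x g. R n x g \<Longrightarrow> x \<in> carrier V \<Longrightarrow> g \<in> carrier G \<Longrightarrow> RU n (r x) (f' g)"
    and eq: "\<And>x. x \<in> carrier V \<Longrightarrow> l x = r x" and g: "g \<in> carrier G"
  shows "f g = f' g"
proof (rule symbol_ext[OF F(1) filtered_symbolsD(2)[OF F(2)] F(3,4) _ g])
  fix n x g assume x: "R n x g" "x \<in> carrier V" "g \<in> carrier G"
  show "f g = f' g"
    by (rule symbol_unique[OF F(2) l[OF x]]) (use r[OF x] eq[OF x(2)] in simp)
qed

end

context hopf_base
begin

lemma act_tensor_right [lin]: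
  "linear_map K X (tensor_product K C D) e \<Longrightarrow> yd_pre C \<Longrightarrow> yd_pre D \<Longrightarrow> h \<in> carrier H \<Longrightarrow>
    linear_map K X (tensor_product K C D) (\<lambda>x. act (yd_tensor K H C D) h (e x))"
  using act_right[of X "yd_tensor K H C D" e h] yd_pre_tensor[of C D] by simp

lemma coact_tensor_lin [lin]:
  "linear_map K X (tensor_product K C D) e \<Longrightarrow> yd_pre C \<Longrightarrow> yd_pre D \<Longrightarrow>
    linear_map K X (tensor_product K H (tensor_product K C D)) (\<lambda>x. coact (yd_tensor K H C D) (e x))"
  using coact_lin[of X "yd_tensor K H C D" e] yd_pre_tensor[of C D] by simp

lemma comult_tensor_lin [lin]:
  "linear_map K X (tensor_product K C D) e \<Longrightarrow> yd_pre C \<Longrightarrow> yd_pre D \<Longrightarrow>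
    linear_map K X (tensor_product K (tensor_product K C D) (tensor_product K C D)) (\<lambda>x. comult (yd_tensor K H C D) (e x))"
  using comult_lin[of X "yd_tensor K H C D" e] yd_pre_tensor[of C D] by simp

lemma counit_tensor_lin [lin]:
  "linear_map K X (tensor_product K C D) e \<Longrightarrow> yd_pre C \<Longrightarrow> yd_pre D \<Longrightarrow>
    linear_map K X (ground_module K) (\<lambda>x. counit (yd_tensor K H C D) (e x))"
  using counit_lin[of X "yd_tensor K H C D" e] yd_pre_tensor[of C D] by simp

end

context connected_coquasi
begin

lemmas grel2_lemmas [rel] = yd_relD(4-7)[OF yd_rel_tensor[OF grel_yd grel_yd], unfolded tensor_rel_yd_tensor]

lemma rel_act_zero: "h \<in> carrier H \<Longrightarrow> grel n x g \<Longrightarrow> grel n (act Q h x) (act G h g)"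
  by (rule grel_lemmas(1)[where a = 0, OF rel_H_zero]) auto

lemma filtered_HHG: "filtered_symbols (tensor_product K H HQ) (tensor_product K H HG) (tensor_rel H H rel_H HQ HG grelH)"
  by (rule rel lin)+

lemma filtered_GGG: "filtered_symbols QQQ (tensor_product K G GG) (tensor_rel Q G grel QQ GG grel2)"
  by (rule rel lin)+

lemma filtered_HGG: "filtered_symbols (tensor_product K H QQ) (tensor_product K H GG) (tensor_rel H H rel_H QQ GG grel2)"
  by (rule rel lin)+

lemma filtered_HK: "filtered_symbols (tensor_product K H (ground_module K)) (tensor_product K H (ground_module K))
    (tensor_rel H H rel_H (ground_module K) (ground_module K) rel_K)"
  by (rule rel lin)+

text \<open>
  Each axiom is transferred from \<open>Q\<close>. Both sides of the axiom are built by the same Sweedler expressions in \<open>Q\<close> and in \<open>gr Q\<close>,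
  so that \<open>rel\<close> provides the relations and \<open>lin\<close> the linearity.
\<close>

lemma yd_module_G: "yd_module K H G"
proof (rule yd_module.intro[OF H.hopf_algebra_axioms G_module yd_module_axioms.intro])
  show "bilinear_map K H G G (act G)" by (rule act_G_bilinear)
  show "linear_map K G HG (coact G)" by (rule coact_G(1))
  show "act G \<one>\<^bsub>H\<^esub> v = v" if v: "v \<in> carrier G" for v
    by (rule symbol_transfer[OF filtered_G filtered_G _ _ _ _ Q.act_one v]; (rule refl | assumption | rule rel lin | arith)+)
  show "act G (g \<otimes>\<^bsub>H\<^esub> h) v = act G g (act G h v)" if [lin]: "g \<in> carrier H" "h \<in> carrier H" and v: "v \<in> carrier G" for g h v
    by (rule symbol_transfer[OF filtered_G filtered_G _ _ _ _ Q.act_mult[OF that(1,2)] v]; (rule refl | assumption | rule rel lin | arith)+)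
  show "tensor_lift K G (\<lambda>h y. counit H h \<odot>\<^bsub>G\<^esub> y) (coact G v) = v" if v: "v \<in> carrier G" for v
    by (rule symbol_transfer[OF filtered_G filtered_G _ _ _ _ Q.coact_counit v]; (rule refl | assumption | rule rel lin | arith)+)
  show "tensor_lift K (tensor_product K H HG)
        (\<lambda>h y. tensor_lift K (tensor_product K H HG)
          (\<lambda>h1 h2. pure_tensor K H HG h1 (pure_tensor K H G h2 y)) (comult H h)) (coact G v)
      = tensor_map K H HG (\<lambda>h. h) (coact G) (coact G v)" if v: "v \<in> carrier G" for v
    unfolding tensor_map_def
    by (rule symbol_transfer[OF filtered_G filtered_HHG _ _ _ _ Q.coact_coassoc[unfolded tensor_map_def]]; (rule v | rule refl | assumption | rule rel lin | arith)+)
  show "tensor_lift K HG (\<lambda>h1 h2. tensor_map K H G (\<lambda>g. g \<otimes>\<^bsub>H\<^esub> h2) (\<lambda>y. y) (coact G (act G h1 v))) (comult H h)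
      = tensor_lift K HG (\<lambda>h1 h2. tensor_map K H G (\<lambda>g. h1 \<otimes>\<^bsub>H\<^esub> g) (\<lambda>y. act G h2 y) (coact G v)) (comult H h)"
    if [lin]: "h \<in> carrier H" and v: "v \<in> carrier G" for h v
    unfolding tensor_map_def
    by (rule symbol_transfer[OF filtered_G filtered_grelH _ _ _ _ Q.yd_compatible[unfolded tensor_map_def, OF that(1)] v]; (rule refl | assumption | rule rel lin | arith)+)
qed

lemma coalgebra_G: "coalgebra K G"
proof (rule coalgebra.intro[OF K.field_axioms G_module coalgebra_axioms.intro])
  show "linear_map K G GG (comult G)" by (rule comult_G(1))
  show "linear_map K G (ground_module K) (counit G)" by (rule counit_G(1))
  show "tensor_lift K (tensor_product K G GG)
        (\<lambda>x y. tensor_lift K (tensor_product K G GG)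
          (\<lambda>x1 x2. pure_tensor K G GG x1 (pure_tensor K G G x2 y)) (comult G x)) (comult G c)
      = tensor_map K G GG (\<lambda>x. x) (comult G) (comult G c)" if c: "c \<in> carrier G" for c
    unfolding tensor_map_def
    by (rule symbol_transfer[OF filtered_G filtered_GGG _ _ _ _ Q.C.coassoc[unfolded tensor_map_def]]; (rule c | rule refl | assumption | rule rel lin | arith)+)
  show "tensor_lift K G (\<lambda>x y. counit G x \<odot>\<^bsub>G\<^esub> y) (comult G c) = c" if c: "c \<in> carrier G" for c
    by (rule symbol_transfer[OF filtered_G filtered_G _ _ _ _ Q.C.counit_left c]; (rule refl | assumption | rule rel lin | arith)+)
  show "tensor_lift K G (\<lambda>x y. counit G y \<odot>\<^bsub>G\<^esub> x) (comult G c) = c" if c: "c \<in> carrier G" for c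
    by (rule symbol_transfer[OF filtered_G filtered_G _ _ _ _ Q.C.counit_right c]; (rule refl | assumption | rule rel lin | arith)+)
qed

lemma coact_comult_G:
  assumes "v \<in> carrier G"
  shows "coact (yd_tensor K H G G) (comult G v) = tensor_map K H GG (\<lambda>h. h) (comult G) (coact G v)"
  unfolding tensor_map_def
  by (rule symbol_transfer[OF filtered_G filtered_HGG _ _ _ _ coact_comult[unfolded tensor_map_def] assms]; (rule refl | assumption | rule rel lin | arith)+)

lemma act_comult_Q: "h \<in> carrier H \<Longrightarrow> x \<in> carrier Q \<Longrightarrow> comult Q (act Q h x) = act (yd_tensor K H Q Q) h (comult Q x)"
  using Q.comult_yd by (simp add: yd_morphism_def)

lemma act_comult_G:
  assumes [lin]: "h \<in> carrier H" and v: "v \<in> carrier G"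
  shows "comult G (act G h v) = act (yd_tensor K H G G) h (comult G v)"
  by (rule symbol_transfer[OF filtered_G filtered_grel2 _ _ _ _ act_comult_Q[OF assms(1)] v]; (rule refl | assumption | rule rel lin | arith)+)

lemma counit_act_Q: "h \<in> carrier H \<Longrightarrow> x \<in> carrier Q \<Longrightarrow> counit Q (act Q h x) = counit H h \<otimes>\<^bsub>K\<^esub> counit Q x"
  using Q.counit_yd by (simp add: yd_morphism_def yd_unit_structure)

lemma counit_act_G:
  assumes [lin]: "h \<in> carrier H" and v: "v \<in> carrier G"
  shows "counit G (act G h v) = counit H h \<otimes>\<^bsub>K\<^esub> counit G v"
  by (rule symbol_transfer[OF filtered_G filtered_triv _ _ _ _ counit_act_Q[OF assms(1)] v]; (rule refl | assumption | rule rel lin | arith)+)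

lemma coact_counit_Q: "x \<in> carrier Q \<Longrightarrow> pure_tensor K H (ground_module K) \<one>\<^bsub>H\<^esub> (counit Q x) =
    tensor_map K H (ground_module K) (\<lambda>h. h) (counit Q) (coact Q x)"
  using Q.counit_yd by (simp add: yd_morphism_def yd_unit_structure tensor_map_def)

lemma coact_counit_G:
  assumes "v \<in> carrier G"
  shows "pure_tensor K H (ground_module K) \<one>\<^bsub>H\<^esub> (counit G v) = tensor_map K H (ground_module K) (\<lambda>h. h) (counit G) (coact G v)"
  unfolding tensor_map_def
  by (rule symbol_transfer[OF filtered_G filtered_HK _ _ _ _ coact_counit_Q[unfolded tensor_map_def] assms]; (rule refl | assumption | rule rel lin | arith)+)

lemma yd_coalgebra_G: "yd_coalgebra K H G"
proof (rule yd_coalgebra.intro[OF yd_module_G coalgebra_G yd_coalgebra_axioms.intro])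
  show "yd_morphism K H G (yd_tensor K H G G) (comult G)"
    unfolding yd_morphism_def using comult_G(1) act_comult_G coact_comult_G by (simp add: tensor_map_def)
  show "yd_morphism K H G (yd_unit K H) (counit G)"
    unfolding yd_morphism_def using counit_G(1) counit_act_G coact_counit_G by (simp add: tensor_map_def yd_unit_structure)
qed

lemma mult_map_Q:
  assumes "t \<in> carrier QQ"
  shows "h \<in> carrier H \<Longrightarrow> mult_map K Q (act (yd_tensor K H Q Q) h t) = act Q h (mult_map K Q t)"
    "coact Q (mult_map K Q t) = tensor_map K H Q (\<lambda>h. h) (mult_map K Q) (coact (yd_tensor K H Q Q) t)"
    "comult Q (mult_map K Q t) = tensor_map K Q Q (mult_map K Q) (mult_map K Q) (comult (yd_tensor K H Q Q) t)"
    "counit Q (mult_map K Q t) = counit (yd_tensor K H Q Q) t"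
  using Q.mult_map_morphism assms by (auto simp: yd_coalgebra_morphism_def yd_morphism_def)

lemma mult_map_Q_lin [lin]: "linear_map K X QQ e \<Longrightarrow> linear_map K X Q (\<lambda>x. mult_map K Q (e x))"
  by (rule linear_comp[OF _ mult_map_linear])

lemma mult_map_G_lin [lin]: "linear_map K X GG e \<Longrightarrow> linear_map K X G (\<lambda>x. mult_map K G (e x))"
  unfolding mult_map_def by (rule lin | assumption)+

lemma mult_map_Q_closed [lin]: "t \<in> carrier QQ \<Longrightarrow> mult_map K Q t \<in> carrier Q"
  by (rule linear_closed[OF mult_map_linear])

lemma mult_map_G_closed [lin]: "t \<in> carrier GG \<Longrightarrow> mult_map K G t \<in> carrier G"
  unfolding mult_map_def by (rule lin | assumption)+

lemma rel_mult_map [rel]: "grel2 n t s \<Longrightarrow> grel n (mult_map K Q t) (mult_map K G s)"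
  unfolding mult_map_def by (rule refl | assumption | rule rel lin | arith)+

lemma mult_map_G:
  assumes t: "t \<in> carrier GG"
  shows "h \<in> carrier H \<Longrightarrow> mult_map K G (act (yd_tensor K H G G) h t) = act G h (mult_map K G t)"
    and "coact G (mult_map K G t) = tensor_map K H G (\<lambda>h. h) (mult_map K G) (coact (yd_tensor K H G G) t)"
    and "comult G (mult_map K G t) = tensor_map K G G (mult_map K G) (mult_map K G) (comult (yd_tensor K H G G) t)"
    and "counit G (mult_map K G t) = counit (yd_tensor K H G G) t"
proof -
  show "mult_map K G (act (yd_tensor K H G G) h t) = act G h (mult_map K G t)" if [lin]: "h \<in> carrier H"
    by (rule symbol_transfer[OF filtered_grel2 filtered_G _ _ _ _ mult_map_Q(1)[OF _ that] t]; (rule refl | assumption | rule rel_act_zero | rule rel lin | arith)+)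
  show "coact G (mult_map K G t) = tensor_map K H G (\<lambda>h. h) (mult_map K G) (coact (yd_tensor K H G G) t)"
    unfolding tensor_map_def
    by (rule symbol_transfer[OF filtered_grel2 filtered_grelH _ _ _ _ mult_map_Q(2)[unfolded tensor_map_def] t];
      (rule refl | assumption | rule rel lin | arith)+)
  show "comult G (mult_map K G t) = tensor_map K G G (mult_map K G) (mult_map K G) (comult (yd_tensor K H G G) t)"
    unfolding tensor_map_def
    by (rule symbol_transfer[OF filtered_grel2 filtered_grel2 _ _ _ _ mult_map_Q(3)[unfolded tensor_map_def] t];
      (rule refl | assumption | rule rel lin | arith)+)
  show "counit G (mult_map K G t) = counit (yd_tensor K H G G) t"
    by (rule symbol_transfer[OF filtered_grel2 filtered_triv _ _ _ _ mult_map_Q(4) t];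
      (rule refl | assumption | rule rel lin | arith)+)
qed

lemma mult_map_G_linear: "linear_map K GG G (mult_map K G)"
  unfolding mult_map_def by (rule tensor_lift_linear) (rule lin | assumption)+

lemma mult_map_G_morphism: "yd_coalgebra_morphism K H (yd_tensor K H G G) G (mult_map K G)"
  unfolding yd_coalgebra_morphism_def yd_morphism_def
  using mult_map_G mult_map_G_linear by simp

subsection \<open>The unit\<close>

lemma act_one_G: "h \<in> carrier H \<Longrightarrow> act G h \<one>\<^bsub>G\<^esub> = counit H h \<odot>\<^bsub>G\<^esub> \<one>\<^bsub>G\<^esub>"
  using act_G_cls[OF _ one_in_F, of h] cls_smult[OF _ one_in_F, of "counit H h"] counit_H_closed[of h]
  by (simp add: G_maps(2) act_one)

lemma coact_one_G: "coact G \<one>\<^bsub>G\<^esub> = pure_tensor K H G \<one>\<^bsub>H\<^esub> \<one>\<^bsub>G\<^esub>"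
proof (rule symbol_unique[OF filtered_grelH])
  show "grelH 0 (coact Q \<one>\<^bsub>Q\<^esub>) (coact G \<one>\<^bsub>G\<^esub>)"
    by (rule refl | rule rel lin)+
  show "grelH 0 (coact Q \<one>\<^bsub>Q\<^esub>) (pure_tensor K H G \<one>\<^bsub>H\<^esub> \<one>\<^bsub>G\<^esub>)"
    unfolding coact_one
    by (rule tensor_rel_pure[where R = rel_H and R' = grel and a = 0 and b = 0]) (rule refl | rule rel lin | simp)+
qed

lemma comult_one_G: "comult G \<one>\<^bsub>G\<^esub> = pure_tensor K G G \<one>\<^bsub>G\<^esub> \<one>\<^bsub>G\<^esub>"
proof (rule symbol_unique[OF filtered_grel2])
  show "grel2 0 (comult Q \<one>\<^bsub>Q\<^esub>) (comult G \<one>\<^bsub>G\<^esub>)"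
    by (rule refl | rule rel lin)+
  show "grel2 0 (comult Q \<one>\<^bsub>Q\<^esub>) (pure_tensor K G G \<one>\<^bsub>G\<^esub> \<one>\<^bsub>G\<^esub>)"
    unfolding comult_one
    by (rule tensor_rel_pure[where R = grel and R' = grel and a = 0 and b = 0]) (rule refl | rule rel lin | simp)+
qed

lemma counit_one_G: "counit G \<one>\<^bsub>G\<^esub> = \<one>\<^bsub>K\<^esub>"
  using counit_G(2)[OF one_in_F] by (simp add: G_maps(2) counit_one)

lemma unit_map_G_linear: "linear_map K (ground_module K) G (unit_map G)"
  unfolding unit_map_def[abs_def] by (rule lin)+

lemma unit_map_G_morphism: "yd_coalgebra_morphism K H (yd_unit K H) G (unit_map G)"
  unfolding yd_coalgebra_morphism_def yd_morphism_def
proof (intro conjI ballI)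
  show "linear_map K (yd_unit K H) G (unit_map G)" using unit_map_G_linear by simp
  fix a assume "a \<in> carrier (yd_unit K H)"
  then have a [lin]: "a \<in> carrier (ground_module K)" and aK: "a \<in> carrier K" by simp_all
  have oneK [lin]: "\<one>\<^bsub>K\<^esub> \<in> carrier (ground_module K)" by simp
  have u: "unit_map G a = a \<odot>\<^bsub>G\<^esub> \<one>\<^bsub>G\<^esub>" by (simp add: unit_map_def)
  show "unit_map G (act (yd_unit K H) h a) = act G h (unit_map G a)" if h: "h \<in> carrier H" for h
    unfolding u linear_smult[OF act_right[OF linear_id G_pre h] aK one_G] act_one_G[OF h]
    using counit_H_closed[OF h] aK one_G
    by (simp add: unit_map_def yd_unit_structure Gm.smult_assoc1[symmetric] K.m_comm)
  show "coact G (unit_map G a) = tensor_map K H G (\<lambda>h. h) (unit_map G) (coact (yd_unit K H) a)"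
    unfolding u linear_smult[OF coact_G(1) aK one_G] coact_one_G yd_unit_structure
      tensor_map_pure[OF linear_id unit_map_G_linear module_H G_module module_H ground_module one_H_closed a]
    using linear_smult[OF bilinear_right[OF pure_bilinear[OF module_H G_module] one_H_closed] aK one_G] by simp
  show "comult G (unit_map G a) = tensor_map K G G (unit_map G) (unit_map G) (comult (yd_unit K H) a)"
    unfolding u linear_smult[OF comult_G(1) aK one_G] comult_one_G yd_unit_structure
      tensor_map_pure[OF unit_map_G_linear unit_map_G_linear G_module G_module ground_module ground_module a oneK]
    using linear_smult[OF bilinear_left[OF pure_bilinear[OF G_module G_module] one_G] aK one_G] one_G
    by (simp add: unit_map_def)
  show "counit G (unit_map G a) = counit (yd_unit K H) a"
    unfolding u linear_smult[OF counit_G(1) aK one_G] counit_one_G yd_unit_structure using aK by simp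
qed

lemma yd_magma_coalgebra_G: "yd_magma_coalgebra K H G"
proof (rule yd_magma_coalgebra.intro[OF yd_coalgebra_G yd_magma_coalgebra_axioms.intro])
  show "\<one>\<^bsub>G\<^esub> \<otimes>\<^bsub>G\<^esub> x = x" if x: "x \<in> carrier G" for x
    by (rule symbol_transfer[OF filtered_G filtered_G _ _ _ _ Q.unit_left x])
      (rule refl | assumption | rule rel lin | simp)+
  show "x \<otimes>\<^bsub>G\<^esub> \<one>\<^bsub>G\<^esub> = x" if x: "x \<in> carrier G" for x
    by (rule symbol_transfer[OF filtered_G filtered_G _ _ _ _ Q.unit_right x])
      (rule refl | assumption | rule rel lin | simp)+
qed (rule mult_G_bilinear one_G mult_map_G_morphism unit_map_G_morphism)+

end

subsection \<open>Counit laws in tensor products\<close>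

context hopf_base
begin

text \<open>
  What is needed of a right factor \<open>D\<close> for the counit laws of \<open>C \<otimes> D\<close>. The property is inherited by \<open>C \<otimes> D\<close> and thus
  reaches all iterated tensor products.
\<close>

definition counital :: "('k, 'h, 'v, 'b) yd_coalgebra_scheme \<Rightarrow> bool"
  where "counital D \<longleftrightarrow> yd_pre D \<and> (\<forall>x\<in>carrier D. act D \<one>\<^bsub>H\<^esub> x = x) \<and>
    (\<forall>h\<in>carrier H. \<forall>x\<in>carrier D. counit D (act D h x) = counit H h \<otimes>\<^bsub>K\<^esub> counit D x) \<and>
    (\<forall>x\<in>carrier D. tensor_lift K D (\<lambda>x y. counit D x \<odot>\<^bsub>D\<^esub> y) (comult D x) = x) \<and>
    (\<forall>x\<in>carrier D. tensor_lift K D (\<lambda>x y. counit D y \<odot>\<^bsub>D\<^esub> x) (comult D x) = x)"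

lemma counital_yd_coalgebra:
  assumes "yd_coalgebra K H C" shows "counital C"
proof -
  interpret C: yd_coalgebra K H C by fact
  show ?thesis unfolding counital_def
    using yd_coalgebra_pre[OF assms] C.counit_yd C.act_one C.C.counit_left C.C.counit_right
    by (auto simp: yd_morphism_def yd_unit_structure)
qed

lemma finsum_yd_tensor: "finsum (yd_tensor K H C D) = finsum (tensor_product K C D)"
  by (intro ext) (simp add: finsum_def finprod_def)

lemma tensor_lift_yd_tensor [simp]: "tensor_lift K (yd_tensor K H C D) = tensor_lift K (tensor_product K C D)"
  unfolding tensor_lift_def[abs_def] by (simp add: finsum_yd_tensor)

text \<open>
  Apply the counit to \<open>\<Delta>(c \<otimes> d) = c\<^sub>1 \<otimes> (c\<^sub>2)\<^sub>-\<^sub>1 d\<^sub>1 \<otimes> (c\<^sub>2)\<^sub>0 \<otimes> d\<^sub>2\<close>. On the left half, \<open>\<epsilon>(h d) = \<epsilon>(h) \<epsilon>(d)\<close> and the counit law of the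
  coaction remove the coaction. On the right half, the coaction disappears because the counit of \<open>C\<close> is
  colinear, that is, \<open>c\<^sub>-\<^sub>1 \<epsilon>(c\<^sub>0) = \<epsilon>(c) 1\<close>. The counit laws of \<open>C\<close> and \<open>D\<close> do the rest.
\<close>

lemma counital_tensor:
  assumes C: "yd_coalgebra K H C" and D: "counital D"
  shows "counital (yd_tensor K H C D)"
proof -
  interpret C: yd_coalgebra K H C by fact
  let ?T = "tensor_product K C D" and ?Y = "yd_tensor K H C D"
  have preC [lin]: "yd_pre C" by (rule yd_coalgebra_pre[OF C])
  have preD [lin]: "yd_pre D" using D by (simp add: counital_def)
  have mods [lin]: "module K C" "module K D" "module K ?T" by (rule lin)+
  have preT: "yd_pre ?Y" by (rule yd_pre_tensor[OF preC preD])
  \<comment> \<open>The rules for a general structure, applied to \<open>C \<otimes> D\<close>, ask for its carrier.\<close>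
  have Ylin [lin]: "x \<in> carrier ?T \<Longrightarrow> x \<in> carrier ?Y" "linear_map K X ?T e \<Longrightarrow> linear_map K X ?Y e" "yd_pre ?Y" for x e and X :: "('k, 'x, 'y) module_scheme"
    using preT by simp_all
  have Dl: "act D \<one>\<^bsub>H\<^esub> x = x" "h \<in> carrier H \<Longrightarrow> counit D (act D h x) = counit H h \<otimes>\<^bsub>K\<^esub> counit D x"
    "tensor_lift K D (\<lambda>x y. counit D x \<odot>\<^bsub>D\<^esub> y) (comult D x) = x"
    "tensor_lift K D (\<lambda>x y. counit D y \<odot>\<^bsub>D\<^esub> x) (comult D x) = x" if "x \<in> carrier D" for x h
    using D that by (simp_all add: counital_def)
  have Cact: "counit C (act C h x) = counit H h \<otimes>\<^bsub>K\<^esub> counit C x" if "h \<in> carrier H" "x \<in> carrier C" for h x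
    using C.counit_yd that by (simp add: yd_morphism_def yd_unit_structure)
  have Ccoact: "tensor_lift K H (\<lambda>g y. counit C y \<odot>\<^bsub>H\<^esub> g) (coact C x) = counit C x \<odot>\<^bsub>H\<^esub> \<one>\<^bsub>H\<^esub>"
    if [lin]: "x \<in> carrier C" for x
  proof -
    have "tensor_lift K H (\<lambda>g a. a \<odot>\<^bsub>H\<^esub> g) (pure_tensor K H (ground_module K) \<one>\<^bsub>H\<^esub> (counit C x)) =
        tensor_lift K H (\<lambda>g a. a \<odot>\<^bsub>H\<^esub> g) (tensor_map K H (ground_module K) (\<lambda>h. h) (counit C) (coact C x))"
      using C.counit_yd that by (simp add: yd_morphism_def yd_unit_structure tensor_map_def)
    also have "\<dots> = tensor_lift K H (\<lambda>g y. counit C y \<odot>\<^bsub>H\<^esub> g) (coact C x)"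
      by (rule lift_tensor_map[OF linear_id C.C.counit_linear]) (rule lin | assumption)+
    also have "tensor_lift K H (\<lambda>g a. a \<odot>\<^bsub>H\<^esub> g) (pure_tensor K H (ground_module K) \<one>\<^bsub>H\<^esub> (counit C x)) = counit C x \<odot>\<^bsub>H\<^esub> \<one>\<^bsub>H\<^esub>"
      by (rule tensor_lift_pure) (rule lin | assumption)+
    finally show ?thesis by simp
  qed
  have cT: "counit ?Y (pure_tensor K C D c d) = counit C c \<otimes>\<^bsub>K\<^esub> counit D d" if "c \<in> carrier C" "d \<in> carrier D" for c d
    by (rule counit_tensor_pure[OF preC preD that])
  have kc: "counit C c \<in> carrier K" if "c \<in> carrier C" for c using counit_in[OF preC that] by simp
  have kd: "counit D c \<in> carrier K" if "c \<in> carrier D" for c using counit_in[OF preD that] by simp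
  have kh: "counit H c \<in> carrier K" if "c \<in> carrier H" for c using counit_H_closed[OF that] by simp
  have pure_scale: "pure_tensor K C D (a \<odot>\<^bsub>C\<^esub> c) (b \<odot>\<^bsub>D\<^esub> d) = (a \<otimes>\<^bsub>K\<^esub> b) \<odot>\<^bsub>?T\<^esub> pure_tensor K C D c d"
    if "a \<in> carrier K" "b \<in> carrier K" "c \<in> carrier C" "d \<in> carrier D" for a b c d
    using linear_smult[OF bilinear_left[OF pure_bilinear[OF mods(1,2)], of "b \<odot>\<^bsub>D\<^esub> d"], of a c]
      linear_smult[OF bilinear_right[OF pure_bilinear[OF mods(1,2)], of c], of b d] that
      pure_closed[OF mods(1,2) that(3,4)]
    by (simp add: module.smult_closed[OF mods(2)] module.smult_assoc1[OF mods(3)])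
  show ?thesis unfolding counital_def yd_tensor_module_simps tensor_lift_yd_tensor
  proof (intro conjI ballI preT)
    fix t assume t: "t \<in> carrier ?T"
    have "act ?Y \<one>\<^bsub>H\<^esub> (pure_tensor K C D c d) = pure_tensor K C D c d" if [lin]: "c \<in> carrier C" "d \<in> carrier D" for c d
      unfolding act_tensor_pure[OF preC preD that one_H_closed] H.comult_one
      by (rule trans, rule tensor_lift_pure, (rule lin | assumption)+) (simp add: that C.act_one Dl)
    note * = this
    show "act ?Y \<one>\<^bsub>H\<^esub> t = t"
      by (rule tensor_ext[OF mods(1,2,3) _ linear_id _ t]) (rule * lin | assumption)+
    fix h assume hH [lin]: "h \<in> carrier H"
    show "counit ?Y (act ?Y h t) = counit H h \<otimes>\<^bsub>K\<^esub> counit ?Y t"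
    proof (rule tensor_ext[OF mods(1,2) ground_module _ _ _ t])
      fix c d assume that [lin]: "c \<in> carrier C" "d \<in> carrier D"
      show "counit ?Y (act ?Y h (pure_tensor K C D c d)) = counit H h \<otimes>\<^bsub>K\<^esub> counit ?Y (pure_tensor K C D c d)"
      proof -
        have kcd [lin]: "counit C c \<otimes>\<^bsub>K\<^esub> counit D d \<in> carrier (ground_module K)" by (rule lin | assumption)+
        have "counit ?Y (act ?Y h (pure_tensor K C D c d)) =
            tensor_lift K (ground_module K) (\<lambda>h1 h2. counit ?Y (pure_tensor K C D (act C h1 c) (act D h2 d))) (comult H h)"
          unfolding act_tensor_pure[OF preC preD that hH]
          by (rule linear_lift_commute) (rule lin | assumption)+
        also have "\<dots> = tensor_lift K (ground_module K) (\<lambda>h1 h2. (counit C c \<otimes>\<^bsub>K\<^esub> counit D d) \<otimes>\<^bsub>K\<^esub> counit H (counit H h2 \<odot>\<^bsub>H\<^esub> h1)) (comult H h)"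
        proof (rule tensor_lift_cong)
          fix h1 h2 assume lin_h [lin]: "h1 \<in> carrier H" "h2 \<in> carrier H"
          have "counit ?Y (pure_tensor K C D (act C h1 c) (act D h2 d)) = counit C (act C h1 c) \<otimes>\<^bsub>K\<^esub> counit D (act D h2 d)"
            by (rule cT) (rule lin | assumption)+
          also have "\<dots> = (counit C c \<otimes>\<^bsub>K\<^esub> counit D d) \<otimes>\<^bsub>K\<^esub> (counit H h2 \<otimes>\<^bsub>K\<^esub> counit H h1)"
            using Cact[of h1 c] Dl(2)[of d h2] kc[of c] kd[of d] kh[of h1] kh[of h2] that lin_h by (simp add: K.m_ac)
          also have "counit H h2 \<otimes>\<^bsub>K\<^esub> counit H h1 = counit H (counit H h2 \<odot>\<^bsub>H\<^esub> h1)"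
            using linear_smult[OF H.counit_linear, of "counit H h2" h1] kh lin_h by simp
          finally show "counit ?Y (pure_tensor K C D (act C h1 c) (act D h2 d)) =
            (counit C c \<otimes>\<^bsub>K\<^esub> counit D d) \<otimes>\<^bsub>K\<^esub> counit H (counit H h2 \<odot>\<^bsub>H\<^esub> h1)" .
        qed (rule lin | assumption)+
        also have "\<dots> = (counit C c \<otimes>\<^bsub>K\<^esub> counit D d) \<otimes>\<^bsub>K\<^esub> counit H (tensor_lift K H (\<lambda>h1 h2. counit H h2 \<odot>\<^bsub>H\<^esub> h1) (comult H h))"
          by (rule linear_lift_commute[symmetric, where f = "\<lambda>x. (counit C c \<otimes>\<^bsub>K\<^esub> counit D d) \<otimes>\<^bsub>K\<^esub> counit H x"]) (rule lin | assumption)+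
        also have "tensor_lift K H (\<lambda>h1 h2. counit H h2 \<odot>\<^bsub>H\<^esub> h1) (comult H h) = h" by (rule H.counit_right[OF hH])
        finally show ?thesis using cT[OF that] kc[of c] kd[of d] kh[OF hH] that by (simp add: K.m_ac)
      qed
    qed (rule lin | assumption)+
  next
    fix t assume t: "t \<in> carrier ?T"
    show "tensor_lift K ?T (\<lambda>x y. counit ?Y x \<odot>\<^bsub>?T\<^esub> y) (comult ?Y t) = t"
    proof (rule tensor_ext[OF mods(1,2,3) _ linear_id _ t])
      fix c d assume cd [lin]: "c \<in> carrier C" "d \<in> carrier D"
      show "tensor_lift K ?T (\<lambda>x y. counit ?Y x \<odot>\<^bsub>?T\<^esub> y) (comult ?Y (pure_tensor K C D c d)) = pure_tensor K C D c d"
      proof -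
        let ?\<beta> = "\<lambda>x y. counit ?Y x \<odot>\<^bsub>?T\<^esub> y"
        have bi [lin]: "bilinear_map K ?T ?T ?T ?\<beta>" by (rule lin | assumption)+
        have \<beta>_lin: "linear_map K (tensor_product K ?T ?T) ?T (tensor_lift K ?T ?\<beta>)"
          by (rule tensor_lift_linear[OF mods(3) mods(3) mods(3) bi])
        have body: "tensor_lift K ?T (\<lambda>g y. tensor_lift K ?T ?\<beta> (pure_tensor K ?T ?T (pure_tensor K C D c1 (act D g d1)) (pure_tensor K C D y d2))) (coact C c2)
            = pure_tensor K C D (counit C c1 \<odot>\<^bsub>C\<^esub> c2) (counit D d1 \<odot>\<^bsub>D\<^esub> d2)"
          if c12 [lin]: "c1 \<in> carrier C" "c2 \<in> carrier C" and d12 [lin]: "d1 \<in> carrier D" "d2 \<in> carrier D" for c1 c2 d1 d2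
        proof -
          have "tensor_lift K ?T (\<lambda>g y. tensor_lift K ?T ?\<beta> (pure_tensor K ?T ?T (pure_tensor K C D c1 (act D g d1)) (pure_tensor K C D y d2))) (coact C c2)
              = tensor_lift K ?T (\<lambda>g y. pure_tensor K C D (counit C c1 \<odot>\<^bsub>C\<^esub> (counit H g \<odot>\<^bsub>C\<^esub> y)) (counit D d1 \<odot>\<^bsub>D\<^esub> d2)) (coact C c2)"
          proof (rule tensor_lift_cong)
            fix g y assume gy [lin]: "g \<in> carrier H" "y \<in> carrier C"
            have "tensor_lift K ?T ?\<beta> (pure_tensor K ?T ?T (pure_tensor K C D c1 (act D g d1)) (pure_tensor K C D y d2)) =
                ?\<beta> (pure_tensor K C D c1 (act D g d1)) (pure_tensor K C D y d2)"
              by (rule tensor_lift_pure) (rule lin | assumption)+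
            also have "counit ?Y (pure_tensor K C D c1 (act D g d1)) = counit C c1 \<otimes>\<^bsub>K\<^esub> (counit H g \<otimes>\<^bsub>K\<^esub> counit D d1)"
              using cT[OF c12(1) act_in[OF preD gy(1) d12(1)]] Dl(2)[OF d12(1) gy(1)] by simp
            finally show "tensor_lift K ?T ?\<beta> (pure_tensor K ?T ?T (pure_tensor K C D c1 (act D g d1)) (pure_tensor K C D y d2)) =
                pure_tensor K C D (counit C c1 \<odot>\<^bsub>C\<^esub> (counit H g \<odot>\<^bsub>C\<^esub> y)) (counit D d1 \<odot>\<^bsub>D\<^esub> d2)"
              using pure_scale[of "counit C c1 \<otimes>\<^bsub>K\<^esub> counit H g" "counit D d1" y d2] gy d12 c12 kc kd kh
              by (simp add: K.m_assoc module.smult_assoc1[OF mods(1)])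
          qed (rule lin | assumption)+
          also have "\<dots> = pure_tensor K C D (counit C c1 \<odot>\<^bsub>C\<^esub> tensor_lift K C (\<lambda>g y. counit H g \<odot>\<^bsub>C\<^esub> y) (coact C c2)) (counit D d1 \<odot>\<^bsub>D\<^esub> d2)"
            by (rule linear_lift_commute[symmetric, where f = "\<lambda>x. pure_tensor K C D (counit C c1 \<odot>\<^bsub>C\<^esub> x) (counit D d1 \<odot>\<^bsub>D\<^esub> d2)"])
              (rule lin | assumption)+
          finally show ?thesis by (simp add: C.coact_counit c12)
        qed
        have "tensor_lift K ?T ?\<beta> (comult ?Y (pure_tensor K C D c d)) =
          tensor_lift K ?T (\<lambda>c1 c2. tensor_lift K ?T (\<lambda>d1 d2. pure_tensor K C D (counit C c1 \<odot>\<^bsub>C\<^esub> c2) (counit D d1 \<odot>\<^bsub>D\<^esub> d2)) (comult D d)) (comult C c)"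
          unfolding comult_tensor_pure[OF preC preD cd]
          apply (rule trans, rule linear_lift_commute[OF _ _ _ _ _ \<beta>_lin], (rule lin | assumption)+)
          apply (rule tensor_lift_cong, (rule lin | assumption)+)
          apply (rule trans, rule linear_lift_commute[OF _ _ _ _ _ \<beta>_lin], (rule lin | assumption)+)
          apply (rule tensor_lift_cong, (rule lin | assumption)+)
          apply (rule trans, rule linear_lift_commute[OF _ _ _ _ _ \<beta>_lin], (rule lin | assumption)+)
          apply (rule body, assumption+)
          done
        also have "\<dots> = tensor_lift K ?T (\<lambda>c1 c2. pure_tensor K C D (counit C c1 \<odot>\<^bsub>C\<^esub> c2) d) (comult C c)"
          apply (rule tensor_lift_cong, (rule lin | assumption)+)
          apply (rule trans, rule linear_lift_commute[symmetric, where f = "pure_tensor K C D (counit C c1 \<odot>\<^bsub>C\<^esub> c2)" and U = D for c1 c2], (rule lin | assumption)+)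
          apply (simp only: Dl(3,4)[OF cd(2)])
          done
        also have "\<dots> = pure_tensor K C D c d"
          apply (rule trans, rule linear_lift_commute[symmetric, where f = "\<lambda>x. pure_tensor K C D x d" and U = C], (rule lin | assumption)+)
          apply (simp only: C.C.counit_left[OF cd(1)] C.C.counit_right[OF cd(1)])
          done
        finally show ?thesis .
      qed
    qed (rule lin | assumption)+
    show "tensor_lift K ?T (\<lambda>x y. counit ?Y y \<odot>\<^bsub>?T\<^esub> x) (comult ?Y t) = t"
    proof (rule tensor_ext[OF mods(1,2,3) _ linear_id _ t])
      fix c d assume cd [lin]: "c \<in> carrier C" "d \<in> carrier D"
      show "tensor_lift K ?T (\<lambda>x y. counit ?Y y \<odot>\<^bsub>?T\<^esub> x) (comult ?Y (pure_tensor K C D c d)) = pure_tensor K C D c d"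
      proof -
        let ?\<beta> = "\<lambda>x y. counit ?Y y \<odot>\<^bsub>?T\<^esub> x"
        have bi [lin]: "bilinear_map K ?T ?T ?T ?\<beta>" by (rule lin | assumption)+
        have \<beta>_lin: "linear_map K (tensor_product K ?T ?T) ?T (tensor_lift K ?T ?\<beta>)"
          by (rule tensor_lift_linear[OF mods(3) mods(3) mods(3) bi])
        have body: "tensor_lift K ?T (\<lambda>g y. tensor_lift K ?T ?\<beta> (pure_tensor K ?T ?T (pure_tensor K C D c1 (act D g d1)) (pure_tensor K C D y d2))) (coact C c2)
            = pure_tensor K C D (counit C c2 \<odot>\<^bsub>C\<^esub> c1) (counit D d2 \<odot>\<^bsub>D\<^esub> d1)"
          if c12 [lin]: "c1 \<in> carrier C" "c2 \<in> carrier C" and d12 [lin]: "d1 \<in> carrier D" "d2 \<in> carrier D" for c1 c2 d1 d2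
        proof -
          have "tensor_lift K ?T (\<lambda>g y. tensor_lift K ?T ?\<beta> (pure_tensor K ?T ?T (pure_tensor K C D c1 (act D g d1)) (pure_tensor K C D y d2))) (coact C c2)
              = tensor_lift K ?T (\<lambda>g y. pure_tensor K C D c1 (act D (counit C y \<odot>\<^bsub>H\<^esub> g) (counit D d2 \<odot>\<^bsub>D\<^esub> d1))) (coact C c2)"
          proof (rule tensor_lift_cong)
            fix g y assume gy [lin]: "g \<in> carrier H" "y \<in> carrier C"
            have "tensor_lift K ?T ?\<beta> (pure_tensor K ?T ?T (pure_tensor K C D c1 (act D g d1)) (pure_tensor K C D y d2)) =
                ?\<beta> (pure_tensor K C D c1 (act D g d1)) (pure_tensor K C D y d2)"
              by (rule tensor_lift_pure) (rule lin | assumption)+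
            also have "counit ?Y (pure_tensor K C D y d2) = counit C y \<otimes>\<^bsub>K\<^esub> counit D d2" by (rule cT[OF gy(2) d12(2)])
            finally show "tensor_lift K ?T ?\<beta> (pure_tensor K ?T ?T (pure_tensor K C D c1 (act D g d1)) (pure_tensor K C D y d2)) =
                pure_tensor K C D c1 (act D (counit C y \<odot>\<^bsub>H\<^esub> g) (counit D d2 \<odot>\<^bsub>D\<^esub> d1))"
              using pure_scale[of "\<one>\<^bsub>K\<^esub>" "counit C y \<otimes>\<^bsub>K\<^esub> counit D d2" c1 "act D g d1"] gy d12 c12 kc kd
                linear_smult[OF act_left[OF linear_id preD] kc[OF gy(2)] gy(1), of "counit D d2 \<odot>\<^bsub>D\<^esub> d1"]
                linear_smult[OF act_right[OF linear_id preD gy(1)] kd[OF d12(2)] d12(1)] act_in[OF preD gy(1) d12(1)]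
              by (simp add: module.smult_assoc1[OF mods(2)] module.smult_closed[OF mods(2)])
          qed (rule lin | assumption)+
          also have "\<dots> = pure_tensor K C D c1 (act D (tensor_lift K H (\<lambda>g y. counit C y \<odot>\<^bsub>H\<^esub> g) (coact C c2)) (counit D d2 \<odot>\<^bsub>D\<^esub> d1))"
            by (rule linear_lift_commute[symmetric, where f = "\<lambda>x. pure_tensor K C D c1 (act D x (counit D d2 \<odot>\<^bsub>D\<^esub> d1))"])
              (rule lin | assumption)+
          also have "\<dots> = pure_tensor K C D c1 (counit C c2 \<odot>\<^bsub>D\<^esub> (counit D d2 \<odot>\<^bsub>D\<^esub> d1))"
            using linear_smult[OF act_left[OF linear_id preD] kc[OF c12(2)] one_H_closed, of "counit D d2 \<odot>\<^bsub>D\<^esub> d1"] kd[OF d12(2)] d12 c12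
            by (simp add: Ccoact Dl module.smult_closed[OF mods(2)])
          also have "\<dots> = pure_tensor K C D (counit C c2 \<odot>\<^bsub>C\<^esub> c1) (counit D d2 \<odot>\<^bsub>D\<^esub> d1)"
            using pure_scale[of "\<one>\<^bsub>K\<^esub>" "counit C c2" c1 "counit D d2 \<odot>\<^bsub>D\<^esub> d1"] pure_scale[of "counit C c2" "\<one>\<^bsub>K\<^esub>" c1 "counit D d2 \<odot>\<^bsub>D\<^esub> d1"]
              c12 d12 kc kd by (simp add: module.smult_closed[OF mods(2)] module.smult_one[OF mods(2)])
          finally show ?thesis .
        qed
        have "tensor_lift K ?T ?\<beta> (comult ?Y (pure_tensor K C D c d)) =
          tensor_lift K ?T (\<lambda>c1 c2. tensor_lift K ?T (\<lambda>d1 d2. pure_tensor K C D (counit C c2 \<odot>\<^bsub>C\<^esub> c1) (counit D d2 \<odot>\<^bsub>D\<^esub> d1)) (comult D d)) (comult C c)"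
          unfolding comult_tensor_pure[OF preC preD cd]
          apply (rule trans, rule linear_lift_commute[OF _ _ _ _ _ \<beta>_lin], (rule lin | assumption)+)
          apply (rule tensor_lift_cong, (rule lin | assumption)+)
          apply (rule trans, rule linear_lift_commute[OF _ _ _ _ _ \<beta>_lin], (rule lin | assumption)+)
          apply (rule tensor_lift_cong, (rule lin | assumption)+)
          apply (rule trans, rule linear_lift_commute[OF _ _ _ _ _ \<beta>_lin], (rule lin | assumption)+)
          apply (rule body, assumption+)
          done
        also have "\<dots> = tensor_lift K ?T (\<lambda>c1 c2. pure_tensor K C D (counit C c2 \<odot>\<^bsub>C\<^esub> c1) d) (comult C c)"
          apply (rule tensor_lift_cong, (rule lin | assumption)+)
          apply (rule trans, rule linear_lift_commute[symmetric, where f = "pure_tensor K C D (counit C c2 \<odot>\<^bsub>C\<^esub> c1)" and U = D for c1 c2], (rule lin | assumption)+)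
          apply (simp only: Dl(3,4)[OF cd(2)])
          done
        also have "\<dots> = pure_tensor K C D c d"
          apply (rule trans, rule linear_lift_commute[symmetric, where f = "\<lambda>x. pure_tensor K C D x d" and U = C], (rule lin | assumption)+)
          apply (simp only: C.C.counit_left[OF cd(1)] C.C.counit_right[OF cd(1)])
          done
        finally show ?thesis .
      qed
    qed (rule lin | assumption)+
  qed
qed

end

context connected_coquasi
begin

subsection \<open>Associativity\<close>

abbreviation GGG where "GGG \<equiv> tensor_product K G GG"
abbreviation Q3 where "Q3 \<equiv> yd_tensor K H Q (yd_tensor K H Q Q)"
abbreviation G3 where "G3 \<equiv> yd_tensor K H G (yd_tensor K H G G)"
abbreviation grel3 where "grel3 \<equiv> tensor_rel Q G grel QQ GG grel2"

lemma triple_pre: "yd_pre Q3" "yd_pre G3"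
  by (intro yd_pre_tensor Q_pre G_pre)+

lemma triple_lin [lin]:
  "linear_map K X QQQ e \<Longrightarrow> linear_map K X (tensor_product K QQQ QQQ) (\<lambda>x. comult Q3 (e x))"
  "linear_map K X GGG e' \<Longrightarrow> linear_map K X (tensor_product K GGG GGG) (\<lambda>x. comult G3 (e' x))"
  "linear_map K X GGG e' \<Longrightarrow> linear_map K X (ground_module K) (\<lambda>x. counit G3 (e' x))"
  "t \<in> carrier QQQ \<Longrightarrow> comult Q3 t \<in> carrier (tensor_product K QQQ QQQ)"
  "s \<in> carrier GGG \<Longrightarrow> comult G3 s \<in> carrier (tensor_product K GGG GGG)"
  "s \<in> carrier GGG \<Longrightarrow> counit G3 s \<in> carrier (ground_module K)"
  using comult_lin[OF _ triple_pre(1), of X e] comult_lin[OF _ triple_pre(2), of X e'] counit_lin[OF _ triple_pre(2), of X e']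
    comult_in[OF triple_pre(1), of t] comult_in[OF triple_pre(2), of s] counit_in[OF triple_pre(2), of s]
  by simp_all

lemma omega_linear: "linear_map K QQQ (ground_module K) \<omega>"
  using Q.omega_morphism by (simp add: yd_morphism_def yd_tensor3_def)

lemma omega_lin [lin]:
  "linear_map K X QQQ e \<Longrightarrow> linear_map K X (ground_module K) (\<lambda>x. \<omega> (e x))"
  "t \<in> carrier QQQ \<Longrightarrow> \<omega> t \<in> carrier (ground_module K)"
  using linear_comp[OF _ omega_linear] linear_closed[OF omega_linear] by auto

lemma triple_rel: "yd_rel Q3 G3 grel3"
  using yd_rel_tensor[OF grel_yd yd_rel_tensor[OF grel_yd grel_yd]] by simp

lemmas triple_comult_rel [rel] = yd_relD(6)[OF triple_rel, unfolded tensor_rel_yd_tensor yd_tensor_product_simps]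

lemma filtered_grel3 [rel]: "filtered_symbols QQQ GGG grel3" by (rule rel)+

definition right_product :: "('k, 'v, 'c) module_scheme \<Rightarrow> ('k, 'v, ('k, 'v, 'v) tensor) tensor \<Rightarrow> 'v"
  where "right_product V = tensor_lift3 K V (\<lambda>x y z. x \<otimes>\<^bsub>V\<^esub> (y \<otimes>\<^bsub>V\<^esub> z))"

definition left_product :: "('k, 'v, 'c) module_scheme \<Rightarrow> ('k, 'v, ('k, 'v, 'v) tensor) tensor \<Rightarrow> 'v"
  where "left_product V = tensor_lift3 K V (\<lambda>x y z. (x \<otimes>\<^bsub>V\<^esub> y) \<otimes>\<^bsub>V\<^esub> z)"

lemma product_lin [lin]:
  "linear_map K X QQQ e \<Longrightarrow> linear_map K X Q (\<lambda>x. right_product Q (e x))"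
  "linear_map K X QQQ e \<Longrightarrow> linear_map K X Q (\<lambda>x. left_product Q (e x))"
  "linear_map K X GGG e' \<Longrightarrow> linear_map K X G (\<lambda>x. right_product G (e' x))"
  "linear_map K X GGG e' \<Longrightarrow> linear_map K X G (\<lambda>x. left_product G (e' x))"
  unfolding right_product_def left_product_def tensor_lift3_def by (rule lin | assumption)+

lemma product_closed [lin]:
  "t \<in> carrier QQQ \<Longrightarrow> right_product Q t \<in> carrier Q" "t \<in> carrier QQQ \<Longrightarrow> left_product Q t \<in> carrier Q"
  "s \<in> carrier GGG \<Longrightarrow> right_product G s \<in> carrier G" "s \<in> carrier GGG \<Longrightarrow> left_product G s \<in> carrier G"
  unfolding right_product_def left_product_def tensor_lift3_def by (rule lin | assumption)+

lemma product_rel [rel]: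
  "grel3 n t s \<Longrightarrow> grel n (right_product Q t) (right_product G s)"
  "grel3 n t s \<Longrightarrow> grel n (left_product Q t) (left_product G s)"
  unfolding right_product_def left_product_def tensor_lift3_def by (rule refl | assumption | rule rel lin | arith)+

lemma product_pure:
  assumes [lin]: "x \<in> carrier G" "y \<in> carrier G" "z \<in> carrier G"
  shows "right_product G (pure_tensor K G GG x (pure_tensor K G G y z)) = x \<otimes>\<^bsub>G\<^esub> (y \<otimes>\<^bsub>G\<^esub> z)"
    "left_product G (pure_tensor K G GG x (pure_tensor K G G y z)) = (x \<otimes>\<^bsub>G\<^esub> y) \<otimes>\<^bsub>G\<^esub> z"
  unfolding right_product_def left_product_def tensor_lift3_def
  by (rule trans, rule tensor_lift_pure, (rule lin | assumption)+, rule tensor_lift_pure, (rule lin | assumption)+)+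

text \<open>
  In degree \<open>0\<close> the middle argument is a multiple of \<open>1\<close>, and \<open>\<omega>(x \<otimes> 1 \<otimes> z) = \<epsilon>(x) \<epsilon>(z)\<close>. In positive total degree the scalar
  on the left has the symbol \<open>0\<close>, and the counit of \<open>gr Q\<close> vanishes on the argument of positive degree.
\<close>

lemma omega_pure:
  assumes x: "x \<in> F a" and y: "y \<in> F b" and z: "z \<in> F c"
  shows "rel_K (a + b + c) (\<omega> (pure_tensor K Q QQ x (pure_tensor K Q Q y z)))
    (counit G3 (pure_tensor K G GG (cls a x) (pure_tensor K G G (cls b y) (cls c z))))"
proof -
  have Q [lin]: "x \<in> carrier Q" "y \<in> carrier Q" "z \<in> carrier Q" using x y z F_D(1) by auto
  have G [lin]: "cls a x \<in> carrier G" "cls b y \<in> carrier G" "cls c z \<in> carrier G" using x y z cls_closed by auto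
  have c: "\<omega> (pure_tensor K Q QQ x (pure_tensor K Q Q y z)) \<in> carrier K"
    using omega_lin(2)[of "pure_tensor K Q QQ x (pure_tensor K Q Q y z)"] pure_closed[OF module_Q tensor_module[OF module_Q module_Q] Q(1) pure_closed[OF module_Q module_Q Q(2,3)]] by simp
  have e: "counit Q u \<in> carrier K" if "u \<in> carrier Q" for u using counit_in[OF Q_pre that] by simp
  have "counit G3 (pure_tensor K G (yd_tensor K H G G) (cls a x) (pure_tensor K G G (cls b y) (cls c z))) =
      counit G (cls a x) \<otimes>\<^bsub>K\<^esub> counit (yd_tensor K H G G) (pure_tensor K G G (cls b y) (cls c z))"
    by (rule counit_tensor_pure[OF G_pre yd_pre_tensor[OF G_pre G_pre] G(1)]) (simp, (rule lin | assumption)+)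
  also have "counit (yd_tensor K H G G) (pure_tensor K G G (cls b y) (cls c z)) = counit G (cls b y) \<otimes>\<^bsub>K\<^esub> counit G (cls c z)"
    by (rule counit_tensor_pure[OF G_pre G_pre G(2,3)])
  finally have ce: "counit G3 (pure_tensor K G GG (cls a x) (pure_tensor K G G (cls b y) (cls c z))) =
      counit G (cls a x) \<otimes>\<^bsub>K\<^esub> (counit G (cls b y) \<otimes>\<^bsub>K\<^esub> counit G (cls c z))" by simp
  show ?thesis
  proof (cases "a = 0 \<and> b = 0 \<and> c = 0")
    case True
    then obtain k where k: "k \<in> carrier K" "y = k \<odot>\<^bsub>Q\<^esub> \<one>\<^bsub>Q\<^esub>" using y F_0 by auto
    have l: "linear_map K Q (ground_module K) (\<lambda>y. \<omega> (pure_tensor K Q QQ x (pure_tensor K Q Q y z)))"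
      by (rule lin | assumption)+
    have "\<omega> (pure_tensor K Q QQ x (pure_tensor K Q Q y z)) = k \<otimes>\<^bsub>K\<^esub> (counit Q x \<otimes>\<^bsub>K\<^esub> counit Q z)"
      using linear_smult[OF l k(1) one_Q] Q.omega_unit_middle[OF Q(1,3)] counit_tensor_pure[OF Q_pre Q_pre Q(1,3)]
      by (simp add: k(2) trilinear_of_def)
    also have "\<dots> = counit Q x \<otimes>\<^bsub>K\<^esub> (counit Q y \<otimes>\<^bsub>K\<^esub> counit Q z)"
      using linear_smult[OF Q.C.counit_linear k(1) one_Q] k(1) e Q by (simp add: k(2) counit_one K.m_ac)
    finally show ?thesis using ce counit_G(2)[OF x] counit_G(2)[OF y] counit_G(2)[OF z] True c by (simp add: triv_rel_def)
  next
    case False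
    then have "counit G3 (pure_tensor K G GG (cls a x) (pure_tensor K G G (cls b y) (cls c z))) = \<zero>\<^bsub>K\<^esub>"
      unfolding ce counit_G(2)[OF x] counit_G(2)[OF y] counit_G(2)[OF z] using e Q by auto
    then show ?thesis using False c by (auto simp: triv_rel_def)
  qed
qed

text \<open>
  The symbol of the reassociator is the counit.
\<close>

lemma omega_rel [rel]:
  assumes "grel3 n t s" shows "rel_K n (\<omega> t) (counit G3 s)"
proof -
  have FK: "filtered_symbols (ground_module K) (ground_module K) rel_K" by (rule filtered_triv[OF ground_module])
  note outer = rel_linear[OF assms filtered_G filtered_grel2 FK omega_linear triple_lin(3)[OF linear_id]]
  show ?thesis
  proof (rule outer)
    fix a b x g t s
    assume xg: "grel a x g" and ts: "grel2 b t s" "a + b = n" and c: "x \<in> carrier Q" "g \<in> carrier G" "t \<in> carrier QQ" "s \<in> carrier GG"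
    have l: "linear_map K QQ (ground_module K) (\<lambda>t. \<omega> (pure_tensor K Q QQ x t))"
      apply (rule omega_lin(1)[OF bilinear_right[OF pure_bilinear c(1)]]) by (rule lin)+
    have l': "linear_map K GG (ground_module K) (\<lambda>s. counit G3 (pure_tensor K G GG g s))"
      by (rule triple_lin(3)[OF bilinear_right[OF pure_bilinear c(2)]]) (rule lin)+
    note inner = rel_linear[OF ts(1) filtered_G filtered_G FK l l']
    show "rel_K n (\<omega> (pure_tensor K Q QQ x t)) (counit G3 (pure_tensor K G GG g s))"
    proof (rule inner)
      fix b1 b2 y h z k assume *: "grel b1 y h" "grel b2 z k" "b1 + b2 = b"
      have n: "n = a + b1 + b2" using *(3) ts(2) by simp
      have **: "x \<in> F a" "g = cls a x" "y \<in> F b1" "h = cls b1 y" "z \<in> F b2" "k = cls b2 z"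
        using xg *(1,2) unfolding grel_def by blast+
      show "rel_K n (\<omega> (pure_tensor K Q QQ x (pure_tensor K Q Q y z))) (counit G3 (pure_tensor K G GG g (pure_tensor K G G h k)))"
        unfolding n **(2,4,6) by (rule omega_pure[OF **(1,3,5)])
    qed
  qed
qed

lemma quasi_assoc_Q:
  assumes "t \<in> carrier QQQ"
  shows "tensor_lift K Q (\<lambda>t1 t2. \<omega> t2 \<odot>\<^bsub>Q\<^esub> right_product Q t1) (comult Q3 t) =
    tensor_lift K Q (\<lambda>t1 t2. \<omega> t1 \<odot>\<^bsub>Q\<^esub> left_product Q t2) (comult Q3 t)"
  using Q.quasi_assoc[of t] assms by (simp add: yd_tensor3_def convolution_def right_product_def left_product_def)

lemma assoc_convolution_G:
  assumes s: "s \<in> carrier GGG"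
  shows "tensor_lift K G (\<lambda>s1 s2. counit G3 s2 \<odot>\<^bsub>G\<^esub> right_product G s1) (comult G3 s) =
    tensor_lift K G (\<lambda>s1 s2. counit G3 s1 \<odot>\<^bsub>G\<^esub> left_product G s2) (comult G3 s)"
proof -
  \<comment> \<open>The names hide that these are maps of a tensor product, so that only the rules for \<open>Q \<otimes> Q \<otimes> Q\<close> as a whole apply.\<close>
  define dQ where "dQ = comult Q3"
  define dG where "dG = comult G3"
  define eG where "eG = counit G3"
  have [lin]: "linear_map K X QQQ e \<Longrightarrow> linear_map K X (tensor_product K QQQ QQQ) (\<lambda>x. dQ (e x))"
    "linear_map K X GGG e' \<Longrightarrow> linear_map K X (tensor_product K GGG GGG) (\<lambda>x. dG (e' x))"
    "linear_map K X GGG e' \<Longrightarrow> linear_map K X (ground_module K) (\<lambda>x. eG (e' x))"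
    "t \<in> carrier QQQ \<Longrightarrow> dQ t \<in> carrier (tensor_product K QQQ QQQ)"
    "u \<in> carrier GGG \<Longrightarrow> dG u \<in> carrier (tensor_product K GGG GGG)"
    "u \<in> carrier GGG \<Longrightarrow> eG u \<in> carrier (ground_module K)" for X :: "('k, 'x, 'y) module_scheme" and e e' t u
    unfolding dQ_def dG_def eG_def by (rule triple_lin, assumption)+
  have [rel]: "tensor_rel QQQ GGG grel3 QQQ GGG grel3 n (dQ x) (dG g)" if "grel3 n x g" for n x g
    unfolding dQ_def dG_def by (rule triple_comult_rel[OF that])
  have [rel]: "rel_K n (\<omega> t) (eG u)" if "grel3 n t u" for n t u
    unfolding eG_def by (rule omega_rel[OF that])
  note quasi_assoc = quasi_assoc_Q[folded dQ_def]
  show ?thesis unfolding dG_def[symmetric] eG_def[symmetric]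
    by (rule symbol_transfer[OF filtered_grel3 filtered_G _ _ _ _ quasi_assoc]; (rule s | rule refl | assumption | rule rel lin | arith)+)
qed

lemma counital_G3: "counital G3"
  by (rule counital_tensor[OF yd_coalgebra_G counital_tensor[OF yd_coalgebra_G counital_yd_coalgebra[OF yd_coalgebra_G]]])

text \<open>
  In \<open>assoc_convolution_G\<close> both sides are convolutions with the counit and can be evaluated by the counit laws.
\<close>

lemma product_assoc_tensor:
  assumes s: "s \<in> carrier GGG" shows "right_product G s = left_product G s"
proof -
  have c: "tensor_lift K GGG (\<lambda>x y. counit G3 x \<odot>\<^bsub>GGG\<^esub> y) (comult G3 s) = s"
    "tensor_lift K GGG (\<lambda>x y. counit G3 y \<odot>\<^bsub>GGG\<^esub> x) (comult G3 s) = s"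
    using counital_G3 s by (simp_all add: counital_def)
  have k: "counit G3 u \<in> carrier K" if "u \<in> carrier GGG" for u using triple_lin(6)[OF that] by simp
  have lr: "linear_map K GGG G (right_product G)" "linear_map K GGG G (left_product G)"
    by (rule product_lin linear_id)+
  have GGG_modules: "module K GGG" "module K GGG" "module K GGG" by (rule lin)+
  have bi: "bilinear_map K GGG GGG GGG (\<lambda>x y. counit G3 x \<odot>\<^bsub>GGG\<^esub> y)" "bilinear_map K GGG GGG GGG (\<lambda>x y. counit G3 y \<odot>\<^bsub>GGG\<^esub> x)"
    by (rule lin | assumption)+
  have cs: "comult G3 s \<in> carrier (tensor_product K GGG GGG)" by (rule triple_lin(5)[OF s])
  have "right_product G s = tensor_lift K G (\<lambda>x y. right_product G (counit G3 y \<odot>\<^bsub>GGG\<^esub> x)) (comult G3 s)"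
    unfolding linear_lift_commute[OF GGG_modules G_module bi(2) lr(1) cs, symmetric] c(2) by (rule refl)
  also have "\<dots> = tensor_lift K G (\<lambda>x y. counit G3 y \<odot>\<^bsub>G\<^esub> right_product G x) (comult G3 s)"
    by (rule tensor_lift_cong) ((rule lin s | assumption)+, (rule linear_smult[OF lr(1)]; (rule k)?; assumption)+)
  also have "\<dots> = tensor_lift K G (\<lambda>x y. counit G3 x \<odot>\<^bsub>G\<^esub> left_product G y) (comult G3 s)"
    by (rule assoc_convolution_G[OF s])
  also have "\<dots> = tensor_lift K G (\<lambda>x y. left_product G (counit G3 x \<odot>\<^bsub>GGG\<^esub> y)) (comult G3 s)"
    by (rule tensor_lift_cong) ((rule lin s | assumption)+, (rule linear_smult[OF lr(2), symmetric]; (rule k)?; assumption)+)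
  also have "\<dots> = left_product G s"
    unfolding linear_lift_commute[OF GGG_modules G_module bi(1) lr(2) cs, symmetric] c(1) by (rule refl)
  finally show ?thesis .
qed

lemma yd_bialgebra_G: "yd_bialgebra K H G"
proof (rule yd_bialgebra.intro[OF yd_magma_coalgebra_G yd_bialgebra_axioms.intro])
  fix x y z assume xyz [lin]: "x \<in> carrier G" "y \<in> carrier G" "z \<in> carrier G"
  have "pure_tensor K G GG x (pure_tensor K G G y z) \<in> carrier GGG" by (rule lin | assumption)+
  then show "(x \<otimes>\<^bsub>G\<^esub> y) \<otimes>\<^bsub>G\<^esub> z = x \<otimes>\<^bsub>G\<^esub> (y \<otimes>\<^bsub>G\<^esub> z)"
    using product_assoc_tensor product_pure[OF xyz] by simp
qed

section \<open>Simple subcoalgebras of the associated graded object\<close>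

definition trunc :: "nat set \<Rightarrow> (nat \<Rightarrow> 'q set) \<Rightarrow> nat \<Rightarrow> 'q set"
  where "trunc A g = (\<lambda>n. if n \<in> A then g n else \<zero>\<^bsub>C n\<^esub>)"

lemma trunc_linear: "linear_map K G G (trunc A)"
  unfolding trunc_def[abs_def]
proof (rule linear_into_G)
  show "linear_map K G (C n) (\<lambda>x. if n \<in> A then x n else \<zero>\<^bsub>C n\<^esub>)" for n
    using G_eval[of n] linear_const_zero[OF C_module] by (cases "n \<in> A") simp_all
  show "finite {n. (if n \<in> A then x n else \<zero>\<^bsub>C n\<^esub>) \<noteq> \<zero>\<^bsub>C n\<^esub>}" if "x \<in> carrier G" for x
    by (rule finite_subset[of _ "{n. x n \<noteq> \<zero>\<^bsub>C n\<^esub>}"]) (use that in \<open>auto simp: G_simps direct_sum_simps\<close>)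
qed

lemma trunc_cls: "trunc A (cls n x) = (if n \<in> A then cls n x else \<zero>\<^bsub>G\<^esub>)"
  by (intro ext) (simp add: trunc_def gr_class_def G_simps direct_sum_simps)

text \<open>
  All components of \<open>\<Delta> d\<close> have total degree at most \<open>n\<close>, whereas \<open>trunc {n..} \<otimes> trunc {n..}\<close> retains only those of total
  degree at least \<open>2 n\<close>.
\<close>

lemma trunc_comult_zero:
  assumes n: "0 < n" and d: "d \<in> carrier G" "trunc {..n} d = d"
  shows "tensor_map K G G (trunc {n..}) (trunc {n..}) (comult G d) = \<zero>\<^bsub>GG\<^esub>"
proof -
  let ?t = "tensor_map K G G (trunc {n..}) (trunc {n..})"
  have GGm: "module K GG" by (rule lin)+
  have tl: "linear_map K GG GG ?t"
    by (rule tensor_map_linear[OF linear_id trunc_linear trunc_linear]) (rule lin)+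
  have z: "?t s = \<zero>\<^bsub>GG\<^esub>" if "grel2 k t s" "k \<le> n" for k t s
    using that(1)
  proof induction
    case tensor_rel_zero show ?case by (rule linear_zero[OF GGm GGm tl])
  next
    case (tensor_rel_pure a x g b y h)
    then have g: "g = cls a x" "h = cls b y" "x \<in> F a" "y \<in> F b" by (auto simp: grel_def)
    then have c: "g \<in> carrier G" "h \<in> carrier G" using cls_closed by auto
    have "a < n \<or> b < n" using tensor_rel_pure(3) that(2) n by linarith
    then have "trunc {n..} g = \<zero>\<^bsub>G\<^esub> \<or> trunc {n..} h = \<zero>\<^bsub>G\<^esub>" by (auto simp: g trunc_cls)
    moreover have "trunc {n..} g \<in> carrier G" "trunc {n..} h \<in> carrier G" using linear_closed[OF trunc_linear] c by auto
    ultimately show ?case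
      using tensor_map_pure[OF trunc_linear trunc_linear G_module G_module G_module G_module c] pure_zero[OF G_module G_module] by auto
  next
    case (tensor_rel_add s s' t t')
    interpret GG: module K GG by (rule GGm)
    show ?case
      using linear_add[OF tl] tensor_rel_add tensor_rel_carrier[OF filtered_G filtered_G] by simp
  qed
  have l: "linear_map K G GG (\<lambda>g. ?t (comult G (trunc {..n} g)))"
    by (rule linear_comp[OF linear_comp[OF trunc_linear comult_G(1)] tl])
  have "?t (comult G (trunc {..n} d)) = \<zero>\<^bsub>GG\<^esub>"
  proof (rule symbol_ext[OF filtered_G GGm l linear_const_zero[OF GGm] _ d(1)])
    fix k x g assume g: "grel k x g"
    then have gc: "g = cls k x" by (simp add: grel_def)
    show "?t (comult G (trunc {..n} g)) = \<zero>\<^bsub>GG\<^esub>"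
    proof (cases "k \<le> n")
      case True
      then have "trunc {..n} g = g" by (simp add: gc trunc_cls)
      moreover have "grel2 k (comult Q x) (comult G g)" by (rule rel g)+
      ultimately show ?thesis using z True by simp
    next
      case False
      then have "trunc {..n} g = \<zero>\<^bsub>G\<^esub>" by (simp add: gc trunc_cls)
      then show ?thesis using linear_zero[OF G_module GGm linear_comp[OF comult_G(1) tl]] by simp
    qed
  qed
  then show ?thesis using d(2) by simp
qed

lemma comult_G_inj:
  assumes d: "d \<in> carrier G" "comult G d = \<zero>\<^bsub>GG\<^esub>" shows "d = \<zero>\<^bsub>G\<^esub>"
proof -
  interpret GC: coalgebra K G by (rule coalgebra_G)
  have "tensor_lift K G (\<lambda>x y. counit G x \<odot>\<^bsub>G\<^esub> y) (comult G d) = \<zero>\<^bsub>G\<^esub>"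
    unfolding d(2) by (rule tensor_lift_zero) (rule lin | assumption)+
  then show ?thesis using GC.counit_left[OF d(1)] by simp
qed

text \<open>
  Take \<open>n\<close> minimal such that \<open>D\<close> has a nonzero element \<open>d\<close> of degree at most \<open>n\<close>, and suppose \<open>n > 0\<close>. By minimality
  \<open>trunc {n..}\<close> is injective on \<open>D\<close>, so it has a left inverse \<open>\<psi>\<close> there. Then \<open>\<Delta> d\<close>, which lies in \<open>D \<otimes> D\<close>, is recovered
  by \<open>\<psi> \<otimes> \<psi>\<close> from its image under \<open>trunc {n..} \<otimes> trunc {n..}\<close>, which is \<open>0\<close>.
\<close>

lemma subcoalgebra_meets_degree_zero:
  assumes D: "subcoalgebra K G D" and ne: "D \<noteq> {\<zero>\<^bsub>G\<^esub>}"
  shows "\<exists>d\<in>D. d \<noteq> \<zero>\<^bsub>G\<^esub> \<and> trunc {..0} d = d"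
proof -
  have sub: "submodule D K G" and co: "comult G ` D \<subseteq> sub_tensor K G G D D"
    using D by (auto simp: subcoalgebra_def)
  note Ds = submoduleD[OF sub G_module]
  define P where "P n \<longleftrightarrow> (\<exists>d\<in>D. d \<noteq> \<zero>\<^bsub>G\<^esub> \<and> trunc {..n} d = d)" for n
  have "\<exists>n. P n"
  proof -
    obtain d where d: "d \<in> D" "d \<noteq> \<zero>\<^bsub>G\<^esub>" using ne Ds(2) by blast
    then have "finite {n. d n \<noteq> \<zero>\<^bsub>C n\<^esub>}" using Ds(1) by (auto simp: G_simps direct_sum_simps)
    then obtain m where "\<forall>n\<in>{n. d n \<noteq> \<zero>\<^bsub>C n\<^esub>}. n \<le> m" using finite_nat_set_iff_bounded_le by blast
    then have "trunc {..m} d = d" by (intro ext) (auto simp: trunc_def)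
    then show ?thesis using d unfolding P_def by blast
  qed
  define n where "n = (LEAST n. P n)"
  have Pn: "P n" unfolding n_def using \<open>\<exists>n. P n\<close> by (rule LeastI_ex)
  have "n = 0"
  proof (rule ccontr)
    assume "n \<noteq> 0"
    then have n: "0 < n" by simp
    obtain d where d: "d \<in> D" "d \<noteq> \<zero>\<^bsub>G\<^esub>" "trunc {..n} d = d" using Pn unfolding P_def by blast
    have inj: "x = \<zero>\<^bsub>G\<^esub>" if x: "x \<in> D" "trunc {n..} x = \<zero>\<^bsub>G\<^esub>" for x
    proof (rule ccontr)
      assume "x \<noteq> \<zero>\<^bsub>G\<^esub>"
      moreover have "trunc {..n - 1} x = x"
      proof (rule ext)
        fix i show "trunc {..n - 1} x i = x i"
          using fun_cong[OF x(2), of i] n by (auto simp: trunc_def G_simps direct_sum_simps split: if_splits)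
      qed
      ultimately have "P (n - 1)" using x(1) unfolding P_def by blast
      then have "n \<le> n - 1" unfolding n_def by (rule Least_le)
      then show False using n by simp
    qed
    have DM: "module K (G\<lparr>carrier := D\<rparr>)" by (rule submodule.submodule_is_module[OF sub G_module])
    have sub_lin: "linear_map K (G\<lparr>carrier := D\<rparr>) G f" if "linear_map K G G f" for f
      using that Ds(1) unfolding linear_map_def by (auto simp: Pi_iff subset_iff)
    have "\<exists>\<psi>. linear_map K G G \<psi> \<and> (\<forall>x\<in>D. \<psi> (trunc {n..} x) = x)"
      by (rule linear_factor[OF DM G_module G_module sub_lin[OF trunc_linear[of "{n..}"]] sub_lin[OF linear_id]])
        (use inj in auto)
    then obtain \<psi> where \<psi>: "linear_map K G G \<psi>" "\<And>x. x \<in> D \<Longrightarrow> \<psi> (trunc {n..} x) = x" by blast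
    let ?f = "\<lambda>x. \<psi> (trunc {n..} x)"
    have fl: "linear_map K G G ?f" by (rule linear_comp[OF trunc_linear \<psi>(1)])
    have GGm: "module K GG" by (rule lin)+
    have dG: "d \<in> carrier G" using d Ds(1) by blast
    have cd: "comult G d \<in> carrier GG" by (rule linear_closed[OF comult_G(1) dG])
    have "tensor_map K G G ?f ?f (comult G d) = comult G d"
    proof (rule linear_hull_cong[OF GGm GGm _ linear_id])
      show "linear_map K GG GG (tensor_map K G G ?f ?f)"
        by (rule tensor_map_linear[OF linear_id fl fl]) (rule lin)+
      show "{pure_tensor K G G x y |x y. x \<in> D \<and> y \<in> D} \<subseteq> carrier GG"
        using pure_closed[OF G_module G_module] Ds(1) by blast
      show "comult G d \<in> subspace_hull K GG {pure_tensor K G G x y |x y. x \<in> D \<and> y \<in> D}"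
        using co d(1) unfolding sub_tensor_def by blast
      fix t assume "t \<in> {pure_tensor K G G x y |x y. x \<in> D \<and> y \<in> D}"
      then obtain x y where xy: "t = pure_tensor K G G x y" "x \<in> D" "y \<in> D" by blast
      then have "x \<in> carrier G" "y \<in> carrier G" using Ds(1) by auto
      then show "tensor_map K G G ?f ?f t = t"
        unfolding xy(1) by (simp only: tensor_map_pure[OF fl fl G_module G_module G_module G_module] \<psi>(2)[OF xy(2)] \<psi>(2)[OF xy(3)])
    qed
    moreover have "tensor_map K G G ?f ?f (comult G d) =
        tensor_map K G G \<psi> \<psi> (tensor_map K G G (trunc {n..}) (trunc {n..}) (comult G d))"
      by (rule tensor_map_comp[symmetric, OF trunc_linear trunc_linear \<psi>(1) \<psi>(1) G_module G_module G_module G_module G_module G_module cd])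
    moreover have "\<dots> = \<zero>\<^bsub>GG\<^esub>"
      unfolding trunc_comult_zero[OF n dG d(3)] by (rule tensor_map_zero[OF \<psi>(1) \<psi>(1)]) (rule lin)+
    ultimately have "comult G d = \<zero>\<^bsub>GG\<^esub>" by simp
    then show False using comult_G_inj[OF dG] d(2) by simp
  qed
  then show ?thesis using Pn unfolding P_def by simp
qed

abbreviation K1 where "K1 \<equiv> {a \<odot>\<^bsub>G\<^esub> \<one>\<^bsub>G\<^esub> | a. a \<in> carrier K}"

lemma K1_submodule: "submodule K1 K G"
proof (rule submodule_criterion[OF G_module])
  show "K1 \<subseteq> carrier G" using one_G by auto
  show "\<zero>\<^bsub>G\<^esub> \<in> K1" using Gm.smult_l_null[OF one_G] by (auto intro!: exI[of _ "\<zero>\<^bsub>K\<^esub>"])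
  show "x \<oplus>\<^bsub>G\<^esub> y \<in> K1" if "x \<in> K1" "y \<in> K1" for x y
  proof -
    obtain a b where ab: "a \<in> carrier K" "b \<in> carrier K" "x = a \<odot>\<^bsub>G\<^esub> \<one>\<^bsub>G\<^esub>" "y = b \<odot>\<^bsub>G\<^esub> \<one>\<^bsub>G\<^esub>" using \<open>x \<in> K1\<close> \<open>y \<in> K1\<close> by auto
    then have "x \<oplus>\<^bsub>G\<^esub> y = (a \<oplus>\<^bsub>K\<^esub> b) \<odot>\<^bsub>G\<^esub> \<one>\<^bsub>G\<^esub>" using Gm.smult_l_distr[OF _ _ one_G] by simp
    then show ?thesis using ab K.a_closed by blast
  qed
  show "a \<odot>\<^bsub>G\<^esub> x \<in> K1" if "a \<in> carrier K" "x \<in> K1" for a x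
  proof -
    obtain b where b: "b \<in> carrier K" "x = b \<odot>\<^bsub>G\<^esub> \<one>\<^bsub>G\<^esub>" using \<open>x \<in> K1\<close> by auto
    then have "a \<odot>\<^bsub>G\<^esub> x = (a \<otimes>\<^bsub>K\<^esub> b) \<odot>\<^bsub>G\<^esub> \<one>\<^bsub>G\<^esub>" using Gm.smult_assoc1[OF _ _ one_G] that(1) by simp
    then show ?thesis using b(1) that(1) K.m_closed by blast
  qed
qed

lemma degree_zero_K1:
  assumes d: "d \<in> carrier G" "trunc {..0} d = d" shows "d \<in> K1"
proof -
  obtain a where a: "a \<in> carrier K" "coset_rep (d 0) = a \<odot>\<^bsub>Q\<^esub> \<one>\<^bsub>Q\<^esub>"
    using G_rep(1)[OF d(1), of 0] F_0 by auto
  have "d = cls 0 (coset_rep (d 0))"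
  proof (rule ext)
    fix i show "d i = cls 0 (coset_rep (d 0)) i"
      using fun_cong[OF d(2), of i] G_rep(2)[OF d(1), of 0] by (auto simp: trunc_def gr_class_def split: if_splits)
  qed
  also have "\<dots> = a \<odot>\<^bsub>G\<^esub> \<one>\<^bsub>G\<^esub>" unfolding a(2) G_maps(2) by (rule cls_smult[OF a(1) one_in_F])
  finally show ?thesis using a(1) by auto
qed

lemma one_G_nonzero: "\<one>\<^bsub>G\<^esub> \<noteq> \<zero>\<^bsub>G\<^esub>"
  using counit_one_G linear_zero[OF G_module ground_module counit_G(1)] by auto

lemma K1_in_submodule:
  assumes D: "submodule D K G" and d: "d \<in> D" "d \<noteq> \<zero>\<^bsub>G\<^esub>" "d \<in> K1" shows "K1 \<subseteq> D"
proof -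
  note Ds = submoduleD[OF D G_module]
  obtain a where a: "a \<in> carrier K" "d = a \<odot>\<^bsub>G\<^esub> \<one>\<^bsub>G\<^esub>" using d(3) by auto
  then have "a \<noteq> \<zero>\<^bsub>K\<^esub>" using d(2) Gm.smult_l_null[OF one_G] by auto
  then have u: "inv\<^bsub>K\<^esub> a \<in> carrier K" "inv\<^bsub>K\<^esub> a \<otimes>\<^bsub>K\<^esub> a = \<one>\<^bsub>K\<^esub>" using a(1) K.field_Units by auto
  have "inv\<^bsub>K\<^esub> a \<odot>\<^bsub>G\<^esub> d = \<one>\<^bsub>G\<^esub>"
    using Gm.smult_assoc1[OF u(1) a(1) one_G] u(2) Gm.smult_one[OF one_G] a(2) by simp
  then have "\<one>\<^bsub>G\<^esub> \<in> D" using Ds(4)[OF u(1) d(1)] by simp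
  then show ?thesis using Ds(4) by auto
qed

lemma K1_subcoalgebra: "subcoalgebra K G K1"
  unfolding subcoalgebra_def
proof (intro conjI K1_submodule image_subsetI)
  fix x assume x: "x \<in> K1"
  then obtain a where a: "a \<in> carrier K" "x = a \<odot>\<^bsub>G\<^esub> \<one>\<^bsub>G\<^esub>" by auto
  have o: "\<one>\<^bsub>G\<^esub> \<in> K1" using Gm.smult_one[OF one_G] by (auto intro!: exI[of _ "\<one>\<^bsub>K\<^esub>"])
  have "comult G x = pure_tensor K G G x \<one>\<^bsub>G\<^esub>"
    unfolding a(2) linear_smult[OF comult_G(1) a(1) one_G] comult_one_G
    by (rule linear_smult[OF bilinear_left[OF pure_bilinear[OF G_module G_module] one_G] a(1) one_G, symmetric])
  then show "comult G x \<in> sub_tensor K G G K1 K1" using sub_tensor_pure[OF x o] by simp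
qed

lemma simple_subcoalgebras_G: "simple_subcoalgebra K G D \<longleftrightarrow> D = K1"
proof
  assume s: "simple_subcoalgebra K G D"
  then have D: "subcoalgebra K G D" "D \<noteq> {\<zero>\<^bsub>G\<^esub>}" by (auto simp: simple_subcoalgebra_def)
  then have sub: "submodule D K G" by (simp add: subcoalgebra_def)
  obtain d where d: "d \<in> D" "d \<noteq> \<zero>\<^bsub>G\<^esub>" "trunc {..0} d = d" using subcoalgebra_meets_degree_zero[OF D] by blast
  have "K1 \<subseteq> D" by (rule K1_in_submodule[OF sub d(1,2) degree_zero_K1[OF _ d(3)]]) (use d(1) submoduleD(1)[OF sub G_module] in blast)
  moreover have "K1 \<noteq> {\<zero>\<^bsub>G\<^esub>}" using one_G_nonzero Gm.smult_one[OF one_G] K.one_closed by (metis (mono_tags, lifting) mem_Collect_eq singletonD)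
  ultimately show "D = K1" using s K1_subcoalgebra unfolding simple_subcoalgebra_def by blast
next
  assume D: "D = K1"
  show "simple_subcoalgebra K G D" unfolding D simple_subcoalgebra_def
  proof (intro conjI K1_subcoalgebra allI impI)
    show "K1 \<noteq> {\<zero>\<^bsub>G\<^esub>}" using one_G_nonzero Gm.smult_one[OF one_G] K.one_closed by (metis (mono_tags, lifting) mem_Collect_eq singletonD)
    fix E assume E: "subcoalgebra K G E \<and> E \<subseteq> K1"
    then have sub: "submodule E K G" by (simp add: subcoalgebra_def)
    show "E = {\<zero>\<^bsub>G\<^esub>} \<or> E = K1"
    proof (cases "E = {\<zero>\<^bsub>G\<^esub>}")
      case False
      then obtain d where "d \<in> E" "d \<noteq> \<zero>\<^bsub>G\<^esub>" using submoduleD(2)[OF sub G_module] by blast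
      then have "K1 \<subseteq> E" using K1_in_submodule[OF sub] E by blast
      then show ?thesis using E by blast
    qed simp
  qed
qed

lemma connected_G: "connected_yd K G"
proof -
  have "coradical K G = subspace_hull K G K1" unfolding coradical_def simple_subcoalgebras_G by simp
  also have "\<dots> = K1" using hull_least[OF K1_submodule subset_refl] hull_subset[of K1 G] by blast
  finally show ?thesis unfolding connected_yd_def .
qed

end

theorem theorem1p5:
  fixes K :: "('k, 'm) ring_scheme"
    and H :: "('k, 'h, 'a) hopf_algebra_scheme"
    and Q :: "('k, 'h, 'q, 'b) yd_coalgebra_scheme"
    and \<omega> :: "('k, 'q, ('k, 'q, 'q) tensor) tensor \<Rightarrow> 'k"
  assumes "field K"
    and "hopf_algebra K H"
    and "yd_coquasi_bialgebra K H Q \<omega>"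
    and "connected_yd K Q"
  shows "yd_bialgebra K H (gr K H Q) \<and> connected_yd K (gr K H Q)"
proof -
  interpret connected_coquasi K H Q \<omega>
    unfolding connected_coquasi_def connected_coquasi_axioms_def hopf_base_def vector_spaces_def
    using assms by simp
  show ?thesis using yd_bialgebra_G connected_G by simp
qed

end
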